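(* Let $A$ be a diagonal AH-algebra given by a diagonal AH-system, let $C\subseteq A$ be its canonical C$^*$-diagonal, let $\mathcal B$ be the Bratteli diagram of the AF-subsystem, and let $\mathcal B_\lambda$ be the associated labelled Bratteli diagram. The labelled tail-equivalence groupoid $\mathcal G_{\mathcal B_\lambda}$ of $\mathcal B_\lambda$ is isomorphic (as a topological groupoid) to the transformation groupoid $\mathcal G_{\mathcal B}\ltimes\widehat C$ of the conjugation action of $\mathcal G_{\mathcal B}$ on $\widehat C$, and hence $\mathcal G_{\mathcal B_\lambda}$ is a groupoid model for $A$, i.e. $A\cong C^*_{\mathrm r}(\mathcal G_{\mathcal B_\lambda})$.
   Context: Diagonal AH-systems. $\mathbb N=\{1,2,\dots\}$. For $n\in\mathbb N$ let $A_n=\bigoplus_{i=1}^{N_n}C(X_{n,i})\otimes M_{k_{n,i}}$ with $X_{n,i}$ compact Hausdorff. A diagonal AH-system is an inductive system of such algebras whose connecting maps $\varphi_n\colon A_n\to A_{n+1}$ are unital injective diagonal maps: for all $i\le N_n$, $j\le N_{n+1}$ there are a finite (possibly empty) set $E_n(i,j)$ and continuous maps (eigenfunctions) $\lambda_e\colon X_{n+1,j}\to X_{n,i}$, $e\in E_n(i,j)$, such that the $j$-th component of $\varphi_n(f_1,\dots,f_{N_n})$ is block diagonal with blocks $f_i\circ\lambda_e$ ($1\le i\le N_n$, $e\in E_n(i,j)$), in some fixed order. The limit $A=\varinjlim_n(A_n,\varphi_n)$ is a diagonal AH-algebra; $A_n$ is identified with its image in $A$. Subalgebras. $C_n=\bigoplus_i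 C(X_{n,i})\otimes D_{k_{n,i}}$ with $D_k\subseteq M_k$ the diagonal matrices, and $C=\varinjlim_n C_n\subseteq A$ with Gelfand spectrum $\widehat C$. $B_n=\bigoplus_i 1\otimes M_{k_{n,i}}\subseteq A_n$ and $B=\varinjlim_n B_n\subseteq A$ (the AF-subalgebra). Bratteli diagram $\mathcal B$ of the AF-subsystem. $V_0=\{v_0\}$ (root), $V_n=\{(n,1),\dots,(n,N_n)\}$ for $n\ge1$; $E_0$ consists of $k_{1,j}$ edges from $v_0$ to $(1,j)$ for each $j$; for $n\ge 1$ the edges from $(n,i)$ to $(n+1,j)$ are the elements of $E_n(i,j)$, and $E_n=\bigsqcup_{i,j}E_n(i,j)$. The index set $\{1,\dots,k_{n,i}\}$ of $M_{k_{n,i}}$ is identified with the set of paths of length $n$ from $v_0$ to $(n,i)$: for $n=1$ via $E_0$, and inductively the diagonal position of index $p$ inside the block $f_i\circ\lambda_e$ of $\varphi_n(f)$ is labelled $pe$. $\mathcal P^\infty_{\mathcal B}$ is the set of infinite paths $x=x_1x_2\cdots$ starting at $v_0$ ($x_k\in E_{k-1}$), with base of open sets $Z_p=\{x: x_{[1,n]}=p\}$. $\mathcal G_{\mathcal B}$ is the groupoid of pairs $(x,y)$ of tail-equivalent paths ($x_{[m,\infty)}=y_{[m,\infty)}$ for some $m$), with $(x,y)(y,z)=(x,z)$, $r(x,y)=x$, $s(x,y)=y$, and base of open sets $Z_{p,q}=\{(x,y): x_{[1,n]}=p,\ y_{[1,n]}=q,\ x_{[n+1,\infty)}=y_{[n+1,\infty)}\}$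 for paths $p,q$ from $v_0$ of equal length $n$ with the same terminal vertex. $C^*_{\mathrm r}(\mathcal G_{\mathcal B})$ is identified with $B$ so that $1_{Z_{p,q}}$ is the matrix unit $e_{p,q}\in B_n$; then $C(\mathcal P^\infty_{\mathcal B})=C\cap B$. Action. The anchor map $\rho\colon\widehat C\to\mathcal P^\infty_{\mathcal B}$ is the Gelfand dual of $C\cap B\subseteq C$, and $((x,y)\cdot\chi)(c)=\chi(1_{Z_{p,q}}^*c\,1_{Z_{p,q}})$ for $\rho(\chi)=y$, $c\in C$ and any $p,q$ with $(x,y)\in Z_{p,q}$. The transformation groupoid $\mathcal G_{\mathcal B}\ltimes\widehat C$ is $\{(\gamma,\chi):s(\gamma)=\rho(\chi)\}$ with the subspace topology of the product topology on $\mathcal G_{\mathcal B}\times\widehat C$, $r(\gamma,\chi)=(r(\gamma),\gamma\cdot\chi)$, $s(\gamma,\chi)=(s(\gamma),\chi)$, $(\eta,\gamma\cdot\chi)(\gamma,\chi)=(\eta\gamma,\chi)$. Labelled Bratteli diagram $\mathcal B_\lambda$. It has the same vertices and edges as $\mathcal B$, with vertex $(n,i)$ regarded as the space $X_{n,i}$ and the root as the one-point space $\{0\}$; each edge $e\in E_n$ ($n\ge1$) is labelled by its eigenfunction $\lambda(e)=\lambda_e\colon r(e)\to s(e)$, and each edge of $E_0$ by the constant map to $\{0\}$. A labelled infinite path starting at the root is $x^\lambda=(e_k,t_k)_{k\ge1}$ with $e_1e_2\cdots\in\mathcal P^\infty_{\mathcal B}$, $t_k\in s(e_k)$, $\lambda(e_k)(t_{k+1})=t_k$;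 the set of these is $\mathcal P^\infty_{\mathcal B_\lambda}$. For a finite path $p=e_1\cdots e_n$ in $\mathcal B$ from $v_0$ and $U\subseteq s(e_n)$ open, the cylinder set $Z(p,U)$ is the set of labelled infinite paths whose first $n$ edges are $e_1,\dots,e_n$ and with $t_n\in U$; these form a base of the topology on $\mathcal P^\infty_{\mathcal B_\lambda}$. Two labelled infinite paths $x^\lambda,y^\lambda\in\mathcal P^\infty_{\mathcal B_\lambda}$ are tail-equivalent if $x^\lambda_{[n,\infty)}=y^\lambda_{[n,\infty)}$ for some $n\in\mathbb N$. $\mathcal G_{\mathcal B_\lambda}$ is the groupoid of pairs $(x^\lambda,y^\lambda)$ of tail-equivalent labelled infinite paths, with $(x^\lambda,y^\lambda)(y^\lambda,z^\lambda)=(x^\lambda,z^\lambda)$, equipped with the subspace topology inherited from the product topology on $\mathcal P^\infty_{\mathcal B_\lambda}\times\mathcal P^\infty_{\mathcal B_\lambda}$.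
   Formalization: The labelled tail-equivalence groupoid carries the inductive limit topology of the subrelations of pairs agreeing from position m on (each open, with the product's subspace topology); with the subspace topology on the whole groupoid the claim fails, e.g. for one-point spaces and k_n = 2^n. *)

theory Defs
  imports "HOL-Analysis.Analysis" "Jordan_Normal_Form.Matrix"
begin

section \<open>Normed *-algebras, completions and inductive limits\<close>

record 'x cstar = "(complex, 'x) module" +
  star :: "'x \<Rightarrow> 'x"
  cnorm :: "'x \<Rightarrow> real"

definition cdist :: "'x cstar \<Rightarrow> 'x \<Rightarrow> 'x \<Rightarrow> real" where
  "cdist A x y = cnorm A (x \<oplus>\<^bsub>A\<^esub> ((-1) \<odot>\<^bsub>A\<^esub> y))"

definition cstar_iso :: "'x cstar \<Rightarrow> 'y cstar \<Rightarrow> ('x \<Rightarrow> 'y) \<Rightarrow> bool" where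
  "cstar_iso A B h \<longleftrightarrow>
     h \<in> ring_hom A B \<and> bij_betw h (carrier A) (carrier B) \<and>
     (\<forall>z. \<forall>x\<in>carrier A. h (z \<odot>\<^bsub>A\<^esub> x) = z \<odot>\<^bsub>B\<^esub> h x) \<and>
     (\<forall>x\<in>carrier A. h (star A x) = star B (h x)) \<and>
     (\<forall>x\<in>carrier A. cnorm B (h x) = cnorm A x)"

text \<open>For a sequence of algebras \<open>A n\<close> and a set \<open>S\<close> of sequences in the product of the \<open>A n\<close>,
  \<open>seq_quotient A S\<close> is the quotient of \<open>S\<close> by the null sequences, with the entrywise operations
  and the norm \<open>lim \<parallel>a n\<parallel>\<close>.\<close>

definition seq_class :: "(nat \<Rightarrow> 'x cstar) \<Rightarrow> (nat \<Rightarrow> 'x) set \<Rightarrow> (nat \<Rightarrow> 'x) \<Rightarrow> (nat \<Rightarrow> 'x) set" where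
  "seq_class A S a = {b \<in> S. (\<lambda>n. cdist (A n) (b n) (a n)) \<longlonglongrightarrow> 0}"

definition seq_quotient :: "(nat \<Rightarrow> 'x cstar) \<Rightarrow> (nat \<Rightarrow> 'x) set \<Rightarrow> (nat \<Rightarrow> 'x) set cstar" where
  "seq_quotient A S =
    \<lparr> carrier = seq_class A S ` S,
      mult = (\<lambda>P Q. \<Union>a\<in>P. \<Union>b\<in>Q. seq_class A S (\<lambda>n. a n \<otimes>\<^bsub>A n\<^esub> b n)),
      one = seq_class A S (\<lambda>n. \<one>\<^bsub>A n\<^esub>),
      zero = seq_class A S (\<lambda>n. \<zero>\<^bsub>A n\<^esub>),
      add = (\<lambda>P Q. \<Union>a\<in>P. \<Union>b\<in>Q. seq_class A S (\<lambda>n. a n \<oplus>\<^bsub>A n\<^esub> b n)),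
      smult = (\<lambda>z P. \<Union>a\<in>P. seq_class A S (\<lambda>n. z \<odot>\<^bsub>A n\<^esub> a n)),
      star = (\<lambda>P. \<Union>a\<in>P. seq_class A S (\<lambda>n. star (A n) (a n))),
      cnorm = (\<lambda>P. THE l. \<forall>a\<in>P. (\<lambda>n. cnorm (A n) (a n)) \<longlonglongrightarrow> l) \<rparr>"

definition completion :: "'x cstar \<Rightarrow> (nat \<Rightarrow> 'x) set cstar" where
  "completion A = seq_quotient (\<lambda>_. A)
     {a. (\<forall>n. a n \<in> carrier A) \<and> (\<forall>\<epsilon>>0. \<exists>M. \<forall>m\<ge>M. \<forall>n\<ge>M. cdist A (a m) (a n) < \<epsilon>)}"

text \<open>\<open>transit \<phi> m d\<close> is the composite connecting map from level \<open>m\<close> to level \<open>m + d\<close>.\<close>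

primrec transit :: "(nat \<Rightarrow> 'x \<Rightarrow> 'x) \<Rightarrow> nat \<Rightarrow> nat \<Rightarrow> 'x \<Rightarrow> 'x" where
  "transit \<phi> m 0 x = x"
| "transit \<phi> m (Suc d) x = \<phi> (m + d) (transit \<phi> m d x)"

text \<open>The C*-inductive limit in its usual concrete model: the closure, inside the product of the
  \<open>A n\<close> modulo null sequences, of the union of the images of the \<open>A m\<close>, where \<open>x \<in> A m\<close> is sent to
  the class of \<open>(0, \<dots>, 0, x, \<phi> m x, \<phi> (m+1) (\<phi> m x), \<dots>)\<close>. A sequence represents a point of that
  closure iff it is asymptotically a thread, which is the condition below.\<close>

definition limit_seqs :: "(nat \<Rightarrow> 'x cstar) \<Rightarrow> (nat \<Rightarrow> 'x \<Rightarrow> 'x) \<Rightarrow> (nat \<Rightarrow> 'x) set" where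
  "limit_seqs A \<phi> =
     {a. (\<forall>n. a n \<in> carrier (A n)) \<and>
         (\<forall>\<epsilon>>0. \<exists>m. \<forall>n\<ge>m. cdist (A n) (a n) (transit \<phi> m (n - m) (a m)) < \<epsilon>)}"

definition ind_limit :: "(nat \<Rightarrow> 'x cstar) \<Rightarrow> (nat \<Rightarrow> 'x \<Rightarrow> 'x) \<Rightarrow> (nat \<Rightarrow> 'x) set cstar" where
  "ind_limit A \<phi> = seq_quotient A (limit_seqs A \<phi>)"

definition limit_map ::
    "(nat \<Rightarrow> 'x cstar) \<Rightarrow> (nat \<Rightarrow> 'x \<Rightarrow> 'x) \<Rightarrow> nat \<Rightarrow> 'x \<Rightarrow> (nat \<Rightarrow> 'x) set" where
  "limit_map A \<phi> m x = seq_class A (limit_seqs A \<phi>)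
     (\<lambda>n. if n < m then \<zero>\<^bsub>A n\<^esub> else transit \<phi> m (n - m) x)"

definition closure_in :: "'x cstar \<Rightarrow> 'x set \<Rightarrow> 'x set" where
  "closure_in A Y = {x \<in> carrier A. \<forall>\<epsilon>>0. \<exists>y\<in>Y. cdist A x y < \<epsilon>}"

text \<open>The Gelfand spectrum: nonzero multiplicative linear functionals (extensional on the carrier)
  with the topology of pointwise convergence.\<close>

definition characters :: "'x cstar \<Rightarrow> ('x \<Rightarrow> complex) set" where
  "characters A = {\<tau> \<in> extensional (carrier A).
     (\<forall>x\<in>carrier A. \<forall>y\<in>carrier A. \<tau> (x \<oplus>\<^bsub>A\<^esub> y) = \<tau> x + \<tau> y) \<and>
     (\<forall>x\<in>carrier A. \<forall>y\<in>carrier A. \<tau> (x \<otimes>\<^bsub>A\<^esub> y) = \<tau> x * \<tau> y) \<and>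
     (\<forall>z. \<forall>x\<in>carrier A. \<tau> (z \<odot>\<^bsub>A\<^esub> x) = z * \<tau> x) \<and>
     (\<exists>x\<in>carrier A. \<tau> x \<noteq> 0)}"

definition gelfand_spectrum :: "'x cstar \<Rightarrow> ('x \<Rightarrow> complex) topology" where
  "gelfand_spectrum A =
     subtopology (product_topology (\<lambda>_. euclidean) (carrier A)) (characters A)"


section \<open>Hilbert spaces of square-summable functions\<close>

definition ell2 :: "'g set \<Rightarrow> ('g \<Rightarrow> complex) set" where
  "ell2 S = {\<xi>. (\<forall>x. x \<notin> S \<longrightarrow> \<xi> x = 0) \<and> (\<lambda>x. (cmod (\<xi> x))\<^sup>2) summable_on S}"

definition l2norm :: "'g set \<Rightarrow> ('g \<Rightarrow> complex) \<Rightarrow> real" where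
  "l2norm S \<xi> = sqrt (\<Sum>\<^sub>\<infinity>x\<in>S. (cmod (\<xi> x))\<^sup>2)"

definition opnorm :: "'g set \<Rightarrow> (('g \<Rightarrow> complex) \<Rightarrow> ('g \<Rightarrow> complex)) \<Rightarrow> real" where
  "opnorm S T = (SUP \<xi>\<in>{\<xi> \<in> ell2 S. l2norm S \<xi> \<le> 1}. l2norm S (T \<xi>))"


section \<open>Topological groupoids and reduced groupoid C*-algebras\<close>

text \<open>\<open>gtop\<close> is the topology on the set of arrows; the product \<open>gmult G \<gamma> \<delta>\<close> is meaningful for
  arrows with \<open>gsrc G \<gamma> = grng G \<delta>\<close>.\<close>

record ('g, 'u) tgroupoid =
  gtop :: "'g topology"
  gsrc :: "'g \<Rightarrow> 'u"
  grng :: "'g \<Rightarrow> 'u"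
  gmult :: "'g \<Rightarrow> 'g \<Rightarrow> 'g"
  ginv :: "'g \<Rightarrow> 'g"

abbreviation arrows :: "('g, 'u) tgroupoid \<Rightarrow> 'g set" where
  "arrows G \<equiv> topspace (gtop G)"

definition tgroupoid_iso ::
    "('g, 'u) tgroupoid \<Rightarrow> ('h, 'v) tgroupoid \<Rightarrow> ('g \<Rightarrow> 'h) \<Rightarrow> bool" where
  "tgroupoid_iso G H f \<longleftrightarrow>
     homeomorphic_map (gtop G) (gtop H) f \<and>
     (\<forall>\<gamma>\<in>arrows G. \<forall>\<delta>\<in>arrows G.
        (gsrc G \<gamma> = grng G \<delta> \<longleftrightarrow> gsrc H (f \<gamma>) = grng H (f \<delta>)) \<and>
        (gsrc G \<gamma> = grng G \<delta> \<longrightarrow> f (gmult G \<gamma> \<delta>) = gmult H (f \<gamma>) (f \<delta>)))"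

definition src_fibre :: "('g, 'u) tgroupoid \<Rightarrow> 'u \<Rightarrow> 'g set" where
  "src_fibre G u = {\<gamma> \<in> arrows G. gsrc G \<gamma> = u}"

definition Cc :: "('g, 'u) tgroupoid \<Rightarrow> ('g \<Rightarrow> complex) set" where
  "Cc G = {f. (\<forall>\<gamma>. \<gamma> \<notin> arrows G \<longrightarrow> f \<gamma> = 0) \<and> continuous_map (gtop G) euclidean f \<and>
              compactin (gtop G) (gtop G closure_of {\<gamma> \<in> arrows G. f \<gamma> \<noteq> 0})}"

definition conv ::
    "('g, 'u) tgroupoid \<Rightarrow> ('g \<Rightarrow> complex) \<Rightarrow> ('g \<Rightarrow> complex) \<Rightarrow> 'g \<Rightarrow> complex" where
  "conv G f g = (\<lambda>\<gamma>. if \<gamma> \<in> arrows G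
     then \<Sum>\<^sub>\<infinity>\<beta>\<in>src_fibre G (gsrc G \<gamma>). f (gmult G \<gamma> (ginv G \<beta>)) * g \<beta> else 0)"

text \<open>The regular representation of \<open>f\<close> at the unit \<open>u\<close> is \<open>\<xi> \<mapsto> conv G f \<xi>\<close> on
  \<open>\<ell>\<^sup>2(src_fibre G u)\<close>.\<close>

definition reduced_norm :: "('g, 'u) tgroupoid \<Rightarrow> ('g \<Rightarrow> complex) \<Rightarrow> real" where
  "reduced_norm G f = (SUP u\<in>gsrc G ` arrows G. opnorm (src_fibre G u) (conv G f))"

text \<open>The field \<open>one\<close> is the indicator function of the unit space; it lies in the carrier when the
  unit space is compact and open.\<close>

definition Cc_algebra :: "('g, 'u) tgroupoid \<Rightarrow> ('g \<Rightarrow> complex) cstar" where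
  "Cc_algebra G =
    \<lparr> carrier = Cc G,
      mult = conv G,
      one = (\<lambda>\<gamma>. if \<gamma> \<in> arrows G \<and> gmult G (ginv G \<gamma>) \<gamma> = \<gamma> then 1 else 0),
      zero = (\<lambda>_. 0),
      add = (\<lambda>f g \<gamma>. f \<gamma> + g \<gamma>),
      smult = (\<lambda>z f \<gamma>. z * f \<gamma>),
      star = (\<lambda>f \<gamma>. if \<gamma> \<in> arrows G then cnj (f (ginv G \<gamma>)) else 0),
      cnorm = reduced_norm G \<rparr>"

definition reduced_cstar :: "('g, 'u) tgroupoid \<Rightarrow> (nat \<Rightarrow> 'g \<Rightarrow> complex) set cstar" where
  "reduced_cstar G = completion (Cc_algebra G)"


section \<open>Diagonal AH-systems\<close>

text \<open>Levels are \<open>n \<ge> 1\<close> (values at level 0 are irrelevant); summands and matrix indices are numbered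
  from 0. For \<open>i < nsum S n\<close> and \<open>j < nsum S (Suc n)\<close>, \<open>edg S n i j\<close> is \<open>E\<^sub>n(i,j)\<close> with eigenfunctions
  \<open>eig S n i j e\<close>, and \<open>blocks S n j\<close> is the order of the diagonal blocks \<open>(i, e)\<close> in the \<open>j\<close>-th
  component of the \<open>n\<close>-th connecting map. All spaces live on subsets of one type, which is no
  restriction for countably many spaces.\<close>

record ('a, 'e) diag_AH =
  nsum :: "nat \<Rightarrow> nat"
  msize :: "nat \<Rightarrow> nat \<Rightarrow> nat"
  space_at :: "nat \<Rightarrow> nat \<Rightarrow> 'a topology"
  edg :: "nat \<Rightarrow> nat \<Rightarrow> nat \<Rightarrow> 'e set"
  eig :: "nat \<Rightarrow> nat \<Rightarrow> nat \<Rightarrow> 'e \<Rightarrow> 'a \<Rightarrow> 'a"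
  blocks :: "nat \<Rightarrow> nat \<Rightarrow> (nat \<times> 'e) list"

type_synonym 'a matfun = "nat \<times> 'a \<Rightarrow> complex mat"

text \<open>The direct sum of the \<open>C(X n i) \<otimes> M_k\<close> consists of the functions \<open>(i, t) \<mapsto> f (i, t) \<in> M_k\<close> that
  are continuous in \<open>t \<in> X n i\<close>.\<close>

definition points :: "('a, 'e) diag_AH \<Rightarrow> nat \<Rightarrow> (nat \<times> 'a) set" where
  "points S n = (SIGMA i:{..<nsum S n}. topspace (space_at S n i))"

definition matnorm :: "nat \<Rightarrow> complex mat \<Rightarrow> real" where
  "matnorm k M = opnorm {..<k} (\<lambda>v a. \<Sum>b<k. M $$ (a, b) * v b)"

definition alg :: "('a, 'e) diag_AH \<Rightarrow> nat \<Rightarrow> 'a matfun cstar" where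
  "alg S n =
    \<lparr> carrier = {f \<in> (\<Pi>\<^sub>E (i, t)\<in>points S n. carrier_mat (msize S n i) (msize S n i)).
        \<forall>i<nsum S n. \<forall>a<msize S n i. \<forall>b<msize S n i.
          continuous_map (space_at S n i) euclidean (\<lambda>t. f (i, t) $$ (a, b))},
      mult = (\<lambda>f g. \<lambda>x\<in>points S n. f x * g x),
      one = (\<lambda>(i, t)\<in>points S n. 1\<^sub>m (msize S n i)),
      zero = (\<lambda>(i, t)\<in>points S n. 0\<^sub>m (msize S n i) (msize S n i)),
      add = (\<lambda>f g. \<lambda>x\<in>points S n. f x + g x),
      smult = (\<lambda>z f. \<lambda>x\<in>points S n. z \<cdot>\<^sub>m f x),
      star = (\<lambda>f. \<lambda>x\<in>points S n. map_mat cnj (transpose_mat (f x))),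
      cnorm = (\<lambda>f. SUP (i, t)\<in>points S n. matnorm (msize S n i) (f (i, t))) \<rparr>"

definition phi :: "('a, 'e) diag_AH \<Rightarrow> nat \<Rightarrow> 'a matfun \<Rightarrow> 'a matfun" where
  "phi S n f = (\<lambda>(j, t)\<in>points S (Suc n).
     diag_block_mat (map (\<lambda>(i, e). f (i, eig S n i j e t)) (blocks S n j)))"

definition diagonal_AH_system :: "('a, 'e) diag_AH \<Rightarrow> bool" where
  "diagonal_AH_system S \<longleftrightarrow> (\<forall>n\<ge>1.
     0 < nsum S n \<and>
     (\<forall>i<nsum S n. 0 < msize S n i \<and> compact_space (space_at S n i) \<and>
        Hausdorff_space (space_at S n i) \<and> topspace (space_at S n i) \<noteq> {}) \<and>
     (\<forall>i<nsum S n. \<forall>j<nsum S (Suc n). finite (edg S n i j) \<and>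
        (\<forall>e\<in>edg S n i j. continuous_map (space_at S (Suc n) j) (space_at S n i) (eig S n i j e))) \<and>
     (\<forall>j<nsum S (Suc n). distinct (blocks S n j) \<and>
        set (blocks S n j) = {(i, e). i < nsum S n \<and> e \<in> edg S n i j} \<and>
        msize S (Suc n) j = (\<Sum>(i, e)\<leftarrow>blocks S n j. msize S n i)) \<and>
     phi S n \<one>\<^bsub>alg S n\<^esub> = \<one>\<^bsub>alg S (Suc n)\<^esub> \<and>
     inj_on (phi S n) (carrier (alg S n)))"

definition AH_algebra :: "('a, 'e) diag_AH \<Rightarrow> (nat \<Rightarrow> 'a matfun) set cstar" where
  "AH_algebra S = ind_limit (\<lambda>n. alg S (Suc n)) (\<lambda>n. phi S (Suc n))"

text \<open>The embedding of \<open>alg S n\<close>, \<open>n \<ge> 1\<close>. Sequences in the limit are indexed from 0, whence the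
  shift.\<close>

definition embed :: "('a, 'e) diag_AH \<Rightarrow> nat \<Rightarrow> 'a matfun \<Rightarrow> (nat \<Rightarrow> 'a matfun) set" where
  "embed S n = limit_map (\<lambda>n. alg S (Suc n)) (\<lambda>n. phi S (Suc n)) (n - 1)"

definition C_level :: "('a, 'e) diag_AH \<Rightarrow> nat \<Rightarrow> 'a matfun set" where
  "C_level S n = {f \<in> carrier (alg S n). \<forall>x\<in>points S n. diagonal_mat (f x)}"

definition B_level :: "('a, 'e) diag_AH \<Rightarrow> nat \<Rightarrow> 'a matfun set" where
  "B_level S n = {\<lambda>(i, t)\<in>points S n. M i | M.
     \<forall>i<nsum S n. M i \<in> carrier_mat (msize S n i) (msize S n i)}"

definition C_algebra :: "('a, 'e) diag_AH \<Rightarrow> (nat \<Rightarrow> 'a matfun) set cstar" where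
  "C_algebra S = (AH_algebra S)
     \<lparr> carrier := closure_in (AH_algebra S) (\<Union>n\<in>{1..}. embed S n ` C_level S n) \<rparr>"

definition B_algebra :: "('a, 'e) diag_AH \<Rightarrow> (nat \<Rightarrow> 'a matfun) set cstar" where
  "B_algebra S = (AH_algebra S)
     \<lparr> carrier := closure_in (AH_algebra S) (\<Union>n\<in>{1..}. embed S n ` B_level S n) \<rparr>"

definition CB_algebra :: "('a, 'e) diag_AH \<Rightarrow> (nat \<Rightarrow> 'a matfun) set cstar" where
  "CB_algebra S = (AH_algebra S)
     \<lparr> carrier := carrier (C_algebra S) \<inter> carrier (B_algebra S) \<rparr>"

abbreviation C_hat :: "('a, 'e) diag_AH \<Rightarrow> ((nat \<Rightarrow> 'a matfun) set \<Rightarrow> complex) topology" where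
  "C_hat S \<equiv> gelfand_spectrum (C_algebra S)"


section \<open>The Bratteli diagram and its tail-equivalence groupoid\<close>

text \<open>The vertices at level \<open>n\<close> are represented by their second coordinates, the root by 0.
  \<open>Root j m\<close> is the \<open>m\<close>-th edge from the root to \<open>(1, j)\<close>; at level \<open>n \<ge> 1\<close>, \<open>Link i j e\<close> is the
  edge \<open>e \<in> E\<^sub>n(i,j)\<close> from \<open>(n, i)\<close> to \<open>(n + 1, j)\<close>.\<close>

datatype 'e edge = Root nat nat | Link nat nat 'e

primrec esrc :: "'e edge \<Rightarrow> nat" where
  "esrc (Root j m) = 0"
| "esrc (Link i j e) = i"

primrec etgt :: "'e edge \<Rightarrow> nat" where
  "etgt (Root j m) = j"
| "etgt (Link i j e) = j"

definition edges :: "('a, 'e) diag_AH \<Rightarrow> nat \<Rightarrow> 'e edge set" where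
  "edges S n = (if n = 0 then {Root j m | j m. j < nsum S 1 \<and> m < msize S 1 j}
     else {Link i j e | i j e. i < nsum S n \<and> j < nsum S (Suc n) \<and> e \<in> edg S n i j})"

text \<open>An infinite path \<open>x\<^sub>1 x\<^sub>2 \<dots>\<close> is the function \<open>x\<close> with \<open>x n = x\<^sub>n\<^sub>+\<^sub>1 \<in> E\<^sub>n\<close>; similarly for finite
  paths as lists.\<close>

definition inf_paths :: "('a, 'e) diag_AH \<Rightarrow> (nat \<Rightarrow> 'e edge) set" where
  "inf_paths S = {x. \<forall>n. x n \<in> edges S n \<and> etgt (x n) = esrc (x (Suc n))}"

definition fin_paths :: "('a, 'e) diag_AH \<Rightarrow> 'e edge list set" where
  "fin_paths S = {p. p \<noteq> [] \<and> (\<forall>n<length p. p ! n \<in> edges S n) \<and>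
     (\<forall>n. Suc n < length p \<longrightarrow> etgt (p ! n) = esrc (p ! Suc n))}"

definition Z :: "('a, 'e) diag_AH \<Rightarrow> 'e edge list \<Rightarrow> (nat \<Rightarrow> 'e edge) set" where
  "Z S p = {x \<in> inf_paths S. \<forall>n<length p. x n = p ! n}"

definition parallel_paths :: "('a, 'e) diag_AH \<Rightarrow> ('e edge list \<times> 'e edge list) set" where
  "parallel_paths S = {(p, q). p \<in> fin_paths S \<and> q \<in> fin_paths S \<and>
     length p = length q \<and> etgt (last p) = etgt (last q)}"

definition ZZ ::
    "('a, 'e) diag_AH \<Rightarrow> 'e edge list \<Rightarrow> 'e edge list \<Rightarrow> ((nat \<Rightarrow> 'e edge) \<times> (nat \<Rightarrow> 'e edge)) set" where
  "ZZ S p q = {(x, y). x \<in> Z S p \<and> y \<in> Z S q \<and> (\<forall>n\<ge>length p. x n = y n)}"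

definition tail_groupoid ::
    "('a, 'e) diag_AH \<Rightarrow> ((nat \<Rightarrow> 'e edge) \<times> (nat \<Rightarrow> 'e edge), nat \<Rightarrow> 'e edge) tgroupoid" where
  "tail_groupoid S =
    \<lparr> gtop = topology_generated_by {ZZ S p q | p q. (p, q) \<in> parallel_paths S},
      gsrc = snd, grng = fst,
      gmult = (\<lambda>(x, y) (y', z). (x, z)),
      ginv = (\<lambda>(x, y). (y, x)) \<rparr>"

text \<open>The (0-based) index in \<open>{..<k}\<close> that a path labels: a block \<open>(i, e)\<close> shifts indices by the
  total size of the blocks preceding it.\<close>

definition block_offset :: "('a, 'e) diag_AH \<Rightarrow> nat \<Rightarrow> nat \<Rightarrow> nat \<times> 'e \<Rightarrow> nat" where
  "block_offset S n j b = (\<Sum>(i, e)\<leftarrow>takeWhile (\<lambda>b'. b' \<noteq> b) (blocks S n j). msize S n i)"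

primrec edge_offset :: "('a, 'e) diag_AH \<Rightarrow> nat \<Rightarrow> 'e edge \<Rightarrow> nat" where
  "edge_offset S n (Root j m) = m"
| "edge_offset S n (Link i j e) = block_offset S n j (i, e)"

definition path_index :: "('a, 'e) diag_AH \<Rightarrow> 'e edge list \<Rightarrow> nat" where
  "path_index S p = (\<Sum>n<length p. edge_offset S n (p ! n))"

text \<open>The matrix unit \<open>e\<^sub>p\<^sub>,\<^sub>q\<close> for parallel paths of length \<open>n\<close>, as an element of the limit; it
  corresponds to the indicator function of \<open>ZZ S p q\<close>, and \<open>e\<^sub>p\<^sub>,\<^sub>p\<close> to that of \<open>Z S p\<close>.\<close>

definition mat_unit ::
    "('a, 'e) diag_AH \<Rightarrow> 'e edge list \<Rightarrow> 'e edge list \<Rightarrow> (nat \<Rightarrow> 'a matfun) set" where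
  "mat_unit S p q = embed S (length p) (\<lambda>(i, t)\<in>points S (length p).
     Matrix.mat (msize S (length p) i) (msize S (length p) i)
       (\<lambda>(a, b). if i = etgt (last p) \<and> a = path_index S p \<and> b = path_index S q then 1 else 0))"


section \<open>The conjugation action and the transformation groupoid\<close>

text \<open>Under \<open>C(inf_paths S) = C \<inter> B\<close>, the character \<open>\<omega>\<close> of \<open>C \<inter> B\<close> is evaluation at \<open>x\<close>.\<close>

definition is_evaluation ::
    "('a, 'e) diag_AH \<Rightarrow> ((nat \<Rightarrow> 'a matfun) set \<Rightarrow> complex) \<Rightarrow> (nat \<Rightarrow> 'e edge) \<Rightarrow> bool" where
  "is_evaluation S \<omega> x \<longleftrightarrow> \<omega> \<in> characters (CB_algebra S) \<and>
     (\<forall>p\<in>fin_paths S. \<omega> (mat_unit S p p) = indicator (Z S p) x)"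

definition anchor ::
    "('a, 'e) diag_AH \<Rightarrow> ((nat \<Rightarrow> 'a matfun) set \<Rightarrow> complex) \<Rightarrow> (nat \<Rightarrow> 'e edge)" where
  "anchor S \<tau> = (THE x. x \<in> inf_paths S \<and>
     is_evaluation S (restrict \<tau> (carrier (CB_algebra S))) x)"

definition act ::
    "('a, 'e) diag_AH \<Rightarrow> (nat \<Rightarrow> 'e edge) \<times> (nat \<Rightarrow> 'e edge) \<Rightarrow>
       ((nat \<Rightarrow> 'a matfun) set \<Rightarrow> complex) \<Rightarrow> ((nat \<Rightarrow> 'a matfun) set \<Rightarrow> complex)" where
  "act S \<gamma> \<tau> = (let A = AH_algebra S; C = carrier (C_algebra S) in
     THE \<psi>. \<psi> \<in> extensional C \<and>
       (\<forall>(p, q)\<in>parallel_paths S. \<gamma> \<in> ZZ S p q \<longrightarrow>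
          (\<forall>c\<in>C. \<psi> c = \<tau> ((star A (mat_unit S p q) \<otimes>\<^bsub>A\<^esub> c) \<otimes>\<^bsub>A\<^esub> mat_unit S p q))))"

definition transformation_groupoid ::
    "('a, 'e) diag_AH \<Rightarrow>
      (((nat \<Rightarrow> 'e edge) \<times> (nat \<Rightarrow> 'e edge)) \<times> ((nat \<Rightarrow> 'a matfun) set \<Rightarrow> complex),
       (nat \<Rightarrow> 'e edge) \<times> ((nat \<Rightarrow> 'a matfun) set \<Rightarrow> complex)) tgroupoid" where
  "transformation_groupoid S = (let G = tail_groupoid S in
    \<lparr> gtop = subtopology (prod_topology (gtop G) (C_hat S)) {(\<gamma>, \<tau>). gsrc G \<gamma> = anchor S \<tau>},
      gsrc = (\<lambda>(\<gamma>, \<tau>). (gsrc G \<gamma>, \<tau>)),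
      grng = (\<lambda>(\<gamma>, \<tau>). (grng G \<gamma>, act S \<gamma> \<tau>)),
      gmult = (\<lambda>(\<eta>, \<psi>) (\<gamma>, \<tau>). (gmult G \<eta> \<gamma>, \<tau>)),
      ginv = (\<lambda>(\<gamma>, \<tau>). (ginv G \<gamma>, act S \<gamma> \<tau>)) \<rparr>)"


section \<open>The labelled Bratteli diagram and its tail-equivalence groupoid\<close>

text \<open>The root is the one-point space \<open>{undefined}\<close>.\<close>

definition vertex_space :: "('a, 'e) diag_AH \<Rightarrow> nat \<Rightarrow> nat \<Rightarrow> 'a topology" where
  "vertex_space S n i = (if n = 0 then discrete_topology {undefined} else space_at S n i)"

primrec label :: "('a, 'e) diag_AH \<Rightarrow> nat \<Rightarrow> 'e edge \<Rightarrow> 'a \<Rightarrow> 'a" where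
  "label S n (Root j m) = (\<lambda>_. undefined)"
| "label S n (Link i j e) = eig S n i j e"

text \<open>As for unlabelled paths, \<open>x n\<close> is the pair \<open>(e\<^sub>n\<^sub>+\<^sub>1, t\<^sub>n\<^sub>+\<^sub>1)\<close>.\<close>

definition lab_paths :: "('a, 'e) diag_AH \<Rightarrow> (nat \<Rightarrow> 'e edge \<times> 'a) set" where
  "lab_paths S = {x. (\<lambda>n. fst (x n)) \<in> inf_paths S \<and>
     (\<forall>n. snd (x n) \<in> topspace (vertex_space S n (esrc (fst (x n)))) \<and>
          label S n (fst (x n)) (snd (x (Suc n))) = snd (x n))}"

definition lab_Z :: "('a, 'e) diag_AH \<Rightarrow> 'e edge list \<Rightarrow> 'a set \<Rightarrow> (nat \<Rightarrow> 'e edge \<times> 'a) set" where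
  "lab_Z S p U = {x \<in> lab_paths S. (\<forall>n<length p. fst (x n) = p ! n) \<and> snd (x (length p - 1)) \<in> U}"

definition lab_path_space :: "('a, 'e) diag_AH \<Rightarrow> (nat \<Rightarrow> 'e edge \<times> 'a) topology" where
  "lab_path_space S = topology_generated_by
     {lab_Z S p U | p U. p \<in> fin_paths S \<and>
        openin (vertex_space S (length p - 1) (esrc (last p))) U}"

definition tail_rel ::
    "('a, 'e) diag_AH \<Rightarrow> nat \<Rightarrow> ((nat \<Rightarrow> 'e edge \<times> 'a) \<times> (nat \<Rightarrow> 'e edge \<times> 'a)) set" where
  "tail_rel S m = {(x, y). x \<in> lab_paths S \<and> y \<in> lab_paths S \<and> (\<forall>n\<ge>m. x n = y n)}"

text \<open>The set of arrows is the union of the increasing sequence \<open>tail_rel S m\<close>. Each \<open>tail_rel S m\<close>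
  is an open subgroupoid and carries the subspace topology of the product topology, i.e. the arrow
  space is the inductive limit of the \<open>tail_rel S m\<close>. The subspace topology on the whole union is
  coarser: the unit space is in general not open in it, so that it is not etale and does not agree
  with the topology generated by the \<open>ZZ S p q\<close> even when all spaces are points.\<close>

definition labelled_tail_groupoid ::
    "('a, 'e) diag_AH \<Rightarrow>
      ((nat \<Rightarrow> 'e edge \<times> 'a) \<times> (nat \<Rightarrow> 'e edge \<times> 'a), nat \<Rightarrow> 'e edge \<times> 'a) tgroupoid" where
  "labelled_tail_groupoid S =
    \<lparr> gtop = topology_generated_by
        {W \<inter> tail_rel S m | W m. openin (prod_topology (lab_path_space S) (lab_path_space S)) W},
      gsrc = snd, grng = fst,
      gmult = (\<lambda>(x, y) (y', z). (x, z)),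
      ginv = (\<lambda>(x, y). (y, x)) \<rparr>"

end

theory Submission
  imports Defs
begin

text \<open>An element \<open>f\<close> of level \<open>n\<close> becomes a kernel on the relation \<open>tail_rel S n\<close>: for labelled paths
  \<open>x\<close>, \<open>y\<close> that agree from position \<open>n\<close> on, its value at \<open>(x, y)\<close> is the matrix entry of \<open>f\<close> at the
  common point \<open>snd (x n)\<close> whose indices are those of the initial segments of \<open>x\<close> and \<open>y\<close>.
  On each tail-equivalence class this kernel is a direct sum of values of \<open>f\<close>. Injectivity of
  the connecting maps makes the eigenfunctions into each space jointly surjective, so every point
  of every \<open>X n i\<close> lies on a labelled path and the kernel has reduced norm \<open>cnorm f\<close>. Kernels do not
  change under the connecting maps and, by the Stone-Weierstrass theorem on the compact sets
  \<open>tail_rel S m\<close>, are dense in the compactly supported functions; hence the two completions are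
  isomorphic. The same approximation on the diagonal shows that the characters of \<open>C\<close> are the
  evaluations at labelled paths, and \<open>(x, y) \<mapsto> ((ed x, ed y), ev y)\<close>, where \<open>ed\<close> forgets the labels
  and \<open>ev y\<close> is evaluation at \<open>y\<close>, is the isomorphism of groupoids.\<close>


section \<open>Preliminaries\<close>

text \<open>Two estimates carry the analysis. A kernel supported on \<open>tail_rel S n\<close> is
  block diagonal on each tail-equivalence class, with blocks of size at most
  \<open>cls_bound n\<close>, so Schur's test bounds its reduced norm by \<open>cls_bound n\<close>
  times its supremum; conversely, every entry is at most the reduced norm. At a fixed
  \<open>n\<close>, uniform approximation is therefore norm approximation, and this is why a
  Stone-Weierstrass argument yields norm density. The approximants must keep their support in one
  fixed \<open>tail_rel S m\<close> while their level grows; multiplication by the indicator of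
  \<open>tail_rel S m\<close>, itself a kernel, ensures this. The pointwise product of kernels comes
  from the entrywise product of matrices, not from the product of the algebra.

  Norm arguments treat arbitrary bounded functions supported on some \<open>tail_rel S n\<close>,
  continuous or not, so that convolutions never have to be shown continuous.

  On the side of the groupoids everything rests on determinism: an edge and the label at its target
  determine the label at its source. A labelled path is thus recovered from its edges and any of its
  tails, and an arrow \<open>(x, y)\<close> from \<open>ed x\<close> and \<open>y\<close>.\<close>

definition offs :: "('b \<Rightarrow> nat) \<Rightarrow> 'b list \<Rightarrow> 'b \<Rightarrow> nat" where
  "offs w xs b = (\<Sum>x\<leftarrow>takeWhile (\<lambda>b'. b' \<noteq> b) xs. w x)"

lemma offs_Cons [simp]: "offs w (x # xs) b = (if x = b then 0 else w x + offs w xs b)"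
  by (simp add: offs_def)

text \<open>\<open>offs w xs b\<close> is where the block \<open>b\<close> begins in a block
  diagonal matrix whose blocks have the sizes \<open>w\<close> and the order \<open>xs\<close>. This
  lemma and the next two make pairs of a block and a position inside it a bijective code for the
  matrix indices; for a link, this is the recursion behind path labels.\<close>

lemma offs_bound:
  "b \<in> set xs \<Longrightarrow> a < w b \<Longrightarrow> offs w xs b + a < sum_list (map w xs)"
  by (induction xs) auto

lemma offs_unique:
  "b \<in> set xs \<Longrightarrow> b' \<in> set xs \<Longrightarrow> a < w b \<Longrightarrow> a' < w b' \<Longrightarrow> offs w xs b + a = offs w xs b' + a'
    \<Longrightarrow> b = b' \<and> a = a'"
proof (induction xs)
  case (Cons x xs)
  consider "b = x" "b' = x" | "b = x" "b' \<noteq> x" | "b \<noteq> x" "b' = x" | "b \<noteq> x" "b' \<noteq> x" by blast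
  then show ?case using Cons by cases simp_all
qed simp

lemma offs_decomp:
  assumes "distinct xs" "a < sum_list (map w xs)"
  shows "\<exists>b\<in>set xs. \<exists>a'<w b. a = offs w xs b + a'"
  using assms
proof (induction xs arbitrary: a)
  case (Cons x xs)
  show ?case
  proof (cases "a < w x")
    case False
    with Cons.prems have "a - w x < sum_list (map w xs)" by auto
    then obtain b a' where b: "b \<in> set xs" "a' < w b" "a - w x = offs w xs b + a'"
      using Cons.IH[of "a - w x"] Cons.prems(1) by auto
    then have "b \<noteq> x" "a = w x + offs w xs b + a'" using Cons.prems False by auto
    with b show ?thesis by (intro bexI[of _ b] exI[of _ a']) auto
  qed auto
qed auto

lemma diag_block_mat_dims:
  assumes "\<And>b. b \<in> set xs \<Longrightarrow> m b \<in> carrier_mat (w b) (w b)"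
  shows "diag_block_mat (map m xs) \<in> carrier_mat (sum_list (map w xs)) (sum_list (map w xs))"
proof -
  have "map (dim_row \<circ> m) xs = map w xs"
    by (rule map_cong) (use carrier_matD(1)[OF assms] in \<open>simp_all only: o_def\<close>)
  moreover have "map (dim_col \<circ> m) xs = map w xs"
    by (rule map_cong) (use carrier_matD(2)[OF assms] in \<open>simp_all only: o_def\<close>)
  ultimately have "sum_list (map dim_row (map m xs)) = sum_list (map w xs)"
    "sum_list (map dim_col (map m xs)) = sum_list (map w xs)" by (simp_all only: map_map)
  then show ?thesis
    unfolding dim_diag_block_mat[symmetric] by (rule carrier_matI)
qed

lemma diag_block_mat_index:
  assumes "\<And>b. b \<in> set xs \<Longrightarrow> m b \<in> carrier_mat (w b) (w b)"
    and "b \<in> set xs" "b' \<in> set xs" "a < w b" "a' < w b'"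
  shows "diag_block_mat (map m xs) $$ (offs w xs b + a, offs w xs b' + a') =
    (if b = b' then m b $$ (a, a') else 0)"
  using assms
proof (induction xs)
  case (Cons x xs)
  have x: "dim_row (m x) = w x" "dim_col (m x) = w x" using Cons.prems(1)[of x] by auto
  have D: "diag_block_mat (map m xs) \<in> carrier_mat (sum_list (map w xs)) (sum_list (map w xs))"
    by (rule diag_block_mat_dims) (rule Cons.prems(1), simp)
  have bd: "c \<in> set xs \<Longrightarrow> k < w c \<Longrightarrow> offs w xs c + k < sum_list (map w xs)" for c k
    by (rule offs_bound)
  have dims: "dim_row (diag_block_mat (map m xs)) = sum_list (map w xs)"
    "dim_col (diag_block_mat (map m xs)) = sum_list (map w xs)" using D by auto
  have four: "diag_block_mat (map m (x # xs)) = four_block_mat (m x)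
      (0\<^sub>m (w x) (sum_list (map w xs))) (0\<^sub>m (sum_list (map w xs)) (w x)) (diag_block_mat (map m xs))"
    by (simp add: Let_def x dims)
  have IH: "b \<in> set xs \<Longrightarrow> b' \<in> set xs \<Longrightarrow> diag_block_mat (map m xs) $$ (offs w xs b + a, offs w xs b' + a') =
    (if b = b' then m b $$ (a, a') else 0)"
    by (rule Cons.IH[OF Cons.prems(1) _ _ Cons.prems(4,5)]) simp_all
  have mem: "b \<noteq> x \<Longrightarrow> b \<in> set xs" "b' \<noteq> x \<Longrightarrow> b' \<in> set xs" using Cons.prems(2,3) by auto
  note bd' = bd[OF mem(1) Cons.prems(4)] bd[OF mem(2) Cons.prems(5)]
  \<comment> \<open>The head block occupies the upper left corner of the
    \<open>four_block_mat\<close>; the cases say which of its four parts contains the entry.\<close>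
  consider "b = x" "b' = x" | "b = x" "b' \<noteq> x" | "b \<noteq> x" "b' = x" | "b \<noteq> x" "b' \<noteq> x" by blast
  then show ?case
  proof cases
    case 1
    then show ?thesis unfolding four using Cons.prems(4,5) by (simp add: x dims)
  next
    case 2
    then show ?thesis unfolding four using Cons.prems(4,5) bd'(2) by (simp add: x dims)
  next
    case 3
    then show ?thesis unfolding four using Cons.prems(4,5) bd'(1) by (simp add: x dims)
  next
    case 4
    then show ?thesis unfolding four using Cons.prems(4,5) bd' mem IH by (simp add: x dims add.assoc)
  qed
qed simp

section \<open>Stone-Weierstrass theorem and ideals of functions on compact spaces\<close>

lemma Hausdorff_t2: "Hausdorff_space (euclidean :: 'a::t2_space topology)"
  unfolding Hausdorff_space_def disjnt_def open_openin[symmetric] using hausdorff by blast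

text \<open>The separation classes are lifted to function types because the Stone-Weierstrass
  argument below embeds a compact space into
  \<open>('a \<Rightarrow> real) \<Rightarrow> real\<close> and needs this type to be
  Hausdorff.\<close>

instance "fun" :: (type, t0_space) t0_space
proof
  fix f g :: "'a \<Rightarrow> 'b" assume "f \<noteq> g"
  then obtain x where "f x \<noteq> g x" by auto
  then obtain U where "open U" "(f x \<in> U) \<noteq> (g x \<in> U)" using t0_space_class.t0_space by metis
  then show "\<exists>U. open U \<and> \<not> (f \<in> U \<longleftrightarrow> g \<in> U)"
    using product_topology_basis'[of "{x}" "\<lambda>_. U" "\<lambda>x. x"]
    by (intro exI[of _ "{h. \<forall>i\<in>{x}. h i \<in> U}"]) auto
qed

instance "fun" :: (type, t1_space) t1_space
proof
  fix f g :: "'a \<Rightarrow> 'b" assume "f \<noteq> g"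
  then obtain x where "f x \<noteq> g x" by auto
  then obtain U where "open U" "f x \<in> U" "g x \<notin> U" using t1_space_class.t1_space by metis
  then show "\<exists>U. open U \<and> f \<in> U \<and> g \<notin> U"
    using product_topology_basis'[of "{x}" "\<lambda>_. U" "\<lambda>x. x"]
    by (intro exI[of _ "{h. \<forall>i\<in>{x}. h i \<in> U}"]) auto
qed

instance "fun" :: (type, t2_space) t2_space
proof
  fix f g :: "'a \<Rightarrow> 'b" assume "f \<noteq> g"
  then obtain x where "f x \<noteq> g x" by auto
  then obtain U V where "open U" "open V" "f x \<in> U" "g x \<in> V" "U \<inter> V = {}"
    using hausdorff by metis
  then show "\<exists>U V. open U \<and> open V \<and> f \<in> U \<and> g \<in> V \<and> U \<inter> V = {}"
    using product_topology_basis'[of "{x}" "\<lambda>_. U" "\<lambda>x. x"]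
      product_topology_basis'[of "{x}" "\<lambda>_. V" "\<lambda>x. x"]
    by (intro exI[of _ "{h. \<forall>i\<in>{x}. h i \<in> U}"] exI[of _ "{h. \<forall>i\<in>{x}. h i \<in> V}"]) auto
qed

text \<open>\<open>Stone_Weierstrass_HOL\<close> speaks of compact sets in a topological type,
  whereas \<open>X\<close> is a topology carried by a set. Evaluation at the members of
  \<open>H\<close> maps \<open>X\<close> into a function space, where every \<open>h\<close> turns
  into a coordinate. Since \<open>H\<close> separates points and \<open>X\<close> is compact, the
  image is a homeomorphic copy of \<open>X\<close>, and the theorem applies there.\<close>

lemma Stone_Weierstrass_compact_space:
  fixes X :: "'a topology" and H :: "('a \<Rightarrow> real) set"
  assumes cpt: "compact_space X"
    and cont: "\<And>h. h \<in> H \<Longrightarrow> continuous_map X euclideanreal h"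
    and add: "\<And>g h. g \<in> H \<Longrightarrow> h \<in> H \<Longrightarrow> (\<lambda>x. g x + h x) \<in> H"
    and mult: "\<And>g h. g \<in> H \<Longrightarrow> h \<in> H \<Longrightarrow> (\<lambda>x. g x * h x) \<in> H"
    and const: "\<And>c. \<exists>h\<in>H. \<forall>x\<in>topspace X. h x = c"
    and sep: "\<And>x y. x \<in> topspace X \<Longrightarrow> y \<in> topspace X \<Longrightarrow> x \<noteq> y \<Longrightarrow> \<exists>h\<in>H. h x \<noteq> h y"
    and f: "continuous_map X euclideanreal f" and e: "0 < e"
  shows "\<exists>h\<in>H. \<forall>x\<in>topspace X. \<bar>f x - h x\<bar> < e"
proof -
  \<comment> \<open>Coordinates outside \<open>H\<close> are set to 0, which keeps
    \<open>emb\<close> continuous.\<close>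
  define emb :: "'a \<Rightarrow> ('a \<Rightarrow> real) \<Rightarrow> real" where "emb x = (\<lambda>h. if h \<in> H then h x else 0)" for x
  define K where "K = emb ` topspace X"
  define P where "P r \<longleftrightarrow> continuous_on K r \<and> (\<exists>h\<in>H. \<forall>x\<in>topspace X. r (emb x) = h x)" for r
  have emb_cont: "continuous_map X euclidean emb"
    unfolding euclidean_product_topology[symmetric] continuous_map_componentwise_UNIV emb_def
    using cont by auto
  have inj: "inj_on emb (topspace X)"
  proof (rule inj_onI, rule ccontr)
    fix x y assume *: "x \<in> topspace X" "y \<in> topspace X" "emb x = emb y" "x \<noteq> y"
    then obtain h where "h \<in> H" "h x \<noteq> h y" using sep by blast
    with fun_cong[OF *(3), of h] show False by (simp add: emb_def)
  qed
  have cK: "compact K"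
    using image_compactin[OF _ emb_cont, of "topspace X"] cpt
    by (simp add: K_def compact_space_def)
  have hom: "homeomorphic_map X (top_of_set K) emb"
    by (rule continuous_imp_homeomorphic_map)
      (use cpt inj emb_cont in \<open>auto simp: continuous_map_in_subtopology K_def
        intro!: Hausdorff_space_subtopology Hausdorff_t2\<close>)
  obtain j where j: "homeomorphic_maps X (top_of_set K) emb j"
    using hom unfolding homeomorphic_map_maps by blast
  then have jc: "continuous_map (top_of_set K) X j" and je: "\<And>x. x \<in> topspace X \<Longrightarrow> j (emb x) = x"
    by (auto simp: homeomorphic_maps_def)
  have fc: "continuous_on K (f \<circ> j)"
    using continuous_map_compose[OF jc f] by simp
  have "\<exists>r. P r \<and> (\<forall>k\<in>K. \<bar>(f \<circ> j) k - r k\<bar> < e)"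
  proof (rule Stone_Weierstrass_HOL[OF cK _ _ _ _ _ fc e])
    show "P (\<lambda>x. c)" for c using const[of c] by (auto simp: P_def)
    show "continuous_on K r" if "P r" for r using that by (simp add: P_def)
    show "P (\<lambda>x. r x + s x)" if rs: "P r \<and> P s" for r s
    proof -
      obtain g h where "g \<in> H" "h \<in> H" "\<forall>x\<in>topspace X. r (emb x) = g x"
          "\<forall>x\<in>topspace X. s (emb x) = h x" using rs by (auto simp: P_def)
      moreover have "continuous_on K (\<lambda>x. r x + s x)"
        using rs by (intro continuous_intros) (auto simp: P_def)
      ultimately show ?thesis
        unfolding P_def using add[of g h] by (auto intro!: bexI[of _ "\<lambda>x. g x + h x"])
    qed
    show "P (\<lambda>x. r x * s x)" if rs: "P r \<and> P s" for r s
    proof -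
      obtain g h where "g \<in> H" "h \<in> H" "\<forall>x\<in>topspace X. r (emb x) = g x"
          "\<forall>x\<in>topspace X. s (emb x) = h x" using rs by (auto simp: P_def)
      moreover have "continuous_on K (\<lambda>x. r x * s x)"
        using rs by (intro continuous_intros) (auto simp: P_def)
      ultimately show ?thesis
        unfolding P_def using mult[of g h] by (auto intro!: bexI[of _ "\<lambda>x. g x * h x"])
    qed
    show "\<exists>r. P r \<and> r k \<noteq> r l" if kl: "k \<in> K \<and> l \<in> K \<and> k \<noteq> l" for k l
    proof -
      obtain x y where xy: "x \<in> topspace X" "y \<in> topspace X" "k = emb x" "l = emb y" "x \<noteq> y"
        using kl by (auto simp: K_def)
      then obtain h where h: "h \<in> H" "h x \<noteq> h y" using sep by blast
      have "continuous_on K (\<lambda>k. k h)"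
        by (intro continuous_on_product_coordinates continuous_on_subset[OF _ subset_UNIV])
      then have "P (\<lambda>k. k h)" unfolding P_def using h by (auto simp: emb_def)
      then show ?thesis using h xy by (auto simp: emb_def intro!: exI[of _ "\<lambda>k. k h"])
    qed
  qed
  then obtain r h where rh: "\<forall>k\<in>K. \<bar>(f \<circ> j) k - r k\<bar> < e" "h \<in> H" "\<forall>x\<in>topspace X. r (emb x) = h x"
    by (auto simp: P_def)
  then have "\<forall>x\<in>topspace X. \<bar>f x - h x\<bar> < e"
    using je by (auto simp: K_def)
  with rh(2) show ?thesis by blast
qed

text \<open>Finitely many members of the ideal have no common zero, so the sum of their squared
  moduli is invertible.\<close>

lemma ideal_without_common_zero:
  fixes X :: "'a topology" and I :: "('a \<Rightarrow> complex) set"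
  assumes cpt: "compact_space X"
    and cont: "\<And>u. u \<in> I \<Longrightarrow> continuous_map X euclidean u"
    and zero: "(\<lambda>_. 0) \<in> I"
    and add: "\<And>u v. u \<in> I \<Longrightarrow> v \<in> I \<Longrightarrow> (\<lambda>x. u x + v x) \<in> I"
    and mult: "\<And>u v. u \<in> I \<Longrightarrow> continuous_map X euclidean v \<Longrightarrow> (\<lambda>x. v x * u x) \<in> I"
    and nz: "\<And>x. x \<in> topspace X \<Longrightarrow> \<exists>u\<in>I. u x \<noteq> 0"
  shows "\<exists>u\<in>I. \<forall>x\<in>topspace X. u x = 1"
proof -
  define \<U> where "\<U> = (\<lambda>u. {x \<in> topspace X. u x \<noteq> 0}) ` I"
  have op: "openin X U" if "U \<in> \<U>" for U
    using that openin_continuous_map_preimage[OF cont, of _ "- {0}"]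
    by (auto simp: \<U>_def)
  have cov: "topspace X \<subseteq> \<Union> \<U>" using nz by (auto simp: \<U>_def)
  obtain \<F> where F: "finite \<F>" "\<F> \<subseteq> \<U>" "topspace X \<subseteq> \<Union> \<F>"
    using cpt op cov unfolding compact_space_alt by meson
  obtain J where J: "J \<subseteq> I" "finite J" "\<F> = (\<lambda>u. {x \<in> topspace X. u x \<noteq> 0}) ` J"
    using F finite_subset_image[of \<F> "\<lambda>u. {x \<in> topspace X. u x \<noteq> 0}" I] by (auto simp: \<U>_def)
  define s where "s x = (\<Sum>u\<in>J. cnj (u x) * u x)" for x
  have ccnj: "continuous_map X euclidean (\<lambda>x. cnj (u x))" if "u \<in> I" for u
  proof -
    have "continuous_map euclidean euclidean cnj" by (simp add: continuous_on_cnj)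
    from continuous_map_compose[OF cont[OF that] this] show ?thesis by (simp add: o_def)
  qed
  have "s \<in> I"
    unfolding s_def using J(2,1)
  proof (induction J rule: finite_induct)
    case (insert u J)
    then show ?case
      using add[OF mult[OF _ ccnj[of u], of u], of "\<lambda>x. \<Sum>u\<in>J. cnj (u x) * u x"] by simp
  qed (simp add: zero)
  moreover have "s x \<noteq> 0" if xX: "x \<in> topspace X" for x
  proof -
    have eq: "s x = of_real (\<Sum>u\<in>J. (cmod (u x))\<^sup>2)"
      unfolding s_def of_real_sum
      by (intro sum.cong refl) (metis complex_norm_square mult.commute)
    obtain u where "u \<in> J" "u x \<noteq> 0"
      using subsetD[OF F(3) xX] unfolding J(3) by auto
    then have "(\<Sum>u\<in>J. (cmod (u x))\<^sup>2) > 0"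
      using J(2) by (intro sum_pos2[of _ u]) auto
    then show ?thesis using eq by (metis less_irrefl of_real_eq_0_iff)
  qed
  moreover have "continuous_map X euclidean (\<lambda>x. inverse (s x))"
  proof -
    have "continuous_map X (top_of_set (- {0})) s"
      using cont[OF \<open>s \<in> I\<close>] \<open>\<And>x. x \<in> topspace X \<Longrightarrow> s x \<noteq> 0\<close>
      by (auto simp: continuous_map_in_subtopology)
    moreover have "continuous_map (top_of_set (- {0::complex})) euclidean inverse"
      by (auto intro!: continuous_intros)
    ultimately show ?thesis
      using continuous_map_compose[of X "top_of_set (- {0})" s euclidean inverse]
      by (simp add: o_def)
  qed
  ultimately show ?thesis
    using mult[of s "\<lambda>x. inverse (s x)"] by (intro bexI[of _ "\<lambda>x. inverse (s x) * s x"]) simp_all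
qed


section \<open>Labelled paths\<close>

locale AH =
  fixes S :: "('a, 'e) diag_AH"
  assumes sys: "diagonal_AH_system S"
begin

abbreviation "P \<equiv> lab_paths S"
abbreviation "R \<equiv> tail_rel S"
abbreviation src :: "(nat \<Rightarrow> 'e edge \<times> 'a) \<Rightarrow> nat \<Rightarrow> nat" where "src x n \<equiv> esrc (fst (x n))"

text \<open>The counterpart of \<open>path_index\<close> for the first \<open>n\<close> edges of a
  labelled path: for \<open>n \<ge> 1\<close>, the row that \<open>x\<close> occupies in the
  matrices at its vertex of level \<open>n\<close>.\<close>

definition idx :: "nat \<Rightarrow> (nat \<Rightarrow> 'e edge \<times> 'a) \<Rightarrow> nat" where
  "idx n x = (\<Sum>m<n. edge_offset S m (fst (x m)))"

lemma idx_Suc: "idx (Suc n) x = edge_offset S n (fst (x n)) + idx n x"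
  by (simp add: idx_def)

lemma
  assumes "1 \<le> n"
  shows nsum_pos: "0 < nsum S n"
    and msize_pos: "i < nsum S n \<Longrightarrow> 0 < msize S n i"
    and compact_space_at: "i < nsum S n \<Longrightarrow> compact_space (space_at S n i)"
    and Hausdorff_space_at: "i < nsum S n \<Longrightarrow> Hausdorff_space (space_at S n i)"
    and space_at_nonempty: "i < nsum S n \<Longrightarrow> topspace (space_at S n i) \<noteq> {}"
    and finite_edg: "i < nsum S n \<Longrightarrow> j < nsum S (Suc n) \<Longrightarrow> finite (edg S n i j)"
    and continuous_eig: "i < nsum S n \<Longrightarrow> j < nsum S (Suc n) \<Longrightarrow> e \<in> edg S n i j \<Longrightarrow>
      continuous_map (space_at S (Suc n) j) (space_at S n i) (eig S n i j e)"
    and distinct_blocks: "j < nsum S (Suc n) \<Longrightarrow> distinct (blocks S n j)"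
    and set_blocks: "j < nsum S (Suc n) \<Longrightarrow>
      set (blocks S n j) = {(i, e). i < nsum S n \<and> e \<in> edg S n i j}"
    and msize_Suc: "j < nsum S (Suc n) \<Longrightarrow>
      msize S (Suc n) j = sum_list (map (\<lambda>(i, e). msize S n i) (blocks S n j))"
    and inj_phi: "inj_on (phi S n) (carrier (alg S n))"
  using sys assms unfolding diagonal_AH_system_def by blast+

lemma eig_mem:
  assumes "1 \<le> n" "i < nsum S n" "j < nsum S (Suc n)" "e \<in> edg S n i j" "t \<in> topspace (space_at S (Suc n) j)"
  shows "eig S n i j e t \<in> topspace (space_at S n i)"
  using continuous_map_image_subset_topspace[OF continuous_eig[OF assms(1-4)]] assms(5) by blast

text \<open>The conditions on a labelled path, imposed from position \<open>n\<close> on only;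
  earlier values are arbitrary. In this form a path can be built downwards to the root, one edge at
  a time.\<close>

definition tail_path :: "nat \<Rightarrow> (nat \<Rightarrow> 'e edge \<times> 'a) \<Rightarrow> bool" where
  "tail_path n y \<longleftrightarrow> (\<forall>k\<ge>n. fst (y k) \<in> edges S k \<and> etgt (fst (y k)) = src y (Suc k) \<and>
     snd (y k) \<in> topspace (vertex_space S k (src y k)) \<and>
     label S k (fst (y k)) (snd (y (Suc k))) = snd (y k))"

lemma lab_paths_iff: "x \<in> P \<longleftrightarrow> tail_path 0 x"
  by (auto simp: lab_paths_def inf_paths_def tail_path_def)

lemma tail_path_mono: "tail_path m x \<Longrightarrow> m \<le> n \<Longrightarrow> tail_path n x"
  by (auto simp: tail_path_def)

lemma path_edges: "x \<in> P \<Longrightarrow> fst (x n) \<in> edges S n"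
  and path_etgt: "x \<in> P \<Longrightarrow> etgt (fst (x n)) = src x (Suc n)"
  and path_mem: "x \<in> P \<Longrightarrow> snd (x n) \<in> topspace (vertex_space S n (src x n))"
  and path_label: "x \<in> P \<Longrightarrow> label S n (fst (x n)) (snd (x (Suc n))) = snd (x n)"
  by (auto simp: lab_paths_iff tail_path_def)

lemma path_0:
  assumes "x \<in> P"
  obtains m where "x 0 = (Root (src x 1) m, undefined)" "m < msize S 1 (src x 1)"
proof -
  have "fst (x 0) \<in> edges S 0" using path_edges assms by blast
  then obtain j m where jm: "fst (x 0) = Root j m" "m < msize S 1 j" by (auto simp: edges_def)
  moreover have "j = src x 1" using path_etgt[OF assms, of 0] jm by simp
  moreover have "snd (x 0) = undefined" using path_label[OF assms, of 0] jm by simp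
  ultimately show ?thesis using that by (metis prod.collapse)
qed

lemma src_less: "x \<in> P \<Longrightarrow> 1 \<le> n \<Longrightarrow> src x n < nsum S n"
  using path_edges[of x n] by (auto simp: edges_def)

lemma path_mem_space: "x \<in> P \<Longrightarrow> 1 \<le> n \<Longrightarrow> snd (x n) \<in> topspace (space_at S n (src x n))"
  using path_mem[of x n] by (auto simp: vertex_space_def)

lemma path_points: "x \<in> P \<Longrightarrow> 1 \<le> n \<Longrightarrow> (src x n, snd (x n)) \<in> points S n"
  using src_less path_mem_space by (auto simp: points_def)

lemma path_step:
  assumes "x \<in> P" "1 \<le> n"
  obtains e where "e \<in> edg S n (src x n) (src x (Suc n))"
    "x n = (Link (src x n) (src x (Suc n)) e, eig S n (src x n) (src x (Suc n)) e (snd (x (Suc n))))"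
proof -
  obtain i j e where ije: "fst (x n) = Link i j e" "e \<in> edg S n i j"
    using path_edges[OF assms(1), of n] assms(2) by (auto simp: edges_def)
  moreover have "j = src x (Suc n)" using path_etgt[OF assms(1), of n] ije by simp
  moreover have "snd (x n) = eig S n i j e (snd (x (Suc n)))"
    using path_label[OF assms(1), of n] ije by simp
  ultimately show ?thesis using that[of e] by (metis esrc.simps(2) prod.collapse)
qed

lemma edge_offset_Link:
  "edge_offset S n (Link i j e) = offs (\<lambda>(i, e). msize S n i) (blocks S n j) (i, e)"
  by (simp add: block_offset_def offs_def)

text \<open>The index at level \<open>n + 1\<close> is the offset of the block of the last edge plus
  the index at level \<open>n\<close>, and \<open>msize_Suc\<close> adds up the block sizes, so
  \<open>offs_bound\<close> carries the bound one level up.\<close>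

lemma idx_less: "x \<in> P \<Longrightarrow> 1 \<le> n \<Longrightarrow> idx n x < msize S n (src x n)"
proof (induction n)
  case (Suc n)
  show ?case
  proof (cases "n = 0")
    case True
    obtain m where "x 0 = (Root (src x 1) m, undefined)" "m < msize S 1 (src x 1)"
      using path_0 Suc.prems by blast
    then show ?thesis using True by (simp add: idx_def)
  next
    case False
    then have n: "1 \<le> n" by simp
    obtain e where e: "e \<in> edg S n (src x n) (src x (Suc n))"
      "x n = (Link (src x n) (src x (Suc n)) e, eig S n (src x n) (src x (Suc n)) e (snd (x (Suc n))))"
      using path_step Suc.prems(1) n by blast
    have j: "src x (Suc n) < nsum S (Suc n)" using src_less Suc.prems by blast
    have "(src x n, e) \<in> set (blocks S n (src x (Suc n)))"
      using e src_less[OF Suc.prems(1) n] by (simp add: set_blocks[OF n j])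
    then have "edge_offset S n (fst (x n)) + idx n x < msize S (Suc n) (src x (Suc n))"
      unfolding msize_Suc[OF n j]
      by (subst e(2), simp only: fst_conv edge_offset_Link)
        (rule offs_bound, use Suc n in auto)
    then show ?thesis by (simp only: idx_Suc)
  qed
qed simp

lemma tail_relI: "x \<in> P \<Longrightarrow> y \<in> P \<Longrightarrow> (\<And>k. n \<le> k \<Longrightarrow> x k = y k) \<Longrightarrow> (x, y) \<in> R n"
  by (auto simp: tail_rel_def)

lemma tail_relD: "(x, y) \<in> R n \<Longrightarrow> x \<in> P" "(x, y) \<in> R n \<Longrightarrow> y \<in> P"
    "(x, y) \<in> R n \<Longrightarrow> n \<le> k \<Longrightarrow> x k = y k"
  by (auto simp: tail_rel_def)

lemma tail_rel_0: "(x, y) \<in> R 0 \<longleftrightarrow> x = y \<and> x \<in> P"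
  by (auto simp: tail_rel_def)

lemma tail_rel_refl: "x \<in> P \<Longrightarrow> (x, x) \<in> R n"
  and tail_rel_sym: "(x, y) \<in> R n \<Longrightarrow> (y, x) \<in> R n"
  and tail_rel_trans: "(x, y) \<in> R n \<Longrightarrow> (y, z) \<in> R n \<Longrightarrow> (x, z) \<in> R n"
  and tail_rel_mono: "m \<le> n \<Longrightarrow> (x, y) \<in> R m \<Longrightarrow> (x, y) \<in> R n"
  by (auto simp: tail_rel_def)

lemma tail_rel_Suc: "(x, y) \<in> R n \<longleftrightarrow> (x, y) \<in> R (Suc n) \<and> x n = y n"
proof
  assume "(x, y) \<in> R (Suc n) \<and> x n = y n"
  then show "(x, y) \<in> R n"
    by (auto simp: tail_rel_def Suc_le_eq) (metis le_neq_implies_less)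
qed (auto simp: tail_rel_def)

text \<open>Labels propagate downwards along common edges.\<close>

lemma tail_rel_edges:
  assumes "(x, y) \<in> R n" "\<And>k. m \<le> k \<Longrightarrow> k < n \<Longrightarrow> fst (x k) = fst (y k)" "m \<le> n"
  shows "(x, y) \<in> R m"
  using assms
proof (induction "n - m" arbitrary: m)
  case (Suc d)
  then have "(x, y) \<in> R (Suc m)" by auto
  moreover have "x m = y m"
    using path_label[of x m] path_label[of y m] tail_relD[OF \<open>(x, y) \<in> R (Suc m)\<close>] Suc.prems(2)[of m]
      Suc.hyps(2) by (metis le_refl prod_eqI zero_less_Suc zero_less_diff)
  ultimately show ?case by (simp add: tail_rel_Suc[of _ _ m])
qed auto

text \<open>\<open>offs_unique\<close> reads off from the index the block, hence the last edge, and
  the index one level below. The label at the source of this edge is the image of the common label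
  at its target, so the paths agree one position earlier, and the argument descends to the
  root.\<close>

lemma idx_inj: "1 \<le> n \<Longrightarrow> (x, y) \<in> R n \<Longrightarrow> idx n x = idx n y \<Longrightarrow> x = y"
proof (induction n)
  case (Suc n)
  note xP = tail_relD(1)[OF Suc.prems(2)] note yP = tail_relD(2)[OF Suc.prems(2)]
  have eqS: "x (Suc n) = y (Suc n)" using tail_relD(3)[OF Suc.prems(2)] by auto
  show ?case
  proof (cases "n = 0")
    case True
    obtain m where m: "x 0 = (Root (src x 1) m, undefined)" using path_0[OF xP] by blast
    obtain m' where m': "y 0 = (Root (src y 1) m', undefined)" using path_0[OF yP] by blast
    have "m = m'" using Suc.prems(3) m m' True by (simp add: idx_def)
    then have "x 0 = y 0" using m m' eqS True by simp
    then have "(x, y) \<in> R 0" using Suc.prems True by (simp add: tail_rel_Suc[of _ _ 0])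
    then show ?thesis by (simp add: tail_rel_0)
  next
    case False
    then have n: "1 \<le> n" by simp
    let ?j = "src x (Suc n)"
    obtain e where e: "e \<in> edg S n (src x n) ?j"
      "x n = (Link (src x n) ?j e, eig S n (src x n) ?j e (snd (x (Suc n))))"
      using path_step xP n by blast
    obtain e' where e': "e' \<in> edg S n (src y n) ?j"
      "y n = (Link (src y n) ?j e', eig S n (src y n) ?j e' (snd (x (Suc n))))"
      using path_step[OF yP n] eqS by metis
    have j: "?j < nsum S (Suc n)" using src_less xP by simp
    let ?w = "\<lambda>(i, e). msize S n i"
    have "edge_offset S n (fst (x n)) = offs ?w (blocks S n ?j) (src x n, e)"
      by (subst e(2)) (simp only: fst_conv edge_offset_Link)
    moreover have "edge_offset S n (fst (y n)) = offs ?w (blocks S n ?j) (src y n, e')"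
      by (subst e'(2)) (simp only: fst_conv edge_offset_Link)
    ultimately have "offs ?w (blocks S n ?j) (src x n, e) + idx n x = offs ?w (blocks S n ?j) (src y n, e') + idx n y"
      using Suc.prems(3) by (simp only: idx_Suc)
    moreover have "idx n x < ?w (src x n, e)" "idx n y < ?w (src y n, e')"
      using idx_less[OF xP n] idx_less[OF yP n] by auto
    moreover have "(src x n, e) \<in> set (blocks S n ?j)" "(src y n, e') \<in> set (blocks S n ?j)"
      using e e' src_less[OF xP n] src_less[OF yP n] by (auto simp: set_blocks[OF n j])
    ultimately have eq: "(src x n, e) = (src y n, e') \<and> idx n x = idx n y"
      by (intro offs_unique)
    then have "x n = y n" using e e' by (metis prod.inject)
    then have "(x, y) \<in> R n" using Suc.prems(2) by (simp add: tail_rel_Suc[of _ _ n])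
    then show ?thesis using Suc.IH n eq by blast
  qed
qed simp

text \<open>The new label is forced to be the image of the next one. It lies in the right space
  because eigenfunctions map between the spaces of their vertices; at the root it is the single
  point \<open>undefined\<close>.\<close>

lemma tail_path_extend:
  assumes y: "tail_path (Suc n) y" and e: "fst c \<in> edges S n" "etgt (fst c) = src y (Suc n)"
    "snd c = label S n (fst c) (snd (y (Suc n)))"
  shows "tail_path n (y(n := c))"
proof -
  have mem: "snd c \<in> topspace (vertex_space S n (esrc (fst c)))"
  proof (cases "n = 0")
    case True
    then show ?thesis using e by (auto simp: edges_def vertex_space_def)
  next
    case False
    obtain i j f where ijf: "fst c = Link i j f" "i < nsum S n" "j < nsum S (Suc n)" "f \<in> edg S n i j"
      using e False by (auto simp: edges_def)
    have "snd (y (Suc n)) \<in> topspace (space_at S (Suc n) j)"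
      using y e(2) ijf by (auto simp: tail_path_def vertex_space_def)
    then show ?thesis using ijf e(3) False eig_mem[of n i j f] by (simp add: vertex_space_def)
  qed
  show ?thesis
    unfolding tail_path_def
  proof (intro allI impI)
    fix k assume "n \<le> k"
    then consider "k = n" | "Suc n \<le> k" by linarith
    then show "fst ((y(n := c)) k) \<in> edges S k \<and> etgt (fst ((y(n := c)) k)) = src (y(n := c)) (Suc k) \<and>
     snd ((y(n := c)) k) \<in> topspace (vertex_space S k (src (y(n := c)) k)) \<and>
     label S k (fst ((y(n := c)) k)) (snd ((y(n := c)) (Suc k))) = snd ((y(n := c)) k)"
      using y e mem by cases (auto simp: tail_path_def)
  qed
qed

text \<open>The converse of \<open>idx_inj\<close>: \<open>offs_decomp\<close> finds in
  \<open>a\<close> the block, hence the edge, that has to precede the tail, together with the index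
  that remains for the level below. The labels follow by applying the eigenfunctions.\<close>

lemma tail_path_prepend:
  assumes "1 \<le> n" "tail_path n y" "a < msize S n (src y n)"
  shows "\<exists>x\<in>P. (\<forall>k\<ge>n. x k = y k) \<and> idx n x = a"
  using assms
proof (induction n arbitrary: y a)
  case (Suc n)
  let ?j = "src y (Suc n)"
  have j: "?j < nsum S (Suc n)" using Suc.prems(2) by (auto simp: tail_path_def edges_def)
  show ?case
  proof (cases "n = 0")
    case True
    define x where "x = y(0 := (Root ?j a, undefined))"
    have "tail_path 0 x"
      unfolding x_def using Suc.prems True j by (intro tail_path_extend) (auto simp: edges_def)
    then show ?thesis using True by (auto simp: x_def lab_paths_iff idx_def intro!: bexI[of _ x])
  next
    case False
    then have n: "1 \<le> n" by simp
    let ?w = "\<lambda>(i, e). msize S n i"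
    obtain b a' where b: "b \<in> set (blocks S n ?j)" "a' < ?w b" "a = offs ?w (blocks S n ?j) b + a'"
      using offs_decomp[OF distinct_blocks[OF n j], of a ?w] Suc.prems(3) msize_Suc[OF n j] by auto
    obtain i e where ie: "b = (i, e)" by force
    have i: "i < nsum S n" "e \<in> edg S n i ?j" using b ie by (auto simp: set_blocks[OF n j])
    define c where "c = (Link i ?j e, eig S n i ?j e (snd (y (Suc n))))"
    have "tail_path n (y(n := c))"
      using Suc.prems i j n by (intro tail_path_extend) (auto simp: c_def edges_def)
    moreover have "a' < msize S n (src (y(n := c)) n)" using b ie by (simp add: c_def)
    ultimately obtain x where x: "x \<in> P" "\<forall>k\<ge>n. x k = (y(n := c)) k" "idx n x = a'"
      using Suc.IH n by blast
    have "x n = c" using x(2) by simp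
    then have "edge_offset S n (fst (x n)) = offs ?w (blocks S n ?j) b"
      by (simp only: c_def fst_conv edge_offset_Link ie)
    then have "idx (Suc n) x = a" using x(3) b(3) by (simp only: idx_Suc)
    then show ?thesis using x by (intro bexI[of _ x]) auto
  qed
qed simp

lemma ex_idx:
  assumes "u \<in> P" "1 \<le> n" "a < msize S n (src u n)"
  obtains x where "(x, u) \<in> R n" "idx n x = a"
proof -
  have "tail_path n u" using assms(1) by (auto simp: lab_paths_iff intro: tail_path_mono)
  from tail_path_prepend[OF assms(2) this assms(3)]
  obtain x where "x \<in> P" "\<forall>k\<ge>n. x k = u k" "idx n x = a" by blast
  then show ?thesis using assms(1) that by (auto intro: tail_relI)
qed

definition cls :: "nat \<Rightarrow> (nat \<Rightarrow> 'e edge \<times> 'a) \<Rightarrow> (nat \<Rightarrow> 'e edge \<times> 'a) set" where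
  "cls n u = {x. (x, u) \<in> R n}"

text \<open>The class of \<open>u\<close> is in this way the index set of the matrix summand at the
  vertex of \<open>u\<close>; every sum over a class below is turned into a matrix sum by this
  bijection.\<close>

lemma bij_idx: "u \<in> P \<Longrightarrow> 1 \<le> n \<Longrightarrow> bij_betw (idx n) (cls n u) {..<msize S n (src u n)}"
  unfolding bij_betw_def
proof (intro conjI)
  assume u: "u \<in> P" and n: "1 \<le> n"
  show "inj_on (idx n) (cls n u)"
    by (rule inj_onI) (metis idx_inj[OF n] cls_def mem_Collect_eq tail_rel_trans tail_rel_sym)
  have "idx n x < msize S n (src u n)" if "x \<in> cls n u" for x
    using idx_less[OF _ n, of x] tail_relD[of x u n] that by (simp add: cls_def)
  moreover have "a \<in> idx n ` cls n u" if "a < msize S n (src u n)" for a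
    using ex_idx[OF u n that] by (auto simp: cls_def)
  ultimately show "idx n ` cls n u = {..<msize S n (src u n)}" by auto
qed

lemma cls_empty: "u \<notin> P \<Longrightarrow> cls n u = {}"
  by (auto simp: cls_def tail_rel_def)

lemma cls_mono: "m \<le> n \<Longrightarrow> cls m u \<subseteq> cls n u"
  by (auto simp: cls_def intro: tail_rel_mono)

lemma cls_eq: "(x, y) \<in> R n \<Longrightarrow> cls n x = cls n y"
  by (auto simp: cls_def intro: tail_rel_trans tail_rel_sym)

text \<open>A crude bound that is uniform over all classes of \<open>R n\<close>: the sum of all
  matrix sizes of the level. Level 0 carries no matrix sizes, whence the maximum with 1; the classes
  of \<open>R 0\<close> are contained in those of \<open>R 1\<close>.\<close>

definition cls_bound :: "nat \<Rightarrow> nat" where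
  "cls_bound n = (\<Sum>i<nsum S (max 1 n). msize S (max 1 n) i)"

lemma cls_finite_card: "finite (cls n u) \<and> card (cls n u) \<le> cls_bound n"
proof (cases "u \<in> P")
  case True
  let ?n = "max 1 n"
  have b: "bij_betw (idx ?n) (cls ?n u) {..<msize S ?n (src u ?n)}" using bij_idx True by simp
  then have f: "finite (cls ?n u)" using bij_betw_finite by blast
  have "msize S ?n (src u ?n) \<le> cls_bound n"
    unfolding cls_bound_def using src_less[OF True, of ?n] by (intro member_le_sum) auto
  then have "card (cls ?n u) \<le> cls_bound n" using bij_betw_same_card[OF b] by simp
  moreover have "cls n u \<subseteq> cls ?n u" by (rule cls_mono) simp
  ultimately show ?thesis using f by (meson card_mono finite_subset le_trans)
qed (simp add: cls_empty)

lemmas finite_cls = cls_finite_card[THEN conjunct1]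
lemmas card_cls = cls_finite_card[THEN conjunct2]

end

section \<open>Elements of a level and the existence of labelled paths\<close>

context AH
begin

lemma alg_carrier_iff:
  "f \<in> carrier (alg S n) \<longleftrightarrow> f \<in> extensional (points S n) \<and>
    (\<forall>i<nsum S n. \<forall>t\<in>topspace (space_at S n i). f (i, t) \<in> carrier_mat (msize S n i) (msize S n i)) \<and>
    (\<forall>i<nsum S n. \<forall>a<msize S n i. \<forall>b<msize S n i.
       continuous_map (space_at S n i) euclidean (\<lambda>t. f (i, t) $$ (a, b)))"
  by (auto simp: alg_def PiE_def Pi_def points_def)

lemma alg_ext:
  assumes "f \<in> carrier (alg S n)" "g \<in> carrier (alg S n)"
    "\<And>i t a b. i < nsum S n \<Longrightarrow> t \<in> topspace (space_at S n i) \<Longrightarrow> a < msize S n i \<Longrightarrow> b < msize S n i \<Longrightarrow>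
      f (i, t) $$ (a, b) = g (i, t) $$ (a, b)"
  shows "f = g"
proof (rule extensionalityI)
  show "f \<in> extensional (points S n)" "g \<in> extensional (points S n)"
    using assms(1,2) by (auto simp: alg_carrier_iff)
  fix p assume "p \<in> points S n"
  then obtain i t where p: "p = (i, t)" "i < nsum S n" "t \<in> topspace (space_at S n i)"
    by (auto simp: points_def)
  have "f (i, t) \<in> carrier_mat (msize S n i) (msize S n i)" "g (i, t) \<in> carrier_mat (msize S n i) (msize S n i)"
    using assms(1,2) p by (auto simp: alg_carrier_iff)
  with assms(3) p show "f p = g p" by (auto intro!: eq_matI)
qed

text \<open>A scalar function times one matrix unit of one summand. These elements witness the
  surjectivity of the eigenfunctions and later separate arrows.\<close>

definition unit_fun :: "nat \<Rightarrow> nat \<Rightarrow> nat \<Rightarrow> nat \<Rightarrow> ('a \<Rightarrow> complex) \<Rightarrow> 'a matfun" where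
  "unit_fun n i a b g = (\<lambda>(i', s)\<in>points S n. Matrix.mat (msize S n i') (msize S n i')
     (\<lambda>(c, d). if i' = i \<and> c = a \<and> d = b then g s else 0))"

lemma unit_fun_index:
  "i' < nsum S n \<Longrightarrow> s \<in> topspace (space_at S n i') \<Longrightarrow> c < msize S n i' \<Longrightarrow> d < msize S n i' \<Longrightarrow>
    unit_fun n i a b g (i', s) $$ (c, d) = (if i' = i \<and> c = a \<and> d = b then g s else 0)"
  by (simp add: unit_fun_def points_def)

lemma unit_fun_carrier:
  assumes "continuous_map (space_at S n i) euclidean g"
  shows "unit_fun n i a b g \<in> carrier (alg S n)"
  unfolding alg_carrier_iff
proof (intro conjI allI impI ballI)
  fix i' c d assume *: "i' < nsum S n" "c < msize S n i'" "d < msize S n i'"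
  show "continuous_map (space_at S n i') euclidean (\<lambda>t. unit_fun n i a b g (i', t) $$ (c, d))"
    by (rule continuous_map_eq[where f="\<lambda>s. if i' = i \<and> c = a \<and> d = b then g s else 0"])
      (use * assms in \<open>auto simp: unit_fun_index\<close>)
qed (auto simp: unit_fun_def points_def)

lemma zero_alg_carrier: "\<zero>\<^bsub>alg S n\<^esub> \<in> carrier (alg S n)"
  unfolding alg_carrier_iff
proof (intro conjI allI impI ballI)
  fix i a b assume *: "i < nsum S n" "a < msize S n i" "b < msize S n i"
  show "continuous_map (space_at S n i) euclidean (\<lambda>t. \<zero>\<^bsub>alg S n\<^esub> (i, t) $$ (a, b))"
    by (rule continuous_map_eq[where f="\<lambda>s. 0"]) (use * in \<open>auto simp: alg_def points_def\<close>)
qed (auto simp: alg_def points_def)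

lemma zero_alg_index:
  "i < nsum S n \<Longrightarrow> t \<in> topspace (space_at S n i) \<Longrightarrow> a < msize S n i \<Longrightarrow> b < msize S n i \<Longrightarrow>
    \<zero>\<^bsub>alg S n\<^esub> (i, t) $$ (a, b) = 0"
  by (simp add: alg_def points_def)

text \<open>A point outside the images of all eigenfunctions would be separated from them by a function in
  the kernel of the connecting map.\<close>

lemma eig_surj:
  assumes n: "1 \<le> n" and i: "i < nsum S n" and t: "t \<in> topspace (space_at S n i)"
  shows "\<exists>j<nsum S (Suc n). \<exists>e\<in>edg S n i j. \<exists>s\<in>topspace (space_at S (Suc n) j). eig S n i j e s = t"
proof (rule ccontr)
  assume no: "\<not> ?thesis"
  let ?X = "space_at S n i"
  define K where "K = (\<Union>j<nsum S (Suc n). \<Union>e\<in>edg S n i j. eig S n i j e ` topspace (space_at S (Suc n) j))"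
  have "compactin ?X K"
  proof -
    have 1: "compactin ?X (eig S n i j e ` topspace (space_at S (Suc n) j))"
      if j: "j < nsum S (Suc n)" and e: "e \<in> edg S n i j" for j e
      using image_compactin[OF _ continuous_eig[OF n i j e]] compact_space_at[of "Suc n" j] j
      by (simp add: compact_space_def)
    have "compactin ?X (\<Union>e\<in>edg S n i j. eig S n i j e ` topspace (space_at S (Suc n) j))"
      if j: "j < nsum S (Suc n)" for j
      by (rule compactin_Union) (use 1[OF j] finite_edg[OF n i j] in auto)
    then show ?thesis unfolding K_def by (intro compactin_Union) auto
  qed
  then have cl: "closedin ?X K" using Hausdorff_space_at[OF n i] compactin_imp_closedin by blast
  have tK: "t \<in> topspace ?X - K" using no t by (auto simp: K_def)
  have "completely_regular_space ?X"
    using compact_space_at[OF n i] Hausdorff_space_at[OF n i] normal_imp_completely_regular_space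
      compact_Hausdorff_or_regular_imp_normal_space by blast
  then obtain f where f: "continuous_map ?X (top_of_set {0..1::real}) f" "f t = 0" "f ` K \<subseteq> {1}"
    using cl tK unfolding completely_regular_space_def by blast
  define g where "g s = complex_of_real (1 - f s)" for s
  have "continuous_map ?X euclideanreal f" using f(1) by (simp add: continuous_map_in_subtopology)
  then have gc: "continuous_map ?X euclidean g"
    unfolding g_def
    by (intro continuous_map_compose[of _ euclideanreal "\<lambda>s. 1 - f s" _ complex_of_real, unfolded o_def]
        continuous_map_diff) (auto simp: continuous_on_of_real)
  let ?F = "unit_fun n i 0 0 g"
  have F: "?F \<in> carrier (alg S n)" by (rule unit_fun_carrier[OF gc])
  have Fz: "?F (i', eig S n i' j e s) = \<zero>\<^bsub>alg S n\<^esub> (i', eig S n i' j e s)"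
    if "j < nsum S (Suc n)" "s \<in> topspace (space_at S (Suc n) j)" "i' < nsum S n" "e \<in> edg S n i' j" for j s i' e
  proof -
    have mem: "eig S n i' j e s \<in> topspace (space_at S n i')" using eig_mem n that by blast
    have "g (eig S n i' j e s) = 0" if "i' = i"
    proof -
      have "eig S n i' j e s \<in> K" using \<open>j < _\<close> \<open>s \<in> _\<close> \<open>e \<in> _\<close> that by (auto simp: K_def)
      then show ?thesis using f(3) by (auto simp: g_def)
    qed
    then show ?thesis using mem \<open>i' < _\<close> by (auto simp: unit_fun_def alg_def points_def intro!: eq_matI)
  qed
  have "phi S n ?F = phi S n \<zero>\<^bsub>alg S n\<^esub>"
    unfolding phi_def
  proof (rule restrict_ext, clarify)
    fix j s assume js: "(j, s) \<in> points S (Suc n)"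
    then have j: "j < nsum S (Suc n)" "s \<in> topspace (space_at S (Suc n) j)" by (auto simp: points_def)
    show "diag_block_mat (map (\<lambda>(i', e). ?F (i', eig S n i' j e s)) (blocks S n j)) =
        diag_block_mat (map (\<lambda>(i', e). \<zero>\<^bsub>alg S n\<^esub> (i', eig S n i' j e s)) (blocks S n j))"
      by (intro arg_cong[of _ _ diag_block_mat] map_cong refl)
        (use Fz[OF j] set_blocks[OF n j(1)] in auto)
  qed
  then have "?F = \<zero>\<^bsub>alg S n\<^esub>"
    using inj_onD[OF inj_phi[OF n] _ F zero_alg_carrier] by blast
  then have "?F (i, t) $$ (0, 0) = 0"
    using i t msize_pos[OF n i] by (simp add: zero_alg_index)
  moreover have "?F (i, t) $$ (0, 0) = 1"
    using i t msize_pos[OF n i] f(2) by (simp add: unit_fun_index g_def)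
  ultimately show False by simp
qed

text \<open>Upwards, \<open>eig_surj\<close> gives each point a preimage under some eigenfunction
  into its space, and dependent choice strings these together to a tail. Downwards,
  \<open>tail_path_prepend\<close> attaches the initial segment with index \<open>a\<close>.\<close>

lemma ex_path:
  assumes n: "1 \<le> n" and i: "i < nsum S n" and t: "t \<in> topspace (space_at S n i)" and a: "a < msize S n i"
  obtains x where "x \<in> P" "src x n = i" "snd (x n) = t" "idx n x = a"
proof -
  \<comment> \<open>A candidate \<open>c\<close> packs an edge of level \<open>n + d\<close> with
    the label at its source and the label at its target; consecutive candidates share the label in
    between.\<close>
  define ok where "ok d c \<longleftrightarrow> fst c \<in> edges S (n + d) \<and> snd (snd c) \<in> topspace (space_at S (Suc (n + d)) (etgt (fst c))) \<and>
     fst (snd c) = label S (n + d) (fst c) (snd (snd c))" for d and c :: "'e edge \<times> 'a \<times> 'a"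
  have step: "\<exists>c. ok d c \<and> esrc (fst c) = j \<and> fst (snd c) = s"
    if "j < nsum S (n + d)" "s \<in> topspace (space_at S (n + d) j)" for d j s
  proof -
    have "1 \<le> n + d" using n by simp
    from eig_surj[OF this that] obtain j' e s' where "j' < nsum S (Suc (n + d))" "e \<in> edg S (n + d) j j'"
      "s' \<in> topspace (space_at S (Suc (n + d)) j')" "eig S (n + d) j j' e s' = s"
      by auto
    then show ?thesis using that n
      by (intro exI[of _ "(Link j j' e, s, s')"]) (auto simp: ok_def edges_def)
  qed
  have "\<exists>f. \<forall>d. (ok d (f d) \<and> (d = 0 \<longrightarrow> esrc (fst (f d)) = i \<and> fst (snd (f d)) = t)) \<and>
     (esrc (fst (f (Suc d))) = etgt (fst (f d)) \<and> fst (snd (f (Suc d))) = snd (snd (f d)))"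
  proof (rule dependent_nat_choice)
    show "\<exists>x. ok 0 x \<and> (0 = (0::nat) \<longrightarrow> esrc (fst x) = i \<and> fst (snd x) = t)"
      using step[of i 0 t] i t by auto
    show "\<exists>y. (ok (Suc d) y \<and> (Suc d = 0 \<longrightarrow> esrc (fst y) = i \<and> fst (snd y) = t)) \<and>
        esrc (fst y) = etgt (fst x) \<and> fst (snd y) = snd (snd x)"
      if "ok d x \<and> (d = 0 \<longrightarrow> esrc (fst x) = i \<and> fst (snd x) = t)" for x d
      using step[of "etgt (fst x)" "Suc d" "snd (snd x)"] that n by (auto simp: ok_def edges_def)
  qed
  then obtain f where f: "\<And>d. ok d (f d)" "esrc (fst (f 0)) = i" "fst (snd (f 0)) = t"
     "\<And>d. esrc (fst (f (Suc d))) = etgt (fst (f d))" "\<And>d. fst (snd (f (Suc d))) = snd (snd (f d))"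
    by blast
  define y where "y k = (fst (f (k - n)), fst (snd (f (k - n))))" for k
  have "tail_path n y"
    unfolding tail_path_def
  proof (intro allI impI)
    fix k assume k: "n \<le> k"
    then obtain d where d: "k = n + d" using le_Suc_ex by blast
    have yk: "y k = (fst (f d), fst (snd (f d)))" "y (Suc k) = (fst (f (Suc d)), snd (snd (f d)))"
      using f(5)[of d] by (auto simp: y_def d Suc_diff_le)
    have "fst (snd (f d)) \<in> topspace (space_at S (n + d) (esrc (fst (f d))))"
      using f(1)[of d] n eig_mem[of "n + d"] by (auto simp: ok_def edges_def)
    then show "fst (y k) \<in> edges S k \<and> etgt (fst (y k)) = src y (Suc k) \<and>
      snd (y k) \<in> topspace (vertex_space S k (src y k)) \<and> label S k (fst (y k)) (snd (y (Suc k))) = snd (y k)"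
      using yk f(1)[of d] f(4)[of d] d n by (auto simp: ok_def vertex_space_def)
  qed
  moreover have "src y n = i" "snd (y n) = t" using f(2,3) by (auto simp: y_def)
  ultimately obtain x where x: "x \<in> P" "\<forall>k\<ge>n. x k = y k" "idx n x = a"
    using tail_path_prepend[OF n, of y a] a by auto
  then have "x n = y n" by simp
  then show ?thesis using x that \<open>src y n = i\<close> \<open>snd (y n) = t\<close> by simp
qed

lemma paths_nonempty: "P \<noteq> {}"
proof -
  obtain t where "t \<in> topspace (space_at S 1 0)"
    using space_at_nonempty[OF le_refl nsum_pos[OF le_refl]] by blast
  then show ?thesis using ex_path[of 1 0 t 0] nsum_pos[of 1] msize_pos[of 1 0] by auto
qed

lemma topspace_lab_path_space: "topspace (lab_path_space S) = P"
proof -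
  have "x \<in> topspace (lab_path_space S)" if x: "x \<in> P" for x
  proof -
    have "[fst (x 0)] \<in> fin_paths S" using path_edges[OF x] by (simp add: fin_paths_def)
    moreover have "x \<in> lab_Z S [fst (x 0)] (topspace (vertex_space S 0 (src x 0)))"
      using x path_mem[OF x, of 0] by (simp add: lab_Z_def)
    ultimately show ?thesis
      unfolding lab_path_space_def topology_generated_by_topspace
      by (intro UnionI[of "lab_Z S [fst (x 0)] (topspace (vertex_space S 0 (src x 0)))"] CollectI
          exI[of _ "[fst (x 0)]"] exI[of _ "topspace (vertex_space S 0 (src x 0))"]) auto
  qed
  moreover have "topspace (lab_path_space S) \<subseteq> P"
    unfolding lab_path_space_def topology_generated_by_topspace by (auto simp: lab_Z_def)
  ultimately show ?thesis by blast
qed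

abbreviation "G \<equiv> labelled_tail_groupoid S"

lemma arrows_G: "arrows G = (\<Union>n. R n)"
proof -
  have sub: "R n \<subseteq> P \<times> P" for n by (auto simp: tail_rel_def)
  have "\<exists>W. R n = W \<inter> R n \<and> openin (prod_topology (lab_path_space S) (lab_path_space S)) W" for n
    using sub openin_topspace[of "prod_topology (lab_path_space S) (lab_path_space S)"]
    by (intro exI[of _ "P \<times> P"]) (auto simp: topspace_lab_path_space)
  then show ?thesis
    by (simp add: labelled_tail_groupoid_def) blast
qed

lemma G_simps [simp]: "gsrc G = snd" "grng G = fst" "gmult G (x, y) (y', z) = (x, z)" "ginv G (x, y) = (y, x)"
  by (simp_all add: labelled_tail_groupoid_def)

lemma arrows_trans: "(x, y) \<in> arrows G \<Longrightarrow> (y, z) \<in> arrows G \<Longrightarrow> (x, z) \<in> arrows G"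
proof -
  assume "(x, y) \<in> arrows G" "(y, z) \<in> arrows G"
  then obtain m n where "(x, y) \<in> R m" "(y, z) \<in> R n" by (auto simp: arrows_G)
  then have "(x, y) \<in> R (max m n)" "(y, z) \<in> R (max m n)"
    by (auto intro: tail_rel_mono[rotated])
  then show ?thesis unfolding arrows_G using tail_rel_trans by blast
qed

lemma arrows_sym: "(x, y) \<in> arrows G \<Longrightarrow> (y, x) \<in> arrows G"
  unfolding arrows_G by (auto intro: tail_rel_sym)

lemma arrows_refl: "x \<in> P \<Longrightarrow> (x, x) \<in> arrows G"
  unfolding arrows_G by (auto intro: tail_rel_refl)

lemma arrows_paths: "(x, y) \<in> arrows G \<Longrightarrow> x \<in> P \<and> y \<in> P"
  unfolding arrows_G by (auto simp: tail_rel_def)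

lemma cls_arrows: "x \<in> cls n u \<Longrightarrow> (x, u) \<in> arrows G"
  unfolding arrows_G by (auto simp: cls_def)

end


section \<open>Kernels on tail-equivalence classes\<close>

lemma sum_mult_le_L2_set:
  assumes "\<And>i. i \<in> A \<Longrightarrow> 0 \<le> f i" "\<And>i. i \<in> A \<Longrightarrow> 0 \<le> g i"
  shows "(\<Sum>i\<in>A. f i * g i) \<le> L2_set f A * L2_set g A"
  using L2_set_mult_ineq[of f g A] assms by (simp cong: sum.cong)

lemma L2_set_mono_set: "finite B \<Longrightarrow> A \<subseteq> B \<Longrightarrow> L2_set f A \<le> L2_set f B"
  unfolding L2_set_def by (intro real_sqrt_le_mono sum_mono2) auto

lemma L2_set_power2: "(L2_set f A)\<^sup>2 = (\<Sum>i\<in>A. (f i)\<^sup>2)"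
  unfolding L2_set_def by (simp add: sum_nonneg)

lemma cmod_sum_mult_le: "cmod (\<Sum>x\<in>A. w x * v x) \<le> L2_set (\<lambda>x. cmod (w x)) A * L2_set (\<lambda>x. cmod (v x)) A"
proof -
  have "cmod (\<Sum>x\<in>A. w x * v x) \<le> (\<Sum>x\<in>A. cmod (w x) * cmod (v x))"
    by (rule order_trans[OF norm_sum]) (simp add: norm_mult)
  also have "\<dots> \<le> L2_set (\<lambda>x. cmod (w x)) A * L2_set (\<lambda>x. cmod (v x)) A"
    by (rule sum_mult_le_L2_set) auto
  finally show ?thesis .
qed

text \<open>Testing with \<open>w = v\<close> gives the square of the norm. Operator bounds are kept
  in the form of sesquilinear estimates, and this lemma converts them back into bounds for
  vectors.\<close>

lemma L2_set_le_by_duality: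
  fixes v :: "'i \<Rightarrow> complex"
  assumes "0 \<le> c" "\<And>w. cmod (\<Sum>x\<in>A. cnj (w x) * v x) \<le> c * L2_set (\<lambda>x. cmod (w x)) A"
  shows "L2_set (\<lambda>x. cmod (v x)) A \<le> c"
proof (cases "L2_set (\<lambda>x. cmod (v x)) A = 0")
  case False
  have "(\<Sum>x\<in>A. cnj (v x) * v x) = complex_of_real ((L2_set (\<lambda>x. cmod (v x)) A)\<^sup>2)"
    unfolding L2_set_power2 of_real_sum
    by (intro sum.cong refl) (metis complex_norm_square mult.commute)
  then have "(L2_set (\<lambda>x. cmod (v x)) A)\<^sup>2 \<le> c * L2_set (\<lambda>x. cmod (v x)) A"
    using assms(2)[of v] by (simp add: norm_power)
  then show ?thesis using False by (simp add: power2_eq_square mult_le_cancel_right)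
     (metis L2_set_nonneg less_eq_real_def linorder_not_le)
qed (use assms in simp)

context AH
begin

definition supp :: "nat \<Rightarrow> ((nat \<Rightarrow> 'e edge \<times> 'a) \<times> (nat \<Rightarrow> 'e edge \<times> 'a) \<Rightarrow> complex) \<Rightarrow> bool" where
  "supp n F \<longleftrightarrow> (\<forall>\<gamma>. \<gamma> \<notin> R n \<longrightarrow> F \<gamma> = 0)"

text \<open>The functions for which all norm estimates are made. Continuity is left out on purpose:
  the class is closed under convolution for elementary reasons.\<close>

definition kern :: "((nat \<Rightarrow> 'e edge \<times> 'a) \<times> (nat \<Rightarrow> 'e edge \<times> 'a) \<Rightarrow> complex) \<Rightarrow> bool" where
  "kern F \<longleftrightarrow> (\<exists>n. supp n F) \<and> (\<exists>M. \<forall>\<gamma>. cmod (F \<gamma>) \<le> M)"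

definition tcls :: "(nat \<Rightarrow> 'e edge \<times> 'a) \<Rightarrow> (nat \<Rightarrow> 'e edge \<times> 'a) set" where
  "tcls u = {x. (x, u) \<in> arrows G}"

text \<open>\<open>F\<close> acts on each tail-equivalence class as a matrix of operator norm at most \<open>c\<close>; for the
  class of \<open>u\<close> this is the regular representation at \<open>u\<close>.\<close>

definition bnd :: "real \<Rightarrow> ((nat \<Rightarrow> 'e edge \<times> 'a) \<times> (nat \<Rightarrow> 'e edge \<times> 'a) \<Rightarrow> complex) \<Rightarrow> bool" where
  "bnd c F \<longleftrightarrow> (\<forall>u\<in>P. \<forall>Y. finite Y \<longrightarrow> Y \<subseteq> tcls u \<longrightarrow> (\<forall>v w.
     cmod (\<Sum>x\<in>Y. \<Sum>y\<in>Y. cnj (w x) * F (x, y) * v y) \<le>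
       c * L2_set (\<lambda>x. cmod (w x)) Y * L2_set (\<lambda>x. cmod (v x)) Y))"

abbreviation N where "N \<equiv> reduced_norm G"

lemma supp_mono: "supp m F \<Longrightarrow> m \<le> n \<Longrightarrow> supp n F"
  unfolding supp_def by (metis surj_pair tail_rel_mono)

lemma suppD: "supp n F \<Longrightarrow> (x, y) \<notin> R n \<Longrightarrow> F (x, y) = 0"
  unfolding supp_def by blast

lemma supp_cls: "supp n F \<Longrightarrow> y \<notin> cls n x \<Longrightarrow> F (x, y) = 0"
  unfolding cls_def by (metis suppD tail_rel_sym mem_Collect_eq)

lemma supp_arrows: "supp n F \<Longrightarrow> \<gamma> \<notin> arrows G \<Longrightarrow> F \<gamma> = 0"
  unfolding supp_def arrows_G by blast

lemma kern_arrows: "kern F \<Longrightarrow> \<gamma> \<notin> arrows G \<Longrightarrow> F \<gamma> = 0"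
  unfolding kern_def using supp_arrows by blast

lemma tcls_trans: "x \<in> tcls u \<Longrightarrow> (y, x) \<in> arrows G \<Longrightarrow> y \<in> tcls u"
  by (auto simp: tcls_def intro: arrows_trans)

lemma tcls_src_fibre: "src_fibre G u = (\<lambda>x. (x, u)) ` tcls u"
  by (auto simp: src_fibre_def tcls_def)

text \<open>With \<open>\<beta> = (y, z)\<close> the sum over the source fibre of \<open>z\<close>
  becomes matrix multiplication, and the support of \<open>F\<close> leaves only the finitely many
  \<open>y\<close> in the class of \<open>x\<close>. If \<open>(x, z)\<close> is no arrow, then
  neither is any \<open>(y, z)\<close> in the sum, and both sides vanish.\<close>

lemma conv_eq:
  assumes F: "supp n F" and K: "\<forall>\<gamma>. \<gamma> \<notin> arrows G \<longrightarrow> K \<gamma> = 0"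
  shows "conv G F K (x, z) = (\<Sum>y\<in>cls n x. F (x, y) * K (y, z))"
proof (cases "(x, z) \<in> arrows G")
  case True
  have "conv G F K (x, z) = (\<Sum>\<^sub>\<infinity>\<beta>\<in>src_fibre G z. F (gmult G (x, z) (ginv G \<beta>)) * K \<beta>)"
    using True by (simp add: conv_def)
  also have "\<dots> = (\<Sum>\<^sub>\<infinity>\<beta>\<in>(\<lambda>y. (y, z)) ` cls n x. F (x, fst \<beta>) * K \<beta>)"
  proof (rule infsum_cong_neutral)
    show "F (x, fst \<beta>) * K \<beta> = 0" if "\<beta> \<in> (\<lambda>y. (y, z)) ` cls n x - src_fibre G z" for \<beta>
    proof -
      obtain y where y: "\<beta> = (y, z)" "y \<in> cls n x" "\<beta> \<notin> src_fibre G z"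
        using \<open>\<beta> \<in> _\<close> by auto
      then have "(y, z) \<in> arrows G" using arrows_trans[OF cls_arrows True] by blast
      then show ?thesis using y by (simp add: src_fibre_def)
    qed
    show "F (gmult G (x, z) (ginv G \<beta>)) * K \<beta> = 0" if "\<beta> \<in> src_fibre G z - (\<lambda>y. (y, z)) ` cls n x" for \<beta>
    proof -
      obtain y where "\<beta> = (y, z)" "y \<notin> cls n x"
        using \<open>\<beta> \<in> _\<close> by (cases \<beta>) (auto simp: src_fibre_def)
      then have "(x, y) \<notin> R n" using tail_rel_sym by (auto simp: cls_def)
      then show ?thesis using suppD[OF F] \<open>\<beta> = (y, z)\<close> by simp
    qed
    show "F (gmult G (x, z) (ginv G \<beta>)) * K \<beta> = F (x, fst \<beta>) * K \<beta>"
      if "\<beta> \<in> src_fibre G z \<inter> (\<lambda>y. (y, z)) ` cls n x" for \<beta>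
      using that by auto
  qed
  also have "\<dots> = (\<Sum>y\<in>cls n x. F (x, y) * K (y, z))"
    by (simp add: finite_cls sum.reindex inj_on_def)
  finally show ?thesis .
next
  case False
  have "F (x, y) * K (y, z) = 0" if "y \<in> cls n x" for y
  proof -
    have "(y, z) \<notin> arrows G" using False cls_arrows[OF that] arrows_trans arrows_sym by blast
    then show ?thesis using K by simp
  qed
  then have "(\<Sum>y\<in>cls n x. F (x, y) * K (y, z)) = 0" by (intro sum.neutral) blast
  then show ?thesis using False by (simp add: conv_def)
qed

text \<open>Schur's test. Rows and columns of \<open>F\<close> have at most
  \<open>cls_bound n\<close> nonzero entries; Cauchy-Schwarz over the set \<open>E\<close> of pairs
  related by \<open>R n\<close> costs the square root of this number once for \<open>w\<close> and
  once for \<open>v\<close>.\<close>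

lemma bnd_Schur:
  assumes F: "supp n F" and M: "\<And>\<gamma>. cmod (F \<gamma>) \<le> M"
  shows "bnd (M * cls_bound n) F"
  unfolding bnd_def
proof (intro ballI allI impI)
  fix u Y v w assume Y: "finite Y" "Y \<subseteq> tcls u"
  define E where "E = {(x, y) \<in> Y \<times> Y. (x, y) \<in> R n}"
  have E: "finite E" using Y by (auto simp: E_def intro: finite_subset[of _ "Y \<times> Y"])
  have M0: "0 \<le> M" using M norm_ge_zero order_trans by blast
  have card: "card (cls n x \<inter> Y) \<le> cls_bound n" for x
    using card_cls[of n x] card_mono[OF finite_cls, of "cls n x \<inter> Y" n x] by simp
  \<comment> \<open>A given \<open>x\<close> is the first coordinate of at most
    \<open>cls_bound n\<close> pairs in \<open>E\<close>.\<close>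
  have cnt: "L2_set (\<lambda>p. cmod (f (fst p))) E \<le> sqrt (cls_bound n) * L2_set (\<lambda>x. cmod (f x)) Y" for f :: "_ \<Rightarrow> complex"
  proof -
    have "(\<Sum>p\<in>E. (cmod (f (fst p)))\<^sup>2) = (\<Sum>x\<in>Y. \<Sum>y\<in>cls n x \<inter> Y. (cmod (f x))\<^sup>2)"
    proof -
      have "E = Sigma Y (\<lambda>x. cls n x \<inter> Y)" using tail_rel_sym by (auto simp: E_def cls_def)
      then show ?thesis using Y finite_cls
        by (simp only: sum.Sigma[of Y, symmetric] case_prod_unfold) (subst sum.Sigma, auto simp: case_prod_unfold)
    qed
    also have "\<dots> \<le> (\<Sum>x\<in>Y. cls_bound n * (cmod (f x))\<^sup>2)"
      by (intro sum_mono) (auto intro!: mult_right_mono card)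
    finally have "(\<Sum>p\<in>E. (cmod (f (fst p)))\<^sup>2) \<le> cls_bound n * (\<Sum>x\<in>Y. (cmod (f x))\<^sup>2)"
      by (simp add: sum_distrib_left)
    then show ?thesis unfolding L2_set_def real_sqrt_mult[symmetric] by simp
  qed
  have swap: "L2_set (\<lambda>p. cmod (f (snd p))) E = L2_set (\<lambda>p. cmod (f (fst p))) E" for f :: "_ \<Rightarrow> complex"
    unfolding L2_set_def
    by (rule arg_cong[of _ _ sqrt], rule sum.reindex_bij_witness[of _ prod.swap prod.swap])
      (auto simp: E_def intro: tail_rel_sym)
  have "(\<Sum>x\<in>Y. \<Sum>y\<in>Y. cnj (w x) * F (x, y) * v y) = (\<Sum>(x, y)\<in>E. cnj (w x) * F (x, y) * v y)"
    unfolding sum.cartesian_product E_def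
    by (rule sum.mono_neutral_right) (use Y suppD[OF F] in \<open>fastforce+\<close>)
  then have "cmod (\<Sum>x\<in>Y. \<Sum>y\<in>Y. cnj (w x) * F (x, y) * v y) \<le> (\<Sum>(x, y)\<in>E. cmod (cnj (w x) * F (x, y) * v y))"
    by (simp only: case_prod_unfold norm_sum)
  also have "\<dots> \<le> (\<Sum>p\<in>E. M * (cmod (w (fst p)) * cmod (v (snd p))))"
  proof (intro sum_mono, clarify)
    fix x y
    have "cmod (cnj (w x) * F (x, y) * v y) = cmod (F (x, y)) * (cmod (w x) * cmod (v y))"
      by (simp add: norm_mult)
    also have "\<dots> \<le> M * (cmod (w x) * cmod (v y))" by (intro mult_right_mono M) auto
    finally show "cmod (cnj (w x) * F (x, y) * v y) \<le> M * (cmod (w (fst (x, y))) * cmod (v (snd (x, y))))"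
      by simp
  qed
  also have "\<dots> = M * (\<Sum>p\<in>E. cmod (w (fst p)) * cmod (v (snd p)))" by (simp add: sum_distrib_left)
  also have "\<dots> \<le> M * (L2_set (\<lambda>p. cmod (w (fst p))) E * L2_set (\<lambda>p. cmod (v (snd p))) E)"
    by (intro mult_left_mono sum_mult_le_L2_set M0) auto
  also have "\<dots> \<le> M * ((sqrt (cls_bound n) * L2_set (\<lambda>x. cmod (w x)) Y) * (sqrt (cls_bound n) * L2_set (\<lambda>x. cmod (v x)) Y))"
    unfolding swap by (intro mult_left_mono mult_mono cnt M0) auto
  also have "\<dots> = M * cls_bound n * L2_set (\<lambda>x. cmod (w x)) Y * L2_set (\<lambda>x. cmod (v x)) Y"
    by (simp add: algebra_simps flip: power2_eq_square)
  finally show "cmod (\<Sum>x\<in>Y. \<Sum>y\<in>Y. cnj (w x) * F (x, y) * v y) \<le> \<dots>" .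
qed

lemma kern_bnd: "kern F \<Longrightarrow> \<exists>c\<ge>0. bnd c F"
proof -
  assume "kern F"
  then obtain n M where "supp n F" "\<And>\<gamma>. cmod (F \<gamma>) \<le> M" by (auto simp: kern_def)
  moreover from this(2) have "0 \<le> M" using norm_ge_zero order_trans by blast
  ultimately show ?thesis using bnd_Schur[of n F M] by (intro exI[of _ "M * cls_bound n"]) auto
qed

text \<open>Passage from finite forms to square-summable functions: finitely many arrows of the
  fibre are completed to whole classes, where \<open>F\<close> is a finite matrix bounded by
  \<open>c\<close>. This bounds every finite partial sum of the squared norm, which yields
  summability and the norm bound together.\<close>

lemma fibre_bound:
  assumes c: "0 \<le> c" "bnd c F" and F: "supp n F" and u: "u \<in> P"
    and \<xi>: "\<xi> \<in> ell2 (src_fibre G u)" "l2norm (src_fibre G u) \<xi> \<le> 1"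
  shows "(\<lambda>\<gamma>. (cmod (conv G F \<xi> \<gamma>))\<^sup>2) summable_on src_fibre G u"
    and "l2norm (src_fibre G u) (conv G F \<xi>) \<le> c"
proof -
  let ?S = "src_fibre G u"
  have \<xi>0: "\<forall>\<gamma>. \<gamma> \<notin> arrows G \<longrightarrow> \<xi> \<gamma> = 0"
    using \<xi>(1) unfolding ell2_def src_fibre_def by blast
  have \<xi>sum: "(\<lambda>x. (cmod (\<xi> x))\<^sup>2) summable_on ?S" using \<xi>(1) by (simp add: ell2_def)
  have \<xi>1: "(\<Sum>\<^sub>\<infinity>x\<in>?S. (cmod (\<xi> x))\<^sup>2) \<le> 1"
    using \<xi>(2) by (simp add: l2norm_def)
  have fin: "(\<Sum>\<gamma>\<in>X. (cmod (conv G F \<xi> \<gamma>))\<^sup>2) \<le> c\<^sup>2" if X: "finite X" "X \<subseteq> ?S" for X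
  proof -
    define X0 where "X0 = fst ` X"
    have X0: "finite X0" "X0 \<subseteq> tcls u" "X = (\<lambda>x. (x, u)) ` X0"
    proof -
      show "finite X0" using X by (simp add: X0_def)
      have "p = (fst p, u) \<and> fst p \<in> tcls u" if "p \<in> X" for p
        using X that by (auto simp: tcls_src_fibre)
      then show "X0 \<subseteq> tcls u" "X = (\<lambda>x. (x, u)) ` X0" by (auto simp: X0_def image_image image_iff)
    qed
    \<comment> \<open>The values of \<open>conv G F \<xi>\<close> over \<open>X0\<close> depend only
      on the values of \<open>\<xi>\<close> over this finite union of classes.\<close>
    define Y where "Y = (\<Union>x\<in>X0. cls n x)"
    have Y: "finite Y" "Y \<subseteq> tcls u"
      using X0 finite_cls by (auto simp: Y_def dest: cls_arrows intro: tcls_trans)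
    have XY: "X0 \<subseteq> Y"
      using X0(2) arrows_paths by (fastforce simp: Y_def cls_def tcls_def intro: tail_rel_refl)
    define \<eta> where "\<eta> x = (\<Sum>y\<in>Y. F (x, y) * \<xi> (y, u))" for x
    have \<eta>: "conv G F \<xi> (x, u) = \<eta> x" if "x \<in> X0" for x
      unfolding conv_eq[OF F \<xi>0] \<eta>_def
      by (rule sum.mono_neutral_left)
        (use Y that supp_cls[OF F] in \<open>auto simp: Y_def\<close>)
    have v1: "L2_set (\<lambda>y. cmod (\<xi> (y, u))) Y \<le> 1"
    proof -
      have "(\<Sum>y\<in>Y. (cmod (\<xi> (y, u)))\<^sup>2) = (\<Sum>\<gamma>\<in>(\<lambda>y. (y, u)) ` Y. (cmod (\<xi> \<gamma>))\<^sup>2)"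
        by (simp add: sum.reindex inj_on_def)
      also have "\<dots> \<le> (\<Sum>\<^sub>\<infinity>x\<in>?S. (cmod (\<xi> x))\<^sup>2)"
        by (rule finite_sum_le_infsum[OF \<xi>sum]) (use Y in \<open>auto simp: tcls_src_fibre\<close>)
      finally show ?thesis using \<xi>1 by (simp add: L2_set_def)
    qed
    have "L2_set (\<lambda>x. cmod (\<eta> x)) Y \<le> c"
    proof (rule L2_set_le_by_duality[OF c(1)])
      fix w
      have "cmod (\<Sum>x\<in>Y. \<Sum>y\<in>Y. cnj (w x) * F (x, y) * \<xi> (y, u)) \<le>
        c * L2_set (\<lambda>x. cmod (w x)) Y * L2_set (\<lambda>y. cmod (\<xi> (y, u))) Y"
        using c(2)[unfolded bnd_def, rule_format, OF u Y, of w "\<lambda>y. \<xi> (y, u)"] .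
      also have "\<dots> \<le> c * L2_set (\<lambda>x. cmod (w x)) Y * 1"
        by (intro mult_left_mono v1 mult_nonneg_nonneg c) auto
      finally show "cmod (\<Sum>x\<in>Y. cnj (w x) * \<eta> x) \<le> c * L2_set (\<lambda>x. cmod (w x)) Y"
        by (simp add: \<eta>_def sum_distrib_left mult.assoc)
    qed
    then have "L2_set (\<lambda>x. cmod (\<eta> x)) X0 \<le> c"
      using L2_set_mono_set[OF Y(1) XY] order_trans by blast
    then have "(L2_set (\<lambda>x. cmod (\<eta> x)) X0)\<^sup>2 \<le> c\<^sup>2" by (intro power_mono) auto
    then show ?thesis
      by (simp add: L2_set_power2 X0(3) sum.reindex inj_on_def \<eta>)
  qed
  show s: "(\<lambda>\<gamma>. (cmod (conv G F \<xi> \<gamma>))\<^sup>2) summable_on ?S"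
    by (rule nonneg_bdd_above_summable_on) (use fin in \<open>auto intro!: bdd_aboveI[of _ "c\<^sup>2"]\<close>)
  have "(\<Sum>\<^sub>\<infinity>x\<in>?S. (cmod (conv G F \<xi> x))\<^sup>2) \<le> c\<^sup>2"
    by (rule infsum_le_finite_sums[OF s fin])
  then show "l2norm ?S (conv G F \<xi>) \<le> c"
    using c(1) unfolding l2norm_def by (intro real_le_lsqrt) (auto intro: infsum_nonneg)
qed

lemma zero_ell2: "(\<lambda>_. 0) \<in> {\<xi> \<in> ell2 X. l2norm X \<xi> \<le> 1}"
  by (simp add: ell2_def l2norm_def)

lemma opnorm_le:
  assumes "0 \<le> c" "bnd c F" "supp n F" "u \<in> P"
  shows "opnorm (src_fibre G u) (conv G F) \<le> c"
  unfolding opnorm_def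
  by (rule cSUP_least) (use zero_ell2 fibre_bound[OF assms] in blast)+

lemma units_G: "gsrc G ` arrows G = P"
  using arrows_refl arrows_paths by force

lemma reduced_norm_le:
  assumes "0 \<le> c" "bnd c F" "kern F"
  shows "N F \<le> c"
  unfolding reduced_norm_def units_G
  by (rule cSUP_least[OF paths_nonempty]) (use opnorm_le[OF assms(1,2)] assms(3) in \<open>auto simp: kern_def\<close>)

text \<open>The Schur bound makes both suprema in \<open>reduced_norm\<close> suprema of bounded
  sets of reals; only then do they dominate their members.\<close>

lemma l2norm_le_reduced_norm:
  assumes F: "kern F" and u: "u \<in> P" and \<xi>: "\<xi> \<in> ell2 (src_fibre G u)" "l2norm (src_fibre G u) \<xi> \<le> 1"
  shows "l2norm (src_fibre G u) (conv G F \<xi>) \<le> N F"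
proof -
  obtain c n where c: "0 \<le> c" "bnd c F" "supp n F" using kern_bnd[OF F] F by (auto simp: kern_def)
  have "l2norm (src_fibre G u) (conv G F \<xi>) \<le> opnorm (src_fibre G u) (conv G F)"
    unfolding opnorm_def
    by (rule cSUP_upper) (use \<xi> fibre_bound(2)[OF c u] in \<open>auto intro!: bdd_aboveI[of _ c]\<close>)
  also have "\<dots> \<le> N F"
    unfolding reduced_norm_def units_G
    by (rule cSUP_upper[OF u]) (use opnorm_le[OF c] in \<open>auto intro!: bdd_aboveI[of _ c]\<close>)
  finally show ?thesis .
qed

lemma reduced_norm_nonneg: "kern F \<Longrightarrow> 0 \<le> N F"
proof -
  assume F: "kern F"
  obtain u where u: "u \<in> P" using paths_nonempty by blast
  have "0 \<le> l2norm (src_fibre G u) (conv G F (\<lambda>_. 0))"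
    unfolding l2norm_def by (simp add: infsum_nonneg)
  also have "\<dots> \<le> N F" using l2norm_le_reduced_norm[OF F u] zero_ell2 by blast
  finally show ?thesis .
qed

text \<open>Together with \<open>reduced_norm_le\<close> this characterises the reduced norm as the
  least nonnegative form bound, so that further norm estimates can be made with finite sums. The
  vector \<open>v\<close>, normalised and extended by zero, is a unit vector of the fibre over
  \<open>u\<close>.\<close>

lemma bnd_reduced_norm:
  assumes F: "kern F"
  shows "bnd (N F) F"
  unfolding bnd_def
proof (intro ballI allI impI)
  fix u Y and v w :: "_ \<Rightarrow> complex" assume u: "u \<in> P" and Y: "finite Y" "Y \<subseteq> tcls u"
  obtain c n where c: "0 \<le> c" "bnd c F" "supp n F" using kern_bnd[OF F] F by (auto simp: kern_def)
  let ?v = "L2_set (\<lambda>x. cmod (v x)) Y" and ?S = "src_fibre G u"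
  show "cmod (\<Sum>x\<in>Y. \<Sum>y\<in>Y. cnj (w x) * F (x, y) * v y) \<le> N F * L2_set (\<lambda>x. cmod (w x)) Y * ?v"
  proof (cases "?v = 0")
    case True
    then have "\<forall>y\<in>Y. v y = 0" using Y by (simp add: L2_set_eq_0_iff)
    then show ?thesis using True by simp
  next
    case False
    then have v: "0 < ?v" by (metis L2_set_nonneg less_eq_real_def)
    define \<xi> where "\<xi> \<gamma> = (if snd \<gamma> = u \<and> fst \<gamma> \<in> Y then v (fst \<gamma>) / ?v else 0)" for \<gamma> :: "(nat \<Rightarrow> 'e edge \<times> 'a) \<times> (nat \<Rightarrow> 'e edge \<times> 'a)"
    have YS: "(\<lambda>y. (y, u)) ` Y \<subseteq> ?S" using Y by (auto simp: tcls_src_fibre)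
    have hs: "((\<lambda>\<gamma>. (cmod (\<xi> \<gamma>))\<^sup>2) has_sum (\<Sum>y\<in>Y. (cmod (v y / ?v))\<^sup>2)) ?S"
    proof -
      have "((\<lambda>\<gamma>. (cmod (\<xi> \<gamma>))\<^sup>2) has_sum (\<Sum>\<gamma>\<in>(\<lambda>y. (y, u)) ` Y. (cmod (\<xi> \<gamma>))\<^sup>2)) ((\<lambda>y. (y, u)) ` Y)"
        using Y by (intro has_sum_finite) auto
      then have "((\<lambda>\<gamma>. (cmod (\<xi> \<gamma>))\<^sup>2) has_sum (\<Sum>\<gamma>\<in>(\<lambda>y. (y, u)) ` Y. (cmod (\<xi> \<gamma>))\<^sup>2)) ?S"
        by (rule has_sum_cong_neutral[THEN iffD1, rotated -1]) (use YS in \<open>auto simp: \<xi>_def image_iff\<close>)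
      then show ?thesis by (simp add: sum.reindex inj_on_def \<xi>_def)
    qed
    have one: "(\<Sum>y\<in>Y. (cmod (v y / ?v))\<^sup>2) = 1"
    proof -
      have "(\<Sum>y\<in>Y. (cmod (v y / ?v))\<^sup>2) = (\<Sum>y\<in>Y. (cmod (v y))\<^sup>2) / ?v\<^sup>2"
        by (simp add: norm_divide power_divide sum_divide_distrib)
      then show ?thesis using v by (simp add: L2_set_power2[symmetric])
    qed
    have \<xi>: "\<xi> \<in> ell2 ?S" "l2norm ?S \<xi> \<le> 1"
      using hs[unfolded one] YS infsumI[OF hs] one
      by (auto simp: ell2_def l2norm_def has_sum_imp_summable \<xi>_def)
    have \<xi>0: "\<forall>\<gamma>. \<gamma> \<notin> arrows G \<longrightarrow> \<xi> \<gamma> = 0"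
      using \<xi>(1) unfolding ell2_def src_fibre_def by blast
    define \<eta> where "\<eta> x = (\<Sum>y\<in>Y. F (x, y) * (v y / ?v))" for x
    have \<eta>: "conv G F \<xi> (x, u) = \<eta> x" for x
      unfolding conv_eq[OF c(3) \<xi>0] \<eta>_def
      by (rule sum.mono_neutral_cong)
        (use Y finite_cls supp_cls[OF c(3)] in \<open>auto simp: \<xi>_def\<close>)
    have "L2_set (\<lambda>x. cmod (\<eta> x)) Y \<le> l2norm ?S (conv G F \<xi>)"
    proof -
      have "(\<Sum>x\<in>Y. (cmod (\<eta> x))\<^sup>2) = (\<Sum>\<gamma>\<in>(\<lambda>y. (y, u)) ` Y. (cmod (conv G F \<xi> \<gamma>))\<^sup>2)"
        by (simp add: sum.reindex inj_on_def \<eta>)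
      also have "\<dots> \<le> (\<Sum>\<^sub>\<infinity>\<gamma>\<in>?S. (cmod (conv G F \<xi> \<gamma>))\<^sup>2)"
        by (rule finite_sum_le_infsum[OF fibre_bound(1)[OF c u \<xi>]]) (use Y YS in auto)
      finally show ?thesis by (simp add: L2_set_def l2norm_def)
    qed
    also have "\<dots> \<le> N F" by (rule l2norm_le_reduced_norm[OF F u \<xi>])
    finally have \<eta>N: "L2_set (\<lambda>x. cmod (\<eta> x)) Y \<le> N F" .
    have "(\<Sum>x\<in>Y. \<Sum>y\<in>Y. cnj (w x) * F (x, y) * v y) = ?v * (\<Sum>x\<in>Y. cnj (w x) * \<eta> x)"
      unfolding \<eta>_def sum_distrib_left by (intro sum.cong refl) (use v in simp)
    then have "cmod (\<Sum>x\<in>Y. \<Sum>y\<in>Y. cnj (w x) * F (x, y) * v y) = ?v * cmod (\<Sum>x\<in>Y. cnj (w x) * \<eta> x)"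
      by (simp add: norm_mult)
    also have "\<dots> \<le> ?v * (L2_set (\<lambda>x. cmod (cnj (w x))) Y * L2_set (\<lambda>x. cmod (\<eta> x)) Y)"
      by (intro mult_left_mono cmod_sum_mult_le) auto
    also have "\<dots> \<le> ?v * (L2_set (\<lambda>x. cmod (w x)) Y * N F)"
      using \<eta>N by (auto intro!: mult_left_mono)
    finally show ?thesis by (simp add: mult_ac)
  qed
qed

end

section \<open>The normed star-algebra of kernels\<close>

context AH
begin

abbreviation Q where "Q \<equiv> Cc_algebra G"

lemma Q_simps:
  "\<one>\<^bsub>Q\<^esub> = (\<lambda>\<gamma>. if \<gamma> \<in> R 0 then 1 else 0)"
  "\<zero>\<^bsub>Q\<^esub> = (\<lambda>_. 0)" "F \<oplus>\<^bsub>Q\<^esub> K = (\<lambda>\<gamma>. F \<gamma> + K \<gamma>)" "F \<otimes>\<^bsub>Q\<^esub> K = conv G F K"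
  "z \<odot>\<^bsub>Q\<^esub> F = (\<lambda>\<gamma>. z * F \<gamma>)" "cnorm Q = N" "carrier Q = Cc G"
  "star Q F = (\<lambda>\<gamma>. if \<gamma> \<in> arrows G then cnj (F (ginv G \<gamma>)) else 0)"
proof -
  \<comment> \<open>For \<open>\<gamma> = (x, y)\<close> the product is \<open>(y, y)\<close>, so
    the unit arrows are exactly the diagonal \<open>R 0\<close>.\<close>
  have "\<gamma> \<in> arrows G \<and> gmult G (ginv G \<gamma>) \<gamma> = \<gamma> \<longleftrightarrow> \<gamma> \<in> R 0" for \<gamma>
    by (cases \<gamma>) (auto simp: tail_rel_0 arrows_refl dest: arrows_paths)
  then show "\<one>\<^bsub>Q\<^esub> = (\<lambda>\<gamma>. if \<gamma> \<in> R 0 then 1 else 0)"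
    by (simp add: Cc_algebra_def)
qed (simp_all add: Cc_algebra_def)

definition kdist where "kdist F K = N (\<lambda>\<gamma>. F \<gamma> - K \<gamma>)"

lemma cdist_Q: "cdist Q F K = kdist F K"
  by (simp add: cdist_def Q_simps kdist_def)

lemma kernI: "supp n F \<Longrightarrow> (\<And>\<gamma>. cmod (F \<gamma>) \<le> M) \<Longrightarrow> kern F"
  by (auto simp: kern_def)

lemma kern_zero [simp]: "kern (\<lambda>_. 0)"
  by (rule kernI[of 0 _ 0]) (auto simp: supp_def)

lemma kern_add [intro]: "kern F \<Longrightarrow> kern K \<Longrightarrow> kern (\<lambda>\<gamma>. F \<gamma> + K \<gamma>)"
proof -
  assume "kern F" "kern K"
  then obtain m n A B where *: "supp m F" "supp n K" "\<And>\<gamma>. cmod (F \<gamma>) \<le> A" "\<And>\<gamma>. cmod (K \<gamma>) \<le> B"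
    by (auto simp: kern_def)
  then have "supp (max m n) F" "supp (max m n) K" by (auto intro: supp_mono)
  then have "supp (max m n) (\<lambda>\<gamma>. F \<gamma> + K \<gamma>)" by (auto simp: supp_def)
  then show ?thesis
    by (rule kernI[where M="A + B"]) (rule norm_triangle_le, rule add_mono, fact+)
qed

lemma kern_smult [intro]: "kern F \<Longrightarrow> kern (\<lambda>\<gamma>. z * F \<gamma>)"
proof -
  assume "kern F"
  then obtain n A where *: "supp n F" "\<And>\<gamma>. cmod (F \<gamma>) \<le> A" by (auto simp: kern_def)
  then have "supp n (\<lambda>\<gamma>. z * F \<gamma>)" by (auto simp: supp_def)
  then show ?thesis
    by (rule kernI[where M="cmod z * A"]) (auto simp: norm_mult intro: mult_left_mono *)
qed

lemma kern_diff [intro]: "kern F \<Longrightarrow> kern K \<Longrightarrow> kern (\<lambda>\<gamma>. F \<gamma> - K \<gamma>)"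
  using kern_add[OF _ kern_smult[of K "-1"], of F] by simp

lemma kern_star [intro]: "kern F \<Longrightarrow> kern (star Q F)"
proof -
  assume "kern F"
  then obtain n A where *: "supp n F" "\<And>\<gamma>. cmod (F \<gamma>) \<le> A" by (auto simp: kern_def)
  moreover have "0 \<le> A" using *(2) norm_ge_zero order_trans by blast
  moreover have "supp n (star Q F)"
    unfolding supp_def
  proof (intro allI impI)
    fix \<gamma> assume "\<gamma> \<notin> R n"
    then obtain x y where "\<gamma> = (x, y)" "(y, x) \<notin> R n" using tail_rel_sym by (cases \<gamma>) blast
    then show "star Q F \<gamma> = 0" using suppD[OF *(1)] by (simp add: Q_simps)
  qed
  ultimately show ?thesis by (intro kernI[of n _ A]) (auto simp: Q_simps)
qed

lemma supp_conv:
  assumes "supp n F" "supp n K"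
  shows "supp n (conv G F K)"
  unfolding supp_def
proof (intro allI impI)
  fix \<gamma> assume g: "\<gamma> \<notin> R n"
  obtain x z where xz: "\<gamma> = (x, z)" by force
  have "F (x, y) * K (y, z) = 0" if "y \<in> cls n x" for y
  proof -
    have "(y, z) \<notin> R n" using g xz that tail_rel_trans tail_rel_sym unfolding cls_def by blast
    then show ?thesis using suppD[OF assms(2)] by simp
  qed
  moreover have Ka: "\<forall>\<gamma>. \<gamma> \<notin> arrows G \<longrightarrow> K \<gamma> = 0" using supp_arrows assms(2) by blast
  ultimately show "conv G F K \<gamma> = 0" unfolding xz conv_eq[OF assms(1) Ka] by (intro sum.neutral) blast
qed

lemma kern_conv_eq: "kern F \<Longrightarrow> kern K \<Longrightarrow> \<exists>n. \<forall>m\<ge>n. \<forall>x z. conv G F K (x, z) = (\<Sum>y\<in>cls m x. F (x, y) * K (y, z))"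
proof -
  assume F: "kern F" and K: "kern K"
  then obtain n where "supp n F" by (auto simp: kern_def)
  then have "conv G F K (x, z) = (\<Sum>y\<in>cls m x. F (x, y) * K (y, z))" if "m \<ge> n" for m x z
    using that kern_arrows[OF K] by (intro conv_eq) (auto intro: supp_mono)
  then show ?thesis by blast
qed

lemma kern_conv [intro]: "kern F \<Longrightarrow> kern K \<Longrightarrow> kern (conv G F K)"
proof -
  assume F: "kern F" and K: "kern K"
  then obtain m n A B where *: "supp m F" "supp n K" "\<And>\<gamma>. cmod (F \<gamma>) \<le> A" "\<And>\<gamma>. cmod (K \<gamma>) \<le> B"
    by (auto simp: kern_def)
  have A: "0 \<le> A" using *(3) norm_ge_zero order_trans by blast
  have B: "0 \<le> B" using *(4) norm_ge_zero order_trans by blast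
  have Ka: "\<forall>\<gamma>. \<gamma> \<notin> arrows G \<longrightarrow> K \<gamma> = 0" using kern_arrows[OF K] by blast
  have "cmod (conv G F K \<gamma>) \<le> cls_bound m * (A * B)" for \<gamma>
  proof -
    obtain x z where xz: "\<gamma> = (x, z)" by force
    have "cmod (conv G F K \<gamma>) \<le> (\<Sum>y\<in>cls m x. A * B)"
      unfolding xz conv_eq[OF *(1) Ka]
      by (rule sum_norm_le) (auto simp: norm_mult intro: mult_mono * A)
    also have "\<dots> \<le> cls_bound m * (A * B)"
      using card_cls[of m x] A B by (simp add: mult_right_mono)
    finally show ?thesis .
  qed
  moreover have "supp (max m n) (conv G F K)" using * by (intro supp_conv) (auto intro: supp_mono)
  ultimately show ?thesis by (intro kernI)
qed

lemma reduced_norm_add: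
  assumes "kern F" "kern K"
  shows "N (\<lambda>\<gamma>. F \<gamma> + K \<gamma>) \<le> N F + N K"
proof (rule reduced_norm_le)
  show "bnd (N F + N K) (\<lambda>\<gamma>. F \<gamma> + K \<gamma>)"
    unfolding bnd_def
  proof (intro ballI allI impI)
    fix u Y and v w :: "_ \<Rightarrow> complex" assume *: "u \<in> P" "finite Y" "Y \<subseteq> tcls u"
    have "(\<Sum>x\<in>Y. \<Sum>y\<in>Y. cnj (w x) * (F (x, y) + K (x, y)) * v y) =
       (\<Sum>x\<in>Y. \<Sum>y\<in>Y. cnj (w x) * F (x, y) * v y) + (\<Sum>x\<in>Y. \<Sum>y\<in>Y. cnj (w x) * K (x, y) * v y)"
      by (simp add: algebra_simps sum.distrib)
    also have "cmod \<dots> \<le> N F * L2_set (\<lambda>x. cmod (w x)) Y * L2_set (\<lambda>x. cmod (v x)) Y +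
       N K * L2_set (\<lambda>x. cmod (w x)) Y * L2_set (\<lambda>x. cmod (v x)) Y"
      using bnd_reduced_norm[OF assms(1)] bnd_reduced_norm[OF assms(2)] *
      by (intro norm_triangle_mono) (auto simp: bnd_def)
    finally show "cmod (\<Sum>x\<in>Y. \<Sum>y\<in>Y. cnj (w x) * (F (x, y) + K (x, y)) * v y)
      \<le> (N F + N K) * L2_set (\<lambda>x. cmod (w x)) Y * L2_set (\<lambda>x. cmod (v x)) Y"
      by (simp add: algebra_simps)
  qed
qed (use assms reduced_norm_nonneg in auto)

lemma reduced_norm_smult:
  assumes "kern F"
  shows "N (\<lambda>\<gamma>. z * F \<gamma>) \<le> cmod z * N F"
proof (rule reduced_norm_le)
  show "bnd (cmod z * N F) (\<lambda>\<gamma>. z * F \<gamma>)"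
    unfolding bnd_def
  proof (intro ballI allI impI)
    fix u Y and v w :: "_ \<Rightarrow> complex" assume *: "u \<in> P" "finite Y" "Y \<subseteq> tcls u"
    have "(\<Sum>x\<in>Y. \<Sum>y\<in>Y. cnj (w x) * (z * F (x, y)) * v y) =
       z * (\<Sum>x\<in>Y. \<Sum>y\<in>Y. cnj (w x) * F (x, y) * v y)"
      by (simp add: sum_distrib_left mult_ac)
    also have "cmod \<dots> \<le> cmod z * (N F * L2_set (\<lambda>x. cmod (w x)) Y * L2_set (\<lambda>x. cmod (v x)) Y)"
      using bnd_reduced_norm[OF assms] * by (auto simp: bnd_def norm_mult intro!: mult_left_mono)
    finally show "cmod (\<Sum>x\<in>Y. \<Sum>y\<in>Y. cnj (w x) * (z * F (x, y)) * v y)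
      \<le> cmod z * N F * L2_set (\<lambda>x. cmod (w x)) Y * L2_set (\<lambda>x. cmod (v x)) Y"
      by (simp add: mult.assoc)
  qed
qed (use assms reduced_norm_nonneg in auto)

lemma reduced_norm_star_le:
  assumes "kern F"
  shows "N (star Q F) \<le> N F"
proof (rule reduced_norm_le)
  show "bnd (N F) (star Q F)"
    unfolding bnd_def
  proof (intro ballI allI impI)
    fix u Y and v w :: "_ \<Rightarrow> complex" assume *: "u \<in> P" "finite Y" "Y \<subseteq> tcls u"
    have arr: "(x, y) \<in> arrows G" if "x \<in> Y" "y \<in> Y" for x y
      using that * arrows_trans arrows_sym unfolding tcls_def by blast
    have "(\<Sum>x\<in>Y. \<Sum>y\<in>Y. cnj (w x) * star Q F (x, y) * v y) =
       cnj (\<Sum>x\<in>Y. \<Sum>y\<in>Y. cnj (v y) * F (y, x) * w x)"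
      by (simp add: Q_simps arr mult_ac)
    also have "\<dots> = cnj (\<Sum>y\<in>Y. \<Sum>x\<in>Y. cnj (v y) * F (y, x) * w x)" by (subst sum.swap) simp
    also have "cmod \<dots> \<le> N F * L2_set (\<lambda>x. cmod (v x)) Y * L2_set (\<lambda>x. cmod (w x)) Y"
      using bnd_reduced_norm[OF assms] * unfolding complex_mod_cnj by (auto simp: bnd_def)
    finally show "cmod (\<Sum>x\<in>Y. \<Sum>y\<in>Y. cnj (w x) * star Q F (x, y) * v y)
      \<le> N F * L2_set (\<lambda>x. cmod (w x)) Y * L2_set (\<lambda>x. cmod (v x)) Y"
      by (simp only: mult_ac)
  qed
qed (use assms reduced_norm_nonneg in auto)

lemma star_star: "kern F \<Longrightarrow> star Q (star Q F) = F"
proof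
  fix \<gamma> assume F: "kern F"
  show "star Q (star Q F) \<gamma> = F \<gamma>"
    using kern_arrows[OF F, of \<gamma>] arrows_sym by (cases \<gamma>) (auto simp: Q_simps)
qed

lemma reduced_norm_star: "kern F \<Longrightarrow> N (star Q F) = N F"
  using reduced_norm_star_le[of F] reduced_norm_star_le[of "star Q F"] kern_star[of F] star_star[of F] by auto

text \<open>On the finite union of the classes that meet \<open>Y\<close>, convolution is a product
  of matrices: \<open>K\<close> is applied to \<open>v\<close> first, and duality turns its form
  bound into a bound for the vector obtained, which then enters the form of
  \<open>F\<close>.\<close>

lemma reduced_norm_conv:
  assumes F: "kern F" and K: "kern K"
  shows "N (conv G F K) \<le> N F * N K"
proof (rule reduced_norm_le)
  obtain m n where mn: "supp m F" "supp n K" using F K by (auto simp: kern_def)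
  show "bnd (N F * N K) (conv G F K)"
    unfolding bnd_def
  proof (intro ballI allI impI)
    fix u Y and v w :: "_ \<Rightarrow> complex" assume u: "u \<in> P" and Y: "finite Y" "Y \<subseteq> tcls u"
    define Z where "Z = (\<Union>x\<in>Y. cls m x)"
    have Z: "finite Z" "Z \<subseteq> tcls u"
      using Y finite_cls by (auto simp: Z_def dest: cls_arrows intro: tcls_trans)
    have YZ: "Y \<subseteq> Z"
      using Y(2) arrows_paths by (fastforce simp: Z_def cls_def tcls_def intro: tail_rel_refl)
    define v' where "v' y = (if y \<in> Y then v y else 0)" for y
    define w' where "w' y = (if y \<in> Y then w y else 0)" for y
    have nv: "L2_set (\<lambda>x. cmod (v' x)) Z = L2_set (\<lambda>x. cmod (v x)) Y"
      unfolding L2_set_def by (rule arg_cong[of _ _ sqrt], rule sum.mono_neutral_cong_right) (use YZ Z in \<open>auto simp: v'_def\<close>)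
    have nw: "L2_set (\<lambda>x. cmod (w' x)) Z = L2_set (\<lambda>x. cmod (w x)) Y"
      unfolding L2_set_def by (rule arg_cong[of _ _ sqrt], rule sum.mono_neutral_cong_right) (use YZ Z in \<open>auto simp: w'_def\<close>)
    define \<eta> where "\<eta> z = (\<Sum>y\<in>Z. K (z, y) * v' y)" for z
    have Ka: "\<forall>\<gamma>. \<gamma> \<notin> arrows G \<longrightarrow> K \<gamma> = 0" using kern_arrows[OF K] by blast
    have cv: "conv G F K (x, y) = (\<Sum>z\<in>Z. F (x, z) * K (z, y))" if "x \<in> Y" for x y
      unfolding conv_eq[OF mn(1) Ka]
      by (rule sum.mono_neutral_left) (use Z that supp_cls[OF mn(1)] in \<open>auto simp: Z_def\<close>)
    have \<eta>: "L2_set (\<lambda>x. cmod (\<eta> x)) Z \<le> N K * L2_set (\<lambda>x. cmod (v' x)) Z"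
    proof (rule L2_set_le_by_duality)
      show "0 \<le> N K * L2_set (\<lambda>x. cmod (v' x)) Z" using reduced_norm_nonneg[OF K] by simp
      fix f
      have "(\<Sum>x\<in>Z. cnj (f x) * \<eta> x) = (\<Sum>x\<in>Z. \<Sum>y\<in>Z. cnj (f x) * K (x, y) * v' y)"
        by (simp add: \<eta>_def sum_distrib_left mult.assoc)
      then show "cmod (\<Sum>x\<in>Z. cnj (f x) * \<eta> x) \<le> N K * L2_set (\<lambda>x. cmod (v' x)) Z * L2_set (\<lambda>x. cmod (f x)) Z"
        using bnd_reduced_norm[OF K, unfolded bnd_def, rule_format, OF u Z, of f v'] by (simp add: mult_ac)
    qed
    have "(\<Sum>x\<in>Y. \<Sum>y\<in>Y. cnj (w x) * conv G F K (x, y) * v y) =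
        (\<Sum>x\<in>Y. \<Sum>y\<in>Z. cnj (w x) * conv G F K (x, y) * v' y)"
      by (rule sum.cong[OF refl], rule sum.mono_neutral_cong_left) (use YZ Z in \<open>auto simp: v'_def\<close>)
    also have "\<dots> = (\<Sum>x\<in>Y. \<Sum>y\<in>Z. \<Sum>z\<in>Z. cnj (w x) * F (x, z) * (K (z, y) * v' y))"
      by (intro sum.cong refl) (simp add: cv sum_distrib_left sum_distrib_right mult_ac)
    also have "\<dots> = (\<Sum>x\<in>Y. \<Sum>z\<in>Z. cnj (w x) * F (x, z) * \<eta> z)"
      unfolding \<eta>_def sum_distrib_left by (rule sum.cong[OF refl]) (rule sum.swap)
    also have "\<dots> = (\<Sum>x\<in>Z. \<Sum>z\<in>Z. cnj (w' x) * F (x, z) * \<eta> z)"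
      by (rule sum.mono_neutral_cong_left) (use YZ Z in \<open>auto simp: w'_def\<close>)
    also have "cmod \<dots> \<le> N F * L2_set (\<lambda>x. cmod (w' x)) Z * L2_set (\<lambda>x. cmod (\<eta> x)) Z"
      using bnd_reduced_norm[OF F, unfolded bnd_def, rule_format, OF u Z] .
    also have "\<dots> \<le> N F * L2_set (\<lambda>x. cmod (w' x)) Z * (N K * L2_set (\<lambda>x. cmod (v' x)) Z)"
      by (intro mult_left_mono \<eta> mult_nonneg_nonneg reduced_norm_nonneg F) auto
    finally show "cmod (\<Sum>x\<in>Y. \<Sum>y\<in>Y. cnj (w x) * conv G F K (x, y) * v y) \<le>
      N F * N K * L2_set (\<lambda>x. cmod (w x)) Y * L2_set (\<lambda>x. cmod (v x)) Y"
      by (simp add: nv nw mult_ac)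
  qed
qed (use F K reduced_norm_nonneg in auto)

text \<open>The form at the point masses of the two ends of an arrow is the entry there. Norm
  convergence of kernels thus implies uniform convergence of their entries, from which the
  characters will be built.\<close>

lemma entry_le_reduced_norm:
  assumes F: "kern F"
  shows "cmod (F \<gamma>) \<le> N F"
proof (cases "\<gamma> \<in> arrows G")
  case True
  obtain a b where ab: "\<gamma> = (a, b)" by force
  have b: "b \<in> P" using True ab arrows_paths by blast
  have Y: "finite {a, b}" "{a, b} \<subseteq> tcls b" using True ab arrows_refl[OF b] by (auto simp: tcls_def)
  let ?w = "\<lambda>x. if x = a then 1 else 0 :: complex" and ?v = "\<lambda>x. if x = b then 1 else 0 :: complex"
  have "(\<Sum>x\<in>{a, b}. \<Sum>y\<in>{a, b}. cnj (?w x) * F (x, y) * ?v y) = F \<gamma>"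
    by (cases "a = b") (auto simp: ab)
  moreover have "L2_set (\<lambda>x. cmod (?w x)) {a, b} = 1" "L2_set (\<lambda>x. cmod (?v x)) {a, b} = 1"
    by (cases "a = b"; auto simp: L2_set_def)+
  ultimately show ?thesis
    using bnd_reduced_norm[OF F, unfolded bnd_def, rule_format, OF b Y, of ?w ?v] by simp
next
  case False
  then show ?thesis using kern_arrows[OF F False] reduced_norm_nonneg[OF F] by simp
qed

text \<open>Combined with \<open>entry_le_reduced_norm\<close>, this makes norm and supremum
  equivalent among the kernels supported on one \<open>R n\<close>; uniform approximations are
  turned into norm approximations here.\<close>

lemma reduced_norm_le_sup:
  assumes "supp n F" "\<And>\<gamma>. cmod (F \<gamma>) \<le> M"
  shows "N F \<le> M * cls_bound n"
proof -
  have "0 \<le> M" using assms(2) norm_ge_zero order_trans by blast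
  then show ?thesis using bnd_Schur[OF assms] kernI[OF assms] by (intro reduced_norm_le) auto
qed

lemma kdist_nonneg: "kern F \<Longrightarrow> kern K \<Longrightarrow> 0 \<le> kdist F K"
  unfolding kdist_def by (intro reduced_norm_nonneg) auto

lemma kdist_refl [simp]: "kdist F F = 0"
proof -
  have "N (\<lambda>_. 0) \<le> 0 * real (cls_bound 0)" by (rule reduced_norm_le_sup) (auto simp: supp_def)
  then show ?thesis using reduced_norm_nonneg[of "\<lambda>_. 0"] by (simp add: kdist_def)
qed

lemma kdist_triangle:
  assumes "kern F" "kern K" "kern L"
  shows "kdist F L \<le> kdist F K + kdist K L"
  using reduced_norm_add[of "\<lambda>\<gamma>. F \<gamma> - K \<gamma>" "\<lambda>\<gamma>. K \<gamma> - L \<gamma>"] assms by (auto simp: kdist_def)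

lemma kdist_sym:
  assumes "kern F" "kern K"
  shows "kdist F K = kdist K F"
  using reduced_norm_smult[OF kern_diff[OF assms], of "-1"]
    reduced_norm_smult[OF kern_diff[OF assms(2,1)], of "-1"]
  by (simp add: kdist_def)

lemma reduced_norm_diff_le:
  assumes "kern F" "kern K"
  shows "\<bar>N F - N K\<bar> \<le> kdist F K"
  using reduced_norm_add[OF kern_diff[OF assms] assms(2)] reduced_norm_add[OF kern_diff[OF assms(2,1)] assms(1)]
    kdist_sym[OF assms] by (simp add: kdist_def)

lemma kdist_add:
  assumes "kern F" "kern K" "kern F'" "kern K'"
  shows "kdist (\<lambda>\<gamma>. F \<gamma> + K \<gamma>) (\<lambda>\<gamma>. F' \<gamma> + K' \<gamma>) \<le> kdist F F' + kdist K K'"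
  using reduced_norm_add[of "\<lambda>\<gamma>. F \<gamma> - F' \<gamma>" "\<lambda>\<gamma>. K \<gamma> - K' \<gamma>"] assms
  by (auto simp: kdist_def algebra_simps)

lemma kdist_smult:
  assumes "kern F" "kern K"
  shows "kdist (\<lambda>\<gamma>. z * F \<gamma>) (\<lambda>\<gamma>. z * K \<gamma>) \<le> cmod z * kdist F K"
  using reduced_norm_smult[of "\<lambda>\<gamma>. F \<gamma> - K \<gamma>" z] assms by (auto simp: kdist_def algebra_simps)

lemma kdist_star:
  assumes "kern F" "kern K"
  shows "kdist (star Q F) (star Q K) = kdist F K"
proof -
  have "(\<lambda>\<gamma>. star Q F \<gamma> - star Q K \<gamma>) = star Q (\<lambda>\<gamma>. F \<gamma> - K \<gamma>)" by (auto simp: Q_simps)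
  then show ?thesis using reduced_norm_star[of "\<lambda>\<gamma>. F \<gamma> - K \<gamma>"] assms by (auto simp: kdist_def)
qed

lemma kdist_conv:
  assumes F: "kern F" and K: "kern K" and F': "kern F'" and K': "kern K'"
  shows "kdist (conv G F K) (conv G F' K') \<le> kdist F F' * N K + N F' * kdist K K'"
proof -
  let ?F = "\<lambda>\<gamma>. F \<gamma> - F' \<gamma>" and ?K = "\<lambda>\<gamma>. K \<gamma> - K' \<gamma>"
  have k: "kern ?F" "kern ?K" using assms by auto
  have eq: "(\<lambda>\<gamma>. conv G F K \<gamma> - conv G F' K' \<gamma>) = (\<lambda>\<gamma>. conv G ?F K \<gamma> + conv G F' ?K \<gamma>)"
  proof
    fix \<gamma> :: "(nat \<Rightarrow> 'e edge \<times> 'a) \<times> (nat \<Rightarrow> 'e edge \<times> 'a)"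
    obtain x z where xz: "\<gamma> = (x, z)" by force
    obtain n1 where n1: "\<forall>m\<ge>n1. \<forall>x z. conv G F K (x, z) = (\<Sum>y\<in>cls m x. F (x, y) * K (y, z))"
      using kern_conv_eq[OF F K] by blast
    obtain n2 where n2: "\<forall>m\<ge>n2. \<forall>x z. conv G F' K' (x, z) = (\<Sum>y\<in>cls m x. F' (x, y) * K' (y, z))"
      using kern_conv_eq[OF F' K'] by blast
    obtain n3 where n3: "\<forall>m\<ge>n3. \<forall>x z. conv G ?F K (x, z) = (\<Sum>y\<in>cls m x. ?F (x, y) * K (y, z))"
      using kern_conv_eq[OF k(1) K] by blast
    obtain n4 where n4: "\<forall>m\<ge>n4. \<forall>x z. conv G F' ?K (x, z) = (\<Sum>y\<in>cls m x. F' (x, y) * ?K (y, z))"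
      using kern_conv_eq[OF F' k(2)] by blast
    \<comment> \<open>At this level all four convolutions are sums over the same class.\<close>
    define m where "m = n1 + n2 + n3 + n4"
    have m: "m \<ge> n1" "m \<ge> n2" "m \<ge> n3" "m \<ge> n4" by (auto simp: m_def)
    show "conv G F K \<gamma> - conv G F' K' \<gamma> = conv G ?F K \<gamma> + conv G F' ?K \<gamma>"
      unfolding xz n1[rule_format, OF m(1)] n2[rule_format, OF m(2)] n3[rule_format, OF m(3)]
        n4[rule_format, OF m(4)] sum_subtractf[symmetric] sum.distrib[symmetric]
      by (simp add: left_diff_distrib right_diff_distrib)
  qed
  have "N (\<lambda>\<gamma>. conv G ?F K \<gamma> + conv G F' ?K \<gamma>) \<le> N (conv G ?F K) + N (conv G F' ?K)"
    using assms k by (intro reduced_norm_add) auto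
  also have "\<dots> \<le> N ?F * N K + N F' * N ?K"
    using assms k by (intro add_mono reduced_norm_conv) auto
  finally show ?thesis by (simp add: kdist_def eq)
qed

end


section \<open>The kernels of a level\<close>

lemma l2norm_finite: "finite A \<Longrightarrow> l2norm A \<xi> = L2_set (\<lambda>a. cmod (\<xi> a)) A"
  by (simp add: l2norm_def L2_set_def)

text \<open>With \<open>form_le_matnorm\<close> below, this describes the matrix norm as the least
  form bound, exactly as the reduced norm has been described; the two norms can then be compared
  form by form.\<close>

lemma matnorm_le:
  assumes c: "0 \<le> c" and b: "\<And>v w. cmod (\<Sum>a<k. \<Sum>b<k. cnj (w a) * M $$ (a, b) * v b) \<le>
      c * L2_set (\<lambda>a. cmod (w a)) {..<k} * L2_set (\<lambda>a. cmod (v a)) {..<k}"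
  shows "matnorm k M \<le> c"
  unfolding matnorm_def opnorm_def
proof (rule cSUP_least)
  show "{\<xi> \<in> ell2 {..<k}. l2norm {..<k} \<xi> \<le> 1} \<noteq> {}"
    by (auto simp: ell2_def l2norm_def intro!: exI[of _ "\<lambda>_. 0"])
  fix \<xi> :: "nat \<Rightarrow> complex" assume "\<xi> \<in> {\<xi> \<in> ell2 {..<k}. l2norm {..<k} \<xi> \<le> 1}"
  then have \<xi>: "L2_set (\<lambda>a. cmod (\<xi> a)) {..<k} \<le> 1" by (simp add: l2norm_finite)
  show "l2norm {..<k} (\<lambda>a. \<Sum>b<k. M $$ (a, b) * \<xi> b) \<le> c"
    unfolding l2norm_finite[OF finite_lessThan]
  proof (rule L2_set_le_by_duality[OF c])
    fix w
    have "cmod (\<Sum>a<k. cnj (w a) * (\<Sum>b<k. M $$ (a, b) * \<xi> b)) \<le>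
        c * L2_set (\<lambda>a. cmod (w a)) {..<k} * L2_set (\<lambda>a. cmod (\<xi> a)) {..<k}"
      using b[of w \<xi>] by (simp add: sum_distrib_left mult.assoc)
    also have "\<dots> \<le> c * L2_set (\<lambda>a. cmod (w a)) {..<k} * 1"
      by (intro mult_left_mono \<xi> mult_nonneg_nonneg c) auto
    finally show "cmod (\<Sum>a<k. cnj (w a) * (\<Sum>b<k. M $$ (a, b) * \<xi> b)) \<le> c * L2_set (\<lambda>a. cmod (w a)) {..<k}"
      by simp
  qed
qed

text \<open>A rough estimate whose purpose is to show that the supremum defining
  \<open>matnorm\<close> is taken over a bounded set.\<close>

lemma form_le_entries:
  assumes "\<And>a b. a < k \<Longrightarrow> b < k \<Longrightarrow> cmod (M $$ (a, b)) \<le> B"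
  shows "cmod (\<Sum>a<k. \<Sum>b<k. cnj (w a) * M $$ (a, b) * v b) \<le>
      (real k * real k * B) * L2_set (\<lambda>a. cmod (w a)) {..<k} * L2_set (\<lambda>a. cmod (v a)) {..<k}"
proof -
  let ?w = "L2_set (\<lambda>a. cmod (w a)) {..<k}" and ?v = "L2_set (\<lambda>a. cmod (v a)) {..<k}"
  have "cmod (cnj (w a) * M $$ (a, b) * v b) \<le> ?w * B * ?v" if "a < k" "b < k" for a b
  proof -
    have "0 \<le> B" using assms[OF that] norm_ge_zero order_trans by blast
    moreover have "cmod (w a) \<le> ?w" "cmod (v b) \<le> ?v"
      using that member_le_L2_set[of "{..<k}"] by auto
    ultimately show ?thesis
      unfolding norm_mult complex_mod_cnj by (intro mult_mono assms that) auto
  qed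
  then have "cmod (\<Sum>a<k. \<Sum>b<k. cnj (w a) * M $$ (a, b) * v b) \<le> (\<Sum>a<k. \<Sum>b<k. ?w * B * ?v)"
    by (intro sum_norm_le) auto
  then show ?thesis by (simp add: algebra_simps)
qed

lemma form_le_matnorm:
  "cmod (\<Sum>a<k. \<Sum>b<k. cnj (w a) * M $$ (a, b) * v b) \<le>
      matnorm k M * L2_set (\<lambda>a. cmod (w a)) {..<k} * L2_set (\<lambda>a. cmod (v a)) {..<k}"
proof (cases "L2_set (\<lambda>a. cmod (v a)) {..<k} = 0")
  case True
  then have "\<forall>a<k. v a = 0" by (simp add: L2_set_eq_0_iff)
  then show ?thesis using True by simp
next
  case False
  let ?v = "L2_set (\<lambda>a. cmod (v a)) {..<k}"
  let ?T = "\<lambda>\<xi> a. \<Sum>b<k. M $$ (a, b) * \<xi> b"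
  have v: "0 < ?v" using False by (metis L2_set_nonneg less_eq_real_def)
  define \<xi> where "\<xi> a = (if a < k then v a / ?v else 0)" for a
  obtain B where B: "\<And>a b. a < k \<Longrightarrow> b < k \<Longrightarrow> cmod (M $$ (a, b)) \<le> B"
  proof (rule that[of "\<Sum>p\<in>{..<k} \<times> {..<k}. cmod (M $$ p)"])
    show "cmod (M $$ (a, b)) \<le> (\<Sum>p\<in>{..<k} \<times> {..<k}. cmod (M $$ p))" if "a < k" "b < k" for a b
      using that by (intro member_le_sum[of "(a, b)" _ "\<lambda>p. cmod (M $$ p)"]) auto
  qed
  have Tbd: "l2norm {..<k} (?T \<zeta>) \<le> real k * real k * \<bar>B\<bar>"
    if "\<zeta> \<in> {\<xi> \<in> ell2 {..<k}. l2norm {..<k} \<xi> \<le> 1}" for \<zeta>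
    unfolding l2norm_finite[OF finite_lessThan]
  proof (rule L2_set_le_by_duality)
    fix w
    have "cmod (\<Sum>a<k. cnj (w a) * ?T \<zeta> a) \<le>
        (real k * real k * \<bar>B\<bar>) * L2_set (\<lambda>a. cmod (w a)) {..<k} * L2_set (\<lambda>a. cmod (\<zeta> a)) {..<k}"
      using form_le_entries[of k M "\<bar>B\<bar>" w \<zeta>] B by (fastforce simp: sum_distrib_left mult.assoc)
    also have "\<dots> \<le> (real k * real k * \<bar>B\<bar>) * L2_set (\<lambda>a. cmod (w a)) {..<k} * 1"
      using that by (intro mult_left_mono) (auto simp: l2norm_finite)
    finally show "cmod (\<Sum>a<k. cnj (w a) * ?T \<zeta> a) \<le> (real k * real k * \<bar>B\<bar>) * L2_set (\<lambda>a. cmod (w a)) {..<k}"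
      by simp
  qed simp
  have one: "L2_set (\<lambda>a. cmod (\<xi> a)) {..<k} = 1"
  proof -
    have "L2_set (\<lambda>a. cmod (\<xi> a)) {..<k} = L2_set (\<lambda>a. (1 / ?v) * cmod (v a)) {..<k}"
      using v by (intro L2_set_cong) (auto simp: \<xi>_def norm_divide)
    also have "\<dots> = (1 / ?v) * ?v" using v by (subst L2_set_right_distrib) auto
    finally show ?thesis using v by simp
  qed
  have \<xi>: "\<xi> \<in> {\<xi> \<in> ell2 {..<k}. l2norm {..<k} \<xi> \<le> 1}"
    using one by (auto simp: l2norm_finite ell2_def \<xi>_def)
  have le: "L2_set (\<lambda>a. cmod (?T \<xi> a)) {..<k} \<le> matnorm k M"
    unfolding matnorm_def opnorm_def l2norm_finite[OF finite_lessThan, symmetric]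
    by (rule cSUP_upper[OF \<xi>]) (use Tbd in \<open>auto intro!: bdd_aboveI[of _ "real k * real k * \<bar>B\<bar>"]\<close>)
  have "(\<Sum>a<k. \<Sum>b<k. cnj (w a) * M $$ (a, b) * v b) = ?v * (\<Sum>a<k. cnj (w a) * ?T \<xi> a)"
    unfolding sum_distrib_left by (intro sum.cong refl) (use v in \<open>simp add: \<xi>_def\<close>)
  then have "cmod (\<Sum>a<k. \<Sum>b<k. cnj (w a) * M $$ (a, b) * v b) = ?v * cmod (\<Sum>a<k. cnj (w a) * ?T \<xi> a)"
    by (simp add: norm_mult)
  also have "\<dots> \<le> ?v * (L2_set (\<lambda>a. cmod (cnj (w a))) {..<k} * L2_set (\<lambda>a. cmod (?T \<xi> a)) {..<k})"
    by (intro mult_left_mono cmod_sum_mult_le) auto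
  also have "\<dots> \<le> ?v * (L2_set (\<lambda>a. cmod (w a)) {..<k} * matnorm k M)"
    using le by (auto intro!: mult_left_mono)
  finally show ?thesis by (simp add: mult_ac)
qed

context AH
begin

text \<open>Because \<open>F\<close> is supported on \<open>R n\<close>, it is a direct sum over the
  classes of \<open>R n\<close>, and a direct sum is bounded by the common bound of its blocks: the
  block estimates are added and combined by Cauchy-Schwarz over the blocks.\<close>

lemma bnd_cls:
  assumes F: "supp n F" and c: "0 \<le> c"
    and b: "\<And>u v w. u \<in> P \<Longrightarrow> cmod (\<Sum>x\<in>cls n u. \<Sum>y\<in>cls n u. cnj (w x) * F (x, y) * v y) \<le>
      c * L2_set (\<lambda>x. cmod (w x)) (cls n u) * L2_set (\<lambda>x. cmod (v x)) (cls n u)"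
  shows "bnd c F"
  unfolding bnd_def
proof (intro ballI allI impI)
  fix u Y and v w :: "_ \<Rightarrow> complex" assume u: "u \<in> P" and Y: "finite Y" "Y \<subseteq> tcls u"
  define \<K> where "\<K> = cls n ` Y"
  define Z where "Z = \<Union> \<K>"
  have fin: "finite \<K>" "\<And>\<kappa>. \<kappa> \<in> \<K> \<Longrightarrow> finite \<kappa>" using Y finite_cls by (auto simp: \<K>_def)
  then have Z: "finite Z" by (auto simp: Z_def)
  have YP: "Y \<subseteq> P" using Y(2) arrows_paths by (auto simp: tcls_def)
  have YZ: "Y \<subseteq> Z"
    using YP by (auto simp: Z_def \<K>_def cls_def intro: tail_rel_refl)
  have disj: "\<kappa> \<inter> \<kappa>' = {}" if \<kappa>: "\<kappa> \<in> \<K>" "\<kappa>' \<in> \<K>" "\<kappa> \<noteq> \<kappa>'" for \<kappa> \<kappa>'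
  proof (rule ccontr)
    assume "\<kappa> \<inter> \<kappa>' \<noteq> {}"
    then obtain x y y' where "\<kappa> = cls n y" "\<kappa>' = cls n y'" "(x, y) \<in> R n" "(x, y') \<in> R n"
      using \<kappa>(1,2) unfolding \<K>_def cls_def by blast
    then show False using \<kappa>(3) cls_eq by metis
  qed
  have sumZ: "(\<Sum>x\<in>Z. g x) = (\<Sum>\<kappa>\<in>\<K>. \<Sum>x\<in>\<kappa>. g x)" for g :: "_ \<Rightarrow> 'z::comm_monoid_add"
    unfolding Z_def using fin disj by (subst sum.Union_disjoint) auto
  define v' where "v' y = (if y \<in> Y then v y else 0)" for y
  define w' where "w' y = (if y \<in> Y then w y else 0)" for y
  have nv: "L2_set (\<lambda>x. cmod (v' x)) Z = L2_set (\<lambda>x. cmod (v x)) Y"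
    unfolding L2_set_def by (rule arg_cong[of _ _ sqrt], rule sum.mono_neutral_cong_right) (use YZ Z in \<open>auto simp: v'_def\<close>)
  have nw: "L2_set (\<lambda>x. cmod (w' x)) Z = L2_set (\<lambda>x. cmod (w x)) Y"
    unfolding L2_set_def by (rule arg_cong[of _ _ sqrt], rule sum.mono_neutral_cong_right) (use YZ Z in \<open>auto simp: w'_def\<close>)
  \<comment> \<open>Pythagoras for the disjoint classes.\<close>
  have L2Z: "L2_set (\<lambda>\<kappa>. L2_set f \<kappa>) \<K> = L2_set f Z" for f
    by (simp add: L2_set_def[of "\<lambda>\<kappa>. L2_set f \<kappa>"] L2_set_power2 L2_set_def[of f Z] sumZ)
  have "(\<Sum>x\<in>Y. \<Sum>y\<in>Y. cnj (w x) * F (x, y) * v y) = (\<Sum>x\<in>Z. \<Sum>y\<in>Z. cnj (w' x) * F (x, y) * v' y)"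
    unfolding sum.cartesian_product
    by (rule sum.mono_neutral_cong_left) (use YZ Z in \<open>auto simp: w'_def v'_def split: if_splits\<close>)
  also have "\<dots> = (\<Sum>\<kappa>\<in>\<K>. \<Sum>x\<in>\<kappa>. \<Sum>y\<in>Z. cnj (w' x) * F (x, y) * v' y)" by (rule sumZ)
  also have "\<dots> = (\<Sum>\<kappa>\<in>\<K>. \<Sum>x\<in>\<kappa>. \<Sum>y\<in>\<kappa>. cnj (w' x) * F (x, y) * v' y)"
  proof (rule sum.cong[OF refl], rule sum.cong[OF refl])
    fix \<kappa> x assume *: "\<kappa> \<in> \<K>" "x \<in> \<kappa>"
    then obtain y where "\<kappa> = cls n y" "(x, y) \<in> R n" unfolding \<K>_def cls_def by blast
    then have "\<kappa> = cls n x" using cls_eq by simp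
    then show "(\<Sum>y\<in>Z. cnj (w' x) * F (x, y) * v' y) = (\<Sum>y\<in>\<kappa>. cnj (w' x) * F (x, y) * v' y)"
      using supp_cls[OF F] Z * by (intro sum.mono_neutral_right) (auto simp: Z_def)
  qed
  also have "cmod \<dots> \<le> (\<Sum>\<kappa>\<in>\<K>. c * (L2_set (\<lambda>x. cmod (w' x)) \<kappa> * L2_set (\<lambda>x. cmod (v' x)) \<kappa>))"
    by (rule sum_norm_le) (use b YP in \<open>auto simp: \<K>_def mult.assoc[symmetric]\<close>)
  also have "\<dots> = c * (\<Sum>\<kappa>\<in>\<K>. L2_set (\<lambda>x. cmod (w' x)) \<kappa> * L2_set (\<lambda>x. cmod (v' x)) \<kappa>)"
    by (simp add: sum_distrib_left)
  also have "\<dots> \<le> c * (L2_set (\<lambda>x. cmod (w' x)) Z * L2_set (\<lambda>x. cmod (v' x)) Z)"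
    unfolding L2Z[symmetric] by (intro mult_left_mono c sum_mult_le_L2_set) auto
  finally show "cmod (\<Sum>x\<in>Y. \<Sum>y\<in>Y. cnj (w x) * F (x, y) * v y) \<le>
     c * L2_set (\<lambda>x. cmod (w x)) Y * L2_set (\<lambda>x. cmod (v x)) Y"
    by (simp add: nv nw mult.assoc)
qed

definition rep :: "nat \<Rightarrow> 'a matfun \<Rightarrow> (nat \<Rightarrow> 'e edge \<times> 'a) \<times> (nat \<Rightarrow> 'e edge \<times> 'a) \<Rightarrow> complex" where
  "rep n f = (\<lambda>(x, y). if (x, y) \<in> R n then f (src x n, snd (x n)) $$ (idx n x, idx n y) else 0)"

lemma rep_in: "(x, y) \<in> R n \<Longrightarrow> rep n f (x, y) = f (src x n, snd (x n)) $$ (idx n x, idx n y)"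
  and rep_out: "(x, y) \<notin> R n \<Longrightarrow> rep n f (x, y) = 0"
  by (auto simp: rep_def)

lemma supp_rep: "supp n (rep n f)"
  by (auto simp: supp_def rep_def)

lemma tail_rel_src: "(x, y) \<in> R n \<Longrightarrow> src y n = src x n" "(x, y) \<in> R n \<Longrightarrow> snd (y n) = snd (x n)"
  using tail_relD(3)[of x y n n] by auto

text \<open>The pair \<open>(x, y)\<close> depends on the position of the entry and not on
  \<open>f\<close>, so statements about kernels translate back into statements about all matrix
  entries.\<close>

lemma ex_entry:
  assumes "1 \<le> n" "i < nsum S n" "t \<in> topspace (space_at S n i)" "a < msize S n i" "b < msize S n i"
  obtains x y where "(x, y) \<in> R n" "\<And>f. f (i, t) $$ (a, b) = rep n f (x, y)"
    "src x n = i" "snd (x n) = t" "idx n x = a" "idx n y = b"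
proof -
  obtain x where x: "x \<in> P" "src x n = i" "snd (x n) = t" "idx n x = a" using ex_path assms(1-4) by blast
  obtain y where "(y, x) \<in> R n" "idx n y = b" using ex_idx[OF x(1) assms(1), of b] assms(5) x(2) by auto
  then show ?thesis using that[of x y] tail_rel_sym[of y x n] x by (simp add: rep_in)
qed

lemma entries_bounded:
  assumes n: "1 \<le> n" and f: "f \<in> carrier (alg S n)"
  obtains M where "\<And>i t a b. i < nsum S n \<Longrightarrow> t \<in> topspace (space_at S n i) \<Longrightarrow> a < msize S n i \<Longrightarrow> b < msize S n i \<Longrightarrow>
    cmod (f (i, t) $$ (a, b)) \<le> M"
proof -
  have "\<exists>M. 0 \<le> M \<and> (\<forall>t\<in>topspace (space_at S n i). cmod (f (i, t) $$ (a, b)) \<le> M)"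
    if "i < nsum S n" "a < msize S n i" "b < msize S n i" for i a b
  proof -
    have "compactin euclidean ((\<lambda>t. f (i, t) $$ (a, b)) ` topspace (space_at S n i))"
      by (rule image_compactin[where X="space_at S n i"])
        (use compact_space_at[OF n] f that in \<open>auto simp: compact_space_def alg_carrier_iff\<close>)
    then have "bounded ((\<lambda>t. f (i, t) $$ (a, b)) ` topspace (space_at S n i))"
      using compact_imp_bounded by auto
    then show ?thesis unfolding bounded_pos by (auto intro: less_imp_le)
  qed
  note ex = this
  define M where "M i a b = (SOME M. 0 \<le> M \<and> (\<forall>t\<in>topspace (space_at S n i). cmod (f (i, t) $$ (a, b)) \<le> M))" for i a b
  have M: "0 \<le> M i a b \<and> (\<forall>t\<in>topspace (space_at S n i). cmod (f (i, t) $$ (a, b)) \<le> M i a b)"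
    if "i < nsum S n" "a < msize S n i" "b < msize S n i" for i a b
    unfolding M_def using someI_ex[OF ex[OF that]] .
  define B where "B = (\<Sum>i<nsum S n. \<Sum>a<msize S n i. \<Sum>b<msize S n i. M i a b)"
  have "cmod (f (i, t) $$ (a, b)) \<le> B"
    if "i < nsum S n" "t \<in> topspace (space_at S n i)" "a < msize S n i" "b < msize S n i" for i t a b
  proof -
    have "cmod (f (i, t) $$ (a, b)) \<le> M i a b" using M that by blast
    also have "\<dots> \<le> (\<Sum>b<msize S n i. M i a b)"
      using M that by (intro member_le_sum) auto
    also have "\<dots> \<le> (\<Sum>a<msize S n i. \<Sum>b<msize S n i. M i a b)"
      using M that by (intro member_le_sum[of a]) (auto intro!: sum_nonneg)
    also have "\<dots> \<le> B"
      unfolding B_def using M that by (intro member_le_sum[of i]) (auto intro!: sum_nonneg)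
    finally show ?thesis .
  qed
  then show ?thesis using that by blast
qed

lemma kern_rep:
  assumes n: "1 \<le> n" and f: "f \<in> carrier (alg S n)"
  shows "kern (rep n f)"
proof -
  obtain M where M: "\<And>i t a b. i < nsum S n \<Longrightarrow> t \<in> topspace (space_at S n i) \<Longrightarrow> a < msize S n i \<Longrightarrow> b < msize S n i \<Longrightarrow>
    cmod (f (i, t) $$ (a, b)) \<le> M" using entries_bounded[OF n f] by blast
  have "cmod (rep n f \<gamma>) \<le> \<bar>M\<bar>" for \<gamma>
  proof (cases "\<gamma> \<in> R n")
    case True
    obtain x y where xy: "\<gamma> = (x, y)" by force
    have "cmod (rep n f \<gamma>) \<le> M"
    proof -
      have r: "(x, y) \<in> R n" using True xy by simp
      note p = tail_relD(1)[OF r] tail_relD(2)[OF r]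
      have "idx n y < msize S n (src x n)" using idx_less[OF p(2) n] tail_rel_src(1)[OF r] by simp
      then show ?thesis
        unfolding xy rep_in[OF r] by (intro M src_less path_mem_space idx_less p n)
    qed
    then show ?thesis by simp
  qed (cases \<gamma>; simp add: rep_out)
  then show ?thesis using supp_rep by (intro kernI)
qed

text \<open>By \<open>bij_idx\<close> the form of the kernel on the class of \<open>u\<close> is the
  form of the matrix at the point of \<open>u\<close> in level \<open>n\<close>. One inequality
  needs that every point lies on a path (\<open>ex_path\<close>), the other that classes alone have
  to be tested (\<open>bnd_cls\<close>).\<close>

lemma rep_norm:
  assumes n: "1 \<le> n" and f: "f \<in> carrier (alg S n)"
  shows "cnorm (alg S n) f = N (rep n f)"
proof -
  have k: "kern (rep n f)" by (rule kern_rep[OF n f])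
  have eq: "(\<Sum>x\<in>cls n u. \<Sum>y\<in>cls n u. cnj (w (idx n x)) * rep n f (x, y) * v (idx n y)) =
      (\<Sum>a<msize S n (src u n). \<Sum>b<msize S n (src u n). cnj (w a) * f (src u n, snd (u n)) $$ (a, b) * v b)"
    and nrm: "L2_set (\<lambda>x. cmod (v (idx n x))) (cls n u) = L2_set (\<lambda>a. cmod (v a)) {..<msize S n (src u n)}"
    if u: "u \<in> P" for u and v w :: "nat \<Rightarrow> complex"
  proof -
    note bij = sum.reindex_bij_betw[OF bij_idx[OF u n]]
    have "rep n f (x, y) = f (src u n, snd (u n)) $$ (idx n x, idx n y)" if "x \<in> cls n u" "y \<in> cls n u" for x y
    proof -
      have u: "(x, u) \<in> R n" "(y, u) \<in> R n" using that by (auto simp: cls_def)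
      then have "(x, y) \<in> R n" using tail_rel_trans tail_rel_sym by blast
      with u show ?thesis using tail_rel_src[of x u n] by (simp add: rep_in)
    qed
    then have "(\<Sum>x\<in>cls n u. \<Sum>y\<in>cls n u. cnj (w (idx n x)) * rep n f (x, y) * v (idx n y)) =
       (\<Sum>x\<in>cls n u. \<Sum>y\<in>cls n u. cnj (w (idx n x)) * f (src u n, snd (u n)) $$ (idx n x, idx n y) * v (idx n y))"
      by (intro sum.cong refl) simp
    also have "\<dots> = (\<Sum>x\<in>cls n u. \<Sum>b<msize S n (src u n). cnj (w (idx n x)) * f (src u n, snd (u n)) $$ (idx n x, b) * v b)"
      by (intro sum.cong refl bij)
    also have "\<dots> = (\<Sum>a<msize S n (src u n). \<Sum>b<msize S n (src u n). cnj (w a) * f (src u n, snd (u n)) $$ (a, b) * v b)"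
      by (rule bij)
    finally show "(\<Sum>x\<in>cls n u. \<Sum>y\<in>cls n u. cnj (w (idx n x)) * rep n f (x, y) * v (idx n y)) = \<dots>" .
    show "L2_set (\<lambda>x. cmod (v (idx n x))) (cls n u) = L2_set (\<lambda>a. cmod (v a)) {..<msize S n (src u n)}"
      unfolding L2_set_def by (rule arg_cong[of _ _ sqrt], rule bij)
  qed
  let ?m = "\<lambda>(i, t). matnorm (msize S n i) (f (i, t))"
  have upper: "?m p \<le> N (rep n f)" if pp: "p \<in> points S n" for p
  proof -
    obtain i t where p: "p = (i, t)" "i < nsum S n" "t \<in> topspace (space_at S n i)"
      using pp by (auto simp: points_def)
    obtain u where u: "u \<in> P" "src u n = i" "snd (u n) = t" using ex_path[OF n p(2,3) msize_pos[OF n p(2)]] by blast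
    have "cls n u \<subseteq> tcls u" using cls_arrows by (auto simp: tcls_def)
    then have b: "cmod (\<Sum>x\<in>cls n u. \<Sum>y\<in>cls n u. cnj (w x) * rep n f (x, y) * v y) \<le>
       N (rep n f) * L2_set (\<lambda>x. cmod (w x)) (cls n u) * L2_set (\<lambda>x. cmod (v x)) (cls n u)" for v w
      using bnd_reduced_norm[OF k] u(1) finite_cls unfolding bnd_def by blast
    have "matnorm (msize S n i) (f (i, t)) \<le> N (rep n f)"
    proof (rule matnorm_le[OF reduced_norm_nonneg[OF k]])
      fix v w
      show "cmod (\<Sum>a<msize S n i. \<Sum>b<msize S n i. cnj (w a) * f (i, t) $$ (a, b) * v b)
           \<le> N (rep n f) * L2_set (\<lambda>a. cmod (w a)) {..<msize S n i} * L2_set (\<lambda>a. cmod (v a)) {..<msize S n i}"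
        using b[of "\<lambda>x. w (idx n x)" "\<lambda>x. v (idx n x)"] unfolding eq[OF u(1)] nrm[OF u(1)] u(2,3) .
    qed
    then show ?thesis by (simp add: p)
  qed
  have bdd: "bdd_above (?m ` points S n)" using upper by (auto intro!: bdd_aboveI[of _ "N (rep n f)"])
  have ne: "points S n \<noteq> {}" using paths_nonempty path_points[OF _ n] by blast
  have cn: "cnorm (alg S n) f = (SUP p\<in>points S n. ?m p)" by (simp add: alg_def)
  have le: "cnorm (alg S n) f \<le> N (rep n f)"
    unfolding cn by (rule cSUP_least[OF ne upper])
  have form: "cmod (\<Sum>a<msize S n (src u n). \<Sum>b<msize S n (src u n). cnj (w a) * f (src u n, snd (u n)) $$ (a, b) * v b) \<le>
      cnorm (alg S n) f * L2_set (\<lambda>a. cmod (w a)) {..<msize S n (src u n)} * L2_set (\<lambda>a. cmod (v a)) {..<msize S n (src u n)}"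
    if u: "u \<in> P" for u v w
  proof -
    have "matnorm (msize S n (src u n)) (f (src u n, snd (u n))) \<le> cnorm (alg S n) f"
      unfolding cn using cSUP_upper[OF path_points[OF u n] bdd] by simp
    then show ?thesis
      by (intro order_trans[OF form_le_matnorm] mult_right_mono) auto
  qed
  \<comment> \<open>\<open>bnd_cls\<close> asks for a nonnegative constant; the form at the first
    basis vector supplies the sign.\<close>
  have c0: "0 \<le> cnorm (alg S n) f"
  proof -
    obtain u where u: "u \<in> P" using paths_nonempty by blast
    let ?d = "\<lambda>a. if a = 0 then 1 else 0 :: complex"
    have "L2_set (\<lambda>a. cmod (?d a)) {..<msize S n (src u n)} = 1"
    proof -
      have "0 < msize S n (src u n)" using msize_pos[OF n src_less[OF u n]] .
      then have "(\<Sum>a<msize S n (src u n). (cmod (?d a))\<^sup>2) = (\<Sum>a\<in>{0::nat}. 1)"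
        by (intro sum.mono_neutral_cong_right) auto
      then show ?thesis by (simp add: L2_set_def)
    qed
    then have "cmod (\<Sum>a<msize S n (src u n). \<Sum>b<msize S n (src u n).
        cnj (?d a) * f (src u n, snd (u n)) $$ (a, b) * ?d b) \<le> cnorm (alg S n) f"
      using form[OF u, of ?d ?d] by (simp only: mult_1_right)
    then show ?thesis by (rule order_trans[OF norm_ge_zero])
  qed
  have "bnd (cnorm (alg S n) f) (rep n f)"
  proof (rule bnd_cls[OF supp_rep c0])
    fix u and v w :: "_ \<Rightarrow> complex" assume u: "u \<in> P"
    \<comment> \<open>The inverse of \<open>idx n\<close> on the class transports vectors on the
      class to vectors of matrix indices.\<close>
    define j where "j = the_inv_into (cls n u) (idx n)"
    have j: "j (idx n x) = x" if "x \<in> cls n u" for x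
      unfolding j_def using bij_idx[OF u n] that by (intro the_inv_into_f_f) (auto simp: bij_betw_def)
    have "(\<Sum>x\<in>cls n u. \<Sum>y\<in>cls n u. cnj (w x) * rep n f (x, y) * v y) =
      (\<Sum>x\<in>cls n u. \<Sum>y\<in>cls n u. cnj ((w \<circ> j) (idx n x)) * rep n f (x, y) * (v \<circ> j) (idx n y))"
      by (intro sum.cong refl) (simp only: o_def j)
    moreover have "L2_set (\<lambda>x. cmod (h x)) (cls n u) = L2_set (\<lambda>x. cmod ((h \<circ> j) (idx n x))) (cls n u)" for h
      by (intro L2_set_cong refl) (simp only: o_def j)
    ultimately show "cmod (\<Sum>x\<in>cls n u. \<Sum>y\<in>cls n u. cnj (w x) * rep n f (x, y) * v y) \<le>
      cnorm (alg S n) f * L2_set (\<lambda>x. cmod (w x)) (cls n u) * L2_set (\<lambda>x. cmod (v x)) (cls n u)"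
      using form[OF u, of "w \<circ> j" "v \<circ> j"] eq[OF u, of "w \<circ> j" "v \<circ> j"] nrm[OF u, of "w \<circ> j"] nrm[OF u, of "v \<circ> j"]
      by (simp only:)
  qed
  then have "N (rep n f) \<le> cnorm (alg S n) f" using reduced_norm_le[OF c0 _ k] by blast
  with le show ?thesis by simp
qed

end

section \<open>Algebraic operations and connecting maps in terms of kernels\<close>

lemma continuous_map_complex_mult:
  fixes f g :: "'x \<Rightarrow> complex"
  shows "continuous_map X euclidean f \<Longrightarrow> continuous_map X euclidean g \<Longrightarrow> continuous_map X euclidean (\<lambda>x. f x * g x)"
  by (simp add: continuous_map_atin tendsto_mult)

lemma continuous_map_cnj:
  "continuous_map X euclidean f \<Longrightarrow> continuous_map X euclidean (\<lambda>x. cnj (f x))"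
  by (simp add: continuous_map_atin tendsto_cnj)

lemma mult_mat_index:
  assumes "A \<in> carrier_mat k k" "B \<in> carrier_mat k k" "a < k" "b < k"
  shows "(A * B) $$ (a, b) = (\<Sum>c<k. A $$ (a, c) * B $$ (c, b))"
  using assms by (auto simp: scalar_prod_def atLeast0LessThan intro!: sum.cong)

context AH
begin

text \<open>A normal form for elements of a level. Once an operation is written as \<open>mk\<close>
  of an entry formula, membership in the carrier follows from continuity of the entries, and its
  kernel is given by \<open>rep_mk\<close>.\<close>

definition mk :: "nat \<Rightarrow> (nat \<Rightarrow> 'a \<Rightarrow> nat \<Rightarrow> nat \<Rightarrow> complex) \<Rightarrow> 'a matfun" where
  "mk n h = (\<lambda>(i, t)\<in>points S n. Matrix.mat (msize S n i) (msize S n i) (\<lambda>(a, b). h i t a b))"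

lemma mk_index:
  "i < nsum S n \<Longrightarrow> t \<in> topspace (space_at S n i) \<Longrightarrow> a < msize S n i \<Longrightarrow> b < msize S n i \<Longrightarrow>
    mk n h (i, t) $$ (a, b) = h i t a b"
  by (simp add: mk_def points_def)

lemma mk_carrier:
  assumes "\<And>i a b. i < nsum S n \<Longrightarrow> a < msize S n i \<Longrightarrow> b < msize S n i \<Longrightarrow>
    continuous_map (space_at S n i) euclidean (\<lambda>t. h i t a b)"
  shows "mk n h \<in> carrier (alg S n)"
  unfolding alg_carrier_iff
proof (intro conjI allI impI ballI)
  fix i a b assume *: "i < nsum S n" "a < msize S n i" "b < msize S n i"
  show "continuous_map (space_at S n i) euclidean (\<lambda>t. mk n h (i, t) $$ (a, b))"
    by (rule continuous_map_eq[OF assms[OF *]]) (use * in \<open>simp add: mk_index\<close>)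
qed (auto simp: mk_def points_def)

lemma alg_cont: "f \<in> carrier (alg S n) \<Longrightarrow> i < nsum S n \<Longrightarrow> a < msize S n i \<Longrightarrow> b < msize S n i \<Longrightarrow>
    continuous_map (space_at S n i) euclidean (\<lambda>t. f (i, t) $$ (a, b))"
  and alg_mat: "f \<in> carrier (alg S n) \<Longrightarrow> i < nsum S n \<Longrightarrow> t \<in> topspace (space_at S n i) \<Longrightarrow>
    f (i, t) \<in> carrier_mat (msize S n i) (msize S n i)"
  by (simp_all add: alg_carrier_iff)

lemma alg_dims:
  assumes "f \<in> carrier (alg S n)" "i < nsum S n" "t \<in> topspace (space_at S n i)"
  shows "dim_row (f (i, t)) = msize S n i" "dim_col (f (i, t)) = msize S n i"
  using carrier_matD[OF alg_mat[OF assms]] by blast+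

lemma alg_eq_mk:
  assumes "f \<in> extensional (points S n)"
    "\<And>i t. i < nsum S n \<Longrightarrow> t \<in> topspace (space_at S n i) \<Longrightarrow> f (i, t) \<in> carrier_mat (msize S n i) (msize S n i)"
    "\<And>i t a b. i < nsum S n \<Longrightarrow> t \<in> topspace (space_at S n i) \<Longrightarrow> a < msize S n i \<Longrightarrow> b < msize S n i \<Longrightarrow>
      f (i, t) $$ (a, b) = h i t a b"
  shows "f = mk n h"
proof (rule extensionalityI)
  show "mk n h \<in> extensional (points S n)" by (simp add: mk_def)
  fix p assume "p \<in> points S n"
  then obtain i t where p: "p = (i, t)" "i < nsum S n" "t \<in> topspace (space_at S n i)"
    by (auto simp: points_def)
  have "f (i, t) = mk n h (i, t)"
    using assms(2)[OF p(2,3)] assms(3)[OF p(2,3)] p(2,3) by (intro eq_matI) (auto simp: mk_def points_def)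
  then show "f p = mk n h p" by (simp add: p)
qed (rule assms)

lemma add_eq_mk:
  assumes "f \<in> carrier (alg S n)" "g \<in> carrier (alg S n)"
  shows "f \<oplus>\<^bsub>alg S n\<^esub> g = mk n (\<lambda>i t a b. f (i, t) $$ (a, b) + g (i, t) $$ (a, b))"
  by (rule alg_eq_mk; (rule carrier_matI)?) (simp_all add: alg_def points_def alg_dims[OF assms(1)] alg_dims[OF assms(2)])

lemma smult_eq_mk:
  assumes "f \<in> carrier (alg S n)"
  shows "z \<odot>\<^bsub>alg S n\<^esub> f = mk n (\<lambda>i t a b. z * f (i, t) $$ (a, b))"
  by (rule alg_eq_mk; (rule carrier_matI)?) (simp_all add: alg_def points_def alg_dims[OF assms])

lemma star_eq_mk:
  assumes "f \<in> carrier (alg S n)"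
  shows "star (alg S n) f = mk n (\<lambda>i t a b. cnj (f (i, t) $$ (b, a)))"
  by (rule alg_eq_mk; (rule carrier_matI)?) (simp_all add: alg_def points_def alg_dims[OF assms])

lemma mult_eq_mk:
  assumes "f \<in> carrier (alg S n)" "g \<in> carrier (alg S n)"
  shows "f \<otimes>\<^bsub>alg S n\<^esub> g = mk n (\<lambda>i t a b. \<Sum>c<msize S n i. f (i, t) $$ (a, c) * g (i, t) $$ (c, b))"
proof (rule alg_eq_mk)
  fix i t a b assume *: "i < nsum S n" "t \<in> topspace (space_at S n i)" "a < msize S n i" "b < msize S n i"
  have "(f \<otimes>\<^bsub>alg S n\<^esub> g) (i, t) = f (i, t) * g (i, t)" using * by (simp add: alg_def points_def)
  then show "(f \<otimes>\<^bsub>alg S n\<^esub> g) (i, t) $$ (a, b) = (\<Sum>c<msize S n i. f (i, t) $$ (a, c) * g (i, t) $$ (c, b))"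
    using mult_mat_index[OF alg_mat[OF assms(1) *(1,2)] alg_mat[OF assms(2) *(1,2)] *(3,4)] by simp
next
  fix i t assume *: "i < nsum S n" "t \<in> topspace (space_at S n i)"
  have "(f \<otimes>\<^bsub>alg S n\<^esub> g) (i, t) = f (i, t) * g (i, t)" using * by (simp add: alg_def points_def)
  then show "(f \<otimes>\<^bsub>alg S n\<^esub> g) (i, t) \<in> carrier_mat (msize S n i) (msize S n i)"
    using mult_carrier_mat[OF alg_mat[OF assms(1) *] alg_mat[OF assms(2) *]] by simp
qed (simp add: alg_def)

lemma one_eq_mk: "\<one>\<^bsub>alg S n\<^esub> = mk n (\<lambda>i t a b. if a = b then 1 else 0)"
  by (rule alg_eq_mk) (simp_all add: alg_def points_def)

lemma zero_eq_mk: "\<zero>\<^bsub>alg S n\<^esub> = mk n (\<lambda>i t a b. 0)"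
  by (rule alg_eq_mk) (simp_all add: alg_def points_def)

text \<open>The Hadamard product of matrices. Its kernel is the pointwise product of the kernels
  (\<open>rep_had\<close>), which is what makes the kernels an algebra of functions.\<close>

definition had :: "nat \<Rightarrow> 'a matfun \<Rightarrow> 'a matfun \<Rightarrow> 'a matfun" where
  "had n f g = mk n (\<lambda>i t a b. f (i, t) $$ (a, b) * g (i, t) $$ (a, b))"

lemma add_carrier: "f \<in> carrier (alg S n) \<Longrightarrow> g \<in> carrier (alg S n) \<Longrightarrow> f \<oplus>\<^bsub>alg S n\<^esub> g \<in> carrier (alg S n)"
  unfolding add_eq_mk by (intro mk_carrier continuous_map_add alg_cont)

lemma smult_carrier: "f \<in> carrier (alg S n) \<Longrightarrow> z \<odot>\<^bsub>alg S n\<^esub> f \<in> carrier (alg S n)"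
  unfolding smult_eq_mk by (intro mk_carrier continuous_map_complex_mult alg_cont) auto

lemma star_carrier: "f \<in> carrier (alg S n) \<Longrightarrow> star (alg S n) f \<in> carrier (alg S n)"
  unfolding star_eq_mk by (intro mk_carrier continuous_map_cnj alg_cont)

lemma mult_carrier: "f \<in> carrier (alg S n) \<Longrightarrow> g \<in> carrier (alg S n) \<Longrightarrow> f \<otimes>\<^bsub>alg S n\<^esub> g \<in> carrier (alg S n)"
  unfolding mult_eq_mk by (intro mk_carrier continuous_map_sum continuous_map_complex_mult alg_cont) auto

lemma had_carrier: "f \<in> carrier (alg S n) \<Longrightarrow> g \<in> carrier (alg S n) \<Longrightarrow> had n f g \<in> carrier (alg S n)"
  unfolding had_def by (intro mk_carrier continuous_map_complex_mult alg_cont)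

lemma one_carrier: "\<one>\<^bsub>alg S n\<^esub> \<in> carrier (alg S n)"
  unfolding one_eq_mk by (intro mk_carrier) auto

lemma rep_mk:
  assumes n: "1 \<le> n" and xy: "(x, y) \<in> R n"
  shows "rep n (mk n h) (x, y) = h (src x n) (snd (x n)) (idx n x) (idx n y)"
proof -
  note p = tail_relD(1)[OF xy] tail_relD(2)[OF xy]
  have "idx n y < msize S n (src x n)" using idx_less[OF p(2) n] tail_rel_src(1)[OF xy] by simp
  then show ?thesis unfolding rep_in[OF xy] by (intro mk_index src_less path_mem_space idx_less p n)
qed

lemma kernel_eqI:
  assumes "supp n F" "supp n K" "\<And>x y. (x, y) \<in> R n \<Longrightarrow> F (x, y) = K (x, y)"
  shows "F = K"
proof
  fix \<gamma> :: "(nat \<Rightarrow> 'e edge \<times> 'a) \<times> (nat \<Rightarrow> 'e edge \<times> 'a)"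
  obtain x y where "\<gamma> = (x, y)" by force
  then show "F \<gamma> = K \<gamma>" using assms suppD[of n F x y] suppD[of n K x y] by (cases "(x, y) \<in> R n") simp_all
qed

lemma rep_add:
  assumes "1 \<le> n" "f \<in> carrier (alg S n)" "g \<in> carrier (alg S n)"
  shows "rep n (f \<oplus>\<^bsub>alg S n\<^esub> g) = (\<lambda>\<gamma>. rep n f \<gamma> + rep n g \<gamma>)"
proof (rule kernel_eqI[OF supp_rep])
  show "supp n (\<lambda>\<gamma>. rep n f \<gamma> + rep n g \<gamma>)" using supp_rep[of n f] supp_rep[of n g] by (simp add: supp_def)
  fix x y assume xy: "(x, y) \<in> R n"
  show "rep n (f \<oplus>\<^bsub>alg S n\<^esub> g) (x, y) = rep n f (x, y) + rep n g (x, y)"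
    unfolding add_eq_mk[OF assms(2,3)] rep_mk[OF assms(1) xy] by (simp add: rep_in[OF xy])
qed

lemma rep_smult:
  assumes "1 \<le> n" "f \<in> carrier (alg S n)"
  shows "rep n (z \<odot>\<^bsub>alg S n\<^esub> f) = (\<lambda>\<gamma>. z * rep n f \<gamma>)"
proof (rule kernel_eqI[OF supp_rep])
  show "supp n (\<lambda>\<gamma>. z * rep n f \<gamma>)" using supp_rep[of n f] by (simp add: supp_def)
  fix x y assume xy: "(x, y) \<in> R n"
  show "rep n (z \<odot>\<^bsub>alg S n\<^esub> f) (x, y) = z * rep n f (x, y)"
    unfolding smult_eq_mk[OF assms(2)] rep_mk[OF assms(1) xy] by (simp add: rep_in[OF xy])
qed

lemma rep_had:
  assumes "1 \<le> n"
  shows "rep n (had n f g) = (\<lambda>\<gamma>. rep n f \<gamma> * rep n g \<gamma>)"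
proof (rule kernel_eqI[OF supp_rep])
  show "supp n (\<lambda>\<gamma>. rep n f \<gamma> * rep n g \<gamma>)" using supp_rep[of n f] by (simp add: supp_def)
  fix x y assume xy: "(x, y) \<in> R n"
  show "rep n (had n f g) (x, y) = rep n f (x, y) * rep n g (x, y)"
    unfolding had_def rep_mk[OF assms xy] by (simp add: rep_in[OF xy])
qed

lemma rep_zero: "1 \<le> n \<Longrightarrow> rep n \<zero>\<^bsub>alg S n\<^esub> = (\<lambda>_. 0)"
  by (rule kernel_eqI[of n]) (simp_all add: supp_rep supp_def[of n "\<lambda>_. 0"] zero_eq_mk rep_mk)

text \<open>Within a class equal indices mean equal paths, so the identity matrix becomes the
  indicator of the diagonal.\<close>

lemma rep_one:
  assumes n: "1 \<le> n"
  shows "rep n \<one>\<^bsub>alg S n\<^esub> = \<one>\<^bsub>Q\<^esub>"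
proof (rule kernel_eqI[OF supp_rep])
  show "supp n \<one>\<^bsub>Q\<^esub>"
    unfolding supp_def Q_simps using supp_mono[of 0 "\<lambda>\<gamma>. if \<gamma> \<in> R 0 then 1 else 0" n] by (simp add: supp_def)
  fix x y assume xy: "(x, y) \<in> R n"
  have "idx n x = idx n y \<longleftrightarrow> (x, y) \<in> R 0"
    using idx_inj[OF n xy] tail_relD(1)[OF xy] by (auto simp: tail_rel_0)
  then show "rep n \<one>\<^bsub>alg S n\<^esub> (x, y) = \<one>\<^bsub>Q\<^esub> (x, y)"
    by (simp add: one_eq_mk rep_mk[OF n xy] Q_simps)
qed

lemma rep_star:
  assumes n: "1 \<le> n" and f: "f \<in> carrier (alg S n)"
  shows "rep n (star (alg S n) f) = star Q (rep n f)"
proof (rule kernel_eqI[OF supp_rep])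
  show "supp n (star Q (rep n f))"
    unfolding supp_def
  proof (intro allI impI)
    fix \<gamma> assume "\<gamma> \<notin> R n"
    then obtain x y where "\<gamma> = (x, y)" "(y, x) \<notin> R n" using tail_rel_sym by (cases \<gamma>) blast
    then show "star Q (rep n f) \<gamma> = 0" by (simp add: Q_simps rep_out)
  qed
  fix x y assume xy: "(x, y) \<in> R n"
  then have "(x, y) \<in> arrows G" by (auto simp: arrows_G)
  then show "rep n (star (alg S n) f) (x, y) = star Q (rep n f) (x, y)"
    using tail_rel_src[OF xy] by (simp add: star_eq_mk[OF f] rep_mk[OF n xy] Q_simps rep_in[OF tail_rel_sym[OF xy]])
qed

lemma rep_arrows: "\<forall>\<gamma>. \<gamma> \<notin> arrows G \<longrightarrow> rep n f \<gamma> = 0"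
  using supp_arrows[OF supp_rep] by blast

text \<open>By \<open>conv_eq\<close> the convolution at \<open>(x, z)\<close> is a sum over the
  class of \<open>x\<close>, and \<open>bij_idx\<close> rewrites it as the sum over the middle index
  of the matrix product.\<close>

lemma rep_mult:
  assumes n: "1 \<le> n" and f: "f \<in> carrier (alg S n)" and g: "g \<in> carrier (alg S n)"
  shows "rep n (f \<otimes>\<^bsub>alg S n\<^esub> g) = conv G (rep n f) (rep n g)"
proof (rule kernel_eqI[OF supp_rep supp_conv[OF supp_rep supp_rep]])
  fix x z assume xz: "(x, z) \<in> R n"
  have x: "x \<in> P" using tail_relD(1)[OF xz] .
  have "rep n f (x, y) * rep n g (y, z) =
      f (src x n, snd (x n)) $$ (idx n x, idx n y) * g (src x n, snd (x n)) $$ (idx n y, idx n z)"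
    if "y \<in> cls n x" for y
  proof -
    have yx: "(y, x) \<in> R n" using that by (simp add: cls_def)
    have "(y, z) \<in> R n" using tail_rel_trans[OF yx xz] .
    then show ?thesis using tail_rel_src[OF yx] by (simp add: rep_in tail_rel_sym[OF yx])
  qed
  then have "conv G (rep n f) (rep n g) (x, z) = (\<Sum>y\<in>cls n x.
      f (src x n, snd (x n)) $$ (idx n x, idx n y) * g (src x n, snd (x n)) $$ (idx n y, idx n z))"
    unfolding conv_eq[OF supp_rep rep_arrows] by (intro sum.cong refl)
  also have "\<dots> = (\<Sum>c<msize S n (src x n). f (src x n, snd (x n)) $$ (idx n x, c) * g (src x n, snd (x n)) $$ (c, idx n z))"
    by (rule sum.reindex_bij_betw[OF bij_idx[OF x n]])
  finally show "rep n (f \<otimes>\<^bsub>alg S n\<^esub> g) (x, z) = conv G (rep n f) (rep n g) (x, z)"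
    by (simp add: mult_eq_mk[OF f g] rep_mk[OF n xz])
qed

lemma cdist_alg:
  assumes "1 \<le> n" "f \<in> carrier (alg S n)" "g \<in> carrier (alg S n)"
  shows "cdist (alg S n) f g = kdist (rep n f) (rep n g)"
  using rep_norm[OF assms(1) add_carrier[OF assms(2) smult_carrier[OF assms(3), of "-1"]]]
    rep_add[OF assms(1,2) smult_carrier[OF assms(3), of "-1"]] rep_smult[OF assms(1,3), of "-1"]
  by (simp add: cdist_def kdist_def)

lemma block_mem:
  assumes "1 \<le> n" "j < nsum S (Suc n)" "f \<in> carrier (alg S n)" "t \<in> topspace (space_at S (Suc n) j)" "b \<in> set (blocks S n j)"
  shows "(\<lambda>(i, e). f (i, eig S n i j e t)) b \<in> carrier_mat ((\<lambda>(i, e). msize S n i) b) ((\<lambda>(i, e). msize S n i) b)"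
proof -
  obtain i e where b: "b = (i, e)" by force
  then have "i < nsum S n" "e \<in> edg S n i j" using assms(5) set_blocks[OF assms(1,2)] by auto
  then show ?thesis using alg_mat[OF assms(3) _ eig_mem[OF assms(1) _ assms(2) _ assms(4)]] b by simp
qed

lemma phi_index:
  assumes "1 \<le> n" "j < nsum S (Suc n)" "f \<in> carrier (alg S n)" "t \<in> topspace (space_at S (Suc n) j)"
    "(i, e) \<in> set (blocks S n j)" "(i', e') \<in> set (blocks S n j)" "a < msize S n i" "b < msize S n i'"
  shows "phi S n f (j, t) $$ (offs (\<lambda>(i, e). msize S n i) (blocks S n j) (i, e) + a,
      offs (\<lambda>(i, e). msize S n i) (blocks S n j) (i', e') + b) =
    (if (i, e) = (i', e') then f (i, eig S n i j e t) $$ (a, b) else 0)"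
proof -
  have "phi S n f (j, t) = diag_block_mat (map (\<lambda>(i, e). f (i, eig S n i j e t)) (blocks S n j))"
    using assms by (simp add: phi_def points_def)
  moreover have "a < (\<lambda>(i, e). msize S n i) (i, e)" "b < (\<lambda>(i, e). msize S n i) (i', e')" using assms(7,8) by auto
  ultimately show ?thesis
    using diag_block_mat_index[OF block_mem[OF assms(1-4)] assms(5,6)] by simp
qed

text \<open>The position of an entry determines its two blocks, independently of the point. The
  entry is therefore constantly 0, or an entry of \<open>f\<close> composed with one
  eigenfunction.\<close>

lemma phi_carrier:
  assumes n: "1 \<le> n" and f: "f \<in> carrier (alg S n)"
  shows "phi S n f \<in> carrier (alg S (Suc n))"
  unfolding alg_carrier_iff
proof (intro conjI allI impI ballI)
  show "phi S n f \<in> extensional (points S (Suc n))" by (simp add: phi_def)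
next
  fix j t assume *: "j < nsum S (Suc n)" "t \<in> topspace (space_at S (Suc n) j)"
  have "phi S n f (j, t) = diag_block_mat (map (\<lambda>(i, e). f (i, eig S n i j e t)) (blocks S n j))"
    using * by (simp add: phi_def points_def)
  then show "phi S n f (j, t) \<in> carrier_mat (msize S (Suc n) j) (msize S (Suc n) j)"
    unfolding msize_Suc[OF n *(1)] using diag_block_mat_dims[OF block_mem[OF n *(1) f *(2)]] by simp
next
  let ?w = "\<lambda>(i, e). msize S n i"
  fix j a b assume *: "j < nsum S (Suc n)" "a < msize S (Suc n) j" "b < msize S (Suc n) j"
  obtain p a' where p: "p \<in> set (blocks S n j)" "a' < ?w p" "a = offs ?w (blocks S n j) p + a'"
    using offs_decomp[OF distinct_blocks[OF n *(1)]] *(2) unfolding msize_Suc[OF n *(1)] by blast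
  obtain q b' where q: "q \<in> set (blocks S n j)" "b' < ?w q" "b = offs ?w (blocks S n j) q + b'"
    using offs_decomp[OF distinct_blocks[OF n *(1)]] *(3) unfolding msize_Suc[OF n *(1)] by blast
  obtain i e i' e' where pq: "p = (i, e)" "q = (i', e')" by force
  have ie: "i < nsum S n" "e \<in> edg S n i j" using p(1) pq set_blocks[OF n *(1)] by auto
  let ?g = "\<lambda>t. if (i, e) = (i', e') then f (i, eig S n i j e t) $$ (a', b') else 0"
  have "continuous_map (space_at S (Suc n) j) euclidean ?g"
  proof (cases "(i, e) = (i', e')")
    case True
    then have "continuous_map (space_at S (Suc n) j) euclidean ((\<lambda>t. f (i, t) $$ (a', b')) \<circ> eig S n i j e)"
      using p(2) q(2) pq by (intro continuous_map_compose[OF continuous_eig[OF n ie(1) *(1) ie(2)]] alg_cont[OF f ie(1)]) auto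
    then show ?thesis using True by (simp add: o_def)
  qed auto
  then show "continuous_map (space_at S (Suc n) j) euclidean (\<lambda>t. phi S n f (j, t) $$ (a, b))"
  proof (rule continuous_map_eq)
    fix t assume t: "t \<in> topspace (space_at S (Suc n) j)"
    show "?g t = phi S n f (j, t) $$ (a, b)"
      unfolding p(3) q(3) pq
      by (rule phi_index[OF n *(1) f t, symmetric]) (use p q pq in auto)
  qed
qed

text \<open>The indices of \<open>x\<close> and \<open>y\<close> at level \<open>n + 1\<close>
  decompose into the block of the edge at position \<open>n\<close> and the index at level
  \<open>n\<close>. If the blocks coincide, then so do the edges and the labels below, and the block
  evaluates \<open>f\<close> at the eigenfunction of the common label, which is the label at
  position \<open>n\<close>. Distinct blocks give 0, and then \<open>(x, y)\<close> is not in
  \<open>R n\<close>.\<close>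

lemma rep_phi:
  assumes n: "1 \<le> n" and f: "f \<in> carrier (alg S n)"
  shows "rep (Suc n) (phi S n f) = rep n f"
proof (rule kernel_eqI[OF supp_rep supp_mono[OF supp_rep]])
  let ?w = "\<lambda>(i, e). msize S n i"
  fix x y assume xy: "(x, y) \<in> R (Suc n)"
  let ?j = "src x (Suc n)" and ?t = "snd (x (Suc n))"
  note x = tail_relD(1)[OF xy] note y = tail_relD(2)[OF xy]
  have yS: "y (Suc n) = x (Suc n)" using tail_relD(3)[OF xy] by simp
  obtain e where e: "e \<in> edg S n (src x n) ?j" "x n = (Link (src x n) ?j e, eig S n (src x n) ?j e ?t)"
    using path_step[OF x n] by blast
  obtain e' where e': "e' \<in> edg S n (src y n) ?j" "y n = (Link (src y n) ?j e', eig S n (src y n) ?j e' ?t)"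
    using path_step[OF y n] yS by metis
  have j: "?j < nsum S (Suc n)" and t: "?t \<in> topspace (space_at S (Suc n) ?j)"
    using src_less[OF x] path_mem_space[OF x] by auto
  have b: "(src x n, e) \<in> set (blocks S n ?j)" "(src y n, e') \<in> set (blocks S n ?j)"
    using e(1) e'(1) src_less[OF x n] src_less[OF y n] by (auto simp: set_blocks[OF n j])
  have ix: "idx (Suc n) x = offs ?w (blocks S n ?j) (src x n, e) + idx n x"
    unfolding idx_Suc by (subst e(2)) (simp only: fst_conv edge_offset_Link)
  have iy: "idx (Suc n) y = offs ?w (blocks S n ?j) (src y n, e') + idx n y"
    unfolding idx_Suc by (subst e'(2)) (simp only: fst_conv edge_offset_Link)
  have "rep (Suc n) (phi S n f) (x, y) =
     (if (src x n, e) = (src y n, e') then f (src x n, eig S n (src x n) ?j e ?t) $$ (idx n x, idx n y) else 0)"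
    unfolding rep_in[OF xy] ix iy
    by (rule phi_index[OF n j f t b idx_less[OF x n] idx_less[OF y n]])
  also have "\<dots> = rep n f (x, y)"
  proof (cases "x n = y n")
    case True
    then have "(x, y) \<in> R n" using xy by (simp add: tail_rel_Suc[of _ _ n])
    moreover have "(src x n, e) = (src y n, e')" using True e(2) e'(2) by (metis edge.inject(2) prod.inject)
    moreover have "snd (x n) = eig S n (src x n) ?j e ?t" using e(2) by (metis snd_conv)
    ultimately show ?thesis by (simp add: rep_in)
  next
    case False
    then have nr: "(x, y) \<notin> R n" by (simp add: tail_rel_Suc[of _ _ n])
    have ne: "(src x n, e) \<noteq> (src y n, e')" using False e(2) e'(2) by (metis prod.inject)
    show ?thesis unfolding if_not_P[OF ne] rep_out[OF nr] ..
  qed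
  finally show "rep (Suc n) (phi S n f) (x, y) = rep n f (x, y)" .
qed simp

abbreviation tr where "tr \<equiv> transit (\<lambda>n. phi S (Suc n))"

text \<open>The system in \<open>AH_algebra\<close> is indexed from 0, so that index
  \<open>m\<close> stands for level \<open>m + 1\<close>; the shift by \<open>Suc\<close> runs
  through everything that follows.\<close>

lemma rep_transit:
  assumes "f \<in> carrier (alg S (Suc m))"
  shows "tr m d f \<in> carrier (alg S (Suc (m + d))) \<and> rep (Suc (m + d)) (tr m d f) = rep (Suc m) f"
proof (induction d)
  case (Suc d)
  then show ?case using phi_carrier[of "Suc (m + d)" "tr m d f"] rep_phi[of "Suc (m + d)" "tr m d f"] by simp
qed (use assms in simp)

text \<open>Distinct related paths have distinct indices by \<open>idx_inj\<close>, and every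
  off-diagonal matrix position is realised by a pair of distinct paths by \<open>ex_entry\<close>.
  In this form the diagonal subalgebra no longer depends on the level.\<close>

lemma C_level_iff:
  assumes n: "1 \<le> n"
  shows "f \<in> C_level S n \<longleftrightarrow> f \<in> carrier (alg S n) \<and> (\<forall>x y. x \<noteq> y \<longrightarrow> rep n f (x, y) = 0)"
proof (intro iffI conjI allI impI)
  assume f: "f \<in> C_level S n"
  then show fc: "f \<in> carrier (alg S n)" by (simp add: C_level_def)
  fix x y :: "nat \<Rightarrow> 'e edge \<times> 'a" assume ne: "x \<noteq> y"
  show "rep n f (x, y) = 0"
  proof (cases "(x, y) \<in> R n")
    case True
    note p = tail_relD(1)[OF True] tail_relD(2)[OF True]
    have "idx n x \<noteq> idx n y" using idx_inj[OF n True] ne by blast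
    moreover have "diagonal_mat (f (src x n, snd (x n)))"
      using f path_points[OF p(1) n] by (auto simp: C_level_def)
    moreover have "f (src x n, snd (x n)) \<in> carrier_mat (msize S n (src x n)) (msize S n (src x n))"
      using alg_mat[OF fc] src_less path_mem_space p n by blast
    moreover have "idx n x < msize S n (src x n)" "idx n y < msize S n (src x n)"
      using idx_less[OF p(1) n] idx_less[OF p(2) n] tail_rel_src(1)[OF True] by auto
    ultimately show ?thesis unfolding rep_in[OF True] by (auto simp: diagonal_mat_def)
  qed (rule rep_out)
next
  assume f: "f \<in> carrier (alg S n) \<and> (\<forall>x y. x \<noteq> y \<longrightarrow> rep n f (x, y) = 0)"
  have "diagonal_mat (f (i, t))" if it: "i < nsum S n" "t \<in> topspace (space_at S n i)" for i t
    unfolding diagonal_mat_def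
  proof (intro allI impI)
    fix a b assume "a < dim_row (f (i, t))" "b < dim_col (f (i, t))" and ne: "a \<noteq> b"
    then have "a < msize S n i" "b < msize S n i" using alg_dims[of f n i t] f it by auto
    note ab = this
    show "f (i, t) $$ (a, b) = 0"
    proof (rule ex_entry[OF n it ab])
      fix x y
      assume *: "\<And>f. f (i, t) $$ (a, b) = rep n f (x, y)" and "idx n x = a" "idx n y = b"
        and "(x, y) \<in> R n" "src x n = i" "snd (x n) = t"
      have "x \<noteq> y" using \<open>idx n x = a\<close> \<open>idx n y = b\<close> ne by auto
      then have "rep n f (x, y) = 0" using f by blast
      then show "f (i, t) $$ (a, b) = 0" by (simp only: *[of f])
    qed
  qed
  then show "f \<in> C_level S n" using f by (auto simp: C_level_def points_def)
qed

text \<open>An element whose kernel is the indicator of \<open>R m\<close>: for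
  \<open>m \<ge> 1\<close> the matrix with all entries 1 at level \<open>m\<close>, for
  \<open>m = 0\<close> the unit at level 1, in both cases moved up by \<open>d\<close>
  levels.\<close>

definition mask :: "nat \<Rightarrow> nat \<Rightarrow> 'a matfun" where
  "mask m d = (if m = 0 then tr 0 d \<one>\<^bsub>alg S 1\<^esub> else tr (m - 1) d (mk m (\<lambda>_ _ _ _. 1)))"

lemma mask:
  "mask m d \<in> carrier (alg S (Suc (m - 1 + d)))"
  "rep (Suc (m - 1 + d)) (mask m d) = (\<lambda>\<gamma>. if \<gamma> \<in> R m then 1 else 0)"
proof -
  have "mask m d \<in> carrier (alg S (Suc (m - 1 + d))) \<and>
    rep (Suc (m - 1 + d)) (mask m d) = (\<lambda>\<gamma>. if \<gamma> \<in> R m then 1 else 0)"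
  proof (cases "m = 0")
    case True
    then show ?thesis
      using rep_transit[of "\<one>\<^bsub>alg S 1\<^esub>" 0 d] one_carrier[of 1] rep_one[of 1]
      by (simp add: mask_def Q_simps)
  next
    case False
    let ?f = "mk m (\<lambda>_ _ _ _. 1)"
    have "?f \<in> carrier (alg S m)" by (intro mk_carrier) auto
    moreover have "rep m ?f = (\<lambda>\<gamma>. if \<gamma> \<in> R m then 1 else 0)"
      by (rule kernel_eqI[OF supp_rep]) (use False in \<open>simp_all add: supp_def rep_mk\<close>)
    ultimately show ?thesis using False rep_transit[of ?f "m - 1" d] by (simp add: mask_def)
  qed
  then show "mask m d \<in> carrier (alg S (Suc (m - 1 + d)))"
    "rep (Suc (m - 1 + d)) (mask m d) = (\<lambda>\<gamma>. if \<gamma> \<in> R m then 1 else 0)" by blast+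
qed

end


section \<open>Topology of the labelled path space\<close>

lemma compact_space_sum_topology:
  assumes "finite I" "\<And>i. i \<in> I \<Longrightarrow> compact_space (X i)"
  shows "compact_space (sum_topology X I)"
proof -
  have "compactin (sum_topology X I) (Pair i ` topspace (X i))" if "i \<in> I" for i
    by (rule image_compactin[where X="X i"])
      (use assms that continuous_map_component_injection[OF that] in \<open>auto simp: compact_space_def\<close>)
  then have "compactin (sum_topology X I) (\<Union>i\<in>I. Pair i ` topspace (X i))"
    using assms(1) by (intro compactin_Union) auto
  moreover have "(\<Union>i\<in>I. Pair i ` topspace (X i)) = topspace (sum_topology X I)" by auto
  ultimately show ?thesis by (simp only: compact_space_def)
qed

context AH
begin

abbreviation "T \<equiv> lab_path_space S"
abbreviation "TT \<equiv> prod_topology T T"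
abbreviation "TG \<equiv> gtop G"

lemma prefix_fin_path: "x \<in> P \<Longrightarrow> map (\<lambda>m. fst (x m)) [0..<Suc k] \<in> fin_paths S"
  using path_edges path_etgt by (auto simp: fin_paths_def nth_append simp del: upt_Suc)

text \<open>A basic cylinder fixes all edges up to position \<open>k\<close>. A condition on
  position \<open>k\<close> alone is the union of the cylinders over the possible initial
  segments.\<close>

lemma openin_coord:
  assumes U: "openin (vertex_space S k (esrc e)) U"
  shows "openin T {x \<in> P. fst (x k) = e \<and> snd (x k) \<in> U}"
proof (subst openin_subopen, intro ballI)
  fix x assume x: "x \<in> {x \<in> P. fst (x k) = e \<and> snd (x k) \<in> U}"
  let ?p = "map (\<lambda>m. fst (x m)) [0..<Suc k]"
  have p: "?p \<in> fin_paths S" "last ?p = e" "length ?p = Suc k"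
    using x prefix_fin_path by (auto simp: last_map)
  have "openin T (lab_Z S ?p U)"
    unfolding lab_path_space_def
    by (rule topology_generated_by_Basis, rule CollectI, rule exI[of _ ?p], rule exI[of _ U])
      (use p U in \<open>simp del: upt_Suc\<close>)
  moreover have "x \<in> lab_Z S ?p U" using x by (simp add: lab_Z_def del: upt_Suc)
  moreover have "lab_Z S ?p U \<subseteq> {x \<in> P. fst (x k) = e \<and> snd (x k) \<in> U}"
  proof
    fix z assume z: "z \<in> lab_Z S ?p U"
    have "fst (z k) = ?p ! k" using z p(3) by (auto simp: lab_Z_def simp del: upt_Suc)
    also have "\<dots> = e" using x by (simp del: upt_Suc)
    finally show "z \<in> {x \<in> P. fst (x k) = e \<and> snd (x k) \<in> U}"
      using z p(3) by (auto simp: lab_Z_def simp del: upt_Suc)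
  qed
  ultimately show "\<exists>Ta. openin T Ta \<and> x \<in> Ta \<and> Ta \<subseteq> {x \<in> P. fst (x k) = e \<and> snd (x k) \<in> U}" by blast
qed

lemma openin_edge: "openin T {x \<in> P. fst (x k) = e}"
proof -
  have "{x \<in> P. fst (x k) = e} = {x \<in> P. fst (x k) = e \<and> snd (x k) \<in> topspace (vertex_space S k (esrc e))}"
    using path_mem[of _ k] by auto
  then show ?thesis using openin_coord[OF openin_topspace] by simp
qed

lemma openin_edges: "openin T {x \<in> P. \<forall>k<n. fst (x k) = e k}"
proof (induction n)
  case 0
  then show ?case using openin_topspace[of T] by (simp add: topspace_lab_path_space)
next
  case (Suc n)
  have "{x \<in> P. \<forall>k<Suc n. fst (x k) = e k} = {x \<in> P. \<forall>k<n. fst (x k) = e k} \<inter> {x \<in> P. fst (x n) = e n}"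
    by (auto simp: less_Suc_eq)
  then show ?case using openin_Int[OF Suc openin_edge[of n "e n"]] by simp
qed

lemma vertex_space_path:
  assumes "x \<in> P"
  shows "compact_space (vertex_space S k (src x k)) \<and> Hausdorff_space (vertex_space S k (src x k))"
proof (cases "k = 0")
  case True
  then show ?thesis by (simp add: vertex_space_def compact_space_discrete_topology)
next
  case False
  then show ?thesis using compact_space_at Hausdorff_space_at src_less[OF assms, of k] by (simp add: vertex_space_def)
qed

text \<open>Both neighbourhoods restrict position \<open>k\<close> only, so that disagreement at
  \<open>k\<close> is seen to be an open condition on pairs of paths;
  \<open>closedin_tail_rel\<close> follows from this.\<close>

lemma separate_coord:
  assumes x: "x \<in> P" and y: "y \<in> P" and ne: "x k \<noteq> y k"
  obtains U V where "openin T U" "openin T V" "x \<in> U" "y \<in> V" "\<And>x' y'. x' \<in> U \<Longrightarrow> y' \<in> V \<Longrightarrow> x' k \<noteq> y' k"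
proof (cases "fst (x k) = fst (y k)")
  case False
  show ?thesis
    by (rule that[OF openin_edge[of k "fst (x k)"] openin_edge[of k "fst (y k)"]]) (use x y False in auto)
next
  case True
  let ?V = "vertex_space S k (src x k)"
  have "snd (x k) \<noteq> snd (y k)" using ne True by (simp add: prod_eq_iff)
  moreover have "snd (x k) \<in> topspace ?V" "snd (y k) \<in> topspace ?V" using path_mem x y True by metis+
  ultimately obtain A B where AB: "openin ?V A" "openin ?V B" "snd (x k) \<in> A" "snd (y k) \<in> B" "disjnt A B"
    using vertex_space_path[OF x, of k] unfolding Hausdorff_space_def by meson
  show ?thesis
    by (rule that[OF openin_coord[OF AB(1)] openin_coord[OF AB(2)]])
      (use x y True AB in \<open>auto simp: disjnt_def\<close>)
qed

lemma finite_edges: "finite (edges S n)"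
proof (cases "n = 0")
  case True
  have "edges S 0 \<subseteq> (\<lambda>(j, m). Root j m) ` (SIGMA j:{..<nsum S 1}. {..<msize S 1 j})" by (auto simp: edges_def)
  then show ?thesis unfolding True by (rule finite_subset) simp
next
  case False
  have "edges S n = (\<Union>i<nsum S n. \<Union>j<nsum S (Suc n). Link i j ` edg S n i j)" using False by (auto simp: edges_def)
  then show ?thesis using finite_edg False by simp
qed

lemma vertex_space_edge:
  assumes "e \<in> edges S n"
  shows "compact_space (vertex_space S n (esrc e)) \<and> Hausdorff_space (vertex_space S n (esrc e))"
  using assms compact_space_at Hausdorff_space_at
  by (auto simp: edges_def vertex_space_def compact_space_discrete_topology split: if_splits)

lemma continuous_label:
  assumes "e \<in> edges S n" "etgt e = esrc e'"
  shows "continuous_map (vertex_space S (Suc n) (esrc e')) (vertex_space S n (esrc e)) (label S n e)"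
  using assms continuous_eig by (auto simp: edges_def vertex_space_def split: if_splits)

text \<open>Tychonoff's theorem. At each position the pair of an edge and a label is a point of a
  finite disjoint sum of compact vertex spaces, and the labelled paths form a closed subset of the
  product of these sums.\<close>

lemma compact_lab_path_space: "compact_space T"
proof -
  define X where "X = (\<lambda>n. sum_topology (\<lambda>e. vertex_space S n (esrc e)) (edges S n))"
  define Pr where "Pr = product_topology X UNIV"
  have tX: "topspace (X n) = (SIGMA e:edges S n. topspace (vertex_space S n (esrc e)))" for n
    by (simp add: X_def comp_def)
  have tPr: "topspace Pr = {x. \<forall>n. fst (x n) \<in> edges S n \<and> snd (x n) \<in> topspace (vertex_space S n (esrc (fst (x n))))}"
  proof -
    have "p \<in> topspace (X n) \<longleftrightarrow> fst p \<in> edges S n \<and> snd p \<in> topspace (vertex_space S n (esrc (fst p)))" for p n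
      unfolding tX by (cases p) simp
    then show ?thesis unfolding Pr_def topspace_product_topology PiE_UNIV_domain Pi_def by simp
  qed
  have cPr: "compact_space Pr"
  proof -
    have "compact_space (X n)" for n
      unfolding X_def by (rule compact_space_sum_topology[OF finite_edges]) (use vertex_space_edge in blast)
    then show ?thesis unfolding Pr_def compact_space_product_topology by blast
  qed
  have proj: "openin Pr {x \<in> topspace Pr. x k \<in> W}" if "openin (X k) W" for k W
  proof -
    have "continuous_map Pr (X k) (\<lambda>x. x k)" unfolding Pr_def by (rule continuous_map_product_projection) simp
    then show ?thesis using that by (rule openin_continuous_map_preimage)
  qed
  have coord: "openin Pr {x \<in> topspace Pr. fst (x k) = e \<and> snd (x k) \<in> U}"
    if "e \<in> edges S k" "openin (vertex_space S k (esrc e)) U" for k e U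
  proof -
    have "openin (X k) ({e} \<times> U)"
      unfolding X_def openin_sum_topology
    proof (intro conjI ballI)
      show "{e} \<times> U \<subseteq> Sigma (edges S k) (topspace \<circ> (\<lambda>e. vertex_space S k (esrc e)))"
        using that openin_subset[OF that(2)] by auto
      show "openin (vertex_space S k (esrc i)) {x. (i, x) \<in> {e} \<times> U}" for i
        using that(2) by (cases "i = e") auto
    qed
    moreover have "{x \<in> topspace Pr. x k \<in> {e} \<times> U} = {x \<in> topspace Pr. fst (x k) = e \<and> snd (x k) \<in> U}"
      by (auto simp: mem_Times_iff)
    ultimately show ?thesis using proj[of k "{e} \<times> U"] by simp
  qed
  \<comment> \<open>A sequence in the product that is no path breaks a matching condition between
    two consecutive positions \<open>n\<close> and \<open>n + 1\<close>, and does so throughout a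
    neighbourhood: edges are locally constant, and unequal labels have disjoint
    neighbourhoods.\<close>
  have closed: "closedin Pr P"
    unfolding closedin_def
  proof
    show "P \<subseteq> topspace Pr" using path_edges path_mem by (auto simp: tPr)
    show "openin Pr (topspace Pr - P)"
    proof (subst openin_subopen, intro ballI)
      fix x assume x: "x \<in> topspace Pr - P"
      then have "x \<in> topspace Pr" "\<not> tail_path 0 x" by (auto simp: lab_paths_iff)
      then obtain n where n: "\<not> (etgt (fst (x n)) = src x (Suc n) \<and> label S n (fst (x n)) (snd (x (Suc n))) = snd (x n))"
        by (auto simp: tPr tail_path_def)
      let ?e = "fst (x n)" and ?e' = "fst (x (Suc n))" and ?V = "vertex_space S n (src x n)" and ?V' = "vertex_space S (Suc n) (src x (Suc n))"
      have e: "?e \<in> edges S n" "?e' \<in> edges S (Suc n)" "snd (x n) \<in> topspace ?V" "snd (x (Suc n)) \<in> topspace ?V'"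
        using DiffD1[OF x] unfolding tPr mem_Collect_eq by simp_all
      show "\<exists>W. openin Pr W \<and> x \<in> W \<and> W \<subseteq> topspace Pr - P"
      proof (cases "etgt ?e = src x (Suc n)")
        case False
        let ?W = "{y \<in> topspace Pr. fst (y n) = ?e \<and> snd (y n) \<in> topspace ?V} \<inter>
          {y \<in> topspace Pr. fst (y (Suc n)) = ?e' \<and> snd (y (Suc n)) \<in> topspace ?V'}"
        have "openin Pr ?W" by (intro openin_Int coord e openin_topspace)
        moreover have "?W \<inter> P = {}" using False path_etgt[of _ n] by fastforce
        moreover have "x \<in> ?W" using x e by auto
        ultimately show ?thesis by (intro exI[of _ ?W]) auto
      next
        case True
        note lab = continuous_label[OF e(1) True]
        have lne: "label S n ?e (snd (x (Suc n))) \<noteq> snd (x n)" using n True by blast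
        have "label S n ?e (snd (x (Suc n))) \<in> topspace ?V"
          using continuous_map_image_subset_topspace[OF lab] e(4) by blast
        then obtain A B where AB: "openin ?V A" "openin ?V B" "label S n ?e (snd (x (Suc n))) \<in> A" "snd (x n) \<in> B" "disjnt A B"
          using vertex_space_edge[OF e(1)] e(3) lne unfolding Hausdorff_space_def by meson
        let ?A = "{t \<in> topspace ?V'. label S n ?e t \<in> A}"
        have "openin ?V' ?A" by (rule openin_continuous_map_preimage[OF lab AB(1)])
        let ?W = "{y \<in> topspace Pr. fst (y n) = ?e \<and> snd (y n) \<in> B} \<inter>
          {y \<in> topspace Pr. fst (y (Suc n)) = ?e' \<and> snd (y (Suc n)) \<in> ?A}"
        have "openin Pr ?W" by (intro openin_Int coord e AB \<open>openin ?V' ?A\<close>)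
        moreover have "y \<notin> P" if "y \<in> ?W" for y
        proof
          assume "y \<in> P"
          then have "label S n ?e (snd (y (Suc n))) = snd (y n)" using path_label[of y n] that by auto
          then show False using that AB(5) by (auto simp: disjnt_def)
        qed
        moreover have "x \<in> ?W" using x e AB by auto
        ultimately show ?thesis by (intro exI[of _ ?W]) blast
      qed
    qed
  qed
  have PPr: "P \<subseteq> topspace Pr" using closed closedin_subset by blast
  \<comment> \<open>Compactness moves along continuous maps, so continuity of the identity in this
    direction transfers it from the product topology to \<open>T\<close>.\<close>
  have "continuous_map (subtopology Pr P) T (\<lambda>x. x)"
    unfolding lab_path_space_def
  proof (rule continuous_on_generated_topo)
    fix U assume "U \<in> {lab_Z S p U |p U. p \<in> fin_paths S \<and> openin (vertex_space S (length p - 1) (esrc (last p))) U}"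
    then obtain p V where U: "U = lab_Z S p V" and p: "p \<in> fin_paths S" and V: "openin (vertex_space S (length p - 1) (esrc (last p))) V"
      by blast
    have pe: "p ! k \<in> edges S k" if "k < length p" for k using p that by (simp add: fin_paths_def)
    have p0: "p \<noteq> []" using p by (simp add: fin_paths_def)
    let ?l = "length p - 1"
    let ?W = "(\<Inter>k<length p. {x \<in> topspace Pr. fst (x k) = p ! k \<and> snd (x k) \<in> topspace (vertex_space S k (esrc (p ! k)))})
      \<inter> {x \<in> topspace Pr. fst (x ?l) = p ! ?l \<and> snd (x ?l) \<in> V}"
    have l: "?l < length p" "last p = p ! ?l" using p0 by (auto simp: last_conv_nth)
    have "openin Pr ?W"
      by (intro openin_Int openin_INT2 coord pe openin_topspace l) (use p0 l V in auto)
    moreover have "(\<lambda>x. x) -` U \<inter> topspace (subtopology Pr P) = ?W \<inter> P"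
    proof (intro equalityI subsetI)
      fix x assume x: "x \<in> ?W \<inter> P"
      then have "\<forall>k<length p. fst (x k) = p ! k" "snd (x ?l) \<in> V" by auto
      then show "x \<in> (\<lambda>x. x) -` U \<inter> topspace (subtopology Pr P)" using x PPr U by (auto simp: lab_Z_def)
    next
      fix x assume x: "x \<in> (\<lambda>x. x) -` U \<inter> topspace (subtopology Pr P)"
      then have xP: "x \<in> P" "x \<in> topspace Pr" by auto
      have *: "fst (x k) = p ! k" if "k < length p" for k using x U that by (auto simp: lab_Z_def)
      have "snd (x ?l) \<in> V" using x U by (auto simp: lab_Z_def)
      moreover have "snd (x k) \<in> topspace (vertex_space S k (esrc (p ! k)))" if "k < length p" for k
        using path_mem[OF xP(1), of k] *[OF that] by simp
      ultimately show "x \<in> ?W \<inter> P" using xP * l(1) by auto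
    qed
    ultimately show "openin (subtopology Pr P) ((\<lambda>x. x) -` U \<inter> topspace (subtopology Pr P))"
      by (auto simp: openin_subtopology)
  next
    show "(\<lambda>x. x) ` topspace (subtopology Pr P) \<subseteq> \<Union> {lab_Z S p U |p U. p \<in> fin_paths S \<and> openin (vertex_space S (length p - 1) (esrc (last p))) U}"
      using topspace_lab_path_space unfolding lab_path_space_def topology_generated_by_topspace by auto
  qed
  moreover have "compactin (subtopology Pr P) P"
    using closedin_compact_space[OF cPr closed] by (simp add: compactin_subtopology)
  ultimately have "compactin T ((\<lambda>x. x) ` P)" using image_compactin by blast
  then show ?thesis by (simp add: compact_space_def topspace_lab_path_space)
qed

lemma topspace_TT: "topspace TT = P \<times> P"
  by (simp add: topspace_lab_path_space)

lemma closedin_tail_rel: "closedin TT (R n)"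
  unfolding closedin_def topspace_TT
proof
  show "R n \<subseteq> P \<times> P" by (auto simp: tail_rel_def)
  show "openin TT (P \<times> P - R n)"
  proof (subst openin_subopen, intro ballI)
    fix z assume z: "z \<in> P \<times> P - R n"
    then obtain x y k where xy: "z = (x, y)" "x \<in> P" "y \<in> P" "n \<le> k" "x k \<noteq> y k" by (auto simp: tail_rel_def)
    obtain U V where UV: "openin T U" "openin T V" "x \<in> U" "y \<in> V" "\<And>x' y'. x' \<in> U \<Longrightarrow> y' \<in> V \<Longrightarrow> x' k \<noteq> y' k"
      using separate_coord[OF xy(2,3,5)] by blast
    have "U \<subseteq> P" "V \<subseteq> P" using UV openin_subset topspace_lab_path_space by blast+
    then have "U \<times> V \<subseteq> P \<times> P - R n" using UV(5) xy(4) by (auto simp: tail_rel_def)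
    moreover have "openin TT (U \<times> V)" using UV by (simp add: openin_prod_Times_iff)
    ultimately show "\<exists>W. openin TT W \<and> z \<in> W \<and> W \<subseteq> P \<times> P - R n" using UV xy by blast
  qed
qed

lemma openin_edge_pair:
  "openin TT {(x, y) \<in> P \<times> P. \<forall>k<n. fst (x k) = e k \<and> fst (y k) = e' k}"
proof -
  have "{(x, y) \<in> P \<times> P. \<forall>k<n. fst (x k) = e k \<and> fst (y k) = e' k} =
    {x \<in> P. \<forall>k<n. fst (x k) = e k} \<times> {x \<in> P. \<forall>k<n. fst (x k) = e' k}" by auto
  then show ?thesis by (simp add: openin_prod_Times_iff openin_edges)
qed

text \<open>By determinism of labels, only the finitely many edges between levels \<open>m\<close> and \<open>n\<close> matter.\<close>

lemma tail_rel_relatively_open: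
  assumes "m \<le> n"
  obtains W where "openin TT W" "R m = W \<inter> R n"
proof
  let ?W = "{(x, y) \<in> P \<times> P. \<forall>k. m \<le> k \<longrightarrow> k < n \<longrightarrow> fst (x k) = fst (y k)}"
  show "openin TT ?W"
  proof (subst openin_subopen, intro ballI)
    fix z assume "z \<in> ?W"
    then obtain x y where xy: "z = (x, y)" "(x, y) \<in> ?W" by force
    let ?V = "{(x', y') \<in> P \<times> P. \<forall>k<n. fst (x' k) = fst (x k) \<and> fst (y' k) = fst (y k)}"
    have "openin TT ?V" by (rule openin_edge_pair)
    moreover have "z \<in> ?V" using xy by auto
    moreover have "?V \<subseteq> ?W" using xy by auto
    ultimately show "\<exists>V. openin TT V \<and> z \<in> V \<and> V \<subseteq> ?W" by blast
  qed
  show "R m = ?W \<inter> R n"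
  proof (intro equalityI subsetI)
    fix z assume "z \<in> ?W \<inter> R n"
    then show "z \<in> R m" using tail_rel_edges[of _ _ n m] assms by (cases z) auto
  next
    fix z assume "z \<in> R m"
    then show "z \<in> ?W \<inter> R n" using assms tail_rel_mono by (cases z) (auto simp: tail_rel_def)
  qed
qed

lemma GT_eq: "TG = topology_generated_by {W \<inter> R m | W m. openin TT W}"
  by (simp add: labelled_tail_groupoid_def)

lemma openin_TG_Int: "openin TT W \<Longrightarrow> openin TG (W \<inter> R m)"
  unfolding GT_eq by (rule topology_generated_by_Basis) blast

lemma openin_TG_tail_rel: "openin TG (R m)"
proof -
  have "topspace TT \<inter> R m = R m" unfolding topspace_TT by (auto simp: tail_rel_def)
  then show ?thesis using openin_TG_Int[OF openin_topspace, of m] by simp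
qed

text \<open>The inductive limit topology induces no more open sets on \<open>R n\<close> than the
  product topology does: for \<open>m \<le> n\<close> the set \<open>R m\<close> is relatively open
  in \<open>R n\<close>, and for \<open>m > n\<close> it contains \<open>R n\<close>. Compactness of
  \<open>R n\<close> thereby passes to \<open>TG\<close>.\<close>

lemma continuous_tail_rel_TG: "continuous_map (subtopology TT (R n)) TG (\<lambda>\<gamma>. \<gamma>)"
  unfolding GT_eq
proof (rule continuous_on_generated_topo)
  have ts: "topspace (subtopology TT (R n)) = R n" unfolding topspace_subtopology topspace_TT by (auto simp: tail_rel_def)
  fix U assume "U \<in> {W \<inter> R m | W m. openin TT W}"
  then obtain W m where U: "U = W \<inter> R m" "openin TT W" by blast
  have "\<exists>W'. openin TT W' \<and> U \<inter> R n = W' \<inter> R n"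
  proof (cases "m \<le> n")
    case True
    then obtain V where "openin TT V" "R m = V \<inter> R n" using tail_rel_relatively_open by blast
    then show ?thesis using U by (intro exI[of _ "W \<inter> V"]) auto
  next
    case False
    then have "R n \<subseteq> R m" using tail_rel_mono[of n m] by auto
    then show ?thesis using U by (intro exI[of _ W]) auto
  qed
  then show "openin (subtopology TT (R n)) ((\<lambda>\<gamma>. \<gamma>) -` U \<inter> topspace (subtopology TT (R n)))"
    unfolding ts by (auto simp: openin_subtopology)
next
  show "(\<lambda>\<gamma>. \<gamma>) ` topspace (subtopology TT (R n)) \<subseteq> \<Union> {W \<inter> R m | W m. openin TT W}"
    using openin_topspace[of TT] by auto
qed

lemma compactin_TT_tail_rel: "compactin TT (R n)"
proof -
  have "compact_space TT" using compact_lab_path_space by (simp add: compact_space_prod_topology)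
  then show ?thesis using closedin_compact_space closedin_tail_rel by blast
qed

lemma compactin_TG_tail_rel: "compactin TG (R n)"
proof -
  have "compactin (subtopology TT (R n)) (R n)" by (simp add: compactin_subtopology compactin_TT_tail_rel)
  from image_compactin[OF this continuous_tail_rel_TG] show ?thesis by simp
qed

lemma continuous_TG_TT: "continuous_map TG TT (\<lambda>\<gamma>. \<gamma>)"
  unfolding continuous_map_def
proof (intro conjI allI impI)
  show "(\<lambda>\<gamma>. \<gamma>) \<in> topspace TG \<rightarrow> topspace TT"
    unfolding topspace_TT arrows_G by (auto simp: tail_rel_def)
  fix W assume W: "openin TT W"
  have "{\<gamma> \<in> topspace TG. \<gamma> \<in> W} = (\<Union>m. W \<inter> R m)" unfolding arrows_G by auto
  moreover have "openin TG (\<Union>m. W \<inter> R m)"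
    by (rule openin_Union) (use openin_TG_Int[OF W] in blast)
  ultimately show "openin TG {\<gamma> \<in> topspace TG. \<gamma> \<in> W}" by simp
qed

lemma closedin_TG_tail_rel: "closedin TG (R n)"
proof -
  have "closedin TG {\<gamma> \<in> topspace TG. \<gamma> \<in> R n}"
    by (rule closedin_continuous_map_preimage[OF continuous_TG_TT closedin_tail_rel])
  moreover have "{\<gamma> \<in> topspace TG. \<gamma> \<in> R n} = R n" unfolding arrows_G by auto
  ultimately show ?thesis by simp
qed

text \<open>The sets \<open>R n\<close> are open, increasing and cover the arrows, so one of them
  contains the compact support.\<close>

lemma Cc_supp:
  assumes F: "F \<in> Cc G"
  obtains n where "supp n F"
proof -
  let ?K = "TG closure_of {\<gamma> \<in> arrows G. F \<gamma> \<noteq> 0}"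
  have "compactin TG ?K" using F by (simp add: Cc_def)
  moreover have "?K \<subseteq> \<Union> (range R)" using closure_of_subset_topspace[of TG] by (simp add: arrows_G)
  ultimately obtain \<F> where \<F>: "finite \<F>" "\<F> \<subseteq> range R" "?K \<subseteq> \<Union> \<F>"
    using openin_TG_tail_rel compactinD[of TG ?K "range R"] by auto
  obtain J where J: "finite J" "\<F> = R ` J" using finite_subset_image[OF \<F>(1,2)] by blast
  \<comment> \<open>Inserting 0 gives \<open>Max\<close> a value when \<open>J\<close> is
    empty.\<close>
  define n where "n = Max (insert 0 J)"
  have n: "m \<le> n" if "m \<in> J" for m using J(1) that by (simp add: n_def)
  have "F \<gamma> = 0" if "\<gamma> \<notin> R n" for \<gamma>
  proof (rule ccontr)
    assume nz: "F \<gamma> \<noteq> 0"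
    then have "\<gamma> \<in> arrows G" using F unfolding Cc_def by blast
    then have "\<gamma> \<in> ?K" using nz closure_of_subset[of "{\<gamma> \<in> arrows G. F \<gamma> \<noteq> 0}" TG] by auto
    then obtain m where "m \<in> J" "\<gamma> \<in> R m" using \<F>(3) J(2) by auto
    then show False using that tail_rel_mono[OF n] by (cases \<gamma>) auto
  qed
  then show ?thesis using that by (auto simp: supp_def)
qed

lemma Cc_continuous:
  assumes "F \<in> Cc G"
  shows "continuous_map (subtopology TT (R n)) euclidean F"
  using continuous_map_compose[OF continuous_tail_rel_TG, of euclidean F n] assms by (simp add: Cc_def o_def)

lemma kern_Cc:
  assumes F: "F \<in> Cc G"
  shows "kern F"
proof -
  obtain n where n: "supp n F" using Cc_supp[OF F] .
  have "compactin euclidean (F ` R n)"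
    by (rule image_compactin[OF compactin_TG_tail_rel]) (use F in \<open>simp add: Cc_def\<close>)
  then have "bounded (F ` R n)" using compact_imp_bounded by auto
  then obtain M where "0 < M" "\<And>\<gamma>. \<gamma> \<in> R n \<Longrightarrow> cmod (F \<gamma>) \<le> M" unfolding bounded_pos by auto
  moreover have "F \<gamma> = 0" if "\<gamma> \<notin> R n" for \<gamma> using n that unfolding supp_def by blast
  ultimately have "cmod (F \<gamma>) \<le> M" for \<gamma> by (cases "\<gamma> \<in> R n") simp_all
  then show ?thesis using n by (intro kernI)
qed

lemma supp_Cc:
  assumes s: "supp n F" and c: "continuous_map TG euclidean F"
  shows "F \<in> Cc G"
proof -
  have "{\<gamma> \<in> arrows G. F \<gamma> \<noteq> 0} \<subseteq> R n" using s by (auto simp: supp_def)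
  then have "TG closure_of {\<gamma> \<in> arrows G. F \<gamma> \<noteq> 0} \<subseteq> R n" by (rule closure_of_minimal[OF _ closedin_TG_tail_rel])
  then have "compactin TG (TG closure_of {\<gamma> \<in> arrows G. F \<gamma> \<noteq> 0})"
    by (rule closed_compactin[OF compactin_TG_tail_rel _ closedin_closure_of])
  then show ?thesis using c supp_arrows[OF s] by (simp add: Cc_def)
qed

text \<open>Outside the open and closed set \<open>R n\<close> the kernel vanishes. Near an arrow in
  \<open>R n\<close> the first \<open>n\<close> edges of both paths and the edge at position
  \<open>n\<close> are constant; this fixes the summand and both indices, and what remains is a
  continuous function of the label at position \<open>n\<close>.\<close>

lemma rep_Cc:
  assumes n: "1 \<le> n" and f: "f \<in> carrier (alg S n)"
  shows "rep n f \<in> Cc G"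
proof (rule supp_Cc[OF supp_rep])
  show "continuous_map TG euclidean (rep n f)"
    unfolding continuous_map_def
  proof (intro conjI allI impI)
    fix V :: "complex set" assume V: "openin euclidean V"
    show "openin TG {\<gamma> \<in> topspace TG. rep n f \<gamma> \<in> V}"
    proof (subst openin_subopen, intro ballI)
      fix \<gamma> assume g: "\<gamma> \<in> {\<gamma> \<in> topspace TG. rep n f \<gamma> \<in> V}"
      show "\<exists>W. openin TG W \<and> \<gamma> \<in> W \<and> W \<subseteq> {\<gamma> \<in> topspace TG. rep n f \<gamma> \<in> V}"
      proof (cases "\<gamma> \<in> R n")
        case False
        then have "rep n f \<gamma> = 0" by (cases \<gamma>) (simp add: rep_out)
        then have "topspace TG - R n \<subseteq> {\<gamma> \<in> topspace TG. rep n f \<gamma> \<in> V}"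
          using g by (auto simp: rep_out)
        moreover have "openin TG (topspace TG - R n)" using closedin_TG_tail_rel by (simp add: closedin_def)
        ultimately show ?thesis using g False by blast
      next
        case True
        obtain x y where xy: "\<gamma> = (x, y)" by force
        then have r: "(x, y) \<in> R n" using True by simp
        note x = tail_relD(1)[OF r] note y = tail_relD(2)[OF r]
        let ?i = "src x n" and ?a = "idx n x" and ?b = "idx n y"
        let ?A = "{t \<in> topspace (space_at S n ?i). f (?i, t) $$ (?a, ?b) \<in> V}"
        have b: "?b < msize S n ?i" using idx_less[OF y n] tail_rel_src(1)[OF r] by simp
        have "openin (space_at S n ?i) ?A"
          by (rule openin_continuous_map_preimage[OF alg_cont[OF f src_less[OF x n] idx_less[OF x n] b] V])
        then have A: "openin T {z \<in> P. fst (z n) = fst (x n) \<and> snd (z n) \<in> ?A}"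
          using n by (intro openin_coord) (simp add: vertex_space_def)
        let ?W1 = "{(x', y') \<in> P \<times> P. \<forall>k<n. fst (x' k) = fst (x k) \<and> fst (y' k) = fst (y k)}"
        let ?W2 = "{z \<in> P. fst (z n) = fst (x n) \<and> snd (z n) \<in> ?A} \<times> P"
        have "openin TT ?W2" using A openin_topspace[of T] by (simp add: openin_prod_Times_iff topspace_lab_path_space)
        then have o: "openin TG ((?W1 \<inter> ?W2) \<inter> R n)" by (intro openin_TG_Int openin_Int openin_edge_pair)
        have mem: "\<gamma> \<in> (?W1 \<inter> ?W2) \<inter> R n"
          using g r x y path_mem_space[OF x n] by (auto simp: xy rep_in[OF r])
        have "(?W1 \<inter> ?W2) \<inter> R n \<subseteq> {\<gamma> \<in> topspace TG. rep n f \<gamma> \<in> V}"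
        proof clarify
          fix x' y' assume *: "(x', y') \<in> R n" "\<forall>k<n. fst (x' k) = fst (x k) \<and> fst (y' k) = fst (y k)"
            "fst (x' n) = fst (x n)" "f (?i, snd (x' n)) $$ (?a, ?b) \<in> V"
          have "idx n x' = ?a" "idx n y' = ?b" using *(2) by (auto simp: idx_def)
          then have "rep n f (x', y') \<in> V" using * by (simp add: rep_in)
          moreover have "(x', y') \<in> topspace TG" using *(1) unfolding arrows_G by blast
          ultimately show "(x', y') \<in> topspace TG \<and> rep n f (x', y') \<in> V" by blast
        qed
        then show ?thesis using o mem by blast
      qed
    qed
  qed simp
qed

end


section \<open>Density of the levels\<close>

context AH
begin

text \<open>The beginning of \<open>x\<close> followed by the tail of \<open>x'\<close> is a path that agrees with \<open>x'\<close> by \<open>idx_inj\<close>.\<close>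

lemma prefix_unique:
  assumes n: "1 \<le> n" and x: "x \<in> P" "x' \<in> P" and eq: "src x n = src x' n" "snd (x n) = snd (x' n)" "idx n x = idx n x'"
    and k: "k < n"
  shows "x k = x' k"
proof -
  define u where "u j = (if j < n then x j else x' j)" for j
  have "tail_path 0 u"
    unfolding tail_path_def
  proof (intro allI impI)
    fix j
    have "src u (Suc j) = src x (Suc j) \<and> snd (u (Suc j)) = snd (x (Suc j)) \<and> u j = x j" if "j < n"
    proof (cases "Suc j = n")
      case True
      then show ?thesis using that eq(1,2) by (auto simp: u_def)
    qed (use that in \<open>auto simp: u_def\<close>)
    moreover have "u (Suc j) = x' (Suc j) \<and> u j = x' j" if "\<not> j < n" using that by (auto simp: u_def)
    ultimately show "fst (u j) \<in> edges S j \<and> etgt (fst (u j)) = src u (Suc j) \<and>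
       snd (u j) \<in> topspace (vertex_space S j (src u j)) \<and> label S j (fst (u j)) (snd (u (Suc j))) = snd (u j)"
      using x path_edges[of _ j] path_etgt[of _ j] path_mem[of _ j] path_label[of _ j]
      by (cases "j < n") auto
  qed
  then have uP: "u \<in> P" by (simp add: lab_paths_iff)
  have "(u, x') \<in> R n" by (rule tail_relI[OF uP x(2)]) (simp add: u_def)
  moreover have "idx n u = idx n x'" unfolding eq(3)[symmetric] by (simp add: idx_def u_def)
  ultimately have "u = x'" by (rule idx_inj[OF n])
  then have "u k = x' k" by simp
  then show ?thesis using k by (simp add: u_def)
qed

text \<open>The index \<open>Suc (m - 1 + d)\<close> ranges over the levels \<open>n \<ge> max m 1\<close>.\<close>

definition lev :: "nat \<Rightarrow> ((nat \<Rightarrow> 'e edge \<times> 'a) \<times> (nat \<Rightarrow> 'e edge \<times> 'a) \<Rightarrow> complex) set" where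
  "lev m = {F. \<exists>d. \<exists>f\<in>carrier (alg S (Suc (m - 1 + d))). F = rep (Suc (m - 1 + d)) f}"

lemma levI:
  assumes n: "m \<le> n" "1 \<le> n" and f: "f \<in> carrier (alg S n)"
  shows "rep n f \<in> lev m"
proof -
  have "Suc (m - 1 + (n - Suc (m - 1))) = n" using n by auto
  then show ?thesis unfolding lev_def using f by (intro CollectI exI[of _ "n - Suc (m - 1)"] bexI[of _ f]) auto
qed

text \<open>Kernels survive the connecting maps unchanged, so two kernels from different levels can
  be read at a common later one: each is moved up by the amount of the other.\<close>

lemma levE:
  assumes "F \<in> lev m" "K \<in> lev m"
  obtains d f g where "f \<in> carrier (alg S (Suc (m - 1 + d)))" "g \<in> carrier (alg S (Suc (m - 1 + d)))"
    "F = rep (Suc (m - 1 + d)) f" "K = rep (Suc (m - 1 + d)) g"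
proof -
  obtain d f where f: "f \<in> carrier (alg S (Suc (m - 1 + d)))" "F = rep (Suc (m - 1 + d)) f"
    using assms(1) by (auto simp: lev_def)
  obtain d' g where g: "g \<in> carrier (alg S (Suc (m - 1 + d')))" "K = rep (Suc (m - 1 + d')) g"
    using assms(2) by (auto simp: lev_def)
  have 1: "tr (m - 1 + d) d' f \<in> carrier (alg S (Suc (m - 1 + (d + d'))))" "F = rep (Suc (m - 1 + (d + d'))) (tr (m - 1 + d) d' f)"
    using rep_transit[OF f(1), of d'] f(2) by (auto simp: add.assoc)
  have 2: "tr (m - 1 + d') d g \<in> carrier (alg S (Suc (m - 1 + (d + d'))))" "K = rep (Suc (m - 1 + (d + d'))) (tr (m - 1 + d') d g)"
    using rep_transit[OF g(1), of d] g(2) by (auto simp: add_ac)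
  show ?thesis by (rule that[OF 1(1) 2(1) 1(2) 2(2)])
qed

lemma lev_add:
  assumes "F \<in> lev m" "K \<in> lev m"
  shows "(\<lambda>\<gamma>. F \<gamma> + K \<gamma>) \<in> lev m"
proof -
  obtain d f g where *: "f \<in> carrier (alg S (Suc (m - 1 + d)))" "g \<in> carrier (alg S (Suc (m - 1 + d)))"
    "F = rep (Suc (m - 1 + d)) f" "K = rep (Suc (m - 1 + d)) g" using levE[OF assms] .
  have "(\<lambda>\<gamma>. F \<gamma> + K \<gamma>) = rep (Suc (m - 1 + d)) (f \<oplus>\<^bsub>alg S (Suc (m - 1 + d))\<^esub> g)"
    unfolding *(3,4) by (rule rep_add[OF _ *(1,2), symmetric]) simp
  then show ?thesis using add_carrier[OF *(1,2)] unfolding lev_def by blast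
qed

lemma lev_mult:
  assumes "F \<in> lev m" "K \<in> lev m"
  shows "(\<lambda>\<gamma>. F \<gamma> * K \<gamma>) \<in> lev m"
proof -
  obtain d f g where *: "f \<in> carrier (alg S (Suc (m - 1 + d)))" "g \<in> carrier (alg S (Suc (m - 1 + d)))"
    "F = rep (Suc (m - 1 + d)) f" "K = rep (Suc (m - 1 + d)) g" using levE[OF assms] .
  have "(\<lambda>\<gamma>. F \<gamma> * K \<gamma>) = rep (Suc (m - 1 + d)) (had (Suc (m - 1 + d)) f g)"
    unfolding *(3,4) by (rule rep_had[symmetric]) simp
  then show ?thesis using had_carrier[OF *(1,2)] unfolding lev_def by blast
qed

lemma lev_smult:
  assumes "F \<in> lev m"
  shows "(\<lambda>\<gamma>. z * F \<gamma>) \<in> lev m"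
proof -
  obtain d f where *: "f \<in> carrier (alg S (Suc (m - 1 + d)))" "F = rep (Suc (m - 1 + d)) f"
    using assms unfolding lev_def by blast
  have "(\<lambda>\<gamma>. z * F \<gamma>) = rep (Suc (m - 1 + d)) (z \<odot>\<^bsub>alg S (Suc (m - 1 + d))\<^esub> f)"
    unfolding *(2) by (rule rep_smult[OF _ *(1), symmetric]) simp
  then show ?thesis using smult_carrier[OF *(1)] unfolding lev_def by blast
qed

lemma lev_mask: "(\<lambda>\<gamma>. if \<gamma> \<in> R m then 1 else 0) \<in> lev m"
  using mask[of m 0] unfolding lev_def by (intro CollectI exI[of _ 0] bexI[of _ "mask m 0"]) auto

lemma lev_Cc: "F \<in> lev m \<Longrightarrow> F \<in> Cc G"
  using rep_Cc by (auto simp: lev_def)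

text \<open>Beyond a position where the arrows differ, compare them at one level \<open>n\<close>.
  If the vertex or one of the two indices differs, a matrix unit separates the arrows. If they all
  coincide, \<open>prefix_unique\<close> forces the labels at \<open>n\<close> to differ, and a
  matrix unit times a Urysohn function separates.\<close>

lemma lev_separates:
  assumes g: "\<gamma> \<in> R m" "\<gamma>' \<in> R m" "\<gamma> \<noteq> \<gamma>'"
  shows "\<exists>F\<in>lev m. (\<forall>\<gamma>. F \<gamma> \<in> \<real>) \<and> F \<gamma> = 1 \<and> F \<gamma>' = 0"
proof -
  obtain x y x' y' where xy: "\<gamma> = (x, y)" "\<gamma>' = (x', y')" by (cases \<gamma>, cases \<gamma>') blast
  have "x \<noteq> x' \<or> y \<noteq> y'" using g xy by auto
  then obtain k where k: "x k \<noteq> x' k \<or> y k \<noteq> y' k" by blast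
  define n where "n = max m (Suc k)"
  have n: "1 \<le> n" "m \<le> n" "k < n" by (auto simp: n_def)
  have r: "(x, y) \<in> R n" "(x', y') \<in> R n" using g xy tail_rel_mono[OF n(2)] by auto
  note x = tail_relD(1)[OF r(1)] note y = tail_relD(2)[OF r(1)]
  note x' = tail_relD(1)[OF r(2)] note y' = tail_relD(2)[OF r(2)]
  let ?X = "space_at S n (src x n)"
  have i: "src x n < nsum S n" and t: "snd (x n) \<in> topspace ?X" using src_less[OF x n(1)] path_mem_space[OF x n(1)] by auto
  have b: "idx n y < msize S n (src x n)" using idx_less[OF y n(1)] tail_rel_src(1)[OF r(1)] by simp
  define same where "same \<longleftrightarrow> src x' n = src x n \<and> idx n x' = idx n x \<and> idx n y' = idx n y"
  have ne: "snd (x' n) \<noteq> snd (x n)" if same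
  proof
    assume eq: "snd (x' n) = snd (x n)"
    have "x k = x' k" using prefix_unique[OF n(1) x x' _ _ _ n(3)] that eq by (auto simp: same_def)
    moreover have "y k = y' k"
      using prefix_unique[OF n(1) y y' _ _ _ n(3)] that eq tail_rel_src[OF r(1)] tail_rel_src[OF r(2)] by (auto simp: same_def)
    ultimately show False using k by simp
  qed
  obtain f where f: "continuous_map ?X euclideanreal f" "f (snd (x n)) = 1" "same \<Longrightarrow> f (snd (x' n)) = 0"
  proof (cases same)
    case False
    then show ?thesis using that[of "\<lambda>_. 1"] by auto
  next
    case True
    have t': "snd (x' n) \<in> topspace ?X" using path_mem_space[OF x' n(1)] True by (simp add: same_def)
    have "normal_space ?X"
      using compact_space_at[OF n(1) i] Hausdorff_space_at[OF n(1) i]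
      by (intro compact_Hausdorff_or_regular_imp_normal_space) auto
    then have "completely_regular_space ?X"
      using Hausdorff_space_at[OF n(1) i] by (intro normal_imp_completely_regular_space) auto
    moreover have "closedin ?X {snd (x' n)}"
      using closedin_Hausdorff_singleton[OF Hausdorff_space_at[OF n(1) i] t'] .
    moreover have "snd (x n) \<in> topspace ?X - {snd (x' n)}" using t ne[OF True] by auto
    ultimately obtain h where h: "continuous_map ?X (top_of_set {0..1::real}) h" "h (snd (x n)) = 0" "h ` {snd (x' n)} \<subseteq> {1}"
      unfolding completely_regular_space_def by blast
    have "continuous_map ?X euclideanreal (\<lambda>t. 1 - h t)"
      using h(1) by (intro continuous_map_diff) (auto simp: continuous_map_in_subtopology)
    then show ?thesis using h that[of "\<lambda>t. 1 - h t"] by auto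
  qed
  let ?f = "unit_fun n (src x n) (idx n x) (idx n y) (\<lambda>t. complex_of_real (f t))"
  have "continuous_map ?X euclidean (complex_of_real \<circ> f)"
    by (rule continuous_map_compose[OF f(1)]) (simp add: continuous_on_of_real)
  then have fc: "?f \<in> carrier (alg S n)" by (intro unit_fun_carrier) (simp add: o_def)
  have val: "rep n ?f (u, v) = (if src u n = src x n \<and> idx n u = idx n x \<and> idx n v = idx n y then complex_of_real (f (snd (u n))) else 0)"
    if uv: "(u, v) \<in> R n" for u v
  proof -
    note p = tail_relD(1)[OF uv] tail_relD(2)[OF uv]
    have "idx n v < msize S n (src u n)" using idx_less[OF p(2) n(1)] tail_rel_src(1)[OF uv] by simp
    then show ?thesis unfolding rep_in[OF uv] by (intro unit_fun_index src_less path_mem_space idx_less p n(1))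
  qed
  show ?thesis
  proof (intro bexI[OF _ levI[OF n(2,1) fc]] conjI allI)
    show "rep n ?f \<gamma> \<in> \<real>" for \<gamma>
      using val by (cases \<gamma>; cases "\<gamma> \<in> R n") (auto simp: rep_out)
    show "rep n ?f \<gamma> = 1" using val[OF r(1)] f(2) xy by simp
    show "rep n ?f \<gamma>' = 0" using val[OF r(2)] f(3) xy by (auto simp: same_def)
  qed
qed

text \<open>The Stone-Weierstrass theorem on the compact set \<open>R m\<close>, applied to the real
  and the imaginary part of \<open>F\<close>; \<open>H\<close> consists of the real functions that
  coincide on \<open>R m\<close> with some kernel of \<open>lev m\<close>.\<close>

lemma lev_dense:
  assumes F: "F \<in> Cc G" "supp m F" and \<epsilon>: "0 < \<epsilon>"
  obtains K where "K \<in> lev m" "supp m K" "\<And>\<gamma>. cmod (F \<gamma> - K \<gamma>) < \<epsilon>"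
proof -
  let ?X = "subtopology TT (R m)"
  have ts: "topspace ?X = R m" unfolding topspace_subtopology topspace_TT by (auto simp: tail_rel_def)
  have cX: "compact_space ?X" using compactin_TT_tail_rel by (simp add: compact_space_subtopology)
  define H where "H = {h. \<exists>K\<in>lev m. \<forall>\<gamma>\<in>R m. K \<gamma> = complex_of_real (h \<gamma>)}"
  have re: "continuous_map ?X euclideanreal (\<lambda>\<gamma>. Re (K \<gamma>))" and im: "continuous_map ?X euclideanreal (\<lambda>\<gamma>. Im (K \<gamma>))"
    if "K \<in> Cc G" for K
    using Cc_continuous[OF that, of m] by (simp_all add: continuous_map_atin tendsto_Re tendsto_Im)
  have SW: "\<exists>h\<in>H. \<forall>\<gamma>\<in>topspace ?X. \<bar>f \<gamma> - h \<gamma>\<bar> < \<epsilon> / 2" if f: "continuous_map ?X euclideanreal f" for f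
  proof (rule Stone_Weierstrass_compact_space[OF cX _ _ _ _ _ f])
    fix h assume "h \<in> H"
    then obtain K where K: "K \<in> lev m" "\<forall>\<gamma>\<in>R m. K \<gamma> = complex_of_real (h \<gamma>)" by (auto simp: H_def)
    show "continuous_map ?X euclideanreal h"
      by (rule continuous_map_eq[OF re[OF lev_Cc[OF K(1)]]]) (use K(2) in \<open>simp add: ts\<close>)
  next
    fix g h assume "g \<in> H" "h \<in> H"
    then obtain K L where K: "K \<in> lev m" "\<forall>\<gamma>\<in>R m. K \<gamma> = complex_of_real (g \<gamma>)"
      "L \<in> lev m" "\<forall>\<gamma>\<in>R m. L \<gamma> = complex_of_real (h \<gamma>)" by (auto simp: H_def)
    show "(\<lambda>x. g x + h x) \<in> H"
      unfolding H_def by (intro CollectI bexI[OF _ lev_add[OF K(1,3)]]) (use K in simp)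
    show "(\<lambda>x. g x * h x) \<in> H"
      unfolding H_def by (intro CollectI bexI[OF _ lev_mult[OF K(1,3)]]) (use K in simp)
  next
    fix c :: real
    \<comment> \<open>On \<open>R m\<close> a constant is a multiple of the indicator of
      \<open>R m\<close>.\<close>
    have "(\<lambda>_. c) \<in> H"
      unfolding H_def by (intro CollectI bexI[OF _ lev_smult[OF lev_mask, of "complex_of_real c"]]) simp
    then show "\<exists>h\<in>H. \<forall>x\<in>topspace ?X. h x = c" by (rule bexI[rotated]) simp
  next
    fix \<gamma> \<gamma>' assume "\<gamma> \<in> topspace ?X" "\<gamma>' \<in> topspace ?X" "\<gamma> \<noteq> \<gamma>'"
    then have "\<gamma> \<in> R m" "\<gamma>' \<in> R m" "\<gamma> \<noteq> \<gamma>'" by (simp_all only: ts not_False_eq_True)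
    from lev_separates[OF this]
    obtain K where K: "K \<in> lev m" "\<forall>\<gamma>. K \<gamma> \<in> \<real>" "K \<gamma> = 1" "K \<gamma>' = 0" by blast
    have "(\<lambda>\<gamma>. Re (K \<gamma>)) \<in> H"
      unfolding H_def by (intro CollectI bexI[OF _ K(1)] ballI) (simp add: of_real_Re K(2))
    then show "\<exists>h\<in>H. h \<gamma> \<noteq> h \<gamma>'" by (rule bexI[rotated]) (simp add: K(3,4))
  qed (use \<epsilon> in simp)
  obtain h1 K1 where h1: "\<forall>\<gamma>\<in>R m. \<bar>Re (F \<gamma>) - h1 \<gamma>\<bar> < \<epsilon> / 2" "K1 \<in> lev m" "\<forall>\<gamma>\<in>R m. K1 \<gamma> = complex_of_real (h1 \<gamma>)"
    using SW[OF re[OF F(1)]] unfolding H_def ts by blast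
  obtain h2 K2 where h2: "\<forall>\<gamma>\<in>R m. \<bar>Im (F \<gamma>) - h2 \<gamma>\<bar> < \<epsilon> / 2" "K2 \<in> lev m" "\<forall>\<gamma>\<in>R m. K2 \<gamma> = complex_of_real (h2 \<gamma>)"
    using SW[OF im[OF F(1)]] unfolding H_def ts by blast
  \<comment> \<open>The approximants are controlled on \<open>R m\<close> only. Multiplying by the
    indicator, again a member of \<open>lev m\<close>, removes whatever lies outside.\<close>
  define K where "K \<gamma> = (K1 \<gamma> + \<i> * K2 \<gamma>) * (if \<gamma> \<in> R m then 1 else 0)" for \<gamma>
  have "K \<in> lev m"
    unfolding K_def by (intro lev_mult lev_add lev_smult lev_mask h1 h2)
  moreover have "supp m K" by (simp add: supp_def K_def)
  moreover have "cmod (F \<gamma> - K \<gamma>) < \<epsilon>" for \<gamma>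
  proof (cases "\<gamma> \<in> R m")
    case True
    have "cmod (F \<gamma> - K \<gamma>) \<le> \<bar>Re (F \<gamma> - K \<gamma>)\<bar> + \<bar>Im (F \<gamma> - K \<gamma>)\<bar>" by (rule cmod_le)
    also have "\<dots> < \<epsilon> / 2 + \<epsilon> / 2"
      using True h1(1,3) h2(1,3) by (intro add_strict_mono) (simp_all add: K_def)
    finally show ?thesis by simp
  next
    case False
    then have "F \<gamma> = 0" using F(2) unfolding supp_def by blast
    then show ?thesis using False \<epsilon> by (simp add: K_def)
  qed
  ultimately show ?thesis by (rule that)
qed

end


section \<open>Representing the limit algebra\<close>

context AH
begin

text \<open>The limit algebra and the completion of the convolution algebra will both be described
  by Cauchy sequences of kernels modulo \<open>keqv\<close>; comparing them is then a comparison of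
  sequences of kernels.\<close>

definition kcauchy :: "(nat \<Rightarrow> (nat \<Rightarrow> 'e edge \<times> 'a) \<times> (nat \<Rightarrow> 'e edge \<times> 'a) \<Rightarrow> complex) \<Rightarrow> bool" where
  "kcauchy F \<longleftrightarrow> (\<forall>n. kern (F n)) \<and> (\<forall>\<epsilon>>0. \<exists>M. \<forall>m\<ge>M. \<forall>n\<ge>M. kdist (F m) (F n) < \<epsilon>)"

definition keqv :: "(nat \<Rightarrow> (nat \<Rightarrow> 'e edge \<times> 'a) \<times> (nat \<Rightarrow> 'e edge \<times> 'a) \<Rightarrow> complex) \<Rightarrow>
    (nat \<Rightarrow> (nat \<Rightarrow> 'e edge \<times> 'a) \<times> (nat \<Rightarrow> 'e edge \<times> 'a) \<Rightarrow> complex) \<Rightarrow> bool" where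
  "keqv F K \<longleftrightarrow> (\<lambda>n. kdist (F n) (K n)) \<longlonglongrightarrow> 0"

lemma kcauchy_kern: "kcauchy F \<Longrightarrow> kern (F n)"
  by (simp add: kcauchy_def)

lemma keqv_refl: "keqv F F"
  by (simp add: keqv_def)

lemma keqv_sym:
  assumes "\<And>n. kern (F n)" "\<And>n. kern (K n)" "keqv F K"
  shows "keqv K F"
  using assms kdist_sym by (simp add: keqv_def)

lemma keqv_trans:
  assumes "\<And>n. kern (F n)" "\<And>n. kern (K n)" "\<And>n. kern (L n)" "keqv F K" "keqv K L"
  shows "keqv F L"
  unfolding keqv_def
proof (rule tendsto_sandwich[OF _ _ tendsto_const])
  show "(\<lambda>n. kdist (F n) (K n) + kdist (K n) (L n)) \<longlonglongrightarrow> 0"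
    using tendsto_add[OF assms(4,5)[unfolded keqv_def]] by simp
qed (intro always_eventually allI kdist_nonneg kdist_triangle assms)+

lemma kcauchy_keqv:
  assumes F: "kcauchy F" and K: "\<And>n. kern (K n)" and eq: "keqv F K"
  shows "kcauchy K"
  unfolding kcauchy_def
proof (intro conjI allI impI)
  fix \<epsilon> :: real assume \<epsilon>: "0 < \<epsilon>"
  obtain M1 where M1: "\<forall>m\<ge>M1. \<forall>n\<ge>M1. kdist (F m) (F n) < \<epsilon> / 3"
    using F \<epsilon> unfolding kcauchy_def by (meson zero_less_divide_iff zero_less_numeral)
  obtain M2 where M2: "\<forall>n\<ge>M2. kdist (F n) (K n) < \<epsilon> / 3"
    using eq \<epsilon> unfolding keqv_def LIMSEQ_def dist_real_def
    by (metis (no_types, lifting) abs_less_iff diff_zero zero_less_divide_iff zero_less_numeral)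
  note k = kcauchy_kern[OF F] K
  have "kdist (K m) (K n) < \<epsilon>" if "m \<ge> max M1 M2" "n \<ge> max M1 M2" for m n
  proof -
    have "kdist (K m) (K n) \<le> kdist (K m) (F m) + (kdist (F m) (F n) + kdist (F n) (K n))"
      using kdist_triangle[of "K m" "F m" "K n"] kdist_triangle[of "F m" "F n" "K n"] k by fastforce
    also have "kdist (K m) (F m) = kdist (F m) (K m)" by (rule kdist_sym[OF k(2,1)])
    finally show ?thesis using M1[rule_format, of m n] M2[rule_format, of m] M2[rule_format, of n] that by simp
  qed
  then show "\<exists>M. \<forall>m\<ge>M. \<forall>n\<ge>M. kdist (K m) (K n) < \<epsilon>" by blast
qed (rule K)

lemma kcauchy_norm_convergent:
  assumes F: "kcauchy F"
  shows "convergent (\<lambda>n. N (F n))"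
proof (rule Cauchy_convergent, rule metric_CauchyI)
  fix \<epsilon> :: real assume "0 < \<epsilon>"
  then obtain M where "\<forall>m\<ge>M. \<forall>n\<ge>M. kdist (F m) (F n) < \<epsilon>" using F by (auto simp: kcauchy_def)
  then show "\<exists>M. \<forall>m\<ge>M. \<forall>n\<ge>M. dist (N (F m)) (N (F n)) < \<epsilon>"
    using reduced_norm_diff_le[OF kcauchy_kern[OF F] kcauchy_kern[OF F]] unfolding dist_real_def
    by (meson le_less_trans)
qed

lemma kcauchy_bounded:
  assumes F: "kcauchy F"
  shows "\<exists>B>0. \<forall>n. N (F n) \<le> B"
proof -
  have "Bseq (\<lambda>n. N (F n))" using kcauchy_norm_convergent[OF F] by (rule convergent_imp_Bseq)
  then obtain B where "0 < B" "\<forall>n. \<bar>N (F n)\<bar> \<le> B" unfolding Bseq_def by auto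
  then show ?thesis by (meson abs_le_D1)
qed

lemma keqv_norm_limit:
  assumes "\<And>n. kern (F n)" "\<And>n. kern (K n)" "keqv F K" "(\<lambda>n. N (F n)) \<longlonglongrightarrow> l"
  shows "(\<lambda>n. N (K n)) \<longlonglongrightarrow> l"
proof -
  have "(\<lambda>n. N (F n) - N (K n)) \<longlonglongrightarrow> 0"
    by (rule Lim_null_comparison[OF _ assms(3)[unfolded keqv_def]])
      (use reduced_norm_diff_le[OF assms(1,2)] in \<open>simp add: always_eventually\<close>)
  from tendsto_diff[OF assms(4) this] show ?thesis by simp
qed

lemma keqv_add:
  assumes "\<And>n. kern (F n)" "\<And>n. kern (K n)" "\<And>n. kern (F' n)" "\<And>n. kern (K' n)" "keqv F F'" "keqv K K'"
  shows "keqv (\<lambda>n \<gamma>. F n \<gamma> + K n \<gamma>) (\<lambda>n \<gamma>. F' n \<gamma> + K' n \<gamma>)"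
  unfolding keqv_def
proof (rule tendsto_sandwich[OF _ _ tendsto_const])
  show "(\<lambda>n. kdist (F n) (F' n) + kdist (K n) (K' n)) \<longlonglongrightarrow> 0"
    using tendsto_add[OF assms(5,6)[unfolded keqv_def]] by simp
qed (intro always_eventually allI kdist_nonneg kdist_add kern_add assms)+

lemma keqv_smult:
  assumes "\<And>n. kern (F n)" "\<And>n. kern (F' n)" "keqv F F'"
  shows "keqv (\<lambda>n \<gamma>. z * F n \<gamma>) (\<lambda>n \<gamma>. z * F' n \<gamma>)"
  unfolding keqv_def
proof (rule tendsto_sandwich[OF _ _ tendsto_const])
  show "(\<lambda>n. cmod z * kdist (F n) (F' n)) \<longlonglongrightarrow> 0"
    using tendsto_mult_left[OF assms(3)[unfolded keqv_def], of "cmod z"] by simp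
qed (intro always_eventually allI kdist_nonneg kdist_smult kern_smult assms)+

lemma keqv_star:
  assumes "\<And>n. kern (F n)" "\<And>n. kern (F' n)" "keqv F F'"
  shows "keqv (\<lambda>n. star Q (F n)) (\<lambda>n. star Q (F' n))"
  using assms by (simp add: keqv_def kdist_star)

text \<open>The product is uniformly continuous on bounded sets only. The hypotheses therefore ask
  for Cauchy sequences, whose norms are bounded.\<close>

lemma keqv_conv:
  assumes F: "kcauchy F" and K: "kcauchy K" and F': "kcauchy F'" and K': "kcauchy K'" and eq: "keqv F F'" "keqv K K'"
  shows "keqv (\<lambda>n. conv G (F n) (K n)) (\<lambda>n. conv G (F' n) (K' n))"
proof -
  obtain B where B: "0 < B" "\<forall>n. N (K n) \<le> B" using kcauchy_bounded[OF K] by blast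
  obtain C where C: "0 < C" "\<forall>n. N (F' n) \<le> C" using kcauchy_bounded[OF F'] by blast
  note k = kcauchy_kern[OF F] kcauchy_kern[OF K] kcauchy_kern[OF F'] kcauchy_kern[OF K']
  have lim: "(\<lambda>n. kdist (F n) (F' n) * B + C * kdist (K n) (K' n)) \<longlonglongrightarrow> 0"
    using tendsto_add[OF tendsto_mult_right[OF eq(1)[unfolded keqv_def], of B] tendsto_mult_left[OF eq(2)[unfolded keqv_def], of C]] by simp
  have le: "kdist (conv G (F n) (K n)) (conv G (F' n) (K' n)) \<le> kdist (F n) (F' n) * B + C * kdist (K n) (K' n)" for n
    using kdist_conv[OF k(1,2,3,4), of n n n n]
      mult_left_mono[OF B(2)[rule_format, of n] kdist_nonneg[OF k(1,3), of n n]]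
      mult_right_mono[OF C(2)[rule_format, of n] kdist_nonneg[OF k(2,4), of n n]] by linarith
  have "0 \<le> kdist (conv G (F n) (K n)) (conv G (F' n) (K' n))" for n
    by (intro kdist_nonneg kern_conv k)
  then show ?thesis
    unfolding keqv_def using le by (intro tendsto_sandwich[OF _ _ tendsto_const lim] always_eventually allI)
qed

lemma kcauchy_add:
  assumes F: "kcauchy F" and K: "kcauchy K"
  shows "kcauchy (\<lambda>n \<gamma>. F n \<gamma> + K n \<gamma>)"
  unfolding kcauchy_def
proof (intro conjI allI impI)
  note k = kcauchy_kern[OF F] kcauchy_kern[OF K]
  show "kern (\<lambda>\<gamma>. F n \<gamma> + K n \<gamma>)" for n using k by auto
  fix \<epsilon> :: real assume "0 < \<epsilon>"
  then have e: "0 < \<epsilon> / 2" by simp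
  obtain M1 where M1: "\<forall>m\<ge>M1. \<forall>n\<ge>M1. kdist (F m) (F n) < \<epsilon> / 2" using F e unfolding kcauchy_def by blast
  obtain M2 where M2: "\<forall>m\<ge>M2. \<forall>n\<ge>M2. kdist (K m) (K n) < \<epsilon> / 2" using K e unfolding kcauchy_def by blast
  have "kdist (\<lambda>\<gamma>. F m \<gamma> + K m \<gamma>) (\<lambda>\<gamma>. F n \<gamma> + K n \<gamma>) < \<epsilon>" if "m \<ge> max M1 M2" "n \<ge> max M1 M2" for m n
    using kdist_add[OF k(1) k(2) k(1) k(2), of m m n n] M1[rule_format, of m n] M2[rule_format, of m n] that by simp
  then show "\<exists>M. \<forall>m\<ge>M. \<forall>n\<ge>M. kdist (\<lambda>\<gamma>. F m \<gamma> + K m \<gamma>) (\<lambda>\<gamma>. F n \<gamma> + K n \<gamma>) < \<epsilon>" by blast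
qed

lemma kcauchy_smult:
  assumes F: "kcauchy F"
  shows "kcauchy (\<lambda>n \<gamma>. z * F n \<gamma>)"
  unfolding kcauchy_def
proof (intro conjI allI impI)
  note k = kcauchy_kern[OF F]
  show "kern (\<lambda>\<gamma>. z * F n \<gamma>)" for n using k by auto
  fix \<epsilon> :: real assume "0 < \<epsilon>"
  \<comment> \<open>The summand 1 keeps the denominator positive when \<open>z = 0\<close>.\<close>
  then have e: "0 < \<epsilon> / (cmod z + 1)" by (simp add: add_nonneg_pos)
  obtain M where M: "\<forall>m\<ge>M. \<forall>n\<ge>M. kdist (F m) (F n) < \<epsilon> / (cmod z + 1)" using F e unfolding kcauchy_def by blast
  have "kdist (\<lambda>\<gamma>. z * F m \<gamma>) (\<lambda>\<gamma>. z * F n \<gamma>) < \<epsilon>" if "m \<ge> M" "n \<ge> M" for m n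
  proof -
    have "kdist (\<lambda>\<gamma>. z * F m \<gamma>) (\<lambda>\<gamma>. z * F n \<gamma>) \<le> cmod z * kdist (F m) (F n)" by (rule kdist_smult[OF k k])
    also have "\<dots> \<le> (cmod z + 1) * kdist (F m) (F n)" using kdist_nonneg[OF k k] by (intro mult_right_mono) auto
    also have "\<dots> < \<epsilon>"
      using M[rule_format, OF that] by (subst mult.commute) (simp add: pos_less_divide_eq add_nonneg_pos)
    finally show ?thesis .
  qed
  then show "\<exists>M. \<forall>m\<ge>M. \<forall>n\<ge>M. kdist (\<lambda>\<gamma>. z * F m \<gamma>) (\<lambda>\<gamma>. z * F n \<gamma>) < \<epsilon>" by blast
qed

lemma kcauchy_star:
  assumes F: "kcauchy F"
  shows "kcauchy (\<lambda>n. star Q (F n))"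
  using assms kern_star kdist_star unfolding kcauchy_def by simp

lemma kcauchy_conv:
  assumes F: "kcauchy F" and K: "kcauchy K"
  shows "kcauchy (\<lambda>n. conv G (F n) (K n))"
  unfolding kcauchy_def
proof (intro conjI allI impI)
  note k = kcauchy_kern[OF F] kcauchy_kern[OF K]
  show "kern (conv G (F n) (K n))" for n using k by auto
  obtain B where B: "0 < B" "\<forall>n. N (K n) \<le> B" using kcauchy_bounded[OF K] by blast
  obtain C where C: "0 < C" "\<forall>n. N (F n) \<le> C" using kcauchy_bounded[OF F] by blast
  fix \<epsilon> :: real assume \<epsilon>: "0 < \<epsilon>"
  obtain M1 where M1: "\<forall>m\<ge>M1. \<forall>n\<ge>M1. kdist (F m) (F n) < \<epsilon> / (2 * B)"
    using F \<epsilon> B(1) unfolding kcauchy_def by (metis divide_pos_pos mult_pos_pos zero_less_numeral)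
  obtain M2 where M2: "\<forall>m\<ge>M2. \<forall>n\<ge>M2. kdist (K m) (K n) < \<epsilon> / (2 * C)"
    using K \<epsilon> C(1) unfolding kcauchy_def by (metis divide_pos_pos mult_pos_pos zero_less_numeral)
  have "kdist (conv G (F m) (K m)) (conv G (F n) (K n)) < \<epsilon>" if mn: "m \<ge> max M1 M2" "n \<ge> max M1 M2" for m n
  proof -
    have "kdist (F m) (F n) * N (K m) \<le> kdist (F m) (F n) * B"
      by (intro mult_left_mono B(2)[rule_format] kdist_nonneg k)
    moreover have "N (F n) * kdist (K m) (K n) \<le> C * kdist (K m) (K n)"
      by (intro mult_right_mono C(2)[rule_format] kdist_nonneg k)
    moreover have "kdist (F m) (F n) * B < \<epsilon> / 2"
      using M1[rule_format, of m n] mn B(1) by (simp add: field_simps)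
    moreover have "C * kdist (K m) (K n) < \<epsilon> / 2"
      using M2[rule_format, of m n] mn C(1) by (simp add: field_simps)
    ultimately show ?thesis using kdist_conv[OF k(1,2,1,2), of m m n n] by linarith
  qed
  then show "\<exists>M. \<forall>m\<ge>M. \<forall>n\<ge>M. kdist (conv G (F m) (K m)) (conv G (F n) (K n)) < \<epsilon>" by blast
qed

end

section \<open>Quotients of sequences computed through kernels\<close>

lemma UN_eq_const: "x \<in> P \<Longrightarrow> (\<And>a. a \<in> P \<Longrightarrow> f a = c) \<Longrightarrow> (\<Union>a\<in>P. f a) = c"
  by blast

text \<open>A quotient \<open>seq_quotient A X\<close> whose operations are computed through representations \<open>\<pi> n\<close>
  by kernels; \<open>D n\<close> may be larger than the carrier of \<open>A n\<close>, so that it is closed under products.\<close>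

locale rep_seq = AH S for S :: "('a, 'e) diag_AH" +
  fixes A :: "nat \<Rightarrow> 'x cstar" and D :: "nat \<Rightarrow> 'x set"
    and \<pi> :: "nat \<Rightarrow> 'x \<Rightarrow> (nat \<Rightarrow> 'e edge \<times> 'a) \<times> (nat \<Rightarrow> 'e edge \<times> 'a) \<Rightarrow> complex"
    and X :: "(nat \<Rightarrow> 'x) set"
  assumes kern_\<pi>: "x \<in> D n \<Longrightarrow> kern (\<pi> n x)"
    and norm_\<pi>: "x \<in> D n \<Longrightarrow> cnorm (A n) x = N (\<pi> n x)"
    and add_\<pi>: "x \<in> D n \<Longrightarrow> y \<in> D n \<Longrightarrow> x \<oplus>\<^bsub>A n\<^esub> y \<in> D n \<and> \<pi> n (x \<oplus>\<^bsub>A n\<^esub> y) = (\<lambda>\<gamma>. \<pi> n x \<gamma> + \<pi> n y \<gamma>)"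
    and mult_\<pi>: "x \<in> D n \<Longrightarrow> y \<in> D n \<Longrightarrow> x \<otimes>\<^bsub>A n\<^esub> y \<in> D n \<and> \<pi> n (x \<otimes>\<^bsub>A n\<^esub> y) = conv G (\<pi> n x) (\<pi> n y)"
    and smult_\<pi>: "x \<in> D n \<Longrightarrow> z \<odot>\<^bsub>A n\<^esub> x \<in> D n \<and> \<pi> n (z \<odot>\<^bsub>A n\<^esub> x) = (\<lambda>\<gamma>. z * \<pi> n x \<gamma>)"
    and star_\<pi>: "x \<in> D n \<Longrightarrow> star (A n) x \<in> D n \<and> \<pi> n (star (A n) x) = star Q (\<pi> n x)"
    and X_D: "a \<in> X \<Longrightarrow> a n \<in> D n"
    and X_cauchy: "a \<in> X \<Longrightarrow> kcauchy (\<lambda>n. \<pi> n (a n))"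
begin

abbreviation "cl \<equiv> seq_class A X"
abbreviation "SQ \<equiv> seq_quotient A X"
abbreviation (input) "\<pi>s \<equiv> \<lambda>a n. \<pi> n (a n)"

lemma cdist_\<pi>:
  assumes "x \<in> D n" "y \<in> D n"
  shows "cdist (A n) x y = kdist (\<pi> n x) (\<pi> n y)"
  using smult_\<pi>[OF assms(2), of "-1"] add_\<pi>[OF assms(1), of "(-1) \<odot>\<^bsub>A n\<^esub> y"] norm_\<pi>
  by (simp add: cdist_def kdist_def)

text \<open>Stated for \<open>c\<close> with terms in \<open>D\<close>, so that it covers entrywise
  sums and products before their membership in \<open>X\<close> is settled.\<close>

lemma cl_iff: "(\<And>n. c n \<in> D n) \<Longrightarrow> b \<in> cl c \<longleftrightarrow> b \<in> X \<and> keqv (\<pi>s b) (\<pi>s c)"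
  using X_D by (auto simp: seq_class_def keqv_def cdist_\<pi> cong: conj_cong)

lemma cl_D:
  assumes "a \<in> X" "b \<in> cl a"
  shows "b \<in> X" "keqv (\<pi>s b) (\<pi>s a)"
  using cl_iff[of a b] X_D[OF assms(1)] assms(2) by blast+

lemma cl_self: "a \<in> X \<Longrightarrow> a \<in> cl a"
  using X_D by (simp add: cl_iff keqv_refl)

lemma cl_cong:
  assumes c: "\<And>n. c n \<in> D n" "\<And>n. d n \<in> D n" and eq: "keqv (\<pi>s c) (\<pi>s d)"
  shows "cl c = cl d"
proof -
  have k: "kern (\<pi> n (c n))" "kern (\<pi> n (d n))" for n using c kern_\<pi> by blast+
  have eq': "keqv (\<pi>s d) (\<pi>s c)" by (rule keqv_sym[of "\<pi>s c" "\<pi>s d"]) (intro k eq)+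
  have "keqv (\<pi>s b) (\<pi>s c) \<longleftrightarrow> keqv (\<pi>s b) (\<pi>s d)" if "b \<in> X" for b
  proof -
    have kb: "kern (\<pi> n (b n))" for n using X_D[OF that] kern_\<pi> by blast
    show ?thesis
      using keqv_trans[of "\<pi>s b" "\<pi>s c" "\<pi>s d"] keqv_trans[of "\<pi>s b" "\<pi>s d" "\<pi>s c"] kb k eq eq' by blast
  qed
  then show ?thesis using cl_iff[OF c(1)] cl_iff[OF c(2)] by blast
qed

lemma cl_eq_iff:
  assumes "a \<in> X" "b \<in> X"
  shows "cl a = cl b \<longleftrightarrow> keqv (\<pi>s a) (\<pi>s b)"
proof
  assume "cl a = cl b"
  then have "a \<in> cl b" using cl_self[OF assms(1)] by simp
  then show "keqv (\<pi>s a) (\<pi>s b)" using cl_iff X_D[OF assms(2)] by blast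
qed (use cl_cong X_D assms in blast)

lemma carrier_SQ: "carrier SQ = cl ` X"
  by (simp add: seq_quotient_def)

text \<open>\<open>seq_quotient\<close> defines an operation as a union over all representatives.
  Equivalent representatives give the same class, so by \<open>UN_eq_const\<close> the union
  collapses to that class; the other operations are treated alike.\<close>

lemma SQ_add:
  assumes a: "a \<in> X" and b: "b \<in> X"
  shows "cl a \<oplus>\<^bsub>SQ\<^esub> cl b = cl (\<lambda>n. a n \<oplus>\<^bsub>A n\<^esub> b n)"
proof -
  have "cl (\<lambda>n. a' n \<oplus>\<^bsub>A n\<^esub> b' n) = cl (\<lambda>n. a n \<oplus>\<^bsub>A n\<^esub> b n)" if "a' \<in> cl a" "b' \<in> cl b" for a' b'
  proof -
    have *: "a' \<in> X" "b' \<in> X" "keqv (\<pi>s a') (\<pi>s a)" "keqv (\<pi>s b') (\<pi>s b)"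
      using cl_D[OF a that(1)] cl_D[OF b that(2)] by blast+
    have D: "a n \<in> D n" "b n \<in> D n" "a' n \<in> D n" "b' n \<in> D n" for n using X_D[OF a] X_D[OF b] X_D[OF *(1)] X_D[OF *(2)] by blast+
    have "keqv (\<lambda>n \<gamma>. \<pi> n (a' n) \<gamma> + \<pi> n (b' n) \<gamma>) (\<lambda>n \<gamma>. \<pi> n (a n) \<gamma> + \<pi> n (b n) \<gamma>)"
      by (rule keqv_add[of "\<pi>s a'" "\<pi>s b'" "\<pi>s a" "\<pi>s b"]) (rule kern_\<pi> D *(3,4))+
    then show ?thesis by (intro cl_cong) (simp_all add: add_\<pi> D)
  qed
  note eq = this
  have "cl a \<oplus>\<^bsub>SQ\<^esub> cl b = (\<Union>a'\<in>cl a. \<Union>b'\<in>cl b. cl (\<lambda>n. a' n \<oplus>\<^bsub>A n\<^esub> b' n))"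
    by (simp add: seq_quotient_def)
  also have "\<dots> = cl (\<lambda>n. a n \<oplus>\<^bsub>A n\<^esub> b n)"
    by (rule UN_eq_const[OF cl_self[OF a]], rule UN_eq_const[OF cl_self[OF b]], rule eq)
  finally show ?thesis .
qed

lemma SQ_mult:
  assumes a: "a \<in> X" and b: "b \<in> X"
  shows "cl a \<otimes>\<^bsub>SQ\<^esub> cl b = cl (\<lambda>n. a n \<otimes>\<^bsub>A n\<^esub> b n)"
proof -
  have "cl (\<lambda>n. a' n \<otimes>\<^bsub>A n\<^esub> b' n) = cl (\<lambda>n. a n \<otimes>\<^bsub>A n\<^esub> b n)" if "a' \<in> cl a" "b' \<in> cl b" for a' b'
  proof -
    have *: "a' \<in> X" "b' \<in> X" "keqv (\<pi>s a') (\<pi>s a)" "keqv (\<pi>s b') (\<pi>s b)"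
      using cl_D[OF a that(1)] cl_D[OF b that(2)] by blast+
    have "keqv (\<lambda>n. conv G (\<pi> n (a' n)) (\<pi> n (b' n))) (\<lambda>n. conv G (\<pi> n (a n)) (\<pi> n (b n)))"
      using * a b by (intro keqv_conv X_cauchy)
    moreover have "a n \<in> D n" "b n \<in> D n" "a' n \<in> D n" "b' n \<in> D n" for n using X_D[OF a] X_D[OF b] X_D[OF *(1)] X_D[OF *(2)] by blast+
    ultimately show ?thesis by (intro cl_cong) (simp_all add: mult_\<pi>)
  qed
  note eq = this
  have "cl a \<otimes>\<^bsub>SQ\<^esub> cl b = (\<Union>a'\<in>cl a. \<Union>b'\<in>cl b. cl (\<lambda>n. a' n \<otimes>\<^bsub>A n\<^esub> b' n))"
    by (simp add: seq_quotient_def)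
  also have "\<dots> = cl (\<lambda>n. a n \<otimes>\<^bsub>A n\<^esub> b n)"
    by (rule UN_eq_const[OF cl_self[OF a]], rule UN_eq_const[OF cl_self[OF b]], rule eq)
  finally show ?thesis .
qed

lemma SQ_smult:
  assumes a: "a \<in> X"
  shows "z \<odot>\<^bsub>SQ\<^esub> cl a = cl (\<lambda>n. z \<odot>\<^bsub>A n\<^esub> a n)"
proof -
  have "cl (\<lambda>n. z \<odot>\<^bsub>A n\<^esub> a' n) = cl (\<lambda>n. z \<odot>\<^bsub>A n\<^esub> a n)" if "a' \<in> cl a" for a'
  proof -
    have *: "a' \<in> X" "keqv (\<pi>s a') (\<pi>s a)" using cl_D[OF a that] by blast+
    have D: "a n \<in> D n" "a' n \<in> D n" for n using X_D[OF a] X_D[OF *(1)] by blast+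
    have "keqv (\<lambda>n \<gamma>. z * \<pi> n (a' n) \<gamma>) (\<lambda>n \<gamma>. z * \<pi> n (a n) \<gamma>)"
      by (rule keqv_smult[of "\<pi>s a'" "\<pi>s a"]) (rule kern_\<pi> D *(2))+
    then show ?thesis by (intro cl_cong) (simp_all add: smult_\<pi> D)
  qed
  note eq = this
  have "z \<odot>\<^bsub>SQ\<^esub> cl a = (\<Union>a'\<in>cl a. cl (\<lambda>n. z \<odot>\<^bsub>A n\<^esub> a' n))"
    by (simp add: seq_quotient_def)
  also have "\<dots> = cl (\<lambda>n. z \<odot>\<^bsub>A n\<^esub> a n)"
    by (rule UN_eq_const[OF cl_self[OF a]], rule eq)
  finally show ?thesis .
qed

lemma SQ_star:
  assumes a: "a \<in> X"
  shows "star SQ (cl a) = cl (\<lambda>n. star (A n) (a n))"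
proof -
  have "cl (\<lambda>n. star (A n) (a' n)) = cl (\<lambda>n. star (A n) (a n))" if "a' \<in> cl a" for a'
  proof -
    have *: "a' \<in> X" "keqv (\<pi>s a') (\<pi>s a)" using cl_D[OF a that] by blast+
    have D: "a n \<in> D n" "a' n \<in> D n" for n using X_D[OF a] X_D[OF *(1)] by blast+
    have "keqv (\<lambda>n. star Q (\<pi> n (a' n))) (\<lambda>n. star Q (\<pi> n (a n)))"
      by (rule keqv_star[of "\<pi>s a'" "\<pi>s a"]) (rule kern_\<pi> D *(2))+
    then show ?thesis by (intro cl_cong) (simp_all add: star_\<pi> D)
  qed
  note eq = this
  have "star SQ (cl a) = (\<Union>a'\<in>cl a. cl (\<lambda>n. star (A n) (a' n)))"
    by (simp add: seq_quotient_def)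
  also have "\<dots> = cl (\<lambda>n. star (A n) (a n))"
    by (rule UN_eq_const[OF cl_self[OF a]], rule eq)
  finally show ?thesis .
qed

text \<open>The norm is a definite description: existence comes from convergence of the norms along
  a Cauchy sequence and their invariance under \<open>keqv\<close>, uniqueness from the fact that
  the class contains \<open>a\<close>.\<close>

lemma SQ_norm:
  assumes a: "a \<in> X"
  shows "(\<lambda>n. N (\<pi> n (a n))) \<longlonglongrightarrow> cnorm SQ (cl a)"
proof -
  obtain l where l: "(\<lambda>n. N (\<pi> n (a n))) \<longlonglongrightarrow> l"
    using kcauchy_norm_convergent[OF X_cauchy[OF a]] by (auto simp: convergent_def)
  have "(\<lambda>n. cnorm (A n) (b n)) \<longlonglongrightarrow> l" if "b \<in> cl a" for b
  proof -
    have b: "b \<in> X" "keqv (\<pi>s b) (\<pi>s a)" using cl_D[OF a that] by blast+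
    have k: "kern (\<pi> n (a n))" "kern (\<pi> n (b n))" for n using kern_\<pi>[OF X_D[OF a]] kern_\<pi>[OF X_D[OF b(1)]] by blast+
    have "(\<lambda>n. N (\<pi> n (b n))) \<longlonglongrightarrow> l"
      by (rule keqv_norm_limit[of "\<pi>s a" "\<pi>s b"]) (intro k l keqv_sym[of "\<pi>s b" "\<pi>s a"] b)+
    then show ?thesis using norm_\<pi>[OF X_D[OF b(1)]] by simp
  qed
  moreover have "l' = l" if "\<forall>b\<in>cl a. (\<lambda>n. cnorm (A n) (b n)) \<longlonglongrightarrow> l'" for l'
  proof -
    have "(\<lambda>n. cnorm (A n) (a n)) \<longlonglongrightarrow> l'" using that cl_self[OF a] by blast
    then have "(\<lambda>n. N (\<pi> n (a n))) \<longlonglongrightarrow> l'" using norm_\<pi>[OF X_D[OF a]] by simp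
    then show ?thesis using l LIMSEQ_unique by blast
  qed
  ultimately have "(THE l. \<forall>b\<in>cl a. (\<lambda>n. cnorm (A n) (b n)) \<longlonglongrightarrow> l) = l"
    by (intro the_equality) blast+
  then have "cnorm SQ (cl a) = l" by (simp add: seq_quotient_def)
  then show ?thesis using l by simp
qed

end

section \<open>The limit algebra and the reduced groupoid algebra\<close>

context AH
begin

abbreviation (input) "Alg \<equiv> \<lambda>n. alg S (Suc n)"
abbreviation (input) "reps \<equiv> \<lambda>a n. rep (Suc n) (a n)"
abbreviation "LS \<equiv> limit_seqs Alg (\<lambda>n. phi S (Suc n))"

text \<open>Moving \<open>a m\<close> along the connecting maps leaves its kernel unchanged, so
  being asymptotically a thread says that the kernels stay close to the \<open>m\<close>-th one:
  this is the Cauchy condition.\<close>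

lemma limit_seqs_iff: "a \<in> LS \<longleftrightarrow> (\<forall>n. a n \<in> carrier (Alg n)) \<and> kcauchy (reps a)"
proof (intro iffI conjI)
  assume a: "a \<in> LS"
  then have c: "a n \<in> carrier (Alg n)" for n by (simp add: limit_seqs_def)
  then show "\<forall>n. a n \<in> carrier (Alg n)" by blast
  have k: "kern (reps a n)" for n by (rule kern_rep[OF _ c]) simp
  show "kcauchy (reps a)"
    unfolding kcauchy_def
  proof (intro conjI allI impI k)
    fix \<epsilon> :: real assume "0 < \<epsilon>"
    then have "0 < \<epsilon> / 2" by simp
    then obtain m where m: "\<forall>n\<ge>m. cdist (Alg n) (a n) (tr m (n - m) (a m)) < \<epsilon> / 2"
      using a unfolding limit_seqs_def by blast
    have *: "kdist (reps a n) (reps a m) < \<epsilon> / 2" if "n \<ge> m" for n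
    proof -
      have "tr m (n - m) (a m) \<in> carrier (Alg n)" "rep (Suc n) (tr m (n - m) (a m)) = reps a m"
        using rep_transit[OF c[of m], of "n - m"] that by auto
      then show ?thesis using cdist_alg[of "Suc n" "a n" "tr m (n - m) (a m)"] c[of n] m that by auto
    qed
    have "kdist (reps a n) (reps a n') < \<epsilon>" if "n \<ge> m" "n' \<ge> m" for n n'
      using kdist_triangle[OF k[of n] k[of m] k[of n']] *[OF that(1)] *[OF that(2)] kdist_sym[OF k[of n'] k[of m]] by linarith
    then show "\<exists>M. \<forall>m\<ge>M. \<forall>n\<ge>M. kdist (reps a m) (reps a n) < \<epsilon>" by blast
  qed
next
  assume a: "(\<forall>n. a n \<in> carrier (Alg n)) \<and> kcauchy (reps a)"
  then have c: "a n \<in> carrier (Alg n)" for n by blast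
  have "\<exists>m. \<forall>n\<ge>m. cdist (Alg n) (a n) (tr m (n - m) (a m)) < \<epsilon>" if e: "0 < \<epsilon>" for \<epsilon>
  proof -
    obtain M where M: "\<forall>m\<ge>M. \<forall>n\<ge>M. kdist (reps a m) (reps a n) < \<epsilon>"
      using a e unfolding kcauchy_def by blast
    have "cdist (Alg n) (a n) (tr M (n - M) (a M)) < \<epsilon>" if "n \<ge> M" for n
    proof -
      have "tr M (n - M) (a M) \<in> carrier (Alg n)" "rep (Suc n) (tr M (n - M) (a M)) = reps a M"
        using rep_transit[OF c[of M], of "n - M"] that by auto
      then show ?thesis using cdist_alg[of "Suc n" "a n" "tr M (n - M) (a M)"] c[of n] M that by auto
    qed
    then show ?thesis by blast
  qed
  then show "a \<in> LS" using c by (simp add: limit_seqs_def)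
qed

lemma AH_rep_seq: "rep_seq S Alg (\<lambda>n. carrier (Alg n)) (\<lambda>n. rep (Suc n)) LS"
proof
  show "a n \<in> carrier (Alg n)" if "a \<in> LS" for a n using that by (simp add: limit_seqs_iff)
  show "kcauchy (reps a)" if "a \<in> LS" for a using that by (simp add: limit_seqs_iff)
qed (simp_all add: kern_rep rep_norm rep_add add_carrier rep_mult mult_carrier rep_smult smult_carrier rep_star star_carrier)

abbreviation "CS \<equiv> {a :: nat \<Rightarrow> _. (\<forall>n. a n \<in> carrier Q) \<and> (\<forall>\<epsilon>>0. \<exists>M. \<forall>m\<ge>M. \<forall>n\<ge>M. cdist Q (a m) (a n) < \<epsilon>)}"

lemma CS_iff: "a \<in> CS \<longleftrightarrow> (\<forall>n. a n \<in> Cc G) \<and> kcauchy a"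
  using kern_Cc by (auto simp: kcauchy_def cdist_Q Q_simps)

lemma Q_rep_seq: "rep_seq S (\<lambda>_. Q) (\<lambda>_. {F. kern F}) (\<lambda>_ F. F) CS"
proof
  show "a n \<in> {F. kern F}" if "a \<in> CS" for a n using CS_iff[THEN iffD1, OF that] kern_Cc by blast
  show "kcauchy (\<lambda>n. a n)" if "a \<in> CS" for a using CS_iff[THEN iffD1, OF that] by simp
  show "star Q x \<in> {F. kern F} \<and> star Q x = star Q x" if "x \<in> {F. kern F}" for x using that kern_star by simp
qed (auto simp: Q_simps(1-7))

text \<open>A nearest point of \<open>E n\<close> need not exist, so \<open>a n\<close> is chosen
  within \<open>1 / (n + 1)\<close> of the infimum of the distances. A single sequence then serves
  every \<epsilon> at once.\<close>

lemma approx: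
  assumes E: "\<And>n. E n \<subseteq> carrier (Alg n)" "\<And>n. E n \<noteq> {}" and b: "\<And>n. kern (b n)"
    and app: "\<And>\<epsilon>. 0 < \<epsilon> \<Longrightarrow> \<exists>n0. \<forall>n\<ge>n0. \<exists>f\<in>E n. kdist (rep (Suc n) f) (b n) < \<epsilon>"
  shows "\<exists>a. (\<forall>n. a n \<in> E n) \<and> keqv (reps a) b"
proof -
  define I where "I n = Inf ((\<lambda>f. kdist (rep (Suc n) f) (b n)) ` E n)" for n
  have k: "kern (rep (Suc n) f)" if "f \<in> E n" for n f using that E(1) by (intro kern_rep) auto
  have bdd: "bdd_below ((\<lambda>f. kdist (rep (Suc n) f) (b n)) ` E n)" for n
    using kdist_nonneg[OF k b] by (intro bdd_belowI[of _ 0]) auto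
  have "\<exists>f\<in>E n. kdist (rep (Suc n) f) (b n) < I n + 1 / real (Suc n)" for n
    using cInf_lessD[of "(\<lambda>f. kdist (rep (Suc n) f) (b n)) ` E n" "I n + 1 / real (Suc n)"] E(2)
    by (auto simp: I_def)
  then obtain a where a: "\<And>n. a n \<in> E n" "\<And>n. kdist (reps a n) (b n) < I n + 1 / real (Suc n)" by metis
  have "(\<lambda>n. kdist (reps a n) (b n)) \<longlonglongrightarrow> 0"
  proof (rule LIMSEQ_I)
    fix \<epsilon> :: real assume "0 < \<epsilon>"
    then have e: "0 < \<epsilon> / 2" by simp
    obtain n0 where n0: "\<forall>n\<ge>n0. \<exists>f\<in>E n. kdist (rep (Suc n) f) (b n) < \<epsilon> / 2" using app[OF e] by blast
    obtain n1 where n1: "inverse (real (Suc n1)) < \<epsilon> / 2" using reals_Archimedean[OF e] by blast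
    have "norm (kdist (reps a n) (b n) - 0) < \<epsilon>" if nn: "n \<ge> max n0 n1" for n
    proof -
      obtain f where f: "f \<in> E n" "kdist (rep (Suc n) f) (b n) < \<epsilon> / 2" using n0 nn by (meson max.boundedE)
      have "I n \<le> kdist (rep (Suc n) f) (b n)" unfolding I_def by (rule cINF_lower[OF bdd f(1)])
      moreover have "1 / real (Suc n) \<le> inverse (real (Suc n1))" using nn by (simp add: divide_simps)
      moreover have "0 \<le> kdist (reps a n) (b n)" by (intro kdist_nonneg k a b)
      ultimately show ?thesis using a(2)[of n] f(2) n1 by simp
    qed
    then show "\<exists>no. \<forall>n\<ge>no. norm (kdist (reps a n) (b n) - 0) < \<epsilon>" by blast
  qed
  then show ?thesis using a(1) by (auto simp: keqv_def)
qed

lemma limit_approx: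
  assumes E: "\<And>n. E n \<subseteq> carrier (Alg n)" "\<And>n. E n \<noteq> {}" and b: "kcauchy b"
    and app: "\<And>\<epsilon>. 0 < \<epsilon> \<Longrightarrow> \<exists>n0. \<forall>n\<ge>n0. \<exists>f\<in>E n. kdist (rep (Suc n) f) (b n) < \<epsilon>"
  shows "\<exists>a\<in>LS. (\<forall>n. a n \<in> E n) \<and> keqv (reps a) b"
proof -
  obtain a where a: "\<forall>n. a n \<in> E n" "keqv (reps a) b" using approx[OF E kcauchy_kern[OF b] app] by blast
  have k: "kern (reps a n)" for n using a(1) E(1) by (intro kern_rep) auto
  have "kcauchy (reps a)"
    by (rule kcauchy_keqv[OF b k keqv_sym[of "reps a" b]]) (intro k kcauchy_kern[OF b] a(2))+
  then have "a \<in> LS" unfolding limit_seqs_iff using a(1) E(1) by blast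
  with a show ?thesis by blast
qed

text \<open>\<open>lev_dense\<close> approximates uniformly and keeps the difference supported on
  \<open>R m\<close>, where \<open>reduced_norm_le_sup\<close> makes the approximation one in norm.
  The connecting maps then provide the same kernel at all later levels.\<close>

lemma Cc_approx:
  assumes F: "F \<in> Cc G" "supp m F" and \<epsilon>: "0 < \<epsilon>"
  shows "\<exists>n0. \<forall>n\<ge>n0. \<exists>f\<in>carrier (Alg n). supp m (rep (Suc n) f) \<and> kdist (rep (Suc n) f) F < \<epsilon>"
proof -
  \<comment> \<open>The factor \<open>cls_bound m\<close> lost on passing to the norm is compensated
    beforehand; the added 1 makes the final inequality strict.\<close>
  have e: "0 < \<epsilon> / (real (cls_bound m) + 1)" using \<epsilon> by (simp add: add_nonneg_pos)
  obtain K where K: "K \<in> lev m" "supp m K" "\<And>\<gamma>. cmod (F \<gamma> - K \<gamma>) < \<epsilon> / (real (cls_bound m) + 1)"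
    using lev_dense[OF F e] by blast
  have kK: "kern K" "kern F" using kern_Cc lev_Cc[OF K(1)] F(1) by blast+
  have "supp m (\<lambda>\<gamma>. F \<gamma> - K \<gamma>)" using F(2) K(2) by (simp add: supp_def)
  then have "kdist F K \<le> \<epsilon> / (real (cls_bound m) + 1) * cls_bound m"
    unfolding kdist_def using K(3) by (intro reduced_norm_le_sup) (auto intro: less_imp_le)
  also have "\<dots> < \<epsilon>" using \<epsilon> by (simp add: divide_less_eq add_nonneg_pos)
  finally have d: "kdist K F < \<epsilon>" using kdist_sym[OF kK] by simp
  obtain d f where f: "f \<in> carrier (Alg (m - 1 + d))" "K = rep (Suc (m - 1 + d)) f"
    using K(1) unfolding lev_def by blast
  have "\<exists>f\<in>carrier (Alg n). supp m (rep (Suc n) f) \<and> kdist (rep (Suc n) f) F < \<epsilon>" if "n \<ge> m - 1 + d" for n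
    using rep_transit[OF f(1), of "n - (m - 1 + d)"] that f(2) K(2) d
    by (intro bexI[of _ "tr (m - 1 + d) (n - (m - 1 + d)) f"]) auto
  then show ?thesis by blast
qed

text \<open>A late member \<open>b M\<close> is approximated by kernels of all large levels, and it
  is itself close to every later \<open>b n\<close>. Hence the \<open>n\<close>-th term can be taken
  at level \<open>n + 1\<close>, as the limit algebra demands.\<close>

lemma rep_limit_surj:
  assumes b: "b \<in> CS"
  shows "\<exists>a\<in>LS. keqv (reps a) b"
proof -
  have bc: "\<And>n. b n \<in> Cc G" and bk: "kcauchy b" using b unfolding CS_iff by blast+
  have "\<exists>a\<in>LS. (\<forall>n. a n \<in> carrier (Alg n)) \<and> keqv (reps a) b"
  proof (rule limit_approx[OF _ _ bk])
    show "carrier (Alg n) \<noteq> {}" for n using one_carrier by blast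
    fix \<epsilon> :: real assume "0 < \<epsilon>"
    then have e: "0 < \<epsilon> / 2" by simp
    obtain M where M: "\<forall>m\<ge>M. \<forall>n\<ge>M. kdist (b m) (b n) < \<epsilon> / 2" using bk e unfolding kcauchy_def by blast
    obtain m where m: "supp m (b M)" using Cc_supp[OF bc] by blast
    obtain n0 where n0: "\<forall>n\<ge>n0. \<exists>f\<in>carrier (Alg n). supp m (rep (Suc n) f) \<and> kdist (rep (Suc n) f) (b M) < \<epsilon> / 2"
      using Cc_approx[OF bc m e] by blast
    have "\<exists>f\<in>carrier (Alg n). kdist (rep (Suc n) f) (b n) < \<epsilon>" if nn: "n \<ge> max n0 M" for n
    proof -
      obtain f where f: "f \<in> carrier (Alg n)" "kdist (rep (Suc n) f) (b M) < \<epsilon> / 2" using n0 nn by (meson max.boundedE)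
      have "kern (rep (Suc n) f)" using f(1) by (intro kern_rep) auto
      then have "kdist (rep (Suc n) f) (b n) \<le> kdist (rep (Suc n) f) (b M) + kdist (b M) (b n)"
        by (rule kdist_triangle[OF _ kern_Cc[OF bc] kern_Cc[OF bc]])
      also have "\<dots> < \<epsilon>" using f(2) M[rule_format, of M n] nn by simp
      finally show ?thesis using f(1) by blast
    qed
    then show "\<exists>n0. \<forall>n\<ge>n0. \<exists>f\<in>carrier (Alg n). kdist (rep (Suc n) f) (b n) < \<epsilon>" by blast
  qed blast
  then show ?thesis by blast
qed

lemma LS_carrier: "a \<in> LS \<Longrightarrow> a n \<in> carrier (Alg n)"
  and LS_kcauchy: "a \<in> LS \<Longrightarrow> kcauchy (reps a)"
  using limit_seqs_iff by blast+

lemma LSI: "(\<And>n. a n \<in> carrier (Alg n)) \<Longrightarrow> reps a = F \<Longrightarrow> kcauchy F \<Longrightarrow> a \<in> LS"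
  using limit_seqs_iff by blast

lemma op_add:
  assumes a: "a \<in> LS" and b: "b \<in> LS"
  shows "(\<lambda>n. a n \<oplus>\<^bsub>Alg n\<^esub> b n) \<in> LS" "reps (\<lambda>n. a n \<oplus>\<^bsub>Alg n\<^esub> b n) = (\<lambda>n \<gamma>. reps a n \<gamma> + reps b n \<gamma>)"
proof -
  show e: "reps (\<lambda>n. a n \<oplus>\<^bsub>Alg n\<^esub> b n) = (\<lambda>n \<gamma>. reps a n \<gamma> + reps b n \<gamma>)"
    by (rule ext, rule rep_add) (simp_all add: LS_carrier a b)
  show "(\<lambda>n. a n \<oplus>\<^bsub>Alg n\<^esub> b n) \<in> LS"
    by (rule LSI[OF add_carrier e kcauchy_add]) (rule LS_carrier LS_kcauchy a b)+
qed

lemma op_mult: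
  assumes a: "a \<in> LS" and b: "b \<in> LS"
  shows "(\<lambda>n. a n \<otimes>\<^bsub>Alg n\<^esub> b n) \<in> LS" "reps (\<lambda>n. a n \<otimes>\<^bsub>Alg n\<^esub> b n) = (\<lambda>n. conv G (reps a n) (reps b n))"
proof -
  show e: "reps (\<lambda>n. a n \<otimes>\<^bsub>Alg n\<^esub> b n) = (\<lambda>n. conv G (reps a n) (reps b n))"
    by (rule ext, rule rep_mult) (simp_all add: LS_carrier a b)
  show "(\<lambda>n. a n \<otimes>\<^bsub>Alg n\<^esub> b n) \<in> LS"
    by (rule LSI[OF mult_carrier e kcauchy_conv]) (rule LS_carrier LS_kcauchy a b)+
qed

lemma op_smult:
  assumes a: "a \<in> LS"
  shows "(\<lambda>n. z \<odot>\<^bsub>Alg n\<^esub> a n) \<in> LS" "reps (\<lambda>n. z \<odot>\<^bsub>Alg n\<^esub> a n) = (\<lambda>n \<gamma>. z * reps a n \<gamma>)"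
proof -
  show e: "reps (\<lambda>n. z \<odot>\<^bsub>Alg n\<^esub> a n) = (\<lambda>n \<gamma>. z * reps a n \<gamma>)"
    by (rule ext, rule rep_smult) (simp_all add: LS_carrier a)
  show "(\<lambda>n. z \<odot>\<^bsub>Alg n\<^esub> a n) \<in> LS"
    by (rule LSI[OF smult_carrier e kcauchy_smult]) (rule LS_carrier LS_kcauchy a)+
qed

lemma op_star:
  assumes a: "a \<in> LS"
  shows "(\<lambda>n. star (Alg n) (a n)) \<in> LS" "reps (\<lambda>n. star (Alg n) (a n)) = (\<lambda>n. star Q (reps a n))"
proof -
  show e: "reps (\<lambda>n. star (Alg n) (a n)) = (\<lambda>n. star Q (reps a n))"
    by (rule ext, rule rep_star) (simp_all add: LS_carrier a)
  show "(\<lambda>n. star (Alg n) (a n)) \<in> LS"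
    by (rule LSI[OF star_carrier e kcauchy_star]) (rule LS_carrier LS_kcauchy a)+
qed

lemma kcauchy_const: "kern F \<Longrightarrow> kcauchy (\<lambda>_. F)"
  by (simp add: kcauchy_def)

lemma op_one:
  "(\<lambda>n. \<one>\<^bsub>Alg n\<^esub>) \<in> LS" "reps (\<lambda>n. \<one>\<^bsub>Alg n\<^esub>) = (\<lambda>_. \<one>\<^bsub>Q\<^esub>)"
proof -
  show e: "reps (\<lambda>n. \<one>\<^bsub>Alg n\<^esub>) = (\<lambda>_. \<one>\<^bsub>Q\<^esub>)" by (rule ext, rule rep_one) simp
  have "kern \<one>\<^bsub>Q\<^esub>" using kern_rep[OF le_refl one_carrier] unfolding rep_one[OF le_refl] .
  then show "(\<lambda>n. \<one>\<^bsub>Alg n\<^esub>) \<in> LS" by (rule LSI[OF one_carrier e kcauchy_const])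
qed

text \<open>Both sides are quotients by the relation \<open>keqv\<close> on kernels. Sending the
  class of a sequence to the class of its kernels is for this reason well defined, injective and
  isometric; surjectivity is where density enters.\<close>

theorem AH_algebra_iso: "\<exists>\<Phi>. cstar_iso (AH_algebra S) (reduced_cstar G) \<Phi>"
proof -
  interpret A: rep_seq S Alg "\<lambda>n. carrier (Alg n)" "\<lambda>n. rep (Suc n)" LS by (rule AH_rep_seq)
  interpret B: rep_seq S "\<lambda>_. Q" "\<lambda>_. {F. kern F}" "\<lambda>_ F. F" CS by (rule Q_rep_seq)
  have AH: "AH_algebra S = A.SQ" unfolding AH_algebra_def ind_limit_def ..
  have RC: "reduced_cstar G = B.SQ" unfolding reduced_cstar_def completion_def ..
  have into: "reps a \<in> CS" if "a \<in> LS" for a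
  proof -
    have "reps a n \<in> Cc G" for n by (rule rep_Cc[OF _ LS_carrier[OF that]]) simp
    then have "(\<forall>n. reps a n \<in> Cc G) \<and> kcauchy (reps a)" using LS_kcauchy[OF that] by (intro conjI allI)
    then show ?thesis by (rule CS_iff[THEN iffD2])
  qed
  define \<Phi> where "\<Phi> p = B.cl (reps (SOME a. a \<in> p))" for p
  have \<Phi>: "\<Phi> (A.cl a) = B.cl (reps a)" if a: "a \<in> LS" for a
  proof -
    define a' where "a' = (SOME a'. a' \<in> A.cl a)"
    have "a' \<in> A.cl a" unfolding a'_def by (rule someI[of "\<lambda>a'. a' \<in> A.cl a", OF A.cl_self[OF a]])
    note a' = A.cl_D[OF a this]
    have "B.cl (reps a') = B.cl (reps a)"
      by (rule B.cl_cong[OF B.X_D[OF into[OF a'(1)]] B.X_D[OF into[OF a]] a'(2)])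
    then show ?thesis by (simp add: \<Phi>_def a'_def)
  qed
  have mem: "p \<in> carrier A.SQ \<longleftrightarrow> (\<exists>a\<in>LS. p = A.cl a)" for p unfolding A.carrier_SQ by blast
  have "cstar_iso A.SQ B.SQ \<Phi>"
    unfolding cstar_iso_def
  proof (intro conjI ballI allI)
    show "\<Phi> \<in> ring_hom A.SQ B.SQ"
    proof (rule ring_hom_memI)
      show "\<Phi> p \<in> carrier B.SQ" if "p \<in> carrier A.SQ" for p
      proof -
        obtain a where "a \<in> LS" "p = A.cl a" using \<open>p \<in> _\<close> unfolding mem by blast
        then show ?thesis using into[of a] \<Phi>[of a] unfolding B.carrier_SQ by blast
      qed
      show "\<Phi> (p \<otimes>\<^bsub>A.SQ\<^esub> q) = \<Phi> p \<otimes>\<^bsub>B.SQ\<^esub> \<Phi> q" if pq: "p \<in> carrier A.SQ" "q \<in> carrier A.SQ" for p q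
      proof -
        obtain a b where ab: "a \<in> LS" "b \<in> LS" "p = A.cl a" "q = A.cl b" using pq unfolding mem by blast
        show ?thesis unfolding ab(3,4) A.SQ_mult[OF ab(1,2)] \<Phi>[OF op_mult(1)[OF ab(1,2)]] \<Phi>[OF ab(1)] \<Phi>[OF ab(2)]
            B.SQ_mult[OF into[OF ab(1)] into[OF ab(2)], unfolded Q_simps(4)] op_mult(2)[OF ab(1,2)] ..
      qed
      show "\<Phi> (p \<oplus>\<^bsub>A.SQ\<^esub> q) = \<Phi> p \<oplus>\<^bsub>B.SQ\<^esub> \<Phi> q" if pq: "p \<in> carrier A.SQ" "q \<in> carrier A.SQ" for p q
      proof -
        obtain a b where ab: "a \<in> LS" "b \<in> LS" "p = A.cl a" "q = A.cl b" using pq unfolding mem by blast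
        show ?thesis unfolding ab(3,4) A.SQ_add[OF ab(1,2)] \<Phi>[OF op_add(1)[OF ab(1,2)]] \<Phi>[OF ab(1)] \<Phi>[OF ab(2)]
            B.SQ_add[OF into[OF ab(1)] into[OF ab(2)], unfolded Q_simps(3)] op_add(2)[OF ab(1,2)] ..
      qed
      have "\<one>\<^bsub>A.SQ\<^esub> = A.cl (\<lambda>n. \<one>\<^bsub>Alg n\<^esub>)" "\<one>\<^bsub>B.SQ\<^esub> = B.cl (\<lambda>_. \<one>\<^bsub>Q\<^esub>)" by (simp_all add: seq_quotient_def)
      then show "\<Phi> \<one>\<^bsub>A.SQ\<^esub> = \<one>\<^bsub>B.SQ\<^esub>" using \<Phi>[OF op_one(1)] op_one(2) by simp
    qed
    show "bij_betw \<Phi> (carrier A.SQ) (carrier B.SQ)"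
      unfolding bij_betw_def
    proof
      show "inj_on \<Phi> (carrier A.SQ)"
      proof (rule inj_onI)
        fix p q assume pq: "p \<in> carrier A.SQ" "q \<in> carrier A.SQ" "\<Phi> p = \<Phi> q"
        obtain a b where ab: "a \<in> LS" "b \<in> LS" "p = A.cl a" "q = A.cl b" using pq(1,2) unfolding mem by blast
        have "B.cl (reps a) = B.cl (reps b)" using pq(3) unfolding ab(3,4) \<Phi>[OF ab(1)] \<Phi>[OF ab(2)] .
        then have "keqv (reps a) (reps b)" unfolding B.cl_eq_iff[OF into[OF ab(1)] into[OF ab(2)]] .
        then show "p = q" unfolding ab(3,4) A.cl_eq_iff[OF ab(1,2)] .
      qed
      show "\<Phi> ` carrier A.SQ = carrier B.SQ"
      proof (intro equalityI subsetI)
        fix q assume "q \<in> \<Phi> ` carrier A.SQ"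
        then obtain a where "a \<in> LS" "q = \<Phi> (A.cl a)" unfolding A.carrier_SQ by blast
        then have "q = B.cl (reps a)" "reps a \<in> CS" using \<Phi> into by blast+
        then show "q \<in> carrier B.SQ" unfolding B.carrier_SQ by (rule image_eqI)
      next
        fix q assume "q \<in> carrier B.SQ"
        then obtain b where b: "b \<in> CS" "q = B.cl b" unfolding B.carrier_SQ by blast
        obtain a where a: "a \<in> LS" "keqv (reps a) b" using rep_limit_surj[OF b(1)] by blast
        have "B.cl (reps a) = B.cl b" using a(2) unfolding B.cl_eq_iff[OF into[OF a(1)] b(1)] .
        then have "q = \<Phi> (A.cl a)" using b(2) \<Phi>[OF a(1)] by simp
        then show "q \<in> \<Phi> ` carrier A.SQ" using mem a(1) by blast
      qed
    qed
  next
    fix z p assume "p \<in> carrier A.SQ"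
    then obtain a where a: "a \<in> LS" "p = A.cl a" unfolding mem by blast
    show "\<Phi> (z \<odot>\<^bsub>A.SQ\<^esub> p) = z \<odot>\<^bsub>B.SQ\<^esub> \<Phi> p"
      unfolding a(2) A.SQ_smult[OF a(1)] \<Phi>[OF op_smult(1)[OF a(1)]] \<Phi>[OF a(1)] B.SQ_smult[OF into[OF a(1)], unfolded Q_simps(5)] op_smult(2)[OF a(1)] ..
  next
    fix p assume "p \<in> carrier A.SQ"
    then obtain a where a: "a \<in> LS" "p = A.cl a" unfolding mem by blast
    show "\<Phi> (star A.SQ p) = star B.SQ (\<Phi> p)"
      unfolding a(2) A.SQ_star[OF a(1)] \<Phi>[OF op_star(1)[OF a(1)]] \<Phi>[OF a(1)] B.SQ_star[OF into[OF a(1)]] op_star(2)[OF a(1)] ..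
    show "cnorm B.SQ (\<Phi> p) = cnorm A.SQ p"
      unfolding a(2) \<Phi>[OF a(1)] using LIMSEQ_unique[OF B.SQ_norm[OF into[OF a(1)]] A.SQ_norm[OF a(1)]] .
  qed
  then show ?thesis unfolding AH RC by blast
qed

end


section \<open>Characters of the diagonal subalgebra\<close>

context AH
begin

interpretation A: rep_seq S Alg "\<lambda>n. carrier (Alg n)" "\<lambda>n. rep (Suc n)" LS by (rule AH_rep_seq)

lemma AH_SQ: "AH_algebra S = A.SQ"
  unfolding AH_algebra_def ind_limit_def ..

lemma carrier_AH: "p \<in> carrier (AH_algebra S) \<longleftrightarrow> (\<exists>a\<in>LS. p = A.cl a)"
  unfolding AH_SQ A.carrier_SQ by blast

lemmas AH_add = A.SQ_add[folded AH_SQ] and AH_mult = A.SQ_mult[folded AH_SQ]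
  and AH_smult = A.SQ_smult[folded AH_SQ] and AH_star = A.SQ_star[folded AH_SQ]

lemma AH_one: "\<one>\<^bsub>AH_algebra S\<^esub> = A.cl (\<lambda>n. \<one>\<^bsub>Alg n\<^esub>)"
  unfolding AH_SQ by (simp add: seq_quotient_def)

lemma cdist_AH:
  assumes a: "a \<in> LS" and b: "b \<in> LS"
  shows "(\<lambda>n. kdist (reps a n) (reps b n)) \<longlonglongrightarrow> cdist (AH_algebra S) (A.cl a) (A.cl b)"
proof -
  have "(\<lambda>n. N (rep (Suc n) (a n \<oplus>\<^bsub>Alg n\<^esub> ((-1) \<odot>\<^bsub>Alg n\<^esub> b n)))) \<longlonglongrightarrow> cdist (AH_algebra S) (A.cl a) (A.cl b)"
    unfolding cdist_def AH_SQ A.SQ_smult[OF b] A.SQ_add[OF a op_smult(1)[OF b]]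
    by (rule A.SQ_norm[OF op_add(1)[OF a op_smult(1)[OF b]]])
  moreover have "N (rep (Suc n) (a n \<oplus>\<^bsub>Alg n\<^esub> ((-1) \<odot>\<^bsub>Alg n\<^esub> b n))) = kdist (reps a n) (reps b n)" for n
    using fun_cong[OF op_add(2)[OF a op_smult(1)[OF b, of "-1"]], of n] fun_cong[OF op_smult(2)[OF b, of "-1"], of n]
    by (simp add: kdist_def)
  ultimately show ?thesis by simp
qed

lemma entry_le_kdist: "kern F \<Longrightarrow> kern K \<Longrightarrow> cmod (F \<gamma> - K \<gamma>) \<le> kdist F K"
  unfolding kdist_def using entry_le_reduced_norm[OF kern_diff] by blast

lemma keqv_entry:
  assumes "\<And>n. kern (F n)" "\<And>n. kern (K n)" "keqv F K" "(\<lambda>n. K n \<gamma>) \<longlonglongrightarrow> l"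
  shows "(\<lambda>n. F n \<gamma>) \<longlonglongrightarrow> l"
proof -
  have "(\<lambda>n. F n \<gamma> - K n \<gamma>) \<longlonglongrightarrow> 0"
    by (rule Lim_null_comparison[OF _ assms(3)[unfolded keqv_def]])
      (use entry_le_kdist[OF assms(1,2)] in \<open>simp add: always_eventually\<close>)
  from tendsto_add[OF this assms(4)] show ?thesis by simp
qed

lemma kcauchy_entry:
  assumes F: "kcauchy F"
  shows "convergent (\<lambda>n. F n \<gamma>)"
proof (rule Cauchy_convergent, rule metric_CauchyI)
  fix \<epsilon> :: real assume "0 < \<epsilon>"
  then obtain M where "\<forall>m\<ge>M. \<forall>n\<ge>M. kdist (F m) (F n) < \<epsilon>" using F unfolding kcauchy_def by blast
  then show "\<exists>M. \<forall>m\<ge>M. \<forall>n\<ge>M. dist (F m \<gamma>) (F n \<gamma>) < \<epsilon>"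
    using entry_le_kdist[OF kcauchy_kern[OF F] kcauchy_kern[OF F]] unfolding dist_norm by (meson le_less_trans)
qed

text \<open>The entry of an element of the limit algebra at an arrow: the limit of the entries of
  the kernels along any representing sequence (\<open>ent_lim\<close>).\<close>

definition ent :: "(nat \<Rightarrow> 'a matfun) set \<Rightarrow> (nat \<Rightarrow> 'e edge \<times> 'a) \<times> (nat \<Rightarrow> 'e edge \<times> 'a) \<Rightarrow> complex" where
  "ent p \<gamma> = lim (\<lambda>n. rep (Suc n) ((SOME a. a \<in> p) n) \<gamma>)"

lemma ent_lim:
  assumes a: "a \<in> LS"
  shows "(\<lambda>n. reps a n \<gamma>) \<longlonglongrightarrow> ent (A.cl a) \<gamma>"
proof -
  define a' where "a' = (SOME a'. a' \<in> A.cl a)"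
  have "a' \<in> A.cl a" unfolding a'_def by (rule someI[of "\<lambda>a'. a' \<in> A.cl a", OF A.cl_self[OF a]])
  note a' = A.cl_D[OF a this]
  obtain l where l: "(\<lambda>n. reps a n \<gamma>) \<longlonglongrightarrow> l"
    using kcauchy_entry[OF LS_kcauchy[OF a]] unfolding convergent_def by blast
  have "(\<lambda>n. reps a' n \<gamma>) \<longlonglongrightarrow> l"
    by (rule keqv_entry[of "reps a'" "reps a"])
      (rule kcauchy_kern[OF LS_kcauchy[OF a]] kcauchy_kern[OF LS_kcauchy[OF a'(1)]] a'(2) l)+
  then have "ent (A.cl a) \<gamma> = l" unfolding ent_def a'_def by (rule limI)
  then show ?thesis using l by simp
qed

text \<open>Entries differ by at most the norm distance, so the Cauchy condition controls all arrows
  simultaneously. Continuity and injectivity of the Gelfand transform of \<open>C\<close> both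
  depend on this uniformity.\<close>

lemma ent_uniform:
  assumes a: "a \<in> LS" and e: "0 < \<epsilon>"
  shows "\<exists>M. \<forall>n\<ge>M. \<forall>\<gamma>. cmod (reps a n \<gamma> - ent (A.cl a) \<gamma>) \<le> \<epsilon>"
proof -
  note k = LS_kcauchy[OF a]
  obtain M where M: "\<forall>m\<ge>M. \<forall>n\<ge>M. kdist (reps a m) (reps a n) < \<epsilon>" using k e unfolding kcauchy_def by blast
  have "cmod (reps a n \<gamma> - ent (A.cl a) \<gamma>) \<le> \<epsilon>" if "n \<ge> M" for n \<gamma>
  proof (rule LIMSEQ_le_const2)
    show "(\<lambda>m. cmod (reps a n \<gamma> - reps a m \<gamma>)) \<longlonglongrightarrow> cmod (reps a n \<gamma> - ent (A.cl a) \<gamma>)"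
      by (intro tendsto_intros ent_lim a)
    have "cmod (reps a n \<gamma> - reps a m \<gamma>) \<le> \<epsilon>" if "m \<ge> M" for m
      using entry_le_kdist[OF kcauchy_kern[OF k, of n] kcauchy_kern[OF k, of m], of \<gamma>] M \<open>n \<ge> M\<close> that by (meson le_less_trans less_imp_le)
    then show "\<exists>M. \<forall>m\<ge>M. cmod (reps a n \<gamma> - reps a m \<gamma>) \<le> \<epsilon>" by blast
  qed
  then show ?thesis by blast
qed

lemma ent_add: "a \<in> LS \<Longrightarrow> b \<in> LS \<Longrightarrow> ent (A.cl a \<oplus>\<^bsub>AH_algebra S\<^esub> A.cl b) \<gamma> = ent (A.cl a) \<gamma> + ent (A.cl b) \<gamma>"
proof -
  assume a: "a \<in> LS" and b: "b \<in> LS"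
  have "(\<lambda>n. reps a n \<gamma> + reps b n \<gamma>) \<longlonglongrightarrow> ent (A.cl a) \<gamma> + ent (A.cl b) \<gamma>" by (intro tendsto_add ent_lim a b)
  moreover have "(\<lambda>n. reps a n \<gamma> + reps b n \<gamma>) \<longlonglongrightarrow> ent (A.cl a \<oplus>\<^bsub>AH_algebra S\<^esub> A.cl b) \<gamma>"
    unfolding AH_add[OF a b] using ent_lim[OF op_add(1)[OF a b], of \<gamma>] fun_cong[OF fun_cong[OF op_add(2)[OF a b]], of _ \<gamma>] by simp
  ultimately show ?thesis using LIMSEQ_unique by blast
qed

lemma ent_smult: "a \<in> LS \<Longrightarrow> ent (z \<odot>\<^bsub>AH_algebra S\<^esub> A.cl a) \<gamma> = z * ent (A.cl a) \<gamma>"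
proof -
  assume a: "a \<in> LS"
  have "(\<lambda>n. z * reps a n \<gamma>) \<longlonglongrightarrow> z * ent (A.cl a) \<gamma>" by (intro tendsto_mult_left ent_lim a)
  moreover have "(\<lambda>n. z * reps a n \<gamma>) \<longlonglongrightarrow> ent (z \<odot>\<^bsub>AH_algebra S\<^esub> A.cl a) \<gamma>"
    unfolding AH_smult[OF a] using ent_lim[OF op_smult(1)[OF a], of z \<gamma>] fun_cong[OF fun_cong[OF op_smult(2)[OF a, of z]], of _ \<gamma>] by simp
  ultimately show ?thesis using LIMSEQ_unique by blast
qed

lemma ent_one: "ent \<one>\<^bsub>AH_algebra S\<^esub> \<gamma> = \<one>\<^bsub>Q\<^esub> \<gamma>"
proof -
  have "(\<lambda>n. \<one>\<^bsub>Q\<^esub> \<gamma>) \<longlonglongrightarrow> ent \<one>\<^bsub>AH_algebra S\<^esub> \<gamma>"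
    unfolding AH_one using ent_lim[OF op_one(1), of \<gamma>] fun_cong[OF fun_cong[OF op_one(2)], of _ \<gamma>] by simp
  then show ?thesis using LIMSEQ_unique tendsto_const by blast
qed

text \<open>Compatible families of subalgebras, such as \<open>C_level S\<close> and \<open>B_level S\<close>.\<close>

definition fam :: "(nat \<Rightarrow> 'a matfun set) \<Rightarrow> bool" where
  "fam L \<longleftrightarrow> (\<forall>n\<ge>1. L n \<subseteq> carrier (alg S n) \<and> \<zero>\<^bsub>alg S n\<^esub> \<in> L n \<and> \<one>\<^bsub>alg S n\<^esub> \<in> L n \<and>
     (\<forall>f\<in>L n. phi S n f \<in> L (Suc n) \<and> (\<forall>z. z \<odot>\<^bsub>alg S n\<^esub> f \<in> L n) \<and>
       (\<forall>g\<in>L n. f \<oplus>\<^bsub>alg S n\<^esub> g \<in> L n \<and> f \<otimes>\<^bsub>alg S n\<^esub> g \<in> L n)))"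

definition famseq :: "(nat \<Rightarrow> 'a matfun set) \<Rightarrow> (nat \<Rightarrow> 'a matfun) set" where
  "famseq L = {a \<in> LS. \<forall>n. a n \<in> L (Suc n)}"

text \<open>The sequence used in \<open>limit_map\<close> for an element of level \<open>n\<close>:
  zero up to index \<open>n - 2\<close> and its images from index \<open>n - 1\<close> on, since
  index \<open>k\<close> stands for level \<open>k + 1\<close>.\<close>

definition thr :: "nat \<Rightarrow> 'a matfun \<Rightarrow> nat \<Rightarrow> 'a matfun" where
  "thr n f k = (if k < n - 1 then \<zero>\<^bsub>Alg k\<^esub> else tr (n - 1) (k - (n - 1)) f)"

lemma thr:
  assumes n: "1 \<le> n" and f: "f \<in> carrier (alg S n)"
  shows "embed S n f = A.cl (thr n f)" "thr n f \<in> LS" "\<And>k. n - 1 \<le> k \<Longrightarrow> reps (thr n f) k = rep n f"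
    "\<And>k. k < n - 1 \<Longrightarrow> reps (thr n f) k = (\<lambda>_. 0)"
proof -
  have f': "f \<in> carrier (Alg (n - 1))" "Suc (n - 1) = n" using n f by auto
  show "embed S n f = A.cl (thr n f)" unfolding embed_def limit_map_def thr_def ..
  have c: "thr n f k \<in> carrier (Alg k)" for k
    using rep_transit[OF f'(1), of "k - (n - 1)"] zero_alg_carrier by (auto simp: thr_def)
  have r: "reps (thr n f) k = rep n f" if "n - 1 \<le> k" for k
  proof -
    have "n - 1 + (k - (n - 1)) = k" using that by simp
    then have "rep (Suc k) (tr (n - 1) (k - (n - 1)) f) = rep (Suc (n - 1)) f"
      using rep_transit[OF f'(1), of "k - (n - 1)"] by simp
    then show ?thesis using that f'(2) by (simp add: thr_def)
  qed
  show "\<And>k. n - 1 \<le> k \<Longrightarrow> reps (thr n f) k = rep n f" by (rule r)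
  show "\<And>k. k < n - 1 \<Longrightarrow> reps (thr n f) k = (\<lambda>_. 0)" by (simp add: thr_def rep_zero)
  have "kcauchy (reps (thr n f))"
    unfolding kcauchy_def
  proof (intro conjI allI impI)
    show "kern (reps (thr n f) k)" for k by (rule kern_rep[OF _ c]) simp
    fix \<epsilon> :: real assume "0 < \<epsilon>"
    then show "\<exists>M. \<forall>k\<ge>M. \<forall>l\<ge>M. kdist (reps (thr n f) k) (reps (thr n f) l) < \<epsilon>"
      using r by (intro exI[of _ "n - 1"]) simp
  qed
  then show "thr n f \<in> LS" using c by (intro LSI[OF _ refl])
qed

lemma thr_fam:
  assumes n: "1 \<le> n" and L: "fam L" and f: "f \<in> L n"
  shows "thr n f k \<in> L (Suc k)"
proof -
  have "tr (n - 1) d f \<in> L (Suc (n - 1 + d))" for d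
  proof (induction d)
    case (Suc d)
    then show ?case using L unfolding fam_def by simp
  qed (use n f in simp)
  from this[of "k - (n - 1)"] show ?thesis using L unfolding fam_def thr_def by auto
qed

text \<open>The closure of the union consists of the classes of sequences whose terms lie in the
  family, so closedness under the operations can be checked termwise. Freezing such a sequence at a
  late index gives nearby embedded elements; conversely, \<open>limit_approx\<close> replaces a
  representative of a limit point by one with terms in the family.\<close>

lemma closure_fam:
  assumes L: "fam L"
  shows "closure_in (AH_algebra S) (\<Union>n\<in>{1..}. embed S n ` L n) = A.cl ` famseq L"
proof (intro equalityI subsetI)
  have LA: "L n \<subseteq> carrier (alg S n)" if "1 \<le> n" for n using L that unfolding fam_def by blast
  fix p assume "p \<in> A.cl ` famseq L"
  then obtain a where a: "a \<in> LS" "\<And>n. a n \<in> L (Suc n)" "p = A.cl a" unfolding famseq_def by blast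
  have "\<exists>y\<in>(\<Union>n\<in>{1..}. embed S n ` L n). cdist (AH_algebra S) p y < \<epsilon>" if \<epsilon>: "0 < \<epsilon>" for \<epsilon>
  proof -
    have e: "0 < \<epsilon> / 2" using \<epsilon> by simp
    obtain M where M: "\<forall>m\<ge>M. \<forall>n\<ge>M. kdist (reps a m) (reps a n) < \<epsilon> / 2"
      using LS_kcauchy[OF a(1)] e unfolding kcauchy_def by blast
    have aM: "a M \<in> carrier (alg S (Suc M))" using LS_carrier[OF a(1)] .
    note t = thr[OF _ aM, simplified]
    have "cdist (AH_algebra S) p (embed S (Suc M) (a M)) \<le> \<epsilon> / 2"
      unfolding t(1) a(3)
    proof (rule LIMSEQ_le_const2[OF cdist_AH[OF a(1) t(2)]])
      show "\<exists>K. \<forall>k\<ge>K. kdist (reps a k) (reps (thr (Suc M) (a M)) k) \<le> \<epsilon> / 2"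
        using t(3) M by (intro exI[of _ M]) (auto intro: less_imp_le)
    qed
    then have "cdist (AH_algebra S) p (embed S (Suc M) (a M)) < \<epsilon>" using \<epsilon> by simp
    moreover have "embed S (Suc M) (a M) \<in> (\<Union>n\<in>{1..}. embed S n ` L n)" using a(2)[of M] by force
    ultimately show ?thesis by blast
  qed
  moreover have "p \<in> carrier (AH_algebra S)" using a carrier_AH by blast
  ultimately show "p \<in> closure_in (AH_algebra S) (\<Union>n\<in>{1..}. embed S n ` L n)" unfolding closure_in_def by blast
next
  have LA: "L n \<subseteq> carrier (alg S n)" if "1 \<le> n" for n using L that unfolding fam_def by blast
  fix p assume p: "p \<in> closure_in (AH_algebra S) (\<Union>n\<in>{1..}. embed S n ` L n)"
  then obtain b where b: "b \<in> LS" "p = A.cl b" unfolding closure_in_def carrier_AH by blast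
  have "\<exists>a\<in>LS. (\<forall>n. a n \<in> L (Suc n)) \<and> keqv (reps a) (reps b)"
  proof (rule limit_approx[of "\<lambda>n. L (Suc n)", OF _ _ LS_kcauchy[OF b(1)]])
    show "L (Suc n) \<subseteq> carrier (Alg n)" for n by (rule LA) simp
    show "L (Suc n) \<noteq> {}" for n using L unfolding fam_def by (metis empty_iff le_add1 plus_1_eq_Suc)
    fix \<epsilon> :: real assume "0 < \<epsilon>"
    then obtain y where y: "y \<in> (\<Union>n\<in>{1..}. embed S n ` L n)" "cdist (AH_algebra S) p y < \<epsilon>"
      using p unfolding closure_in_def by blast
    then obtain n f where f: "1 \<le> n" "f \<in> L n" "y = embed S n f" by auto
    note fc = subsetD[OF LA[OF f(1)] f(2)]
    note t = thr[OF f(1) fc]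
    have "cdist (AH_algebra S) (A.cl b) (A.cl (thr n f)) < \<epsilon>" using y(2) b(2) f(3) t(1) by simp
    from order_tendstoD(2)[OF cdist_AH[OF b(1) t(2)] this]
    obtain n0 where n0: "\<forall>k\<ge>n0. kdist (reps b k) (reps (thr n f) k) < \<epsilon>" unfolding eventually_sequentially by blast
    have "kdist (reps (thr n f) k) (reps b k) = kdist (reps b k) (reps (thr n f) k)" for k
      by (rule kdist_sym) (rule kcauchy_kern LS_kcauchy t(2) b(1))+
    then have "\<forall>k\<ge>n0. \<exists>f\<in>L (Suc k). kdist (rep (Suc k) f) (reps b k) < \<epsilon>"
      using n0 thr_fam[OF f(1) L f(2)] by metis
    then show "\<exists>n0. \<forall>k\<ge>n0. \<exists>f\<in>L (Suc k). kdist (rep (Suc k) f) (reps b k) < \<epsilon>" by blast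
  qed
  then obtain a where a: "a \<in> LS" "\<forall>n. a n \<in> L (Suc n)" "keqv (reps a) (reps b)" by blast
  have "p = A.cl a" unfolding b(2) using A.cl_eq_iff[OF a(1) b(1)] a(3) by blast
  then show "p \<in> A.cl ` famseq L" using a unfolding famseq_def by blast
qed

lemma famseq_ops:
  assumes L: "fam L" and a: "a \<in> famseq L" and b: "b \<in> famseq L"
  shows "(\<lambda>n. a n \<oplus>\<^bsub>Alg n\<^esub> b n) \<in> famseq L" "(\<lambda>n. a n \<otimes>\<^bsub>Alg n\<^esub> b n) \<in> famseq L"
    "(\<lambda>n. z \<odot>\<^bsub>Alg n\<^esub> a n) \<in> famseq L" "(\<lambda>n. \<one>\<^bsub>Alg n\<^esub>) \<in> famseq L"
proof -
  have m: "a \<in> LS" "b \<in> LS" and l: "\<And>n. a n \<in> L (Suc n)" "\<And>n. b n \<in> L (Suc n)"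
    using a b unfolding famseq_def by blast+
  have "a n \<oplus>\<^bsub>Alg n\<^esub> b n \<in> L (Suc n)" "a n \<otimes>\<^bsub>Alg n\<^esub> b n \<in> L (Suc n)"
    "z \<odot>\<^bsub>Alg n\<^esub> a n \<in> L (Suc n)" "\<one>\<^bsub>Alg n\<^esub> \<in> L (Suc n)" for n
    using L l[of n] unfolding fam_def by simp_all
  then show "(\<lambda>n. a n \<oplus>\<^bsub>Alg n\<^esub> b n) \<in> famseq L" "(\<lambda>n. a n \<otimes>\<^bsub>Alg n\<^esub> b n) \<in> famseq L"
    "(\<lambda>n. z \<odot>\<^bsub>Alg n\<^esub> a n) \<in> famseq L" "(\<lambda>n. \<one>\<^bsub>Alg n\<^esub>) \<in> famseq L"
    using op_add(1)[OF m] op_mult(1)[OF m] op_smult(1)[OF m(1)] op_one(1) unfolding famseq_def by simp_all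
qed

lemma fam_C: "fam (C_level S)"
  unfolding fam_def
proof (intro allI impI conjI ballI)
  fix n :: nat assume n: "1 \<le> n"
  note iff = C_level_iff[OF n]
  show "C_level S n \<subseteq> carrier (alg S n)" using iff by blast
  show "\<zero>\<^bsub>alg S n\<^esub> \<in> C_level S n" using iff zero_alg_carrier by (simp add: rep_zero[OF n])
  show "\<one>\<^bsub>alg S n\<^esub> \<in> C_level S n" using iff one_carrier by (simp add: rep_one[OF n] Q_simps tail_rel_0)
  fix f assume f: "f \<in> C_level S n"
  then have fc: "f \<in> carrier (alg S n)" and f0: "\<And>x y. x \<noteq> y \<Longrightarrow> rep n f (x, y) = 0" using iff by blast+
  show "phi S n f \<in> C_level S (Suc n)"
    using C_level_iff[of "Suc n"] phi_carrier[OF n fc] f0 by (simp add: rep_phi[OF n fc])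
  show "z \<odot>\<^bsub>alg S n\<^esub> f \<in> C_level S n" for z
    using iff smult_carrier[OF fc] f0 by (simp add: rep_smult[OF n fc])
  fix g assume g: "g \<in> C_level S n"
  then have gc: "g \<in> carrier (alg S n)" and g0: "\<And>x y. x \<noteq> y \<Longrightarrow> rep n g (x, y) = 0" using iff by blast+
  show "f \<oplus>\<^bsub>alg S n\<^esub> g \<in> C_level S n" using iff add_carrier[OF fc gc] f0 g0 by (simp add: rep_add[OF n fc gc])
  have "conv G (rep n f) (rep n g) (x, z) = 0" if "x \<noteq> z" for x z
    unfolding conv_eq[OF supp_rep rep_arrows]
  proof (intro sum.neutral ballI)
    fix y show "rep n f (x, y) * rep n g (y, z) = 0" using f0[of x y] g0[of y z] that by (cases "x = y") simp_all
  qed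
  then show "f \<otimes>\<^bsub>alg S n\<^esub> g \<in> C_level S n" using iff mult_carrier[OF fc gc] by (simp add: rep_mult[OF n fc gc])
qed

lemma B_levelI: "(\<And>i. i < nsum S n \<Longrightarrow> M i \<in> carrier_mat (msize S n i) (msize S n i)) \<Longrightarrow>
    f = (\<lambda>(i, t)\<in>points S n. M i) \<Longrightarrow> f \<in> B_level S n"
  unfolding B_level_def by blast

lemma fam_B: "fam (B_level S)"
  unfolding fam_def
proof (intro allI impI conjI ballI)
  fix n :: nat assume n: "1 \<le> n"
  show "B_level S n \<subseteq> carrier (alg S n)"
  proof (rule subsetI)
    fix f assume "f \<in> B_level S n"
    then obtain M where M: "\<And>i. i < nsum S n \<Longrightarrow> M i \<in> carrier_mat (msize S n i) (msize S n i)"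
      "f = (\<lambda>(i, t)\<in>points S n. M i)" unfolding B_level_def by blast
    have "f = mk n (\<lambda>i t a b. M i $$ (a, b))"
      by (rule alg_eq_mk) (use M(1) in \<open>simp_all add: M(2) points_def\<close>)
    moreover have "mk n (\<lambda>i t a b. M i $$ (a, b)) \<in> carrier (alg S n)" by (intro mk_carrier) auto
    ultimately show "f \<in> carrier (alg S n)" by simp
  qed
  show "\<zero>\<^bsub>alg S n\<^esub> \<in> B_level S n" by (rule B_levelI[of _ "\<lambda>i. 0\<^sub>m (msize S n i) (msize S n i)"]) (simp_all add: alg_def)
  show "\<one>\<^bsub>alg S n\<^esub> \<in> B_level S n" by (rule B_levelI[of _ "\<lambda>i. 1\<^sub>m (msize S n i)"]) (simp_all add: alg_def)
  fix f assume "f \<in> B_level S n"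
  then obtain M where M: "\<And>i. i < nsum S n \<Longrightarrow> M i \<in> carrier_mat (msize S n i) (msize S n i)"
      "f = (\<lambda>(i, t)\<in>points S n. M i)" unfolding B_level_def by blast
  show "z \<odot>\<^bsub>alg S n\<^esub> f \<in> B_level S n" for z
    by (rule B_levelI[of _ "\<lambda>i. z \<cdot>\<^sub>m M i"]) (use M(1) in \<open>auto simp: alg_def M(2) fun_eq_iff restrict_def\<close>)
  show "phi S n f \<in> B_level S (Suc n)"
  proof (rule B_levelI[of _ "\<lambda>j. diag_block_mat (map (\<lambda>(i, e). M i) (blocks S n j))"])
    fix j assume j: "j < nsum S (Suc n)"
    have "(\<lambda>(i, e). M i) b \<in> carrier_mat ((\<lambda>(i, e). msize S n i) b) ((\<lambda>(i, e). msize S n i) b)" if "b \<in> set (blocks S n j)" for b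
      using that M(1) by (auto simp: set_blocks[OF n j])
    then show "diag_block_mat (map (\<lambda>(i, e). M i) (blocks S n j)) \<in> carrier_mat (msize S (Suc n) j) (msize S (Suc n) j)"
      unfolding msize_Suc[OF n j] by (intro diag_block_mat_dims)
  next
    show "phi S n f = (\<lambda>(j, t)\<in>points S (Suc n). diag_block_mat (map (\<lambda>(i, e). M i) (blocks S n j)))"
      unfolding phi_def
    proof (rule restrict_ext, clarify)
      fix j t assume "(j, t) \<in> points S (Suc n)"
      then have j: "j < nsum S (Suc n)" "t \<in> topspace (space_at S (Suc n) j)" by (auto simp: points_def)
      have "f (i, eig S n i j e t) = M i" if "(i, e) \<in> set (blocks S n j)" for i e
        using that eig_mem[OF n _ j(1) _ j(2)] by (simp add: M(2) points_def set_blocks[OF n j(1)])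
      then show "diag_block_mat (map (\<lambda>(i, e). f (i, eig S n i j e t)) (blocks S n j)) =
          diag_block_mat (map (\<lambda>(i, e). M i) (blocks S n j))"
        by (intro arg_cong[of _ _ diag_block_mat] map_cong refl) auto
    qed
  qed
  fix g assume "g \<in> B_level S n"
  then obtain K where K: "\<And>i. i < nsum S n \<Longrightarrow> K i \<in> carrier_mat (msize S n i) (msize S n i)"
      "g = (\<lambda>(i, t)\<in>points S n. K i)" unfolding B_level_def by blast
  show "f \<oplus>\<^bsub>alg S n\<^esub> g \<in> B_level S n"
    by (rule B_levelI[of _ "\<lambda>i. M i + K i"]) (use M(1) K(1) in \<open>auto simp: alg_def M(2) K(2) fun_eq_iff restrict_def\<close>)
  show "f \<otimes>\<^bsub>alg S n\<^esub> g \<in> B_level S n"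
  proof (rule B_levelI[of _ "\<lambda>i. M i * K i"])
    show "M i * K i \<in> carrier_mat (msize S n i) (msize S n i)" if "i < nsum S n" for i
      by (rule mult_carrier_mat[OF M(1) K(1)]) (rule that)+
  qed (auto simp: alg_def M(2) K(2) fun_eq_iff restrict_def)
qed

end

section \<open>Evaluations at labelled paths as the characters of the diagonal\<close>

context AH
begin

interpretation A: rep_seq S Alg "\<lambda>n. carrier (Alg n)" "\<lambda>n. rep (Suc n)" LS by (rule AH_rep_seq)

abbreviation "CA \<equiv> C_algebra S"
abbreviation "CL \<equiv> famseq (C_level S)"

lemma carrier_CA: "carrier CA = A.cl ` CL"
  unfolding C_algebra_def using closure_fam[OF fam_C] by simp

lemma CA_ops: "mult CA = mult (AH_algebra S)" "add CA = add (AH_algebra S)" "smult CA = smult (AH_algebra S)"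
  "one CA = one (AH_algebra S)"
  by (simp_all add: C_algebra_def)

lemma CL_LS: "a \<in> CL \<Longrightarrow> a \<in> LS"
  by (simp add: famseq_def)

lemma CL_offdiag: "a \<in> CL \<Longrightarrow> x \<noteq> y \<Longrightarrow> reps a n (x, y) = 0"
  using C_level_iff[of "Suc n" "a n"] by (simp add: famseq_def)

lemma CLI: "a \<in> LS \<Longrightarrow> (\<And>n x y. x \<noteq> y \<Longrightarrow> reps a n (x, y) = 0) \<Longrightarrow> a \<in> CL"
  using C_level_iff LS_carrier by (simp add: famseq_def)

definition ev :: "(nat \<Rightarrow> 'e edge \<times> 'a) \<Rightarrow> (nat \<Rightarrow> 'a matfun) set \<Rightarrow> complex" where
  "ev y = (\<lambda>p\<in>carrier CA. ent p (y, y))"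

lemma ev_cl: "a \<in> CL \<Longrightarrow> ev y (A.cl a) = ent (A.cl a) (y, y)"
  by (simp add: ev_def carrier_CA)

lemma CA_closed:
  assumes "p \<in> carrier CA" "q \<in> carrier CA"
  shows "p \<oplus>\<^bsub>CA\<^esub> q \<in> carrier CA" "p \<otimes>\<^bsub>CA\<^esub> q \<in> carrier CA" "z \<odot>\<^bsub>CA\<^esub> p \<in> carrier CA" "\<one>\<^bsub>CA\<^esub> \<in> carrier CA"
proof -
  obtain a b where ab: "a \<in> CL" "b \<in> CL" "p = A.cl a" "q = A.cl b" using assms unfolding carrier_CA by blast
  note f = famseq_ops[OF fam_C ab(1,2)]
  show "p \<oplus>\<^bsub>CA\<^esub> q \<in> carrier CA"
    unfolding CA_ops ab(3,4) AH_add[OF CL_LS[OF ab(1)] CL_LS[OF ab(2)]] carrier_CA using f(1) by (rule imageI)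
  show "p \<otimes>\<^bsub>CA\<^esub> q \<in> carrier CA"
    unfolding CA_ops ab(3,4) AH_mult[OF CL_LS[OF ab(1)] CL_LS[OF ab(2)]] carrier_CA using f(2) by (rule imageI)
  show "z \<odot>\<^bsub>CA\<^esub> p \<in> carrier CA"
    unfolding CA_ops ab(3) AH_smult[OF CL_LS[OF ab(1)]] carrier_CA using f(3) by (rule imageI)
  show "\<one>\<^bsub>CA\<^esub> \<in> carrier CA"
    unfolding CA_ops AH_one carrier_CA using f(4) by (rule imageI)
qed

text \<open>For multiplicativity: kernels from \<open>C\<close> vanish off the diagonal, so in the
  convolution at \<open>(y, y)\<close> only the term with middle path \<open>y\<close>
  survives.\<close>

lemma ev_ops:
  assumes "p \<in> carrier CA" "q \<in> carrier CA"
  shows "ev y (p \<oplus>\<^bsub>CA\<^esub> q) = ev y p + ev y q" "ev y (z \<odot>\<^bsub>CA\<^esub> p) = z * ev y p"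
    "y \<in> P \<Longrightarrow> ev y (p \<otimes>\<^bsub>CA\<^esub> q) = ev y p * ev y q" "y \<in> P \<Longrightarrow> ev y \<one>\<^bsub>CA\<^esub> = 1"
proof -
  obtain a b where ab: "a \<in> CL" "b \<in> CL" "p = A.cl a" "q = A.cl b" using assms unfolding carrier_CA by blast
  note LS = CL_LS[OF ab(1)] CL_LS[OF ab(2)]
  note c = CA_closed[OF assms]
  show "ev y (p \<oplus>\<^bsub>CA\<^esub> q) = ev y p + ev y q"
    using c(1) assms ent_add[OF LS, of "(y, y)"] unfolding ev_def CA_ops ab(3,4) by simp
  show "ev y (z \<odot>\<^bsub>CA\<^esub> p) = z * ev y p"
    using c(3)[of z] assms ent_smult[OF LS(1), of z "(y, y)"] unfolding ev_def CA_ops ab(3) by simp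
  show "ev y (p \<otimes>\<^bsub>CA\<^esub> q) = ev y p * ev y q" if y: "y \<in> P"
  proof -
    have "reps (\<lambda>n. a n \<otimes>\<^bsub>Alg n\<^esub> b n) n (y, y) = reps a n (y, y) * reps b n (y, y)" for n
    proof -
      have "reps (\<lambda>n. a n \<otimes>\<^bsub>Alg n\<^esub> b n) n (y, y) = (\<Sum>z\<in>cls (Suc n) y. reps a n (y, z) * reps b n (z, y))"
        unfolding fun_cong[OF op_mult(2)[OF LS], of n] conv_eq[OF supp_rep rep_arrows] ..
      also have "\<dots> = (\<Sum>z\<in>{y}. reps a n (y, z) * reps b n (z, y))"
        by (rule sum.mono_neutral_right[OF finite_cls])
          (use CL_offdiag[OF ab(1)] tail_rel_refl[OF y] in \<open>auto simp: cls_def\<close>)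
      finally show ?thesis by simp
    qed
    then have "(\<lambda>n. reps a n (y, y) * reps b n (y, y)) \<longlonglongrightarrow> ent (p \<otimes>\<^bsub>CA\<^esub> q) (y, y)"
      using ent_lim[OF op_mult(1)[OF LS], of "(y, y)"] unfolding CA_ops ab(3,4) AH_mult[OF LS] by simp
    moreover have "(\<lambda>n. reps a n (y, y) * reps b n (y, y)) \<longlonglongrightarrow> ent p (y, y) * ent q (y, y)"
      unfolding ab(3,4) by (intro tendsto_mult ent_lim LS)
    ultimately have "ent (p \<otimes>\<^bsub>CA\<^esub> q) (y, y) = ent p (y, y) * ent q (y, y)" using LIMSEQ_unique by blast
    then show ?thesis using c(2) assms by (simp add: ev_def)
  qed
  show "ev y \<one>\<^bsub>CA\<^esub> = 1" if y: "y \<in> P"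
    using c(4) y ent_one[of "(y, y)"] unfolding ev_def CA_ops by (simp add: Q_simps tail_rel_0)
qed

lemma one_CA: "\<one>\<^bsub>CA\<^esub> \<in> carrier CA"
  unfolding CA_ops AH_one carrier_CA
proof (rule imageI, rule CLI[OF op_one(1)])
  fix n and x y :: "nat \<Rightarrow> 'e edge \<times> 'a" assume "x \<noteq> y"
  then show "reps (\<lambda>n. \<one>\<^bsub>Alg n\<^esub>) n (x, y) = 0"
    using fun_cong[OF op_one(2), of n] by (simp add: Q_simps tail_rel_0)
qed

lemma ev_character: "y \<in> P \<Longrightarrow> ev y \<in> characters CA"
  unfolding characters_def
proof (intro CollectI conjI ballI allI)
  assume y: "y \<in> P"
  show "ev y \<in> extensional (carrier CA)" by (simp add: ev_def)
  show "\<exists>p\<in>carrier CA. ev y p \<noteq> 0" using ev_ops(4)[OF one_CA one_CA y] one_CA by (intro bexI[of _ "\<one>\<^bsub>CA\<^esub>"]) simp_all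
  fix p q z assume p: "p \<in> carrier CA"
  show "ev y (z \<odot>\<^bsub>CA\<^esub> p) = z * ev y p" by (rule ev_ops(2)[OF p p])
  assume q: "q \<in> carrier CA"
  show "ev y (p \<oplus>\<^bsub>CA\<^esub> q) = ev y p + ev y q" by (rule ev_ops(1)[OF p q])
  show "ev y (p \<otimes>\<^bsub>CA\<^esub> q) = ev y p * ev y q" by (rule ev_ops(3)[OF p q y])
qed

lemma continuous_diag:
  assumes "F \<in> Cc G"
  shows "continuous_map T euclidean (\<lambda>y. F (y, y))"
proof -
  have "continuous_map T (subtopology TT (R 0)) (\<lambda>y. (y, y))"
    unfolding continuous_map_in_subtopology
    by (auto simp: topspace_lab_path_space tail_rel_0 intro!: continuous_map_pairedI)
  from continuous_map_compose[OF this Cc_continuous[OF assms]] show ?thesis by (simp add: o_def)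
qed

text \<open>By \<open>ent_uniform\<close> the function is a uniform limit of the diagonals of
  kernels of levels, which are continuous; the rest is the usual division of \<epsilon> by
  3.\<close>

lemma continuous_ev:
  assumes "p \<in> carrier CA"
  shows "continuous_map T euclidean (\<lambda>y. ev y p)"
proof -
  obtain a where a: "a \<in> CL" "p = A.cl a" using assms unfolding carrier_CA by blast
  have u: "ev y p = ent (A.cl a) (y, y)" for y unfolding a(2) by (rule ev_cl[OF a(1)])
  have ac: "a n \<in> carrier (Alg n)" for n by (rule LS_carrier[OF CL_LS[OF a(1)]])
  show ?thesis
    unfolding continuous_map_def
  proof (intro conjI allI impI)
    fix V :: "complex set" assume "openin euclidean V"
    then have V: "open V" by simp
    show "openin T {y \<in> topspace T. ev y p \<in> V}"
    proof (subst openin_subopen, intro ballI)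
      fix y0 assume y0: "y0 \<in> {y \<in> topspace T. ev y p \<in> V}"
      then obtain \<epsilon> where \<epsilon>: "0 < \<epsilon>" "ball (ev y0 p) \<epsilon> \<subseteq> V" using V openE by blast
      have e: "0 < \<epsilon> / 3" using \<epsilon> by simp
      obtain n where n: "\<And>\<gamma>. cmod (reps a n \<gamma> - ent (A.cl a) \<gamma>) \<le> \<epsilon> / 3"
        using ent_uniform[OF CL_LS[OF a(1)] e] by blast
      have g: "continuous_map T euclidean (\<lambda>y. reps a n (y, y))"
        by (intro continuous_diag rep_Cc ac) simp
      let ?W = "{y \<in> topspace T. reps a n (y, y) \<in> ball (reps a n (y0, y0)) (\<epsilon> / 3)}"
      have "openin T ?W" by (rule openin_continuous_map_preimage[OF g]) simp
      moreover have "y0 \<in> ?W" using y0 e by simp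
      moreover have "?W \<subseteq> {y \<in> topspace T. ev y p \<in> V}"
      proof
        fix y assume y: "y \<in> ?W"
        have "cmod (ev y0 p - ev y p) \<le> cmod (ev y0 p - reps a n (y0, y0)) + cmod (reps a n (y0, y0) - reps a n (y, y)) + cmod (reps a n (y, y) - ev y p)"
          using norm_triangle_ineq[of "ev y0 p - reps a n (y0, y0)" "reps a n (y0, y0) - ev y p"]
            norm_triangle_ineq[of "reps a n (y0, y0) - reps a n (y, y)" "reps a n (y, y) - ev y p"] by simp
        also have "\<dots> < \<epsilon> / 3 + \<epsilon> / 3 + \<epsilon> / 3"
          using n[of "(y0, y0)"] n[of "(y, y)"] y unfolding u
          by (intro add_less_le_mono add_le_less_mono) (auto simp: dist_norm norm_minus_commute)
        finally have "ev y p \<in> ball (ev y0 p) \<epsilon>" by (simp add: dist_norm)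
        then show "y \<in> {y \<in> topspace T. ev y p \<in> V}" using y \<epsilon>(2) by blast
      qed
      ultimately show "\<exists>W. openin T W \<and> y0 \<in> W \<and> W \<subseteq> {y \<in> topspace T. ev y p \<in> V}" by blast
    qed
  qed simp
qed

text \<open>The unit space \<open>R 0\<close> is open and closed among the arrows, so a continuous
  function on it extends by zero.\<close>

lemma Cc_diag:
  assumes u: "continuous_map T euclidean u"
  shows "(\<lambda>\<gamma>. if \<gamma> \<in> R 0 then u (fst \<gamma>) else 0) \<in> Cc G"
proof (rule supp_Cc)
  let ?F = "\<lambda>\<gamma>. if \<gamma> \<in> R 0 then u (fst \<gamma>) else (0 :: complex)"
  show "supp 0 ?F" by (simp add: supp_def)
  have c: "continuous_map TG euclidean (\<lambda>\<gamma>. u (fst \<gamma>))"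
    using continuous_map_compose[OF continuous_map_compose[OF continuous_TG_TT continuous_map_fst] u] by (simp add: o_def)
  show "continuous_map TG euclidean ?F"
    unfolding continuous_map_def
  proof (intro conjI allI impI)
    fix V :: "complex set" assume V: "openin euclidean V"
    have 1: "openin TG (R 0 \<inter> {\<gamma> \<in> topspace TG. u (fst \<gamma>) \<in> V})"
      by (intro openin_Int openin_TG_tail_rel openin_continuous_map_preimage[OF c V])
    have 2: "openin TG (topspace TG - R 0)" using closedin_TG_tail_rel by (simp add: closedin_def)
    have "{\<gamma> \<in> topspace TG. ?F \<gamma> \<in> V} = (R 0 \<inter> {\<gamma> \<in> topspace TG. u (fst \<gamma>) \<in> V}) \<union> (if 0 \<in> V then topspace TG - R 0 else {})"
      by auto
    then show "openin TG {\<gamma> \<in> topspace TG. ?F \<gamma> \<in> V}" using 1 2 by (simp add: openin_Un)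
  qed simp
qed

text \<open>The Gelfand transform of \<open>C\<close> reaches every continuous function on the path
  space: \<open>Cc_approx\<close> with \<open>m = 0\<close> keeps the approximants on the diagonal,
  hence in \<open>C_level\<close> by \<open>C_level_iff\<close>.\<close>

lemma ev_surj:
  assumes u: "continuous_map T euclidean u"
  shows "\<exists>c\<in>carrier CA. \<forall>y\<in>P. ev y c = u y"
proof -
  let ?F = "\<lambda>\<gamma>. if \<gamma> \<in> R 0 then u (fst \<gamma>) else (0 :: complex)"
  have F: "?F \<in> Cc G" "supp 0 ?F" using Cc_diag[OF u] by (simp_all add: supp_def)
  have k: "kern ?F" by (rule kern_Cc[OF F(1)])
  have "\<exists>a\<in>LS. (\<forall>n. a n \<in> C_level S (Suc n)) \<and> keqv (reps a) (\<lambda>_. ?F)"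
  proof (rule limit_approx[of "\<lambda>n. C_level S (Suc n)", OF _ _ kcauchy_const[OF k]])
    show "C_level S (Suc n) \<subseteq> carrier (Alg n)" for n by (auto simp: C_level_def)
    show "C_level S (Suc n) \<noteq> {}" for n using fam_C unfolding fam_def by (metis empty_iff le_add1 plus_1_eq_Suc)
    fix \<epsilon> :: real assume "0 < \<epsilon>"
    from Cc_approx[OF F this] obtain n0 where n0: "\<forall>n\<ge>n0. \<exists>f\<in>carrier (Alg n). supp 0 (rep (Suc n) f) \<and> kdist (rep (Suc n) f) ?F < \<epsilon>" by blast
    have "\<exists>f\<in>C_level S (Suc n). kdist (rep (Suc n) f) ?F < \<epsilon>" if nn: "n \<ge> n0" for n
    proof -
      obtain f where f: "f \<in> carrier (Alg n)" "supp 0 (rep (Suc n) f)" "kdist (rep (Suc n) f) ?F < \<epsilon>" using n0 nn by blast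
      have "rep (Suc n) f (x, y) = 0" if "x \<noteq> y" for x y using suppD[OF f(2)] that tail_rel_0 by blast
      then have "f \<in> C_level S (Suc n)" using C_level_iff[of "Suc n" f] f(1) by simp
      then show ?thesis using f(3) by blast
    qed
    then show "\<exists>n0. \<forall>n\<ge>n0. \<exists>f\<in>C_level S (Suc n). kdist (rep (Suc n) f) ?F < \<epsilon>" by blast
  qed
  then obtain a where a: "a \<in> LS" "\<forall>n. a n \<in> C_level S (Suc n)" "keqv (reps a) (\<lambda>_. ?F)" by blast
  have aC: "a \<in> CL" using a(1,2) by (simp add: famseq_def)
  have "ev y (A.cl a) = u y" if y: "y \<in> P" for y
  proof -
    have "(\<lambda>n. reps a n (y, y)) \<longlonglongrightarrow> ?F (y, y)"
      by (rule keqv_entry[of "reps a" "\<lambda>_. ?F"]) (rule kcauchy_kern[OF LS_kcauchy[OF a(1)]] k a(3) tendsto_const)+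
    then have "ent (A.cl a) (y, y) = ?F (y, y)" using LIMSEQ_unique[OF ent_lim[OF a(1)]] by blast
    then show ?thesis using y by (simp add: ev_cl[OF aC] tail_rel_0)
  qed
  then show ?thesis using aC carrier_CA by blast
qed

text \<open>Differences of sequences in \<open>CL\<close> are supported on \<open>R 0\<close>, where
  the norm is controlled by the supremum; and the diagonal entries of both sequences converge
  uniformly to the same function.\<close>

lemma ev_inj:
  assumes p: "p \<in> carrier CA" and q: "q \<in> carrier CA" and eq: "\<And>y. y \<in> P \<Longrightarrow> ev y p = ev y q"
  shows "p = q"
proof -
  obtain a b where ab: "a \<in> CL" "b \<in> CL" "p = A.cl a" "q = A.cl b" using p q unfolding carrier_CA by blast
  note LS = CL_LS[OF ab(1)] CL_LS[OF ab(2)]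
  have "(\<lambda>n. kdist (reps a n) (reps b n)) \<longlonglongrightarrow> 0"
  proof (rule LIMSEQ_I)
    fix \<epsilon> :: real assume \<epsilon>: "0 < \<epsilon>"
    \<comment> \<open>Two errors of size \<delta> and the factor \<open>cls_bound 0\<close> must
      together stay below \<epsilon>; the added 1 makes the denominator positive.\<close>
    define \<delta> where "\<delta> = \<epsilon> / (2 * (real (cls_bound 0) + 1))"
    have d: "0 < \<delta>" using \<epsilon> by (simp add: \<delta>_def add_nonneg_pos)
    obtain M1 where M1: "\<forall>n\<ge>M1. \<forall>\<gamma>. cmod (reps a n \<gamma> - ent (A.cl a) \<gamma>) \<le> \<delta>" using ent_uniform[OF LS(1) d] by blast
    obtain M2 where M2: "\<forall>n\<ge>M2. \<forall>\<gamma>. cmod (reps b n \<gamma> - ent (A.cl b) \<gamma>) \<le> \<delta>" using ent_uniform[OF LS(2) d] by blast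
    have "norm (kdist (reps a n) (reps b n) - 0) < \<epsilon>" if n: "n \<ge> max M1 M2" for n
    proof -
      let ?F = "\<lambda>\<gamma>. reps a n \<gamma> - reps b n \<gamma>"
      have s: "supp 0 ?F"
        unfolding supp_def
      proof (intro allI impI)
        fix \<gamma> assume g: "\<gamma> \<notin> R 0"
        obtain x y where xy: "\<gamma> = (x, y)" by force
        show "?F \<gamma> = 0"
        proof (cases "x = y")
          case True
          then have "(x, y) \<notin> R (Suc n)" using g xy tail_relD(1)[of x y "Suc n"] by (auto simp: tail_rel_0)
          then show ?thesis by (simp add: xy rep_out)
        qed (simp add: xy CL_offdiag ab)
      qed
      have "cmod (?F \<gamma>) \<le> 2 * \<delta>" for \<gamma>
      proof (cases "\<gamma> \<in> R 0")
        case True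
        then obtain y where y: "\<gamma> = (y, y)" "y \<in> P" using tail_rel_0 by (cases \<gamma>) auto
        have e: "ent (A.cl a) \<gamma> = ent (A.cl b) \<gamma>" using eq[OF y(2)] unfolding ab(3,4) ev_cl[OF ab(1)] ev_cl[OF ab(2)] y(1) .
        have "cmod (?F \<gamma>) \<le> cmod (reps a n \<gamma> - ent (A.cl a) \<gamma>) + cmod (reps b n \<gamma> - ent (A.cl b) \<gamma>)"
          using norm_triangle_ineq4[of "reps a n \<gamma> - ent (A.cl a) \<gamma>" "reps b n \<gamma> - ent (A.cl b) \<gamma>"] e by simp
        also have "\<dots> \<le> \<delta> + \<delta>" using n by (intro add_mono M1[rule_format] M2[rule_format]) simp_all
        finally show ?thesis by simp
      next
        case False
        then have "?F \<gamma> = 0" using s unfolding supp_def by blast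
        then show ?thesis using d by simp
      qed
      then have "kdist (reps a n) (reps b n) \<le> 2 * \<delta> * cls_bound 0" unfolding kdist_def by (intro reduced_norm_le_sup s)
      also have "\<dots> < \<epsilon>" using \<epsilon> by (simp add: \<delta>_def divide_less_eq add_nonneg_pos)
      finally show ?thesis using kdist_nonneg[OF kcauchy_kern[OF LS_kcauchy[OF LS(1)]] kcauchy_kern[OF LS_kcauchy[OF LS(2)]], of n n] by simp
    qed
    then show "\<exists>no. \<forall>n\<ge>no. norm (kdist (reps a n) (reps b n) - 0) < \<epsilon>" by blast
  qed
  then have "keqv (reps a) (reps b)" by (simp add: keqv_def)
  then show ?thesis unfolding ab(3,4) using A.cl_eq_iff[OF LS] by blast
qed

text \<open>If a character differed from all evaluations, its kernel would be an ideal of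
  \<open>C(lab_paths S)\<close> without common zeros and hence contain the unit.\<close>

lemma characters_CA: "characters CA = ev ` P"
proof (intro equalityI subsetI)
  fix \<tau> assume \<tau>: "\<tau> \<in> characters CA"
  have add: "\<tau> (p \<oplus>\<^bsub>CA\<^esub> q) = \<tau> p + \<tau> q" and mult: "\<tau> (p \<otimes>\<^bsub>CA\<^esub> q) = \<tau> p * \<tau> q" and smult: "\<tau> (z \<odot>\<^bsub>CA\<^esub> p) = z * \<tau> p"
    if "p \<in> carrier CA" "q \<in> carrier CA" for p q z using \<tau> that unfolding characters_def by blast+
  obtain c0 where c0: "c0 \<in> carrier CA" "\<tau> c0 \<noteq> 0" using \<tau> unfolding characters_def by blast
  have "c0 \<otimes>\<^bsub>CA\<^esub> \<one>\<^bsub>CA\<^esub> = c0"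
    by (rule ev_inj[OF CA_closed(2)[OF c0(1) one_CA] c0(1)]) (simp add: ev_ops(3)[OF c0(1) one_CA] ev_ops(4)[OF c0(1) one_CA])
  then have \<tau>1: "\<tau> \<one>\<^bsub>CA\<^esub> = 1" using mult[OF c0(1) one_CA] c0(2) by simp
  show "\<tau> \<in> ev ` P"
  proof (rule ccontr)
    assume no: "\<tau> \<notin> ev ` P"
    define I where "I = {u. continuous_map T euclidean u \<and> (\<exists>c\<in>carrier CA. \<tau> c = 0 \<and> (\<forall>y\<in>P. ev y c = u y))}"
    have "\<exists>u\<in>I. \<forall>x\<in>topspace T. u x = 1"
    proof (rule ideal_without_common_zero[OF compact_lab_path_space])
      show "continuous_map T euclidean u" if "u \<in> I" for u using that unfolding I_def by blast
      have "\<tau> (0 \<odot>\<^bsub>CA\<^esub> \<one>\<^bsub>CA\<^esub>) = 0" "\<forall>y\<in>P. ev y (0 \<odot>\<^bsub>CA\<^esub> \<one>\<^bsub>CA\<^esub>) = 0"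
        using smult[OF one_CA one_CA, of 0] ev_ops(2)[OF one_CA one_CA, of _ 0] by simp_all
      then show "(\<lambda>_. 0) \<in> I" unfolding I_def using CA_closed(3)[OF one_CA one_CA, of 0] by force
    next
      fix u v assume "u \<in> I" "v \<in> I"
      then obtain c d where c: "continuous_map T euclidean u" "c \<in> carrier CA" "\<tau> c = 0" "\<forall>y\<in>P. ev y c = u y"
        and d: "continuous_map T euclidean v" "d \<in> carrier CA" "\<tau> d = 0" "\<forall>y\<in>P. ev y d = v y" unfolding I_def by blast
      have "\<tau> (c \<oplus>\<^bsub>CA\<^esub> d) = 0" "\<forall>y\<in>P. ev y (c \<oplus>\<^bsub>CA\<^esub> d) = u y + v y"
        using add[OF c(2) d(2)] c(3,4) d(3,4) ev_ops(1)[OF c(2) d(2)] by simp_all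
      then show "(\<lambda>x. u x + v x) \<in> I"
        unfolding I_def using CA_closed(1)[OF c(2) d(2)] continuous_map_add[OF c(1) d(1)] by blast
    next
      fix u and v :: "_ \<Rightarrow> complex" assume "u \<in> I" and v: "continuous_map T euclidean v"
      then obtain c where c: "continuous_map T euclidean u" "c \<in> carrier CA" "\<tau> c = 0" "\<forall>y\<in>P. ev y c = u y" unfolding I_def by blast
      obtain d where d: "d \<in> carrier CA" "\<forall>y\<in>P. ev y d = v y" using ev_surj[OF v] by blast
      have "\<tau> (d \<otimes>\<^bsub>CA\<^esub> c) = 0" "\<forall>y\<in>P. ev y (d \<otimes>\<^bsub>CA\<^esub> c) = v y * u y"
        using mult[OF d(1) c(2)] c(3,4) d(2) ev_ops(3)[OF d(1) c(2)] by simp_all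
      then show "(\<lambda>x. v x * u x) \<in> I"
        unfolding I_def using CA_closed(2)[OF d(1) c(2)] continuous_map_complex_mult[OF v c(1)] by blast
    next
      fix x assume "x \<in> topspace T"
      then have x: "x \<in> P" unfolding topspace_lab_path_space .
      have "\<tau> \<noteq> ev x" using no x by blast
      moreover have "\<tau> \<in> extensional (carrier CA)" "ev x \<in> extensional (carrier CA)"
        using \<tau> unfolding characters_def ev_def by simp_all
      ultimately obtain c where c: "c \<in> carrier CA" "\<tau> c \<noteq> ev x c" using extensionalityI by metis
      \<comment> \<open>Subtracting \<open>\<tau> c\<close> times the unit moves \<open>c\<close>
        into the kernel of \<tau>; at \<open>x\<close> the result has the value
        \<open>ev x c - \<tau> c\<close>, which is not 0.\<close>
      let ?d = "c \<oplus>\<^bsub>CA\<^esub> ((- \<tau> c) \<odot>\<^bsub>CA\<^esub> \<one>\<^bsub>CA\<^esub>)"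
      note z = CA_closed(3)[OF one_CA one_CA, of "- \<tau> c"]
      have "?d \<in> carrier CA" by (rule CA_closed(1)[OF c(1) z])
      moreover have "\<tau> ?d = 0" using add[OF c(1) z] smult[OF one_CA one_CA, of "- \<tau> c"] \<tau>1 by simp
      moreover have "ev x ?d \<noteq> 0"
        using ev_ops(1)[OF c(1) z, of x] ev_ops(2)[OF one_CA one_CA, of x "- \<tau> c"] ev_ops(4)[OF one_CA one_CA x] c(2) by simp
      ultimately show "\<exists>u\<in>I. u x \<noteq> 0"
        unfolding I_def using continuous_ev[of ?d] by (intro bexI[of _ "\<lambda>y. ev y ?d"]) auto
    qed
    then obtain u c where c: "c \<in> carrier CA" "\<tau> c = 0" "\<forall>y\<in>P. ev y c = 1"
      unfolding I_def topspace_lab_path_space by auto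
    have "c = \<one>\<^bsub>CA\<^esub>" by (rule ev_inj[OF c(1) one_CA]) (use c(3) ev_ops(4)[OF one_CA one_CA] in simp)
    then show False using c(2) \<tau>1 by simp
  qed
qed (use ev_character in blast)

text \<open>A kernel that separates the unit arrows at \<open>x\<close> and \<open>y\<close>
  restricts to a continuous function on the diagonal, and \<open>ev_surj\<close> turns this function
  into an element of \<open>C\<close>.\<close>

lemma ev_injective:
  assumes x: "x \<in> P" and y: "y \<in> P" and eq: "ev x = ev y"
  shows "x = y"
proof (rule ccontr)
  assume "x \<noteq> y"
  then have "(x, x) \<in> R 0" "(y, y) \<in> R 0" "(x, x) \<noteq> (y, y)" using x y by (simp_all add: tail_rel_0)
  from lev_separates[OF this] obtain F where F: "F \<in> lev 0" "F (x, x) = 1" "F (y, y) = 0" by blast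
  obtain c where c: "c \<in> carrier CA" "\<forall>z\<in>P. ev z c = F (z, z)"
    using ev_surj[OF continuous_diag[OF lev_Cc[OF F(1)]]] by blast
  then have "ev x c = 1" "ev y c = 0" using F(2,3) x y by simp_all
  then show False unfolding eq by simp
qed

lemma continuous_ev_C_hat: "continuous_map T (C_hat S) ev"
  unfolding gelfand_spectrum_def continuous_map_in_subtopology
proof
  show "ev \<in> topspace T \<rightarrow> characters CA"
    unfolding topspace_lab_path_space using ev_character by blast
  show "continuous_map T (product_topology (\<lambda>_. euclidean) (carrier CA)) ev"
    unfolding continuous_map_componentwise using continuous_ev by (auto simp: ev_def)
qed

lemma topspace_C_hat: "topspace (C_hat S) = ev ` P"
  unfolding gelfand_spectrum_def using characters_CA
  by (auto simp: characters_def PiE_def)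

lemma Hausdorff_C_hat: "Hausdorff_space (C_hat S)"
  unfolding gelfand_spectrum_def
  by (intro Hausdorff_space_subtopology) (simp add: Hausdorff_space_product_topology)

end


section \<open>The anchor map and the action\<close>

lemma ind_eq_iff: "indicator A x = (indicator A y :: complex) \<longleftrightarrow> (x \<in> A \<longleftrightarrow> y \<in> A)"
  by (simp add: indicator_def)

context AH
begin

interpretation A: rep_seq S Alg "\<lambda>n. carrier (Alg n)" "\<lambda>n. rep (Suc n)" LS by (rule AH_rep_seq)

definition ed :: "(nat \<Rightarrow> 'e edge \<times> 'a) \<Rightarrow> nat \<Rightarrow> 'e edge" where
  "ed x = (\<lambda>k. fst (x k))"

lemma ed_inf_path: "x \<in> P \<Longrightarrow> ed x \<in> inf_paths S"
  by (simp add: lab_paths_def ed_def)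

text \<open>The edges of the initial segment are prescribed, and its labels are then forced,
  computed downwards from the first label of the tail.\<close>

lemma graft:
  assumes "tail_path n y" "\<And>k. k < n \<Longrightarrow> e k \<in> edges S k" "\<And>k. Suc k < n \<Longrightarrow> etgt (e k) = esrc (e (Suc k))"
    "1 \<le> n \<Longrightarrow> etgt (e (n - 1)) = src y n"
  shows "\<exists>x\<in>P. (\<forall>k\<ge>n. x k = y k) \<and> (\<forall>k<n. fst (x k) = e k)"
  using assms
proof (induction n arbitrary: y)
  case 0
  then show ?case by (intro bexI[of _ y]) (auto simp: lab_paths_iff)
next
  case (Suc n)
  define y' where "y' = y(n := (e n, label S n (e n) (snd (y (Suc n)))))"
  have "tail_path n y'"
    unfolding y'_def by (rule tail_path_extend[OF Suc.prems(1)]) (use Suc.prems(2,4) in simp_all)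
  moreover have "etgt (e (n - 1)) = src y' n" if "1 \<le> n" using Suc.prems(3)[of "n - 1"] that by (simp add: y'_def)
  ultimately obtain x where x: "x \<in> P" "\<forall>k\<ge>n. x k = y' k" "\<forall>k<n. fst (x k) = e k"
    using Suc.IH[of y'] Suc.prems(2,3) by auto
  have "x k = y k" if "k \<ge> Suc n" for k using x(2) that by (simp add: y'_def)
  moreover have "fst (x k) = e k" if "k < Suc n" for k
    using x(2,3) that by (cases "k = n") (auto simp: y'_def)
  ultimately show ?case using x(1) by blast
qed

text \<open>Lifts an unlabelled path that is tail-equivalent to \<open>ed y\<close> to a labelled
  path with the tail of \<open>y\<close>; surjectivity of the groupoid map rests on it.\<close>

lemma graft_path:
  assumes y: "y \<in> P" and x: "x \<in> inf_paths S" and eq: "\<And>k. n \<le> k \<Longrightarrow> x k = ed y k" "1 \<le> n \<Longrightarrow> etgt (x (n - 1)) = src y n"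
  shows "\<exists>u. (u, y) \<in> R n \<and> ed u = x"
proof -
  have t: "tail_path n y" using y by (auto simp: lab_paths_iff intro: tail_path_mono)
  obtain u where u: "u \<in> P" "\<forall>k\<ge>n. u k = y k" "\<forall>k<n. fst (u k) = x k"
    using graft[OF t, of x] x eq(2) by (auto simp: inf_paths_def)
  have "ed u k = x k" for k using u eq(1) by (cases "k < n") (auto simp: ed_def)
  then show ?thesis using u(1,2) y by (intro exI[of _ u] conjI tail_relI) auto
qed

lemma in_Z_iff: "x \<in> P \<Longrightarrow> ed x \<in> Z S p \<longleftrightarrow> (\<forall>k<length p. fst (x k) = p ! k)"
  using ed_inf_path by (simp add: Z_def ed_def)

lemma Z_src: "x \<in> P \<Longrightarrow> p \<in> fin_paths S \<Longrightarrow> ed x \<in> Z S p \<Longrightarrow> src x (length p) = etgt (last p)"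
  using path_etgt[of x "length p - 1"] by (auto simp: in_Z_iff fin_paths_def last_conv_nth)

lemma fin_path_length: "p \<in> fin_paths S \<Longrightarrow> 1 \<le> length p"
  by (cases p) (auto simp: fin_paths_def)

text \<open>Grafting \<open>p\<close> onto the tail of \<open>u\<close> produces a path in the class
  of \<open>u\<close> with index \<open>path_index S p\<close>. If \<open>u\<close> has this index
  too, \<open>idx_inj\<close> identifies the two, so \<open>u\<close> begins with
  \<open>p\<close>.\<close>

lemma path_index_iff:
  assumes p: "p \<in> fin_paths S" and u: "u \<in> P" and s: "src u (length p) = etgt (last p)"
  shows "idx (length p) u = path_index S p \<longleftrightarrow> ed u \<in> Z S p"
proof
  assume "ed u \<in> Z S p"
  then show "idx (length p) u = path_index S p" unfolding in_Z_iff[OF u] idx_def path_index_def by simp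
next
  assume i: "idx (length p) u = path_index S p"
  note n = fin_path_length[OF p]
  have t: "tail_path (length p) u" using u by (auto simp: lab_paths_iff intro: tail_path_mono)
  have "\<exists>x\<in>P. (\<forall>k\<ge>length p. x k = u k) \<and> (\<forall>k<length p. fst (x k) = p ! k)"
    by (rule graft[OF t]) (use p s in \<open>auto simp: fin_paths_def last_conv_nth\<close>)
  then obtain x where x: "x \<in> P" "\<forall>k\<ge>length p. x k = u k" "\<forall>k<length p. fst (x k) = p ! k" by blast
  have "idx (length p) x = path_index S p" using x(3) unfolding idx_def path_index_def by simp
  moreover have "(x, u) \<in> R (length p)" by (rule tail_relI[OF x(1) u]) (use x(2) in simp)
  ultimately have "x = u" using idx_inj[OF n] i by metis
  then show "ed u \<in> Z S p" unfolding in_Z_iff[OF u] using x(3) by blast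
qed

definition mu :: "'e edge list \<Rightarrow> 'e edge list \<Rightarrow> 'a matfun" where
  "mu p q = mk (length p) (\<lambda>i t a b. if i = etgt (last p) \<and> a = path_index S p \<and> b = path_index S q then 1 else 0)"

lemma mat_unit_mu: "mat_unit S p q = embed S (length p) (mu p q)"
  by (simp add: mat_unit_def mu_def mk_def)

lemma mu_carrier: "mu p q \<in> carrier (alg S (length p))"
  unfolding mu_def by (rule mk_carrier) simp

text \<open>The kernel of a matrix unit is the indicator of the labelled version of
  \<open>ZZ S p q\<close>: paths that begin with \<open>p\<close> and \<open>q\<close> and agree
  afterwards in edges and labels.\<close>

lemma rep_mu:
  assumes pq: "(p, q) \<in> parallel_paths S"
  shows "rep (length p) (mu p q) (x, y) = (if (x, y) \<in> R (length p) \<and> ed x \<in> Z S p \<and> ed y \<in> Z S q then 1 else 0)"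
proof (cases "(x, y) \<in> R (length p)")
  case True
  have p: "p \<in> fin_paths S" "q \<in> fin_paths S" "length q = length p" "etgt (last q) = etgt (last p)"
    using pq unfolding parallel_paths_def by auto
  note x = tail_relD(1)[OF True] note y = tail_relD(2)[OF True]
  have s: "src y (length p) = src x (length p)" by (rule tail_rel_src(1)[OF True])
  have "src x (length p) = etgt (last p) \<and> idx (length p) x = path_index S p \<and> idx (length p) y = path_index S q \<longleftrightarrow>
      ed x \<in> Z S p \<and> ed y \<in> Z S q"
    using path_index_iff[OF p(1) x] path_index_iff[OF p(2) y] Z_src[OF x p(1)] p(3,4) s by auto
  then show ?thesis unfolding mu_def rep_mk[OF fin_path_length[OF p(1)] True] using True by simp
qed (simp add: rep_out)

lemma Z_unique: "(u, v) \<in> R (length q) \<Longrightarrow> ed u \<in> Z S q \<Longrightarrow> ed v \<in> Z S q \<Longrightarrow> u = v"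
  using tail_rel_edges[of u v "length q" 0] in_Z_iff[of u q] in_Z_iff[of v q] tail_relD[of u v]
  by (auto simp: tail_rel_0)

lemma ent_embed:
  assumes n: "1 \<le> n" and f: "f \<in> carrier (alg S n)"
  shows "ent (embed S n f) \<gamma> = rep n f \<gamma>"
proof -
  have "(\<lambda>k. reps (thr n f) k \<gamma>) \<longlonglongrightarrow> rep n f \<gamma>"
    by (rule tendsto_eventually, unfold eventually_sequentially, intro exI[of _ "n - 1"] allI impI)
      (simp only: thr(3)[OF n f])
  then show ?thesis unfolding thr(1)[OF n f] using LIMSEQ_unique[OF ent_lim[OF thr(2)[OF n f]]] by blast
qed

lemma carrier_BA: "carrier (B_algebra S) = A.cl ` famseq (B_level S)"
  unfolding B_algebra_def using closure_fam[OF fam_B] by simp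

lemma BA_closed:
  assumes "p \<in> carrier (B_algebra S)" "q \<in> carrier (B_algebra S)"
  shows "p \<oplus>\<^bsub>CA\<^esub> q \<in> carrier (B_algebra S)" "p \<otimes>\<^bsub>CA\<^esub> q \<in> carrier (B_algebra S)"
    "z \<odot>\<^bsub>CA\<^esub> p \<in> carrier (B_algebra S)" "\<one>\<^bsub>CA\<^esub> \<in> carrier (B_algebra S)"
proof -
  obtain a b where ab: "a \<in> famseq (B_level S)" "b \<in> famseq (B_level S)" "p = A.cl a" "q = A.cl b"
    using assms unfolding carrier_BA by blast
  have LS: "a \<in> LS" "b \<in> LS" using ab(1,2) unfolding famseq_def by blast+
  note f = famseq_ops[OF fam_B ab(1,2)]
  show "p \<oplus>\<^bsub>CA\<^esub> q \<in> carrier (B_algebra S)"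
    unfolding CA_ops ab(3,4) AH_add[OF LS] carrier_BA using f(1) by (rule imageI)
  show "p \<otimes>\<^bsub>CA\<^esub> q \<in> carrier (B_algebra S)"
    unfolding CA_ops ab(3,4) AH_mult[OF LS] carrier_BA using f(2) by (rule imageI)
  show "z \<odot>\<^bsub>CA\<^esub> p \<in> carrier (B_algebra S)"
    unfolding CA_ops ab(3) AH_smult[OF LS(1)] carrier_BA using f(3) by (rule imageI)
  show "\<one>\<^bsub>CA\<^esub> \<in> carrier (B_algebra S)"
    unfolding CA_ops AH_one carrier_BA using f(4) by (rule imageI)
qed

lemma embed_fam:
  assumes "1 \<le> n" "fam L" "f \<in> L n"
  shows "embed S n f \<in> A.cl ` famseq L"
proof -
  have f: "f \<in> carrier (alg S n)" using assms unfolding fam_def by blast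
  show ?thesis unfolding thr(1)[OF assms(1) f]
    using thr(2)[OF assms(1) f] thr_fam[OF assms(1,2,3)] by (intro imageI) (simp add: famseq_def)
qed

lemma mat_unit_CB:
  assumes p: "p \<in> fin_paths S"
  shows "mat_unit S p p \<in> carrier CA" "mat_unit S p p \<in> carrier (B_algebra S)"
proof -
  note n = fin_path_length[OF p]
  have "mu p p \<in> C_level S (length p)"
    unfolding C_level_iff[OF n]
  proof (intro conjI allI impI mu_carrier)
    fix x y :: "nat \<Rightarrow> 'e edge \<times> 'a" assume "x \<noteq> y"
    moreover have "(p, p) \<in> parallel_paths S" using p by (simp add: parallel_paths_def)
    ultimately show "rep (length p) (mu p p) (x, y) = 0" using Z_unique by (auto simp: rep_mu)
  qed
  then show "mat_unit S p p \<in> carrier CA" unfolding mat_unit_mu carrier_CA by (rule embed_fam[OF n fam_C])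
  have "mu p p \<in> B_level S (length p)" unfolding mu_def mk_def by (rule B_levelI[OF _ refl]) simp
  then show "mat_unit S p p \<in> carrier (B_algebra S)" unfolding mat_unit_mu carrier_BA by (rule embed_fam[OF n fam_B])
qed

lemma carrier_CB: "carrier (CB_algebra S) = carrier CA \<inter> carrier (B_algebra S)"
  by (simp add: CB_algebra_def)

lemma CB_ops: "mult (CB_algebra S) = mult CA" "add (CB_algebra S) = add CA" "smult (CB_algebra S) = smult CA"
  by (simp_all add: CB_algebra_def C_algebra_def)

lemma restrict_ev_character:
  assumes y: "y \<in> P"
  shows "restrict (ev y) (carrier (CB_algebra S)) \<in> characters (CB_algebra S)"
  unfolding characters_def
proof (intro CollectI conjI ballI allI)
  let ?r = "restrict (ev y) (carrier (CB_algebra S))"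
  show "?r \<in> extensional (carrier (CB_algebra S))" by simp
  have one: "\<one>\<^bsub>CA\<^esub> \<in> carrier (CB_algebra S)"
    using one_CA BA_closed(4)[OF mat_unit_CB(2) mat_unit_CB(2)] prefix_fin_path[OF y] unfolding carrier_CB by blast
  then show "\<exists>p\<in>carrier (CB_algebra S). ?r p \<noteq> 0"
    using ev_ops(4)[OF one_CA one_CA y] by (intro bexI[OF _ one]) simp
  fix p q z assume p: "p \<in> carrier (CB_algebra S)"
  then have p': "p \<in> carrier CA" "p \<in> carrier (B_algebra S)" unfolding carrier_CB by blast+
  have "z \<odot>\<^bsub>CA\<^esub> p \<in> carrier (CB_algebra S)"
    unfolding carrier_CB using CA_closed(3)[OF p'(1,1)] BA_closed(3)[OF p'(2,2)] by blast
  then show "?r (z \<odot>\<^bsub>CB_algebra S\<^esub> p) = z * ?r p"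
    unfolding CB_ops using ev_ops(2)[OF p'(1,1)] p by simp
  assume q: "q \<in> carrier (CB_algebra S)"
  then have q': "q \<in> carrier CA" "q \<in> carrier (B_algebra S)" unfolding carrier_CB by blast+
  have "p \<oplus>\<^bsub>CA\<^esub> q \<in> carrier (CB_algebra S)" "p \<otimes>\<^bsub>CA\<^esub> q \<in> carrier (CB_algebra S)"
    unfolding carrier_CB using CA_closed(1,2)[OF p'(1) q'(1)] BA_closed(1,2)[OF p'(2) q'(2)] by blast+
  then show "?r (p \<oplus>\<^bsub>CB_algebra S\<^esub> q) = ?r p + ?r q" "?r (p \<otimes>\<^bsub>CB_algebra S\<^esub> q) = ?r p * ?r q"
    unfolding CB_ops using ev_ops(1,3)[OF p'(1) q'(1)] p q y by simp_all
qed

lemma ev_mat_unit: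
  assumes y: "y \<in> P" and p: "p \<in> fin_paths S"
  shows "ev y (mat_unit S p p) = indicator (Z S p) (ed y)"
proof -
  have "(p, p) \<in> parallel_paths S" using p by (simp add: parallel_paths_def)
  then show ?thesis
    using mat_unit_CB(1)[OF p] tail_rel_refl[OF y] unfolding ev_def mat_unit_mu
    by (simp add: ent_embed[OF fin_path_length[OF p] mu_carrier] rep_mu indicator_def)
qed

text \<open>The values on the projections \<open>mat_unit S p p\<close> tell which finite paths
  \<open>p\<close> are initial segments. Testing all initial segments of \<open>y\<close> leaves
  \<open>ed y\<close> as the only candidate, as the definite description in \<open>anchor\<close>
  requires.\<close>

lemma anchor_ev:
  assumes y: "y \<in> P"
  shows "anchor S (ev y) = ed y"
  unfolding anchor_def
proof (rule the_equality)
  let ?r = "restrict (ev y) (carrier (CB_algebra S))"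
  have r: "?r (mat_unit S p p) = indicator (Z S p) (ed y)" if "p \<in> fin_paths S" for p
    using mat_unit_CB[OF that] ev_mat_unit[OF y that] unfolding carrier_CB by simp
  show "ed y \<in> inf_paths S \<and> is_evaluation S ?r (ed y)"
    unfolding is_evaluation_def using ed_inf_path[OF y] restrict_ev_character[OF y] r by blast
  fix x assume x: "x \<in> inf_paths S \<and> is_evaluation S ?r x"
  show "x = ed y"
  proof
    fix k
    let ?p = "map (\<lambda>m. fst (y m)) [0..<Suc k]"
    have p: "?p \<in> fin_paths S" by (rule prefix_fin_path[OF y])
    have "indicator (Z S ?p) x = (indicator (Z S ?p) (ed y) :: complex)"
      using x r[OF p] p unfolding is_evaluation_def by (simp del: upt_Suc)
    then have "x \<in> Z S ?p \<longleftrightarrow> ed y \<in> Z S ?p" unfolding ind_eq_iff .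
    moreover have "ed y \<in> Z S ?p" unfolding in_Z_iff[OF y] by (simp del: upt_Suc)
    ultimately have "x \<in> Z S ?p" by blast
    then have "x k = ?p ! k" unfolding Z_def by (simp del: upt_Suc)
    then show "x k = ed y k" by (simp add: ed_def del: upt_Suc)
  qed
qed

lemma ZZ_prefix:
  assumes xy: "x \<in> inf_paths S" "y \<in> inf_paths S" and eq: "\<And>k. n \<le> k \<Longrightarrow> x k = y k" and n: "1 \<le> n"
  shows "(map x [0..<n], map y [0..<n]) \<in> parallel_paths S" "(x, y) \<in> ZZ S (map x [0..<n]) (map y [0..<n])"
proof -
  have fp: "map z [0..<n] \<in> fin_paths S" if "z \<in> inf_paths S" for z
    using that n by (auto simp: fin_paths_def inf_paths_def)
  have tg: "etgt (last (map z [0..<n])) = esrc (z n)" if "z \<in> inf_paths S" for z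
  proof -
    have "last (map z [0..<n]) = z (n - 1)" using n by (simp add: last_map)
    moreover have "etgt (z (n - 1)) = esrc (z (Suc (n - 1)))" using that unfolding inf_paths_def by blast
    ultimately show ?thesis using n by simp
  qed
  show "(map x [0..<n], map y [0..<n]) \<in> parallel_paths S"
    using fp[OF xy(1)] fp[OF xy(2)] tg[OF xy(1)] tg[OF xy(2)] eq[of n] by (simp add: parallel_paths_def)
  show "(x, y) \<in> ZZ S (map x [0..<n]) (map y [0..<n])"
    using xy eq by (simp add: ZZ_def Z_def)
qed

text \<open>The labelled paths agree eventually, and their edges agree from \<open>length p\<close>
  on, so \<open>tail_rel_edges\<close> carries the agreement of labels down to
  \<open>length p\<close>.\<close>

lemma ZZ_tail_rel:
  assumes xy: "(x, y) \<in> arrows G" and z: "(ed x, ed y) \<in> ZZ S p q"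
  shows "(x, y) \<in> R (length p)"
proof -
  obtain m where m: "(x, y) \<in> R m" using xy unfolding arrows_G by blast
  have "(x, y) \<in> R (max m (length p))" using tail_rel_mono[OF _ m] by simp
  then show ?thesis
    by (rule tail_rel_edges) (use z in \<open>auto simp: ZZ_def ed_def\<close>)
qed

lemma arrows_ZZ:
  assumes "(x, y) \<in> R n" "1 \<le> n"
  shows "\<exists>p q. (p, q) \<in> parallel_paths S \<and> (ed x, ed y) \<in> ZZ S p q \<and> length p = n"
proof -
  have "ed x k = ed y k" if "n \<le> k" for k using tail_relD(3)[OF assms(1) that] by (simp add: ed_def)
  from ZZ_prefix[OF ed_inf_path[OF tail_relD(1)[OF assms(1)]] ed_inf_path[OF tail_relD(2)[OF assms(1)]] this assms(2)]
  show ?thesis by (intro exI[of _ "map (ed x) [0..<n]"] exI[of _ "map (ed y) [0..<n]"]) simp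
qed

text \<open>Conjugating the diagonal kernel \<open>F\<close> by \<open>E\<close> involves one
  intermediate path \<open>w\<close> instead of two.\<close>

lemma conjugation_entry:
  assumes A: "supp n F" "\<And>x y. x \<noteq> y \<Longrightarrow> F (x, y) = 0" and E: "supp n E"
  shows "conv G (conv G (star Q E) F) E (u, v) = (\<Sum>w\<in>cls n u. cnj (E (w, u)) * F (w, w) * E (w, v))"
proof -
  have sE: "star Q E (u, w) = cnj (E (w, u))" for u w
    using supp_arrows[OF E, of "(w, u)"] arrows_sym by (auto simp: Q_simps)
  have ssE: "supp n (star Q E)"
    unfolding supp_def
  proof (intro allI impI)
    fix \<gamma> assume "\<gamma> \<notin> R n"
    then obtain x y where "\<gamma> = (x, y)" "(y, x) \<notin> R n" using tail_rel_sym by (cases \<gamma>) blast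
    then show "star Q E \<gamma> = 0" using suppD[OF E] by (simp add: sE)
  qed
  have Fa: "\<forall>\<gamma>. \<gamma> \<notin> arrows G \<longrightarrow> F \<gamma> = 0" using supp_arrows[OF A(1)] by blast
  have Ea: "\<forall>\<gamma>. \<gamma> \<notin> arrows G \<longrightarrow> E \<gamma> = 0" using supp_arrows[OF E] by blast
  have 1: "conv G (star Q E) F (u, w) = cnj (E (w, u)) * F (w, w)" for u w
  proof -
    have "conv G (star Q E) F (u, w) = (\<Sum>z\<in>cls n u. cnj (E (z, u)) * F (z, w))"
      unfolding conv_eq[OF ssE Fa] sE ..
    also have "\<dots> = (\<Sum>z\<in>{w}. cnj (E (z, u)) * F (z, w))"
    proof (rule sum.mono_neutral_cong[OF _ finite_cls])
      show "cnj (E (z, u)) * F (z, w) = 0" if "z \<in> {w} - cls n u" for z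
      proof -
        have "(z, u) \<notin> R n" using that by (auto simp: cls_def)
        then show ?thesis using suppD[OF E] by simp
      qed
      show "cnj (E (z, u)) * F (z, w) = 0" if "z \<in> cls n u - {w}" for z using A(2)[of z w] that by simp
    qed simp_all
    finally show ?thesis by simp
  qed
  show ?thesis unfolding conv_eq[OF supp_conv[OF ssE A(1)] Ea] 1 ..
qed

text \<open>In the column of \<open>y\<close> the kernel of the matrix unit has a single entry 1, in
  the row of \<open>x\<close>. Conjugation by it therefore carries the diagonal entry of
  \<open>c\<close> at \<open>x\<close> to the place of \<open>y\<close>.\<close>

lemma act_conj:
  assumes xy: "(x, y) \<in> arrows G" and pq: "(p, q) \<in> parallel_paths S" and z: "(ed x, ed y) \<in> ZZ S p q"
    and c: "c \<in> carrier CA"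
  shows "ev y ((star (AH_algebra S) (mat_unit S p q) \<otimes>\<^bsub>AH_algebra S\<^esub> c) \<otimes>\<^bsub>AH_algebra S\<^esub> mat_unit S p q) = ev x c"
proof -
  let ?n = "length p"
  have p: "p \<in> fin_paths S" "q \<in> fin_paths S" "length q = length p" using pq unfolding parallel_paths_def by auto
  note n = fin_path_length[OF p(1)]
  have r: "(x, y) \<in> R ?n" by (rule ZZ_tail_rel[OF xy z])
  note x = tail_relD(1)[OF r] note y = tail_relD(2)[OF r]
  have zx: "ed x \<in> Z S p" "ed y \<in> Z S q" using z unfolding ZZ_def by blast+
  obtain a where a: "a \<in> CL" "c = A.cl a" using c unfolding carrier_CA by blast
  note aL = CL_LS[OF a(1)]
  define t where "t = thr ?n (mu p q)"
  have t: "mat_unit S p q = A.cl t" "t \<in> LS" "\<And>k. ?n - 1 \<le> k \<Longrightarrow> reps t k = rep ?n (mu p q)"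
    "\<And>k. k < ?n - 1 \<Longrightarrow> reps t k = (\<lambda>_. 0)"
    unfolding mat_unit_mu t_def by (rule thr[OF n mu_carrier]; assumption)+
  define s where "s k = (star (Alg k) (t k) \<otimes>\<^bsub>Alg k\<^esub> a k) \<otimes>\<^bsub>Alg k\<^esub> t k" for k
  note st = op_star(1)[OF t(2)]
  note sta = op_mult(1)[OF st aL]
  have sL: "s \<in> LS" unfolding s_def using op_mult(1)[OF sta t(2)] .
  have eq: "(star (AH_algebra S) (mat_unit S p q) \<otimes>\<^bsub>AH_algebra S\<^esub> c) \<otimes>\<^bsub>AH_algebra S\<^esub> mat_unit S p q = A.cl s"
    unfolding t(1) a(2) AH_star[OF t(2)] AH_mult[OF st aL] AH_mult[OF sta t(2)] s_def ..
  have rs: "reps s k (u, v) = (\<Sum>w\<in>cls (Suc k) u. cnj (reps t k (w, u)) * reps a k (w, w) * reps t k (w, v))" for k u v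
  proof -
    have "reps s k = conv G (conv G (star Q (reps t k)) (reps a k)) (reps t k)"
      using fun_cong[OF op_mult(2)[OF sta t(2)], of k] fun_cong[OF op_mult(2)[OF st aL], of k]
        fun_cong[OF op_star(2)[OF t(2)], of k] unfolding s_def by simp
    then show ?thesis using conjugation_entry[OF supp_rep CL_offdiag[OF a(1)] supp_rep] by simp
  qed
  \<comment> \<open>The rows of the matrix unit have at most one nonzero entry as well: by
    \<open>Z_unique\<close>, only one path beginning with \<open>q\<close> is related to a given
    \<open>w\<close>. So the conjugate is again diagonal.\<close>
  have "s \<in> CL"
  proof (rule CLI[OF sL])
    fix k and u v :: "nat \<Rightarrow> 'e edge \<times> 'a" assume uv: "u \<noteq> v"
    have "cnj (reps t k (w, u)) * reps a k (w, w) * reps t k (w, v) = 0" for w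
    proof (cases "k < ?n - 1")
      case True
      then show ?thesis by (simp add: t(4))
    next
      case False
      have "\<not> ((w, u) \<in> R ?n \<and> ed u \<in> Z S q \<and> (w, v) \<in> R ?n \<and> ed v \<in> Z S q)"
        using Z_unique[of u v q] uv tail_rel_trans tail_rel_sym p(3) by metis
      then show ?thesis using False by (auto simp: t(3) rep_mu[OF pq])
    qed
    then show "reps s k (u, v) = 0" unfolding rs by (intro sum.neutral) blast
  qed
  have "(\<lambda>k. reps s k (y, y)) \<longlonglongrightarrow> ent (A.cl a) (x, x)"
  proof (rule Lim_transform_eventually[OF ent_lim[OF aL]], unfold eventually_sequentially, intro exI allI impI)
    fix k assume k: "?n \<le> k"
    have E: "reps t k (w, y) = (if w = x then 1 else 0)" for w
    proof -
      have "(w, y) \<in> R ?n \<and> ed w \<in> Z S p \<longleftrightarrow> w = x"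
        using Z_unique[of w x p] r zx(1) tail_rel_trans[OF _ tail_rel_sym[OF r]] by blast
      then show ?thesis using k zx(2) by (auto simp: t(3) rep_mu[OF pq])
    qed
    have "x \<in> cls (Suc k) y" using tail_rel_mono[OF _ r, of "Suc k"] k by (simp add: cls_def)
    have "reps s k (y, y) = (\<Sum>w\<in>cls (Suc k) y. if w = x then reps a k (w, w) else 0)"
      unfolding rs E by (intro sum.cong refl) simp
    also have "\<dots> = reps a k (x, x)" using \<open>x \<in> cls (Suc k) y\<close> finite_cls by (simp add: sum.delta)
    finally show "reps a k (x, x) = reps s k (y, y)" by simp
  qed
  then have "ent (A.cl s) (y, y) = ent (A.cl a) (x, x)" using LIMSEQ_unique[OF ent_lim[OF sL]] by blast
  then show ?thesis unfolding eq unfolding a(2) ev_cl[OF \<open>s \<in> CL\<close>] ev_cl[OF a(1)] .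
qed

text \<open>\<open>act_conj\<close> gives \<open>ev x\<close> for every admissible choice of
  \<open>p\<close> and \<open>q\<close>, so the conditions in the definite description are
  compatible; the existence of one such choice makes the solution unique.\<close>

lemma act_ev:
  assumes xy: "(x, y) \<in> arrows G"
  shows "act S (ed x, ed y) (ev y) = ev x"
  unfolding act_def Let_def
proof (rule the_equality)
  show "ev x \<in> extensional (carrier CA) \<and> (\<forall>(p, q)\<in>parallel_paths S. (ed x, ed y) \<in> ZZ S p q \<longrightarrow>
     (\<forall>c\<in>carrier CA. ev x c = ev y ((star (AH_algebra S) (mat_unit S p q) \<otimes>\<^bsub>AH_algebra S\<^esub> c) \<otimes>\<^bsub>AH_algebra S\<^esub> mat_unit S p q)))"
    using act_conj[OF xy] by (auto simp: ev_def[of x])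
  fix \<psi> assume \<psi>: "\<psi> \<in> extensional (carrier CA) \<and> (\<forall>(p, q)\<in>parallel_paths S. (ed x, ed y) \<in> ZZ S p q \<longrightarrow>
     (\<forall>c\<in>carrier CA. \<psi> c = ev y ((star (AH_algebra S) (mat_unit S p q) \<otimes>\<^bsub>AH_algebra S\<^esub> c) \<otimes>\<^bsub>AH_algebra S\<^esub> mat_unit S p q)))"
  obtain m where m: "(x, y) \<in> R m" using xy unfolding arrows_G by blast
  \<comment> \<open>Finite paths are nonempty, so a positive level is taken.\<close>
  have "(x, y) \<in> R (max 1 m)" using tail_rel_mono[OF _ m] by simp
  from arrows_ZZ[OF this] obtain p q where pq: "(p, q) \<in> parallel_paths S" "(ed x, ed y) \<in> ZZ S p q" by auto
  show "\<psi> = ev x"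
  proof (rule extensionalityI)
    show "\<psi> \<in> extensional (carrier CA)" using \<psi> by blast
    show "ev x \<in> extensional (carrier CA)" by (simp add: ev_def)
    fix c assume "c \<in> carrier CA"
    then show "\<psi> c = ev x c" using \<psi> pq act_conj[OF xy pq] by fastforce
  qed
qed

end


section \<open>The isomorphism of groupoids\<close>

lemma Hausdorff_generated:
  assumes "\<And>x y. x \<in> \<Union>\<S> \<Longrightarrow> y \<in> \<Union>\<S> \<Longrightarrow> x \<noteq> y \<Longrightarrow> \<exists>U\<in>\<S>. \<exists>V\<in>\<S>. x \<in> U \<and> y \<in> V \<and> U \<inter> V = {}"
  shows "Hausdorff_space (topology_generated_by \<S>)"
  unfolding Hausdorff_space_def topology_generated_by_topspace disjnt_def
  using assms topology_generated_by_Basis by metis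

context AH
begin

abbreviation "TR \<equiv> gtop (tail_groupoid S)"
abbreviation "HG \<equiv> transformation_groupoid S"

lemma TR_eq: "TR = topology_generated_by {ZZ S p q | p q. (p, q) \<in> parallel_paths S}"
  by (simp add: tail_groupoid_def)

lemma openin_ZZ: "(p, q) \<in> parallel_paths S \<Longrightarrow> openin TR (ZZ S p q)"
  unfolding TR_eq by (rule topology_generated_by_Basis) blast

lemma ZZ_disjoint: "length p = length p' \<Longrightarrow> length q = length q' \<Longrightarrow> (p, q) \<noteq> (p', q') \<Longrightarrow>
    length p = length q \<Longrightarrow> ZZ S p q \<inter> ZZ S p' q' = {}"
  by (auto simp: ZZ_def Z_def intro: nth_equalityI)

text \<open>Basic neighbourhoods of an arrow exist for every larger prefix length. Two distinct
  arrows can so be compared at one common length, where different basic sets are disjoint.\<close>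

lemma ZZ_reprefix:
  assumes pq: "(p, q) \<in> parallel_paths S" and xy: "(x, y) \<in> ZZ S p q" and n: "length p \<le> n"
  shows "(map x [0..<n], map y [0..<n]) \<in> parallel_paths S" "(x, y) \<in> ZZ S (map x [0..<n]) (map y [0..<n])"
proof -
  have "p \<in> fin_paths S" using pq by (simp add: parallel_paths_def)
  then have "1 \<le> n" using fin_path_length n by fastforce
  moreover have "x \<in> inf_paths S" "y \<in> inf_paths S" "\<And>k. n \<le> k \<Longrightarrow> x k = y k"
    using xy n by (auto simp: ZZ_def Z_def)
  ultimately show "(map x [0..<n], map y [0..<n]) \<in> parallel_paths S"
    "(x, y) \<in> ZZ S (map x [0..<n]) (map y [0..<n])" using ZZ_prefix by blast+
qed

lemma Hausdorff_TR: "Hausdorff_space TR"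
  unfolding TR_eq
proof (rule Hausdorff_generated)
  fix \<gamma> \<delta> assume "\<gamma> \<in> \<Union> {ZZ S p q | p q. (p, q) \<in> parallel_paths S}"
    "\<delta> \<in> \<Union> {ZZ S p q | p q. (p, q) \<in> parallel_paths S}" and ne: "\<gamma> \<noteq> \<delta>"
  then obtain p q p' q' where pq: "(p, q) \<in> parallel_paths S" "\<gamma> \<in> ZZ S p q"
    "(p', q') \<in> parallel_paths S" "\<delta> \<in> ZZ S p' q'" by blast
  obtain x y u v where \<gamma>: "\<gamma> = (x, y)" and \<delta>: "\<delta> = (u, v)" by fastforce
  obtain k where k: "x k \<noteq> u k \<or> y k \<noteq> v k" using ne unfolding \<gamma> \<delta> by auto
  define n where "n = Suc k + length p + length p'"
  note A = ZZ_reprefix[OF pq(1) pq(2)[unfolded \<gamma>], of n] and B = ZZ_reprefix[OF pq(3) pq(4)[unfolded \<delta>], of n]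
  have "(map x [0..<n], map y [0..<n]) \<noteq> (map u [0..<n], map v [0..<n])"
  proof
    assume "(map x [0..<n], map y [0..<n]) = (map u [0..<n], map v [0..<n])"
    moreover have "k \<in> set [0..<n]" by (simp add: n_def)
    ultimately show False using k by (simp only: prod.inject map_eq_conv) blast
  qed
  then have "ZZ S (map x [0..<n]) (map y [0..<n]) \<inter> ZZ S (map u [0..<n]) (map v [0..<n]) = {}"
    by (intro ZZ_disjoint) simp_all
  then show "\<exists>U\<in>{ZZ S p q | p q. (p, q) \<in> parallel_paths S}. \<exists>V\<in>{ZZ S p q | p q. (p, q) \<in> parallel_paths S}.
      \<gamma> \<in> U \<and> \<delta> \<in> V \<and> U \<inter> V = {}"
    using A B unfolding \<gamma> \<delta> n_def
    by (intro bexI[of _ "ZZ S (map x [0..<n]) (map y [0..<n])"] bexI[of _ "ZZ S (map u [0..<n]) (map v [0..<n])"])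
      (auto simp: n_def)
qed

lemma HG_top: "gtop HG = subtopology (prod_topology TR (C_hat S)) {(\<gamma>, \<tau>). snd \<gamma> = anchor S \<tau>}"
  by (simp add: transformation_groupoid_def Let_def tail_groupoid_def)

lemma HG_simps: "gsrc HG (\<gamma>, \<tau>) = (snd \<gamma>, \<tau>)" "grng HG (\<gamma>, \<tau>) = (fst \<gamma>, act S \<gamma> \<tau>)"
    "gmult HG ((a, b), \<sigma>) ((c, d), \<tau>) = ((a, d), \<tau>)"
  by (simp_all add: transformation_groupoid_def Let_def tail_groupoid_def)

lemma topspace_HG:
  "topspace (gtop HG) = {((a, b), \<tau>). (a, b) \<in> topspace TR \<and> \<tau> \<in> ev ` P \<and> b = anchor S \<tau>}"
  unfolding HG_top topspace_subtopology topspace_prod_topology topspace_C_hat by auto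

lemma Hausdorff_HG: "Hausdorff_space (gtop HG)"
  unfolding HG_top using Hausdorff_TR Hausdorff_C_hat
  by (intro Hausdorff_space_subtopology) (simp add: Hausdorff_space_prod_topology)

lemma topspace_TR: "topspace TR = \<Union> {ZZ S p q | p q. (p, q) \<in> parallel_paths S}"
  unfolding TR_eq by (rule topology_generated_by_topspace)

definition gmap where
  "gmap \<gamma> = ((ed (fst \<gamma>), ed (snd \<gamma>)), ev (snd \<gamma>))" for \<gamma> :: "(nat \<Rightarrow> 'e edge \<times> 'a) \<times> (nat \<Rightarrow> 'e edge \<times> 'a)"

text \<open>The image of \<open>R m\<close> is cut out by an open condition on the unlabelled arrow
  alone: given such an arrow and a labelled source \<open>y\<close>, \<open>graft_path\<close> finds
  the labelled range. Surjectivity and openness both use this description.\<close>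

lemma gmap_tail_rel:
  assumes m: "1 \<le> m"
  shows "gmap ` R m = topspace (gtop HG) \<inter>
    ((\<Union>(p, q)\<in>{(p, q) \<in> parallel_paths S. length p = m}. ZZ S p q) \<times> UNIV)"
proof (intro equalityI subsetI)
  fix z assume "z \<in> gmap ` R m"
  then obtain x y where xy: "(x, y) \<in> R m" "z = ((ed x, ed y), ev y)" by (auto simp: gmap_def)
  note y = tail_relD(2)[OF xy(1)]
  obtain p q where pq: "(p, q) \<in> parallel_paths S" "(ed x, ed y) \<in> ZZ S p q" "length p = m"
    using arrows_ZZ[OF xy(1) m] by blast
  then have "z \<in> topspace (gtop HG)"
    unfolding topspace_HG topspace_TR xy(2) using y anchor_ev[OF y] by auto
  then show "z \<in> topspace (gtop HG) \<inter>
    ((\<Union>(p, q)\<in>{(p, q) \<in> parallel_paths S. length p = m}. ZZ S p q) \<times> UNIV)" using pq xy(2) by blast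
next
  fix z assume z: "z \<in> topspace (gtop HG) \<inter>
    ((\<Union>(p, q)\<in>{(p, q) \<in> parallel_paths S. length p = m}. ZZ S p q) \<times> UNIV)"
  then obtain a y p q where y: "y \<in> P" "z = ((a, anchor S (ev y)), ev y)"
    and pq: "(p, q) \<in> parallel_paths S" "length p = m" "(a, anchor S (ev y)) \<in> ZZ S p q"
    unfolding topspace_HG by blast
  note pq = pq(1,2) pq(3)[unfolded anchor_ev[OF y(1)]]
  have p: "p \<noteq> []" "q \<in> fin_paths S" "length q = m" "etgt (last p) = etgt (last q)"
    using pq unfolding parallel_paths_def fin_paths_def by auto
  have a: "a \<in> inf_paths S" "ed y \<in> Z S q" "\<And>k. m \<le> k \<Longrightarrow> a k = ed y k" "\<And>k. k < m \<Longrightarrow> a k = p ! k"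
    using pq unfolding ZZ_def Z_def by auto
  have "etgt (a (m - 1)) = src y m"
    using a(4)[of "m - 1"] p(1,4) pq(2) m Z_src[OF y(1) p(2) a(2)] p(3) by (simp add: last_conv_nth)
  then obtain x where "(x, y) \<in> R m" "ed x = a" using graft_path[OF y(1) a(1,3)] by blast
  then show "z \<in> gmap ` R m"
    unfolding y(2) anchor_ev[OF y(1)] by (intro image_eqI[of _ _ "(x, y)"]) (simp_all add: gmap_def)
qed

lemma arrows_G_pos: "arrows G = (\<Union>m\<in>{1..}. R m)"
proof -
  have "R m \<subseteq> R (Suc m)" for m using tail_rel_mono[of m "Suc m"] by auto
  then have "R m \<subseteq> (\<Union>m\<in>{1..}. R m)" for m by (intro subset_trans[OF _ UN_upper[of "Suc m"]]) auto
  then show ?thesis unfolding arrows_G by blast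
qed

lemma gmap_surj: "gmap ` arrows G = topspace (gtop HG)"
proof -
  have "topspace (gtop HG) \<subseteq> (\<Union>m\<in>{1..}. gmap ` R m)"
  proof
    fix z assume z: "z \<in> topspace (gtop HG)"
    then obtain p q where pq: "(p, q) \<in> parallel_paths S" "fst z \<in> ZZ S p q"
      unfolding topspace_HG topspace_TR by fastforce
    then have l: "1 \<le> length p" using fin_path_length by (simp add: parallel_paths_def)
    have "z \<in> gmap ` R (length p)"
      unfolding gmap_tail_rel[OF l] using z pq by (cases z) auto
    then show "z \<in> (\<Union>m\<in>{1..}. gmap ` R m)" using l by blast
  qed
  moreover have "gmap ` R m \<subseteq> topspace (gtop HG)" if "1 \<le> m" for m using gmap_tail_rel[OF that] by blast
  ultimately show ?thesis unfolding arrows_G_pos image_UN by auto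
qed

text \<open>The evaluation determines the source \<open>y\<close>. The two ranges are then
  tail-equivalent with the same edges, and propagation of labels makes them equal.\<close>

lemma gmap_inj: "inj_on gmap (arrows G)"
proof (rule inj_onI, clarify)
  fix x y u v assume *: "(x, y) \<in> arrows G" "(u, v) \<in> arrows G" "gmap (x, y) = gmap (u, v)"
  have yv: "y = v" using ev_injective[of y v] arrows_paths[OF *(1)] arrows_paths[OF *(2)] *(3) by (simp add: gmap_def)
  then have "(x, u) \<in> arrows G" using arrows_trans[OF *(1)] arrows_sym[OF *(2)] by simp
  then obtain m where "(x, u) \<in> R m" unfolding arrows_G by blast
  moreover have "ed x = ed u" using *(3) by (simp add: gmap_def)
  then have "fst (x k) = fst (u k)" for k unfolding ed_def by (rule fun_cong)
  ultimately have "(x, u) \<in> R 0" by (rule tail_rel_edges) simp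
  then show "x = u \<and> y = v" using yv by (simp add: tail_rel_0)
qed

text \<open>By \<open>ZZ_tail_rel\<close> the preimage of \<open>ZZ S p q\<close> lies in
  \<open>R (length p)\<close> and is cut out of it by the prescribed initial edges, an open
  condition in the product topology.\<close>

lemma continuous_gmap: "continuous_map TG (gtop HG) gmap"
  unfolding HG_top continuous_map_in_subtopology
proof
  have s: "(\<lambda>\<gamma>. (ed (fst \<gamma>), ed (snd \<gamma>))) ` arrows G \<subseteq> \<Union> {ZZ S p q | p q. (p, q) \<in> parallel_paths S}"
    unfolding topspace_TR[symmetric]
  proof
    fix z assume "z \<in> (\<lambda>\<gamma>. (ed (fst \<gamma>), ed (snd \<gamma>))) ` arrows G"
    then obtain \<gamma> where \<gamma>: "\<gamma> \<in> arrows G" "z = fst (gmap \<gamma>)" by (auto simp: gmap_def)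
    then have "gmap \<gamma> \<in> topspace (gtop HG)" using gmap_surj by blast
    then show "z \<in> topspace TR" unfolding topspace_HG \<gamma>(2) by auto
  qed
  have "continuous_map TG TR (\<lambda>\<gamma>. (ed (fst \<gamma>), ed (snd \<gamma>)))"
    unfolding TR_eq
  proof (rule continuous_on_generated_topo[OF _ s])
    fix U assume "U \<in> {ZZ S p q | p q. (p, q) \<in> parallel_paths S}"
    then obtain p q where pq: "(p, q) \<in> parallel_paths S" "U = ZZ S p q" by blast
    let ?W = "{(x, y) \<in> P \<times> P. \<forall>k<length p. fst (x k) = p ! k \<and> fst (y k) = q ! k}"
    have l: "length q = length p" using pq(1) by (simp add: parallel_paths_def)
    have "(\<lambda>\<gamma>. (ed (fst \<gamma>), ed (snd \<gamma>))) -` U \<inter> arrows G = ?W \<inter> R (length p)"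
    proof (intro equalityI subsetI)
      fix \<gamma> assume "\<gamma> \<in> (\<lambda>\<gamma>. (ed (fst \<gamma>), ed (snd \<gamma>))) -` U \<inter> arrows G"
      then obtain x y where \<gamma>: "\<gamma> = (x, y)" "(x, y) \<in> arrows G" "(ed x, ed y) \<in> ZZ S p q" using pq(2) by (cases \<gamma>) auto
      note P = arrows_paths[OF \<gamma>(2)]
      have "ed x \<in> Z S p" "ed y \<in> Z S q" using \<gamma>(3) unfolding ZZ_def by blast+
      then show "\<gamma> \<in> ?W \<inter> R (length p)"
        unfolding \<gamma>(1) using ZZ_tail_rel[OF \<gamma>(2,3)] P l in_Z_iff[of x p] in_Z_iff[of y q] by auto
    next
      fix \<gamma> assume "\<gamma> \<in> ?W \<inter> R (length p)"
      then obtain x y where \<gamma>: "\<gamma> = (x, y)" "(x, y) \<in> R (length p)" "x \<in> P" "y \<in> P"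
        "\<forall>k<length p. fst (x k) = p ! k" "\<forall>k<length q. fst (y k) = q ! k" using l by (cases \<gamma>) auto
      have "(ed x, ed y) \<in> ZZ S p q"
        unfolding ZZ_def using \<gamma>(5,6) in_Z_iff[OF \<gamma>(3)] in_Z_iff[OF \<gamma>(4)] tail_relD(3)[OF \<gamma>(2)] by (simp add: ed_def)
      then show "\<gamma> \<in> (\<lambda>\<gamma>. (ed (fst \<gamma>), ed (snd \<gamma>))) -` U \<inter> arrows G"
        unfolding \<gamma>(1) pq(2) arrows_G using \<gamma>(2) by auto
    qed
    then show "openin TG ((\<lambda>\<gamma>. (ed (fst \<gamma>), ed (snd \<gamma>))) -` U \<inter> arrows G)"
      using openin_TG_Int[OF openin_edge_pair] by simp
  qed
  moreover have "continuous_map TG (C_hat S) (\<lambda>\<gamma>. ev (snd \<gamma>))"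
    using continuous_map_compose[OF continuous_map_compose[OF continuous_TG_TT continuous_map_snd] continuous_ev_C_hat]
    by (simp add: o_def)
  ultimately show "continuous_map TG (prod_topology TR (C_hat S)) gmap"
    unfolding gmap_def by (rule continuous_map_pairedI)
  show "gmap \<in> arrows G \<rightarrow> {(\<gamma>, \<tau>). snd \<gamma> = anchor S \<tau>}"
    using anchor_ev arrows_paths by (auto simp: gmap_def)
qed

text \<open>Each \<open>R m\<close> is compact, hence mapped homeomorphically onto its image, which is open.\<close>

lemma open_gmap: "open_map TG (gtop HG) gmap"
  unfolding open_map_def
proof (intro allI impI)
  fix U assume U: "openin TG U"
  have "openin (gtop HG) (gmap ` (U \<inter> R m))" if m: "1 \<le> m" for m
  proof -
    define W where "W = (\<Union>(p, q)\<in>{(p, q) \<in> parallel_paths S. length p = m}. ZZ S p q)"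
    have "openin TR W"
      unfolding W_def
    proof (rule openin_Union)
      fix K assume "K \<in> (\<lambda>(p, q). ZZ S p q) ` {(p, q) \<in> parallel_paths S. length p = m}"
      then obtain p q where "(p, q) \<in> parallel_paths S" "K = ZZ S p q" by blast
      then show "openin TR K" using openin_ZZ by simp
    qed
    then have "openin (prod_topology TR (C_hat S)) (W \<times> topspace (C_hat S))"
      by (simp add: openin_prod_Times_iff)
    then have "openin (gtop HG) (W \<times> topspace (C_hat S) \<inter> {(\<gamma>, \<tau>). snd \<gamma> = anchor S \<tau>})"
      unfolding HG_top by (rule openin_subtopology_Int)
    moreover have "gmap ` R m = W \<times> topspace (C_hat S) \<inter> {(\<gamma>, \<tau>). snd \<gamma> = anchor S \<tau>} \<inter> topspace (gtop HG)"
      unfolding gmap_tail_rel[OF m, folded W_def] topspace_HG topspace_C_hat by force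
    ultimately have o: "openin (gtop HG) (gmap ` R m)"
      by (simp only: openin_Int openin_topspace)
    have "closedin TG (R m - U)" using closedin_TG_tail_rel U by blast
    then have "compactin TG (R m - U)" using closed_compactin[OF compactin_TG_tail_rel] by blast
    then have "closedin (gtop HG) (gmap ` (R m - U))"
      using image_compactin[OF _ continuous_gmap] compactin_imp_closedin[OF Hausdorff_HG] by blast
    then have "openin (gtop HG) (gmap ` R m - gmap ` (R m - U))" using o by blast
    moreover have "inj_on gmap (R m)" using inj_on_subset[OF gmap_inj] unfolding arrows_G by blast
    then have "gmap ` R m - gmap ` (R m - U) = gmap ` (U \<inter> R m)" by (auto simp: inj_on_def)
    ultimately show ?thesis by simp
  qed
  then have "openin (gtop HG) (\<Union>m\<in>{1..}. gmap ` (U \<inter> R m))" by (intro openin_Union) blast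
  moreover have "gmap ` U = (\<Union>m\<in>{1..}. gmap ` (U \<inter> R m))"
    using openin_subset[OF U] unfolding arrows_G_pos by blast
  ultimately show "openin (gtop HG) (gmap ` U)" by simp
qed

text \<open>\<open>act_ev\<close> computes the range of the image of \<open>(u, v)\<close> as
  \<open>(ed u, ev u)\<close>; by injectivity of \<open>ev\<close>, composability means
  \<open>y = u\<close> on both sides.\<close>

lemma gmap_iso: "tgroupoid_iso G HG gmap"
  unfolding tgroupoid_iso_def
proof (intro conjI ballI)
  show "homeomorphic_map TG (gtop HG) gmap"
    using bijective_open_imp_homeomorphic_map[OF continuous_gmap open_gmap gmap_surj gmap_inj] .
  fix \<gamma> \<delta> assume g: "\<gamma> \<in> arrows G" "\<delta> \<in> arrows G"
  obtain x y u v where \<gamma>: "\<gamma> = (x, y)" and \<delta>: "\<delta> = (u, v)" by fastforce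
  note P = arrows_paths[OF g(1)[unfolded \<gamma>]] arrows_paths[OF g(2)[unfolded \<delta>]]
  have "grng HG (gmap \<delta>) = (ed u, ev u)"
    using act_ev[OF g(2)[unfolded \<delta>]] by (simp add: \<delta> gmap_def HG_simps)
  moreover have "gsrc HG (gmap \<gamma>) = (ed y, ev y)" by (simp add: \<gamma> gmap_def HG_simps)
  ultimately show "gsrc G \<gamma> = grng G \<delta> \<longleftrightarrow> gsrc HG (gmap \<gamma>) = grng HG (gmap \<delta>)"
    using ev_injective[of y u] P by (auto simp: \<gamma> \<delta>)
  show "gsrc G \<gamma> = grng G \<delta> \<longrightarrow> gmap (gmult G \<gamma> \<delta>) = gmult HG (gmap \<gamma>) (gmap \<delta>)"
    by (simp add: \<gamma> \<delta> gmap_def HG_simps)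
qed

lemma groupoid_model: "(\<exists>h. tgroupoid_iso G HG h) \<and> (\<exists>\<Phi>. cstar_iso (AH_algebra S) (reduced_cstar G) \<Phi>)"
proof
  show "\<exists>h. tgroupoid_iso G HG h" by (rule exI, rule gmap_iso)
  show "\<exists>\<Phi>. cstar_iso (AH_algebra S) (reduced_cstar G) \<Phi>" by (rule AH_algebra_iso)
qed

end

theorem theoremB:
  fixes S :: "('a, 'e) diag_AH"
  assumes "diagonal_AH_system S"
  shows "(\<exists>h. tgroupoid_iso (labelled_tail_groupoid S) (transformation_groupoid S) h) \<and>
         (\<exists>\<Phi>. cstar_iso (AH_algebra S) (reduced_cstar (labelled_tail_groupoid S)) \<Phi>)"
  by (rule AH.groupoid_model[OF AH.intro[OF assms]])

end
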